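(* Let $p$ be a prime, let $(\mathcal L_1,\Delta_1,S_1)$ and $(\mathcal L_2,\Delta_2,S_2)$ be localities, and let $(\mathcal L,\Delta,S)=(\mathcal L_1\times\mathcal L_2,\Delta_1*\Delta_2,S_1\times S_2)$ be their external direct product. Let $\iota_1:\mathcal L_1\to\mathcal L$, $f\mapsto(f,\mathbf 1)$, and $\iota_2:\mathcal L_2\to\mathcal L$, $f\mapsto(\mathbf 1,f)$. Let $Z\le Z(\mathcal L)$ be a subgroup with $Z\cap(\mathcal L_i\iota_i)=\{\mathbf 1\}$ for $i=1,2$, and let $\beta:\mathcal L\to\mathcal L/Z$ be the canonical projection, so that $(\mathcal L/Z,\Delta\beta,S\beta)$ is the external central product of $(\mathcal L_1,\Delta_1,S_1)$ and $(\mathcal L_2,\Delta_2,S_2)$ over $Z$. Set $\mathcal F_i=\mathcal F_{S_i}(\mathcal L_i)$ for $i=1,2$. Then: (a) The localities $(\mathcal L_1,\Delta_1,S_1)$ and $(\mathcal L_2,\Delta_2,S_2)$ are of objective characteristic $p$ if and only if $Z\le S$ and $(\mathcal L/Z,\Delta\beta,S\beta)$ is of objective characteristic $p$. (b) The localities $(\mathcal L_1,\Delta_1,S_1)$ and $(\mathcal L_2,\Delta_2,S_2)$ are linking localities if and only if $Z\le S$ and $(\mathcal L/Z,\Delta\beta,S\beta)$ is a linking locality. (c) If $Z\le S$, then $Z\le Z(\mathcal F_1\times\mathcal F_2)$, $(\mathcal F_1\times\mathcal F_2)/Z$ is a central product of the fusion systems $\mathcal F_1$ and $\mathcal F_2$,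 and $(\mathcal L/Z,\Delta\beta,S\beta)$ is a locality over $(\mathcal F_1\times\mathcal F_2)/Z$.
   Context: Partial groups. For a set $X$, $\mathbf W(X)$ is the set of finite words in $X$ (including the empty word $\emptyset$), $\circ$ is concatenation, and $x\in X$ is identified with the word $(x)$. A partial group is a nonempty set $\mathcal L$ with an involutory bijection $f\mapsto f^{-1}$ (extended to words by $(f_1,\dots,f_n)^{-1}=(f_n^{-1},\dots,f_1^{-1})$), a domain $\mathbf D\subseteq\mathbf W(\mathcal L)$ and a product $\Pi:\mathbf D\to\mathcal L$ such that: (1) $\mathcal L\subseteq\mathbf D$, and $u\circ v\in\mathbf D$ implies $u,v\in\mathbf D$; (2) $\Pi$ restricts to the identity on $\mathcal L$; (3) if $u\circ v\circ w\in\mathbf D$ then $u\circ(\Pi(v))\circ w\in\mathbf D$ and $\Pi(u\circ v\circ w)=\Pi(u\circ(\Pi(v))\circ w)$; (4) if $w\in\mathbf D$ then $w^{-1}\circ w\in\mathbf D$ and $\Pi(w^{-1}\circ w)=\mathbf 1:=\Pi(\emptyset)$. A partial subgroup is a subset $\mathcal H$ closed under inversion and with $\Pi(w)\in\mathcal H$ for all $w\in\mathbf W(\mathcal H)\cap\mathbf D$; it is a subgroup if moreover $\mathbf W(\mathcal H)\subseteq\mathbf D$ (then it is a group), and a $p$-subgroup if its order is a power of $p$. For $g\in\mathcal L$, $\mathbf D(g)=\{x\in\mathcal L:(g^{-1},x,g)\in\mathbf D\}$, $x^g=\Pi(g^{-1},x,g)$ for $x\in\mathbf D(g)$, and $X^g=\{x^g:x\in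 X\}$ for $X\subseteq\mathbf D(g)$. For $X\subseteq\mathcal L$, $N_{\mathcal L}(X)=\{g: X\subseteq\mathbf D(g),\ X^g=X\}$, $C_{\mathcal L}(X)=\{g: X\subseteq\mathbf D(g),\ x^g=x\ \forall x\in X\}$, and $Z(\mathcal L)=C_{\mathcal L}(\mathcal L)$. A partial subgroup $\mathcal N$ is a partial normal subgroup if $n^f\in\mathcal N$ for all $f\in\mathcal L$ and $n\in\mathcal N\cap\mathbf D(f)$. Localities. For a set $\Delta$ of subgroups of $\mathcal L$, $\mathbf D_\Delta$ is the set of words $(f_1,\dots,f_n)\in\mathbf W(\mathcal L)$ for which there are $P_0,\dots,P_n\in\Delta$ with $P_{i-1}\subseteq\mathbf D(f_i)$ and $P_{i-1}^{f_i}=P_i$ for all $i$. $(\mathcal L,\Delta,S)$ is a locality if $\mathcal L$ is a partial group that is finite as a set, $S$ is a $p$-subgroup of $\mathcal L$, $\Delta$ is a nonempty set of subgroups of $S$, and (L1) $S$ is maximal under inclusion among the $p$-subgroups of $\mathcal L$; (L2) $\mathbf D=\mathbf D_\Delta$; (L3) every subgroup $Q\le S$ for which there are $P\in\Delta$ and $g\in\mathcal L$ with $P\subseteq\mathbf D(g)$ and $P^g\le Q$ lies in $\Delta$. Then $N_{\mathcal L}(P)$ is a finite group for $P\in\Delta$. $\mathcal F_S(\mathcal L)$ is the fusion system over $S$ generated by the conjugation maps $c_g:P\to P^g$, $x\mapsto x^g$, with $P\in\Delta$, $g\in\mathcal L$, $P\subseteq\mathbf D(g)$ and $P^g\subseteq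 S$. $(\mathcal L,\Delta,S)$ is a locality over $\mathcal F$ if $\mathcal F=\mathcal F_S(\mathcal L)$. Linking localities. A finite group $G$ is of characteristic $p$ if $C_G(O_p(G))\le O_p(G)$. A locality $(\mathcal L,\Delta,S)$ is of objective characteristic $p$ if $N_{\mathcal L}(P)$ is of characteristic $p$ for all $P\in\Delta$. For a fusion system $\mathcal F$ over $S$, $P\le S$ is centric if $C_S(Q)\le Q$ for all $\mathcal F$-conjugates $Q$ of $P$, and radical if $O_p(\mathrm{Aut}_{\mathcal F}(P))=\mathrm{Inn}(P)$; $\mathcal F^{cr}$ is the set of centric radical subgroups. $(\mathcal L,\Delta,S)$ is a linking locality if $\mathcal F_S(\mathcal L)^{cr}\subseteq\Delta$ and it is of objective characteristic $p$. External direct product. For partial groups $\mathcal L_1,\mathcal L_2$ with products $\Pi_i:\mathbf D_i\to\mathcal L_i$, the external direct product $\mathcal L=\mathcal L_1\times\mathcal L_2$ is the set of pairs; for $u=((f_1,g_1),\dots,(f_n,g_n))\in\mathbf W(\mathcal L)$ put $u_1=(f_1,\dots,f_n)$, $u_2=(g_1,\dots,g_n)$; then $\mathbf D=\{u:u_1\in\mathbf D_1,u_2\in\mathbf D_2\}$, $\Pi(u)=(\Pi_1(u_1),\Pi_2(u_2))$, $(f,g)^{-1}=(f^{-1},g^{-1})$. This is a partial group. For localities $(\mathcal L_i,\Delta_i,S_i)$, $\Delta_1*\Delta_2$ is the set of subgroups of $S_1\times S_2$ containing some $P_1\times P_2$ with $P_i\in\Delta_i$; $(\mathcal L_1\times\mathcal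 L_2,\Delta_1*\Delta_2,S_1\times S_2)$ is a locality. Quotients. Maps are written on the right. For a partial normal subgroup $\mathcal N$ of a locality $\mathcal L$, the right coset of $f$ is $\mathcal Nf=\{\Pi(n,f):n\in\mathcal N,(n,f)\in\mathbf D\}$; the right cosets maximal under inclusion partition $\mathcal L$, and $\mathcal L/\mathcal N$ is the set of these. The canonical projection $\beta:\mathcal L\to\mathcal L/\mathcal N$ sends an element to the maximal coset containing it; $\mathcal L/\mathcal N$ is the partial group with domain $\{v\beta^*:v\in\mathbf D\}$ (where $\beta^*$ applies $\beta$ entrywise to words), product $v\beta^*\mapsto\Pi(v)\beta$ and inversion $(f\beta)^{-1}=(f^{-1})\beta$. With $\Delta\beta=\{P\beta:P\in\Delta\}$, $(\mathcal L/\mathcal N,\Delta\beta,S\beta)$ is a locality. Every subgroup $Z\le Z(\mathcal L)$ is a partial normal subgroup; for $\mathcal L=\mathcal L_1\times\mathcal L_2$ and $Z$ as in the claim, $(\mathcal L/Z,\Delta\beta,S\beta)$ is called the external central product over $Z$. Fusion systems. $\mathcal F_1\times\mathcal F_2$ is the fusion system over $S_1\times S_2$ whose morphisms are the restrictions of maps $\phi_1\times\phi_2:(x_1,x_2)\mapsto(x_1\phi_1,x_2\phi_2)$ with $\phi_i$ a morphism of $\mathcal F_i$. $Z(\mathcal F)$ is the centre of $\mathcal F$. For $Z\le Z(\mathcal F)$, $\mathcal F/Z$ is the factor fusion system on $S/Z$ whose morphisms are induced by $\mathcal F$-morphisms between subgroups containing $Z$. For $Z\le Z(\mathcal F_1)\times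 Z(\mathcal F_2)=Z(\mathcal F_1\times\mathcal F_2)$ meeting $S_1\times1$ and $1\times S_2$ trivially, $(\mathcal F_1\times\mathcal F_2)/Z$ is called an (external) central product of $\mathcal F_1$ and $\mathcal F_2$. If $Z\le S$, the group $S\beta$ is identified with $S/Z$. *)

theory Defs
  imports
    "HOL-Algebra.Coset"
    "HOL-Algebra.Bij"
    "HOL-Algebra.Generated_Groups"
    "HOL-Computational_Algebra.Primes"
begin

text \<open>
  Words are lists. As in the literature on localities, maps are thought of as acting from the
  right, so \<open>x\<^sup>g\<close> is \<open>g\<^sup>-\<^sup>1 x g\<close>.
\<close>


section \<open>Finite groups\<close>

definition p_power :: "nat \<Rightarrow> 'a set \<Rightarrow> bool" where
  "p_power p H \<longleftrightarrow> (\<exists>n. card H = p ^ n)"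

definition centralizer :: "('a, 'm) monoid_scheme \<Rightarrow> 'a set \<Rightarrow> 'a set" where
  "centralizer G X = {g \<in> carrier G. \<forall>x\<in>X. inv\<^bsub>G\<^esub> g \<otimes>\<^bsub>G\<^esub> x \<otimes>\<^bsub>G\<^esub> g = x}"

text \<open>For finite \<open>G\<close> this is the largest normal \<open>p\<close>-subgroup.\<close>

definition O_p :: "nat \<Rightarrow> ('a, 'm) monoid_scheme \<Rightarrow> 'a set" where
  "O_p p G = generate G (\<Union>{N. N \<lhd> G \<and> p_power p N})"

definition characteristic_p :: "nat \<Rightarrow> ('a, 'm) monoid_scheme \<Rightarrow> bool" where
  "characteristic_p p G \<longleftrightarrow>
     group G \<and> finite (carrier G) \<and> centralizer G (O_p p G) \<subseteq> O_p p G"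


section \<open>Partial groups\<close>

record 'a partial_group = "'a partial_object" +
  pinv :: "'a \<Rightarrow> 'a"
  pdom :: "'a list set"
  pprod :: "'a list \<Rightarrow> 'a"

definition pone :: "('a, 'm) partial_group_scheme \<Rightarrow> 'a" where
  "pone L = pprod L []"

definition word_inv :: "('a, 'm) partial_group_scheme \<Rightarrow> 'a list \<Rightarrow> 'a list" where
  "word_inv L w = rev (map (pinv L) w)"

locale partial_group =
  fixes L :: "('a, 'm) partial_group_scheme"
  assumes carrier_nonempty: "carrier L \<noteq> {}"
    and pinv_closed: "f \<in> carrier L \<Longrightarrow> pinv L f \<in> carrier L"
    and pinv_pinv: "f \<in> carrier L \<Longrightarrow> pinv L (pinv L f) = f"
    and pdom_words: "pdom L \<subseteq> lists (carrier L)"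
    and pprod_closed: "w \<in> pdom L \<Longrightarrow> pprod L w \<in> carrier L"
    and pdom_singleton: "f \<in> carrier L \<Longrightarrow> [f] \<in> pdom L"
    and pdom_append: "u @ v \<in> pdom L \<Longrightarrow> u \<in> pdom L \<and> v \<in> pdom L"
    and pprod_singleton: "f \<in> carrier L \<Longrightarrow> pprod L [f] = f"
    and pprod_assoc: "u @ v @ w \<in> pdom L \<Longrightarrow>
          u @ [pprod L v] @ w \<in> pdom L \<and> pprod L (u @ v @ w) = pprod L (u @ [pprod L v] @ w)"
    and pprod_inv: "w \<in> pdom L \<Longrightarrow>
          word_inv L w @ w \<in> pdom L \<and> pprod L (word_inv L w @ w) = pone L"

definition partial_subgroup :: "('a, 'm) partial_group_scheme \<Rightarrow> 'a set \<Rightarrow> bool" where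
  "partial_subgroup L H \<longleftrightarrow>
     H \<subseteq> carrier L \<and> (\<forall>h\<in>H. pinv L h \<in> H) \<and> (\<forall>w \<in> lists H \<inter> pdom L. pprod L w \<in> H)"

definition pg_subgroup :: "('a, 'm) partial_group_scheme \<Rightarrow> 'a set \<Rightarrow> bool" where
  "pg_subgroup L H \<longleftrightarrow> partial_subgroup L H \<and> lists H \<subseteq> pdom L"

definition pg_p_subgroup :: "nat \<Rightarrow> ('a, 'm) partial_group_scheme \<Rightarrow> 'a set \<Rightarrow> bool" where
  "pg_p_subgroup p L H \<longleftrightarrow> pg_subgroup L H \<and> p_power p H"

definition group_on :: "('a, 'm) partial_group_scheme \<Rightarrow> 'a set \<Rightarrow> 'a monoid" where
  "group_on L H = \<lparr>carrier = H, monoid.mult = (\<lambda>x y. pprod L [x, y]), one = pone L\<rparr>"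

definition conj_dom :: "('a, 'm) partial_group_scheme \<Rightarrow> 'a \<Rightarrow> 'a set" where
  "conj_dom L g = {x \<in> carrier L. [pinv L g, x, g] \<in> pdom L}"

definition pconj :: "('a, 'm) partial_group_scheme \<Rightarrow> 'a \<Rightarrow> 'a \<Rightarrow> 'a" where
  "pconj L g x = pprod L [pinv L g, x, g]"

definition pg_normalizer :: "('a, 'm) partial_group_scheme \<Rightarrow> 'a set \<Rightarrow> 'a set" where
  "pg_normalizer L X = {g \<in> carrier L. X \<subseteq> conj_dom L g \<and> pconj L g ` X = X}"

definition pg_centralizer :: "('a, 'm) partial_group_scheme \<Rightarrow> 'a set \<Rightarrow> 'a set" where
  "pg_centralizer L X = {g \<in> carrier L. X \<subseteq> conj_dom L g \<and> (\<forall>x\<in>X. pconj L g x = x)}"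

definition pg_center :: "('a, 'm) partial_group_scheme \<Rightarrow> 'a set" where
  "pg_center L = pg_centralizer L (carrier L)"


section \<open>Localities\<close>

definition dom_of :: "('a, 'm) partial_group_scheme \<Rightarrow> 'a set set \<Rightarrow> 'a list set" where
  "dom_of L \<Delta> = {w \<in> lists (carrier L).
     \<exists>Ps. length Ps = Suc (length w) \<and> set Ps \<subseteq> \<Delta> \<and>
       (\<forall>i<length w. Ps ! i \<subseteq> conj_dom L (w ! i) \<and> pconj L (w ! i) ` (Ps ! i) = Ps ! Suc i)}"

locale locality = partial_group L
  for p :: nat and L :: "('a, 'm) partial_group_scheme" and \<Delta> :: "'a set set" and S :: "'a set" +
  assumes finite_carrier: "finite (carrier L)"
    and p_subgroup_S: "pg_p_subgroup p L S"
    and objects_nonempty: "\<Delta> \<noteq> {}"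
    and objects_subgroups: "P \<in> \<Delta> \<Longrightarrow> pg_subgroup L P \<and> P \<subseteq> S"
    and S_maximal: "pg_p_subgroup p L R \<Longrightarrow> S \<subseteq> R \<Longrightarrow> R = S"
    and dom_eq: "pdom L = dom_of L \<Delta>"
    and objects_closed: "P \<in> \<Delta> \<Longrightarrow> g \<in> carrier L \<Longrightarrow> P \<subseteq> conj_dom L g \<Longrightarrow>
          pg_subgroup L Q \<Longrightarrow> Q \<subseteq> S \<Longrightarrow> pconj L g ` P \<subseteq> Q \<Longrightarrow> Q \<in> \<Delta>"

definition objective_characteristic_p ::
    "nat \<Rightarrow> ('a, 'm) partial_group_scheme \<Rightarrow> 'a set set \<Rightarrow> 'a set \<Rightarrow> bool" where
  "objective_characteristic_p p L \<Delta> S \<longleftrightarrow>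
     locality p L \<Delta> S \<and> (\<forall>P\<in>\<Delta>. characteristic_p p (group_on L (pg_normalizer L P)))"


section \<open>Fusion systems\<close>

text \<open>
  A fusion system over the group \<open>G\<close> is given by its morphism sets: \<open>F P Q\<close> is the set of
  morphisms from \<open>P\<close> to \<open>Q\<close>. Morphisms are extensional functions (\<open>undefined\<close> outside \<open>P\<close>), so
  that equality of functions is equality of morphisms, and \<open>F P Q\<close> is empty unless \<open>P\<close> and \<open>Q\<close>
  are subgroups of \<open>G\<close>, so that equality of the families \<open>F\<close> is equality of fusion systems.
  Conjugation by \<open>\<one>\<close> yields the identities and the inclusions, hence also all restrictions.
\<close>

type_synonym 'a fusion = "'a set \<Rightarrow> 'a set \<Rightarrow> ('a \<Rightarrow> 'a) set"

locale fusion_system = group G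
  for p :: nat and G :: "('a, 'm) monoid_scheme" (structure) and F :: "'a fusion" +
  assumes finite_G: "finite (carrier G)"
    and p_power_G: "p_power p (carrier G)"
    and mor_subgroups: "\<phi> \<in> F P Q \<Longrightarrow> subgroup P G \<and> subgroup Q G"
    and mor_inj_hom: "\<phi> \<in> F P Q \<Longrightarrow>
          \<phi> \<in> extensional P \<and> inj_on \<phi> P \<and> \<phi> \<in> hom (G\<lparr>carrier := P\<rparr>) (G\<lparr>carrier := Q\<rparr>)"
    and mor_conj: "subgroup P G \<Longrightarrow> subgroup Q G \<Longrightarrow> g \<in> carrier G \<Longrightarrow>
          (\<lambda>x. inv g \<otimes> x \<otimes> g) ` P \<subseteq> Q \<Longrightarrow> (\<lambda>x\<in>P. inv g \<otimes> x \<otimes> g) \<in> F P Q"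
    and mor_compose: "\<phi> \<in> F P Q \<Longrightarrow> \<psi> \<in> F Q R \<Longrightarrow> compose P \<psi> \<phi> \<in> F P R"
    and mor_iso: "\<phi> \<in> F P Q \<Longrightarrow>
          \<phi> \<in> F P (\<phi> ` P) \<and> restrict (inv_into P \<phi>) (\<phi> ` P) \<in> F (\<phi> ` P) P"

text \<open>The smallest fusion system over \<open>S\<close> containing the conjugation maps between objects.\<close>

definition fusion_of ::
    "nat \<Rightarrow> ('a, 'm) partial_group_scheme \<Rightarrow> 'a set set \<Rightarrow> 'a set \<Rightarrow> 'a fusion" where
  "fusion_of p L \<Delta> S P Q = \<Inter>{F P Q | F.
     fusion_system p (group_on L S) F \<and>
     (\<forall>R\<in>\<Delta>. \<forall>g\<in>carrier L. R \<subseteq> conj_dom L g \<and> pconj L g ` R \<subseteq> S \<longrightarrow>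
        restrict (pconj L g) R \<in> F R (pconj L g ` R))}"

text \<open>
  Here \<open>F\<close> is a fusion system over \<open>G\<close>, and \<open>G\<close> is the group \<open>S\<close>; the multiplication of
  \<open>G\<close> is only compared on \<open>S\<close>, as its values elsewhere carry no meaning.
\<close>

definition locality_over ::
    "nat \<Rightarrow> ('a, 'm) partial_group_scheme \<Rightarrow> 'a set set \<Rightarrow> 'a set \<Rightarrow>
     ('a, 'n) monoid_scheme \<Rightarrow> 'a fusion \<Rightarrow> bool" where
  "locality_over p L \<Delta> S G F \<longleftrightarrow>
     locality p L \<Delta> S \<and>
     carrier G = S \<and> (\<forall>x\<in>S. \<forall>y\<in>S. x \<otimes>\<^bsub>G\<^esub> y = pprod L [x, y]) \<and>
     F = fusion_of p L \<Delta> S"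

definition fus_conjugates :: "'a fusion \<Rightarrow> 'a set \<Rightarrow> 'a set set" where
  "fus_conjugates F P = {Q. \<exists>\<phi> \<in> F P Q. \<phi> ` P = Q}"

definition fus_centric :: "('a, 'm) monoid_scheme \<Rightarrow> 'a fusion \<Rightarrow> 'a set \<Rightarrow> bool" where
  "fus_centric G F P \<longleftrightarrow> subgroup P G \<and> (\<forall>Q \<in> fus_conjugates F P. centralizer G Q \<subseteq> Q)"

definition fus_Aut :: "'a fusion \<Rightarrow> 'a set \<Rightarrow> ('a \<Rightarrow> 'a) monoid" where
  "fus_Aut F P = (BijGroup P)\<lparr>carrier := F P P\<rparr>"

definition Inn :: "('a, 'm) monoid_scheme \<Rightarrow> 'a set \<Rightarrow> ('a \<Rightarrow> 'a) set" where
  "Inn G P = {(\<lambda>x\<in>P. inv\<^bsub>G\<^esub> g \<otimes>\<^bsub>G\<^esub> x \<otimes>\<^bsub>G\<^esub> g) | g. g \<in> P}"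

definition fus_radical :: "nat \<Rightarrow> ('a, 'm) monoid_scheme \<Rightarrow> 'a fusion \<Rightarrow> 'a set \<Rightarrow> bool" where
  "fus_radical p G F P \<longleftrightarrow> subgroup P G \<and> O_p p (fus_Aut F P) = Inn G P"

definition fus_cr :: "nat \<Rightarrow> ('a, 'm) monoid_scheme \<Rightarrow> 'a fusion \<Rightarrow> 'a set set" where
  "fus_cr p G F = {P. fus_centric G F P \<and> fus_radical p G F P}"

definition linking_locality ::
    "nat \<Rightarrow> ('a, 'm) partial_group_scheme \<Rightarrow> 'a set set \<Rightarrow> 'a set \<Rightarrow> bool" where
  "linking_locality p L \<Delta> S \<longleftrightarrow>
     locality p L \<Delta> S \<and>
     fus_cr p (group_on L S) (fusion_of p L \<Delta> S) \<subseteq> \<Delta> \<and>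
     objective_characteristic_p p L \<Delta> S"

text \<open>
  \<open>X\<close> is central in \<open>F\<close> if \<open>F = C\<^sub>F(X)\<close>, i.e. every morphism \<open>P \<rightarrow> Q\<close> extends to a morphism
  \<open>PX \<rightarrow> QX\<close> that is the identity on \<open>X\<close> (applied to inner automorphisms of \<open>G\<close>, this forces
  \<open>X \<le> Z(G)\<close>). The centre of \<open>F\<close> is the largest central subgroup.
\<close>

definition fus_central :: "('a, 'm) monoid_scheme \<Rightarrow> 'a fusion \<Rightarrow> 'a set \<Rightarrow> bool" where
  "fus_central G F X \<longleftrightarrow> subgroup X G \<and>
     (\<forall>P Q. \<forall>\<phi> \<in> F P Q. \<exists>\<psi> \<in> F (P <#>\<^bsub>G\<^esub> X) (Q <#>\<^bsub>G\<^esub> X).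
        (\<forall>x\<in>P. \<psi> x = \<phi> x) \<and> (\<forall>x\<in>X. \<psi> x = x))"

definition fus_center :: "('a, 'm) monoid_scheme \<Rightarrow> 'a fusion \<Rightarrow> 'a set" where
  "fus_center G F = generate G (\<Union>{X. fus_central G F X})"

text \<open>
  The product of a fusion system over \<open>G\<^sub>1\<close> and one over \<open>G\<^sub>2\<close>, a fusion system over
  \<open>G\<^sub>1 \<times>\<times> G\<^sub>2\<close>.
\<close>

definition fus_prod ::
    "('a, 'm) monoid_scheme \<Rightarrow> 'a fusion \<Rightarrow> ('b, 'n) monoid_scheme \<Rightarrow> 'b fusion \<Rightarrow>
     ('a \<times> 'b) fusion" where
  "fus_prod G\<^sub>1 F\<^sub>1 G\<^sub>2 F\<^sub>2 P Q =
     {restrict (map_prod \<phi>\<^sub>1 \<phi>\<^sub>2) P | \<phi>\<^sub>1 \<phi>\<^sub>2 P\<^sub>1 Q\<^sub>1 P\<^sub>2 Q\<^sub>2.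
        subgroup P (G\<^sub>1 \<times>\<times> G\<^sub>2) \<and> subgroup Q (G\<^sub>1 \<times>\<times> G\<^sub>2) \<and>
        \<phi>\<^sub>1 \<in> F\<^sub>1 P\<^sub>1 Q\<^sub>1 \<and> \<phi>\<^sub>2 \<in> F\<^sub>2 P\<^sub>2 Q\<^sub>2 \<and>
        P \<subseteq> P\<^sub>1 \<times> P\<^sub>2 \<and> map_prod \<phi>\<^sub>1 \<phi>\<^sub>2 ` P \<subseteq> Q}"

text \<open>The factor system over \<open>G Mod Z\<close>; a subgroup \<open>P\<close> containing \<open>Z\<close> has image \<open>P/Z\<close>.\<close>

definition fus_quot ::
    "('a, 'm) monoid_scheme \<Rightarrow> 'a fusion \<Rightarrow> 'a set \<Rightarrow> 'a set fusion" where
  "fus_quot G F Z A B =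
     {\<psi>. \<exists>P Q. \<exists>\<phi> \<in> F P Q. Z \<subseteq> P \<and> Z \<subseteq> Q \<and>
        A = (\<lambda>x. Z #>\<^bsub>G\<^esub> x) ` P \<and> B = (\<lambda>x. Z #>\<^bsub>G\<^esub> x) ` Q \<and>
        \<psi> \<in> extensional A \<and> (\<forall>x\<in>P. \<psi> (Z #>\<^bsub>G\<^esub> x) = Z #>\<^bsub>G\<^esub> \<phi> x)}"

text \<open>
  \<open>E\<close>, over \<open>(G\<^sub>1 \<times>\<times> G\<^sub>2) Mod Z\<close>, is the external central product of \<open>F\<^sub>1\<close> and \<open>F\<^sub>2\<close>
  over \<open>Z\<close>.
\<close>

definition fus_central_product ::
    "nat \<Rightarrow> ('a, 'm) monoid_scheme \<Rightarrow> 'a fusion \<Rightarrow> ('b, 'n) monoid_scheme \<Rightarrow> 'b fusion \<Rightarrow>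
     ('a \<times> 'b) set \<Rightarrow> ('a \<times> 'b) set fusion \<Rightarrow> bool" where
  "fus_central_product p G\<^sub>1 F\<^sub>1 G\<^sub>2 F\<^sub>2 Z E \<longleftrightarrow>
     fusion_system p G\<^sub>1 F\<^sub>1 \<and> fusion_system p G\<^sub>2 F\<^sub>2 \<and>
     subgroup Z (G\<^sub>1 \<times>\<times> G\<^sub>2) \<and>
     Z \<subseteq> fus_center G\<^sub>1 F\<^sub>1 \<times> fus_center G\<^sub>2 F\<^sub>2 \<and>
     Z \<inter> (carrier G\<^sub>1 \<times> {\<one>\<^bsub>G\<^sub>2\<^esub>}) = {\<one>\<^bsub>G\<^sub>1 \<times>\<times> G\<^sub>2\<^esub>} \<and>
     Z \<inter> ({\<one>\<^bsub>G\<^sub>1\<^esub>} \<times> carrier G\<^sub>2) = {\<one>\<^bsub>G\<^sub>1 \<times>\<times> G\<^sub>2\<^esub>} \<and>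
     E = fus_quot (G\<^sub>1 \<times>\<times> G\<^sub>2) (fus_prod G\<^sub>1 F\<^sub>1 G\<^sub>2 F\<^sub>2) Z"


section \<open>Products and quotients of localities\<close>

definition pg_prod ::
    "('a, 'm) partial_group_scheme \<Rightarrow> ('b, 'n) partial_group_scheme \<Rightarrow> ('a \<times> 'b) partial_group"
  where
  "pg_prod L\<^sub>1 L\<^sub>2 =
     \<lparr>carrier = carrier L\<^sub>1 \<times> carrier L\<^sub>2,
      pinv = map_prod (pinv L\<^sub>1) (pinv L\<^sub>2),
      pdom = {u. map fst u \<in> pdom L\<^sub>1 \<and> map snd u \<in> pdom L\<^sub>2},
      pprod = (\<lambda>u. (pprod L\<^sub>1 (map fst u), pprod L\<^sub>2 (map snd u)))\<rparr>"

definition objects_prod ::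
    "('a, 'm) partial_group_scheme \<Rightarrow> 'a set set \<Rightarrow> 'a set \<Rightarrow>
     ('b, 'n) partial_group_scheme \<Rightarrow> 'b set set \<Rightarrow> 'b set \<Rightarrow> ('a \<times> 'b) set set" where
  "objects_prod L\<^sub>1 \<Delta>\<^sub>1 S\<^sub>1 L\<^sub>2 \<Delta>\<^sub>2 S\<^sub>2 =
     {P. pg_subgroup (pg_prod L\<^sub>1 L\<^sub>2) P \<and> P \<subseteq> S\<^sub>1 \<times> S\<^sub>2 \<and>
         (\<exists>P\<^sub>1\<in>\<Delta>\<^sub>1. \<exists>P\<^sub>2\<in>\<Delta>\<^sub>2. P\<^sub>1 \<times> P\<^sub>2 \<subseteq> P)}"

definition pg_rcoset :: "('a, 'm) partial_group_scheme \<Rightarrow> 'a set \<Rightarrow> 'a \<Rightarrow> 'a set" where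
  "pg_rcoset L N f = {pprod L [n, f] | n. n \<in> N \<and> [n, f] \<in> pdom L}"

definition max_rcosets :: "('a, 'm) partial_group_scheme \<Rightarrow> 'a set \<Rightarrow> 'a set set" where
  "max_rcosets L N = {C \<in> pg_rcoset L N ` carrier L.
     \<forall>C' \<in> pg_rcoset L N ` carrier L. C \<subseteq> C' \<longrightarrow> C' = C}"

text \<open>
  For a partial normal subgroup of a locality the maximal cosets partition \<open>carrier L\<close>, so \<open>f\<close>
  lies in exactly one of them.
\<close>

definition pg_proj :: "('a, 'm) partial_group_scheme \<Rightarrow> 'a set \<Rightarrow> 'a \<Rightarrow> 'a set" where
  "pg_proj L N f = (THE C. C \<in> max_rcosets L N \<and> f \<in> C)"

text \<open>
  If \<open>L\<close> is a locality and \<open>N\<close> is a partial normal subgroup, then the results of inversion and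
  product do not depend on the chosen preimages, so the definite descriptions are meaningful.
\<close>

definition pg_quot :: "('a, 'm) partial_group_scheme \<Rightarrow> 'a set \<Rightarrow> 'a set partial_group" where
  "pg_quot L N =
     \<lparr>carrier = max_rcosets L N,
      pinv = (\<lambda>C. THE C'. \<exists>f\<in>carrier L. pg_proj L N f = C \<and> C' = pg_proj L N (pinv L f)),
      pdom = map (pg_proj L N) ` pdom L,
      pprod = (\<lambda>w. THE C. \<exists>v\<in>pdom L. map (pg_proj L N) v = w \<and> C = pg_proj L N (pprod L v))\<rparr>"

end

theory Submission
  imports
    Defs
    "HOL-Algebra.Sylow"
    "HOL-Algebra.Group_Action"
    "HOL-Algebra.Multiplicative_Group"
    "HOL-Algebra.Zassenhaus"
begin

text \<open>
  If \<open>\<L>\<close> is of objective characteristic \<open>p\<close>, then \<open>Z(\<L>) \<le> S\<close>, because \<open>Z(\<L>)\<close> centralizes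
  \<open>S = O\<^sub>p(N(S))\<close>. Being of characteristic \<open>p\<close> passes in both directions between a finite group and
  its quotient by a central \<open>p\<close>-subgroup and between a direct product and its factors, and it passes from
  \<open>N(R)\<close> to \<open>N(P)\<close> for objects \<open>P \<le> R\<close> with \<open>N(P) \<le> N(R)\<close>. The last fact is applied to
  \<open>R = P\<^sub>1 \<times> P\<^sub>2\<close>, where \<open>P\<^sub>1, P\<^sub>2\<close> are the projections of \<open>P\<close>, and to \<open>R = P Z\<close>; this gives (a).

  For (b), every centric radical subgroup of \<open>(\<F>\<^sub>1 \<times> \<F>\<^sub>2)/Z\<close> has the form \<open>(P\<^sub>1 \<times> P\<^sub>2)/Z\<close>. As \<open>Z\<close>
  meets both factors trivially, an automorphism of \<open>P\<^sub>1 \<times> P\<^sub>2\<close> is determined by the one it induces on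
  \<open>(P\<^sub>1 \<times> P\<^sub>2)/Z\<close>, so \<open>(P\<^sub>1 \<times> P\<^sub>2)/Z\<close> is centric radical if and only if both \<open>P\<^sub>i\<close> are. This
  avoids any appeal to saturation, which is not available for general localities and without which the
  centric radical subgroups of \<open>\<F>/Z\<close> need not lift to those of \<open>\<F>\<close>. To recover \<open>P\<^sub>1\<close> from
  the quotient, take \<open>P\<^sub>2 = S\<^sub>2\<close>, which is centric radical.

  For (c), the morphisms of \<open>\<F>\<^sub>S(\<L>)\<close> are the composites of restrictions of conjugation maps
  between objects; such chains can be multiplied, extended by a central subgroup, and pushed to a quotient.
\<close>

section \<open>Finite groups\<close>

text \<open>Objects do not correspond under either construction: an object of the product need not
  be a rectangle, and an object of \<open>L\<close> need not contain \<open>Z\<close>. Both gaps are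
  closed by enlarging P to an object R with N(P) inside N(R); the return from N(R) to N(P) works
  because R is a normal p-subgroup of N(R). The harder characteristic p arguments test elements x
  with x^q = 1 for a prime q distinct from p: the centralizer of O_p is normal, so it lies in O_p as
  soon as it is a p-group.

  The fusion system of a locality is given as an intersection. Upper bounds therefore come from
  minimality, while lower bounds need the morphisms written out; this is the role of the chains.
  Linking is compared only once objective characteristic p is known for both factors, because the
  choice of S_2 as second factor rests on N(S_2) being of characteristic p.

  The quotient is given by definite descriptions over maximal cosets, so all cosets of a central
  subgroup must first be shown maximal, and products independent of the chosen lifts.\<close>

lemma p_power_dvd:
  assumes "prime p" "p_power p A" "card B dvd card A"
  shows "p_power p B"
  using assms by (auto simp: p_power_def divides_primepow_nat)

abbreviation cj :: "('a, 'm) monoid_scheme \<Rightarrow> 'a \<Rightarrow> 'a \<Rightarrow> 'a" where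
  "cj G g x \<equiv> inv\<^bsub>G\<^esub> g \<otimes>\<^bsub>G\<^esub> x \<otimes>\<^bsub>G\<^esub> g"

section \<open>Conjugation, Lagrange and Cauchy in finite groups\<close>

context group
begin

lemma mult_inv_cancel_left [simp]:
  assumes "x \<in> carrier G" "y \<in> carrier G"
  shows "x \<otimes> (inv x \<otimes> y) = y" "inv x \<otimes> (x \<otimes> y) = y"
  using assms by (simp_all flip: m_assoc)

lemma cj_mult:
  assumes "g \<in> carrier G" "x \<in> carrier G" "y \<in> carrier G"
  shows "cj G g (x \<otimes> y) = cj G g x \<otimes> cj G g y"
  using assms by (simp add: m_assoc)

lemma cj_cj:
  assumes "g \<in> carrier G" "h \<in> carrier G" "x \<in> carrier G"
  shows "cj G (g \<otimes> h) x = cj G h (cj G g x)"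
  using assms by (simp add: m_assoc inv_mult_group)

lemma cj_cancel [simp]:
  assumes "g \<in> carrier G" "x \<in> carrier G"
  shows "cj G g (cj G (inv g) x) = x" "cj G (inv g) (cj G g x) = x"
  using assms by (simp_all add: m_assoc)

lemma cj_eq_self_iff:
  assumes "g \<in> carrier G" "x \<in> carrier G"
  shows "cj G g x = x \<longleftrightarrow> x \<otimes> g = g \<otimes> x"
  using assms by (metis inv_solve_left l_inv_ex m_assoc m_closed inv_closed)

lemma cj_inj:
  assumes "g \<in> carrier G" "x \<in> carrier G" "y \<in> carrier G" "cj G g x = cj G g y"
  shows "x = y"
  using assms cj_cancel by metis

lemma cj_fixed_inv:
  assumes "g \<in> carrier G" "x \<in> carrier G" "cj G g x = x"
  shows "cj G (inv g) x = x"
  using cj_cancel(2)[of g x] assms by simp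

lemma cj_fixed_swap:
  assumes "g \<in> carrier G" "x \<in> carrier G"
  shows "cj G g x = x \<longleftrightarrow> cj G x g = g"
  using assms by (auto simp: cj_eq_self_iff)

lemma normal_cj_iff:
  "N \<lhd> G \<longleftrightarrow> subgroup N G \<and> (\<forall>g\<in>carrier G. \<forall>x\<in>N. cj G g x \<in> N)"
  by (metis inv_closed inv_inv normal_inv_iff)

lemma cj_image_eq:
  assumes "finite X" "X \<subseteq> carrier G" "g \<in> carrier G" "cj G g ` X \<subseteq> X"
  shows "cj G g ` X = X"
proof -
  have "inj_on (cj G g) X"
    using assms cj_inj by (meson inj_onI subsetD)
  then show ?thesis
    using assms by (metis card_image card_subset_eq)
qed

lemma subgroup_cj_image:
  assumes "subgroup H G" "g \<in> carrier G"
  shows "subgroup (cj G g ` H) G"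
proof -
  have "group_hom G G (cj G g)"
    using assms by unfold_locales (auto simp: hom_def cj_mult)
  then show ?thesis
    using assms group_hom.subgroup_img_is_subgroup by blast
qed

lemma subgroup_restrict_iff:
  assumes "subgroup K G" "H \<subseteq> K"
  shows "subgroup H (G\<lparr>carrier := K\<rparr>) \<longleftrightarrow> subgroup H G"
  using assms by (metis incl_subgroup subgroup_incl)

lemma pow_subgroup_card:
  assumes "finite (carrier G)" "subgroup H G" "x \<in> H"
  shows "x [^] card H = \<one>"
proof -
  interpret H: group "G\<lparr>carrier := H\<rparr>"
    using assms by (simp add: subgroup_imp_group)
  have "finite H"
    using assms by (meson finite_subset subgroup.subset)
  then have "x [^]\<^bsub>G\<lparr>carrier := H\<rparr>\<^esub> card H = \<one>"
    using H.pow_order_eq_1[of x] assms by (simp add: order_def)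
  then show ?thesis
    by (metis nat_pow_consistent)
qed

lemma card_subgroup_dvd:
  assumes "subgroup H G"
  shows "card H dvd card (carrier G)"
  using lagrange[OF assms] by (metis dvd_triv_right order_def)

lemma card_subgroup_dvd_subgroup:
  assumes "subgroup H G" "subgroup K G" "H \<subseteq> K"
  shows "card H dvd card K"
proof -
  interpret K: group "G\<lparr>carrier := K\<rparr>"
    using assms by (simp add: subgroup_imp_group)
  show ?thesis
    using K.card_subgroup_dvd[of H] assms by (simp add: subgroup_incl)
qed

lemma p_power_subgroup:
  assumes "prime p" "p_power p K" "subgroup H G" "subgroup K G" "H \<subseteq> K"
  shows "p_power p H"
  using assms card_subgroup_dvd_subgroup p_power_dvd by metis

lemma cauchy:
  assumes "finite (carrier G)" "prime q" "q dvd card (carrier G)"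
  obtains x where "x \<in> carrier G" "x \<noteq> \<one>" "x [^] q = \<one>"
proof -
  obtain m where "order G = q ^ 1 * m"
    using assms by (auto simp: order_def)
  then obtain H where H: "subgroup H G" "card H = q"
    using sylow_thm[of q G 1 m] assms is_group by auto
  have "H \<noteq> {\<one>}"
    using H assms prime_gt_1_nat by fastforce
  then obtain x where "x \<in> H" "x \<noteq> \<one>"
    using H subgroup.one_closed by blast
  then show ?thesis
    using that H pow_subgroup_card assms subgroup.mem_carrier by metis
qed

text \<open>This is how elements are shown to be trivial later: one exponent is a prime q distinct
  from p, the other is the order of a p-subgroup or a product of such orders.\<close>

lemma pow_coprime_one:
  assumes "x \<in> carrier G" "x [^] (m::nat) = \<one>" "x [^] (n::nat) = \<one>" "coprime m n"
  shows "x = \<one>"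
proof -
  have "ord x dvd m" "ord x dvd n"
    using assms pow_eq_id by auto
  then have "ord x = 1"
    using assms by (metis coprime_common_divisor_nat nat_dvd_1_iff_1 coprime_def)
  then show ?thesis
    using assms(1) pow_ord_eq_1[of x] by (metis nat_pow_eone)
qed

text \<open>A prime divisor q of the order other than p would give, by Cauchy, a nontrivial element
  killed by q. Hence the part of the order prime to p has no prime divisor and is 1.\<close>

lemma p_power_if_elements:
  assumes "finite (carrier G)" "prime p"
    and "\<And>x q. x \<in> carrier G \<Longrightarrow> prime q \<Longrightarrow> q \<noteq> p \<Longrightarrow> x [^] q = \<one> \<Longrightarrow> x = \<one>"
  shows "p_power p (carrier G)"
proof -
  have pos: "card (carrier G) \<noteq> 0"
    using assms(1) by auto
  have "q = p" if "prime q" "q dvd card (carrier G)" for q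
    using that assms cauchy by metis
  moreover obtain m where m: "card (carrier G) = p ^ multiplicity p (card (carrier G)) * m" "\<not> p dvd m"
    using pos assms(2) by (metis multiplicity_decompose' not_prime_unit)
  ultimately have "m = 1"
    by (metis dvd_mult prime_factor_nat)
  then have "card (carrier G) = p ^ multiplicity p (card (carrier G))"
    using m by simp
  then show ?thesis
    by (auto simp: p_power_def)
qed

end

section \<open>Homomorphisms: orders of kernels and images\<close>

context group_hom
begin

lemma card_kernel_image:
  assumes "finite (carrier G)"
  shows "card (carrier G) = card (kernel G H h) * card (h ` carrier G)"
proof -
  \<comment> \<open>The isomorphism theorem is stated for surjective homomorphisms, so the codomain
    is cut down to the image; the kernel does not change.\<close>
  interpret I: group_hom G "H\<lparr>carrier := h ` carrier G\<rparr>" h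
    by (simp add: G.is_group H.subgroup_imp_group group_hom_axioms_def group_hom_def hom_def
        img_is_subgroup Pi_def)
  have eq: "kernel G (H\<lparr>carrier := h ` carrier G\<rparr>) h = kernel G H h"
    by (simp add: kernel_def)
  have "card (rcosets (kernel G H h)) = card (h ` carrier G)"
    using I.FactGroup_iso_set bij_betw_same_card unfolding eq
    by (fastforce simp: iso_def FactGroup_def)
  then show ?thesis
    using G.lagrange[OF subgroup_kernel] by (simp add: order_def mult.commute)
qed

lemma restrict_subgroup:
  assumes "subgroup X G"
  shows "group_hom (G\<lparr>carrier := X\<rparr>) H h"
  using assms by (simp add: G.subgroup_imp_group group_hom_axioms_def group_hom_def hom_def
      Pi_def H.is_group subgroup.mem_carrier)

lemma card_subgroup_image:
  assumes "finite (carrier G)" "subgroup X G"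
  shows "card X = card (kernel G H h \<inter> X) * card (h ` X)"
proof -
  have "kernel (G\<lparr>carrier := X\<rparr>) H h = kernel G H h \<inter> X"
    using assms subgroup.subset by (auto simp: kernel_def)
  then show ?thesis
    using group_hom.card_kernel_image[OF restrict_subgroup[OF assms(2)]] assms
    by (auto dest!: subgroup.subset intro: finite_subset)
qed

lemma p_power_image:
  assumes "finite (carrier G)" "subgroup X G" "prime p" "p_power p X"
  shows "p_power p (h ` X)"
  using assms card_subgroup_image p_power_dvd by (metis dvd_triv_right)

lemma p_power_extension:
  assumes "finite (carrier G)" "subgroup X G"
    and "p_power p (kernel G H h \<inter> X)" "p_power p (h ` X)"
  shows "p_power p X"
  using assms card_subgroup_image unfolding p_power_def by (metis power_add)

lemma hom_cj:
  assumes "g \<in> carrier G" "x \<in> carrier G"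
  shows "h (cj G g x) = cj H (h g) (h x)"
  using assms by simp

lemma subgroup_preimage:
  assumes "subgroup Y H"
  shows "subgroup {x \<in> carrier G. h x \<in> Y} G"
  using assms by unfold_locales (auto simp: subgroup.m_closed subgroup.one_closed subgroup.m_inv_closed)

lemma normal_preimage:
  assumes "Y \<lhd> H"
  shows "{x \<in> carrier G. h x \<in> Y} \<lhd> G"
  using assms subgroup_preimage unfolding G.normal_cj_iff H.normal_cj_iff by simp

lemma normal_image:
  assumes "N \<lhd> G" "h ` carrier G = carrier H"
  shows "h ` N \<lhd> H"
  unfolding H.normal_cj_iff
proof (intro conjI ballI)
  show "subgroup (h ` N) H"
    using assms normal_imp_subgroup subgroup_img_is_subgroup by blast
  fix y x assume y: "y \<in> carrier H" and x: "x \<in> h ` N"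
  obtain g where "y = h g" "g \<in> carrier G"
    using y assms by blast
  moreover obtain n where "x = h n" "n \<in> N"
    using x by blast
  ultimately show "cj H y x \<in> h ` N"
    using assms(1) G.normal_cj_iff subgroup.mem_carrier[of N G n]
    by (metis hom_cj image_eqI)
qed

end

subsection \<open>The largest normal \<open>p\<close>-subgroup\<close>

context group
begin

text \<open>K is the product NM, taken as the preimage in G of the image of M in G/N. In this form
  it is an extension of the p-group N by an image of the p-group M, and no formula for the order of
  a product is involved.\<close>

lemma normal_p_join:
  assumes "finite (carrier G)" "prime p" "N \<lhd> G" "p_power p N" "M \<lhd> G" "p_power p M"
  obtains K where "K \<lhd> G" "p_power p K" "N \<subseteq> K" "M \<subseteq> K"
proof -
  interpret N: normal N G by fact
  interpret h: group_hom G "G Mod N" "\<lambda>x. N #> x"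
    by (simp add: N.factorgroup_is_group N.r_coset_hom_Mod group_hom_axioms_def group_hom_def is_group)
  have ker: "kernel G (G Mod N) (\<lambda>x. N #> x) = N"
    by (auto simp: kernel_def subgroup.rcos_const[OF N.is_subgroup is_group]
        intro: coset_join1[OF _ _ N.is_subgroup])
  define K where "K = {x \<in> carrier G. N #> x \<in> (\<lambda>x. N #> x) ` M}"
  have M: "subgroup M G" "M \<subseteq> carrier G"
    using assms normal_imp_subgroup subgroup.subset by blast+
  have K: "K \<lhd> G"
    unfolding K_def by (intro h.normal_preimage h.normal_image assms) (simp add: carrier_FactGroup)
  have NK: "N \<subseteq> K"
    using N.subset N.rcos_const subgroup.one_closed[OF M(1)]
    by (force simp: K_def image_iff subgroup.rcos_const[OF N.is_subgroup is_group])
  have "(\<lambda>x. N #> x) ` K = (\<lambda>x. N #> x) ` M"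
    using M by (auto simp: K_def)
  then have "p_power p ((\<lambda>x. N #> x) ` K)"
    using h.p_power_image assms M by metis
  then have "p_power p K"
    using h.p_power_extension[of K p] K NK assms normal_imp_subgroup[OF K] unfolding ker
    by (simp add: Int_absorb2)
  then show ?thesis
    using that[of K] K NK M by (auto simp: K_def)
qed

text \<open>\<open>O_p\<close> is a generated subgroup, which hides that it is itself a normal
  p-subgroup. Take a normal p-subgroup of largest order: joining it with any other one cannot
  enlarge it, so it contains them all and the generated subgroup is equal to it.\<close>

lemma O_p_facts:
  assumes "finite (carrier G)" "prime p"
  shows O_p_normal: "O_p p G \<lhd> G" and O_p_p_power: "p_power p (O_p p G)"
proof -
  define \<N> where "\<N> = {N. N \<lhd> G \<and> p_power p N}"
  have sub: "N \<in> \<N> \<Longrightarrow> N \<subseteq> carrier G" for N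
    unfolding \<N>_def using normal_imp_subgroup subgroup.subset by blast
  then have fin: "finite \<N>"
    using assms(1) by (meson finite_Pow_iff finite_subset subsetI PowI)
  have "p_power p {\<one>}"
    unfolding p_power_def by (rule exI[of _ 0]) simp
  then have "{\<one>} \<in> \<N>"
    by (simp add: \<N>_def one_is_normal)
  \<comment> \<open>The successor is there because \<open>arg_max_nat_lemma\<close> asks for a
    strict upper bound on the orders.\<close>
  then obtain N where N: "N \<in> \<N>" "\<And>M. M \<in> \<N> \<Longrightarrow> card M \<le> card N"
    using fin arg_max_nat_lemma[of "\<lambda>N. N \<in> \<N>" _ card "Suc (card (carrier G))"] sub assms(1)
    by (metis card_mono le_imp_less_Suc)
  have "M \<subseteq> N" if "M \<in> \<N>" for M
  proof -
    obtain K where "K \<lhd> G" "p_power p K" "N \<subseteq> K" "M \<subseteq> K"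
      by (rule normal_p_join[OF assms, of N M]) (use N(1) \<open>M \<in> \<N>\<close> in \<open>auto simp: \<N>_def\<close>)
    then have K: "K \<in> \<N>" "N \<subseteq> K" "M \<subseteq> K"
      by (auto simp: \<N>_def)
    then have "K = N"
      using N sub assms(1) by (metis card_seteq finite_subset)
    then show ?thesis using K by simp
  qed
  then have "\<Union>\<N> = N"
    using N by blast
  moreover have "subgroup N G"
    using N(1) normal_imp_subgroup unfolding \<N>_def by blast
  then have "generate G N \<subseteq> N"
    using generate_subgroup_incl[of N N] by blast
  then have "generate G N = N"
    using generate.incl[of _ N G] by blast
  ultimately have "O_p p G = N"
    by (simp add: O_p_def \<N>_def)
  then show "O_p p G \<lhd> G" "p_power p (O_p p G)"
    using N by (auto simp: \<N>_def)
qed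

lemma O_p_max:
  assumes "N \<lhd> G" "p_power p N"
  shows "N \<subseteq> O_p p G"
  using assms unfolding O_p_def by (auto intro: generate.incl)

lemma O_p_subgroup:
  assumes "finite (carrier G)" "prime p"
  shows "subgroup (O_p p G) G"
  using O_p_normal assms normal_imp_subgroup by blast

section \<open>Centralizers and a criterion for characteristic p\<close>

lemma subgroup_centralizer:
  assumes "X \<subseteq> carrier G"
  shows "subgroup (centralizer G X) G"
proof
  show "centralizer G X \<subseteq> carrier G"
    by (auto simp: centralizer_def)
  show "\<one> \<in> centralizer G X"
    using assms by (auto simp: centralizer_def)
  show "x \<otimes> y \<in> centralizer G X" if "x \<in> centralizer G X" "y \<in> centralizer G X" for x y
    using that assms by (auto simp: centralizer_def cj_cj subsetD)
  show "inv x \<in> centralizer G X" if "x \<in> centralizer G X" for x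
    using that assms cj_fixed_inv by (auto simp: centralizer_def subsetD)
qed

lemma normal_centralizer:
  assumes "N \<lhd> G"
  shows "centralizer G N \<lhd> G"
  unfolding normal_cj_iff
proof (intro conjI ballI)
  have N: "N \<subseteq> carrier G"
    using assms normal_imp_subgroup subgroup.subset by blast
  then show "subgroup (centralizer G N) G"
    by (rule subgroup_centralizer)
  fix g c assume g: "g \<in> carrier G" and c: "c \<in> centralizer G N"
  have "cj G (cj G g c) x = x" if x: "x \<in> N" for x
  proof -
    \<comment> \<open>To evaluate the conjugated element on x, move x back by \<open>inv g\<close>,
      which keeps it in N, let c fix it there, and return by g.\<close>
    have "cj G (inv g) x \<in> N"
      using assms g x unfolding normal_cj_iff by blast
    then have "cj G c (cj G (inv g) x) = cj G (inv g) x"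
      using c by (simp add: centralizer_def)
    then have *: "cj G g (cj G c (cj G (inv g) x)) = x"
      using cj_cancel(1)[of g x] g x N by (simp del: inv_inv cj_cancel add: subsetD)
    have "cj G (cj G g c) x = cj G (inv g \<otimes> (c \<otimes> g)) x"
      using g c by (simp add: centralizer_def m_assoc)
    also have "\<dots> = x"
      using * g c x N cj_cj[of "inv g" "c \<otimes> g" x] cj_cj[of c g "cj G (inv g) x"]
      by (simp del: inv_inv cj_cancel add: subsetD centralizer_def)
    finally show ?thesis .
  qed
  then show "cj G g c \<in> centralizer G N"
    using g c by (simp add: centralizer_def)
qed

text \<open>The centralizer of O_p is normal, so maximality of O_p absorbs it once it is a p-group.
  By Cauchy it then suffices to exclude nontrivial elements of prime order other than p.\<close>

lemma characteristic_pI: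
  assumes "finite (carrier G)" "prime p"
    and "\<And>x q. x \<in> centralizer G (O_p p G) \<Longrightarrow> prime q \<Longrightarrow> q \<noteq> p \<Longrightarrow> x [^] q = \<one> \<Longrightarrow> x = \<one>"
  shows "characteristic_p p G"
proof -
  let ?C = "centralizer G (O_p p G)"
  have n: "?C \<lhd> G"
    using assms O_p_normal normal_centralizer by blast
  then have s: "subgroup ?C G"
    by (rule normal_imp_subgroup)
  interpret C: group "G\<lparr>carrier := ?C\<rparr>"
    using s by (rule subgroup_imp_group)
  have "p_power p (carrier (G\<lparr>carrier := ?C\<rparr>))"
    by (rule C.p_power_if_elements)
      (use assms subgroup.subset[OF s] in \<open>auto intro: finite_subset simp flip: nat_pow_consistent\<close>)
  then have "?C \<subseteq> O_p p G"
    using O_p_max n by simp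
  then show ?thesis
    by (simp add: characteristic_p_def is_group assms)
qed


text \<open>P acts by right multiplication on its right cosets. Their number is a power of p
  different from 1, and every orbit of more than one point has size divisible by p. As P is one
  fixed coset there must be another, and its representative yields an element outside P normalizing
  P.\<close>

lemma p_group_normalizer_grows:
  assumes "finite (carrier G)" "prime p" "p_power p (carrier G)" "subgroup P G" "P \<noteq> carrier G"
  obtains x where "x \<in> carrier G" "x \<notin> P" "cj G x ` P = P"
proof -
  define X where "X = rcosets P"
  \<comment> \<open>The inverse is required because \<open>BijGroup\<close> composes from the left:
    right multiplication by u itself would reverse products.\<close>
  define \<phi> where "\<phi> = (\<lambda>u. \<lambda>C\<in>X. C #> inv u)"
  interpret P: subgroup P G by fact
  interpret PG: group "G\<lparr>carrier := P\<rparr>"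
    using assms by (simp add: subgroup_imp_group)
  have XG: "C \<subseteq> carrier G" if "C \<in> X" for C
    using that P.subset P.rcosets_carrier[OF is_group] X_def by blast
  have shift: "C #> u \<in> X" if "C \<in> X" "u \<in> carrier G" for C u
    using that P.subset unfolding X_def RCOSETS_def by (auto simp: coset_mult_assoc)
  have "group_hom (G\<lparr>carrier := P\<rparr>) (BijGroup X) \<phi>"
  proof (rule group_hom.intro[OF PG.is_group group_BijGroup], unfold_locales, rule homI)
    fix u assume u: "u \<in> carrier (G\<lparr>carrier := P\<rparr>)"
    then have "u \<in> carrier G" by simp
    then have "bij_betw (\<phi> u) X X"
      by (intro bij_betw_byWitness[where f' = "\<lambda>C. C #> u"])
        (auto simp: \<phi>_def shift coset_mult_assoc XG)
    then show "\<phi> u \<in> carrier (BijGroup X)"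
      by (simp add: BijGroup_def Bij_def \<phi>_def)
    fix v assume v: "v \<in> carrier (G\<lparr>carrier := P\<rparr>)"
    then have "v \<in> carrier G" by simp
    then have "bij_betw (\<phi> v) X X"
      by (intro bij_betw_byWitness[where f' = "\<lambda>C. C #> v"])
        (auto simp: \<phi>_def shift coset_mult_assoc XG)
    then have "\<phi> u \<in> Bij X" "\<phi> v \<in> Bij X"
      using \<open>bij_betw (\<phi> u) X X\<close> by (simp_all add: Bij_def \<phi>_def)
    then show "\<phi> (u \<otimes>\<^bsub>G\<lparr>carrier := P\<rparr>\<^esub> v) = \<phi> u \<otimes>\<^bsub>BijGroup X\<^esub> \<phi> v"
      using u v shift XG
      by (auto simp: BijGroup_def compose_def \<phi>_def inv_mult_group coset_mult_assoc fun_eq_iff)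
  qed
  then interpret A: group_action "G\<lparr>carrier := P\<rparr>" X \<phi>
    by (rule group_action.intro)
  have finX: "finite X"
    unfolding X_def RCOSETS_def using assms by simp
  have PX: "P \<in> X"
    unfolding X_def using P.subgroup_in_rcosets is_group by blast
  have card_X: "card X * card P = card (carrier G)"
    unfolding X_def using lagrange assms by (simp add: order_def)
  then have "p_power p X"
    using assms(2,3) p_power_dvd by (metis dvd_triv_left)
  moreover have "card X \<noteq> 1"
    using card_X assms by (metis P.subset card_subset_eq mult_1)
  ultimately have p_dvd_X: "p dvd card X"
    by (metis dvd_power not_gr_zero p_power_def power_0)
  have orb: "p dvd card B" if B: "B \<in> orbits (G\<lparr>carrier := P\<rparr>) X \<phi>" and B1: "card B \<noteq> 1" for B
  proof -
    obtain C where C: "C \<in> X" "B = orbit (G\<lparr>carrier := P\<rparr>) \<phi> C"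
      using B unfolding orbits_def by blast
    have "card B * card (stabilizer (G\<lparr>carrier := P\<rparr>) \<phi> C) = card P"
      using A.orbit_stabilizer_theorem[OF C(1)] C(2) by (simp add: order_def)
    then have "card B dvd card P"
      by (metis dvd_triv_left)
    then have "p_power p B"
      using p_power_dvd[OF assms(2)] p_power_subgroup[OF assms(2,3,4) subgroup_self P.subset] by blast
    then show ?thesis
      using B1 by (metis dvd_power not_gr_zero p_power_def power_0)
  qed
  have orbP: "orbit (G\<lparr>carrier := P\<rparr>) \<phi> P = {P}"
  proof -
    have "\<phi> g P = P" if "g \<in> P" for g
      using that PX P.m_inv_closed by (simp add: \<phi>_def P.rcos_const is_group)
    then show ?thesis
      using P.one_closed unfolding orbit_def by (auto intro!: exI[of _ \<one>])
  qed
  let ?O = "orbits (G\<lparr>carrier := P\<rparr>) X \<phi>"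
  have PO: "{P} \<in> ?O"
    unfolding orbits_def using orbP PX by blast
  \<comment> \<open>If P were the only fixed coset, all orbits except {P} would have size divisible
    by p. Then p would divide both the number of cosets and one less than it.\<close>
  have "\<exists>C\<in>X. C \<noteq> P \<and> orbit (G\<lparr>carrier := P\<rparr>) \<phi> C = {C}"
  proof (rule ccontr)
    assume none: "\<not> ?thesis"
    interpret O: partition X ?O
      by (rule A.orbit_partition)
    have U: "\<Union>?O = X"
      by (rule O.partition_coverture)
    have "p dvd card B" if B: "B \<in> ?O - {{P}}" for B
    proof (cases "card B = 1")
      case True
      then obtain D where D: "B = {D}"
        using card_1_singletonE by blast
      obtain C where C: "C \<in> X" "B = orbit (G\<lparr>carrier := P\<rparr>) \<phi> C"
        using B unfolding orbits_def by blast
      then have "C \<in> B"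
        using A.orbit_refl by blast
      then have "B = {C}"
        using D by blast
      then have "C = P"
        using none C by metis
      then show ?thesis
        using B \<open>B = {C}\<close> by blast
    qed (use orb B in blast)
    moreover have "card X = (\<Sum>B\<in>?O. card B)"
    proof -
      have "pairwise disjnt ?O"
        using O.disjoint_union by (intro pairwiseI) (metis disjnt_def)
      moreover have "finite B" if "B \<in> ?O" for B
        using that finX O.incl finite_subset by blast
      ultimately have "card (\<Union>?O) = (\<Sum>B\<in>?O. card B)"
        by (intro card_Union_disjoint)
      then show ?thesis
        by (simp only: U)
    qed
    moreover have "finite ?O"
      by (rule finite_UnionD) (simp only: U finX)
    ultimately have "p dvd card X - card {P}"
      using PO by (auto simp: sum.remove intro!: dvd_sum)
    moreover have "card X \<noteq> 0"
      using finX PX by auto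
    ultimately have "p dvd 1"
      using p_dvd_X dvd_diffD1[of p "card X" 1] by simp
    then show False
      using assms(2) not_prime_unit by blast
  qed
  then obtain C where C: "C \<in> X" "C \<noteq> P" "orbit (G\<lparr>carrier := P\<rparr>) \<phi> C = {C}"
    by blast
  then obtain x where x: "x \<in> carrier G" "C = P #> x"
    unfolding X_def RCOSETS_def by blast
  \<comment> \<open>That u fixes the coset Px means that x u lies in Px, so x u x^-1 lies in P.
    Hence \<open>inv x\<close>, and not x, is the element that normalizes P in the convention of
    \<open>cj\<close>.\<close>
  have "cj G (inv x) u \<in> P" if u: "u \<in> P" for u
  proof -
    have uG: "u \<in> carrier G" using u by simp
    have "\<phi> (inv u) C \<in> orbit (G\<lparr>carrier := P\<rparr>) \<phi> C"
      using P.m_inv_closed[OF u] unfolding orbit_def by auto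
    then have "\<phi> (inv u) C = C"
      using C(3) by blast
    then have "P #> (x \<otimes> u) = P #> x"
      using C(1) x u P.subset uG by (simp add: \<phi>_def coset_mult_assoc)
    then have "x \<otimes> u \<in> P #> x"
      using rcos_self[of "x \<otimes> u" P] x uG assms(4) by auto
    then obtain v where "v \<in> P" "x \<otimes> u = v \<otimes> x"
      unfolding r_coset_def by blast
    then show ?thesis
      using x uG by (simp add: m_assoc)
  qed
  then have "cj G (inv x) ` P = P"
    using cj_image_eq[of P "inv x"] assms(1) P.subset x finite_subset by blast
  moreover have "inv x \<notin> P"
    using C(2) x P.rcos_const[OF is_group] P.m_inv_closed inv_inv by metis
  ultimately show ?thesis
    using that x by blast
qed

lemma subgroup_normalizer:
  assumes "finite P" "P \<subseteq> carrier G"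
  shows "subgroup {g \<in> carrier G. cj G g ` P = P} G"
proof
  show "\<one> \<in> {g \<in> carrier G. cj G g ` P = P}"
    using assms by (auto simp: subsetD image_iff)
  show "x \<otimes> y \<in> {g \<in> carrier G. cj G g ` P = P}"
    if "x \<in> {g \<in> carrier G. cj G g ` P = P}" "y \<in> {g \<in> carrier G. cj G g ` P = P}" for x y
  proof -
    have "cj G (x \<otimes> y) ` P = cj G y ` cj G x ` P"
      unfolding image_image using that assms cj_cj by (intro image_cong) auto
    then show ?thesis
      using that by auto
  qed
  show "inv x \<in> {g \<in> carrier G. cj G g ` P = P}" if "x \<in> {g \<in> carrier G. cj G g ` P = P}" for x
  proof -
    have "cj G (inv x) (cj G x u) = u" if "u \<in> P" for u
      using that \<open>x \<in> _\<close> assms cj_cancel(2)[of x u] by blast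
    then have "cj G (inv x) ` cj G x ` P = P"
      unfolding image_image by simp
    then show ?thesis
      using that by auto
  qed
qed auto

text \<open>
  The case of Thompson's \<open>A \<times> B\<close> lemma needed here is elementary because \<open>P\<close> lies in the group
  \<open>Q = O\<^sub>p(G)\<close> acted upon: if a \<open>p'\<close>-element \<open>x\<close> centralizes \<open>N\<^sub>Q(P)\<close> and \<open>y\<close> normalizes
  \<open>Y = C\<^sub>Q(x)\<close>, then \<open>y\<^sup>x = c y\<close> with \<open>c \<in> C\<^sub>Q(Y) \<subseteq> Y\<close>, so the order of \<open>c\<close> divides that of \<open>x\<close>.
\<close>

lemma characteristic_p_normalizer:
  assumes p: "prime p" and ch: "characteristic_p p G" and P: "subgroup P G" "P \<subseteq> O_p p G"
  shows "characteristic_p p (G\<lparr>carrier := {g \<in> carrier G. cj G g ` P = P}\<rparr>)"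
proof -
  define N where "N = {g \<in> carrier G. cj G g ` P = P}"
  let ?Q = "O_p p G"
  have fin: "finite (carrier G)"
    using ch by (simp add: characteristic_p_def)
  have PG: "P \<subseteq> carrier G"
    using P subgroup.subset by blast
  have finP: "finite P"
    using fin PG finite_subset by blast
  have N: "subgroup N G"
    unfolding N_def by (rule subgroup_normalizer[OF finP PG])
  then have NG: "N \<subseteq> carrier G"
    by (rule subgroup.subset)
  interpret N: group "G\<lparr>carrier := N\<rparr>"
    using N by (rule subgroup_imp_group)
  have Q: "?Q \<lhd> G" "p_power p ?Q" "subgroup ?Q G"
    using O_p_facts[OF fin p] normal_imp_subgroup by auto
  have QG: "?Q \<subseteq> carrier G"
    using Q subgroup.subset by blast
  interpret Q: group "G\<lparr>carrier := ?Q\<rparr>"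
    using Q(3) by (rule subgroup_imp_group)
  have PN: "P \<subseteq> N"
  proof
    fix x assume x: "x \<in> P"
    then have "cj G x ` P \<subseteq> P"
      using P(1) by (auto intro!: subgroup.m_closed subgroup.m_inv_closed)
    then show "x \<in> N"
      using cj_image_eq[OF finP PG] x PG by (auto simp: N_def)
  qed
  \<comment> \<open>An element centralizing O_p(N) is thereby known to centralize N_Q(P), which is a
    normal p-subgroup of N. This is the link from the small group back to Q.\<close>
  have QN: "?Q \<inter> N \<subseteq> O_p p (G\<lparr>carrier := N\<rparr>)"
  proof (rule N.O_p_max)
    have s: "subgroup (?Q \<inter> N) G"
      using subgroups_Inter_pair[OF Q(3) N] .
    show "?Q \<inter> N \<lhd> G\<lparr>carrier := N\<rparr>"
      unfolding N.normal_cj_iff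
    proof (intro conjI ballI)
      show "subgroup (?Q \<inter> N) (G\<lparr>carrier := N\<rparr>)"
        using s subgroup_restrict_iff[OF N] by blast
      fix g x assume g: "g \<in> carrier (G\<lparr>carrier := N\<rparr>)" and x: "x \<in> ?Q \<inter> N"
      then have "cj G g x \<in> ?Q" "cj G g x \<in> N"
        using Q(1) N NG unfolding normal_cj_iff
        by (auto simp: subgroup.m_closed subgroup.m_inv_closed)
      then show "cj (G\<lparr>carrier := N\<rparr>) g x \<in> ?Q \<inter> N"
        using g m_inv_consistent[OF N] by simp
    qed
    show "p_power p (?Q \<inter> N)"
      using p_power_subgroup[OF p Q(2) s Q(3)] by simp
  qed
  show ?thesis
    unfolding N_def[symmetric]
  proof (rule N.characteristic_pI[OF _ p])
    show "finite (carrier (G\<lparr>carrier := N\<rparr>))"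
      using fin NG finite_subset by auto
    fix x q assume x: "x \<in> centralizer (G\<lparr>carrier := N\<rparr>) (O_p p (G\<lparr>carrier := N\<rparr>))"
      and q: "prime q" "q \<noteq> p" and xq: "x [^]\<^bsub>G\<lparr>carrier := N\<rparr>\<^esub> q = \<one>\<^bsub>G\<lparr>carrier := N\<rparr>\<^esub>"
    have xq: "x [^] q = \<one>"
      using xq by (simp flip: nat_pow_consistent)
    have xN: "x \<in> N" and xG: "x \<in> carrier G"
      using x NG by (auto simp: centralizer_def)
    have fix_QN: "cj G x y = y" if "y \<in> ?Q \<inter> N" for y
      using x that QN m_inv_consistent[OF N xN] by (auto simp: centralizer_def)
    have cop: "coprime q (card ?Q)"
      using Q(2) q p by (auto simp: p_power_def primes_coprime coprime_power_right_iff)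
    \<comment> \<open>The aim is Y = Q: then x centralizes O_p(G), so it lies in the p-group Q
      although its order divides q.\<close>
    define Y where "Y = ?Q \<inter> centralizer G {x}"
    have Y_iff: "y \<in> Y \<longleftrightarrow> y \<in> ?Q \<and> cj G x y = y" for y
      using xG QG cj_fixed_swap unfolding Y_def centralizer_def by auto
    have Ysub: "subgroup Y G"
      unfolding Y_def using subgroups_Inter_pair[OF Q(3)] subgroup_centralizer[of "{x}"] xG by auto
    have YQ: "Y \<subseteq> ?Q"
      by (simp add: Y_def)
    have QNY: "?Q \<inter> N \<subseteq> Y"
      using fix_QN Y_iff by blast
    have PY: "P \<subseteq> Y"
      using PN P QNY by blast
    have "Y = ?Q"
    proof (rule ccontr)
      assume "Y \<noteq> ?Q"
      then obtain y where y: "y \<in> ?Q" "y \<notin> Y" "cj (G\<lparr>carrier := ?Q\<rparr>) y ` Y = Y"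
        using Q.p_group_normalizer_grows[OF _ p, of Y] fin QG Q(2,3) Ysub YQ subgroup_restrict_iff
        by (auto intro: finite_subset)
      have yG: "y \<in> carrier G" using y QG by blast
      have yY: "cj G y u \<in> Y" if "u \<in> Y" for u
        using y that m_inv_consistent[OF Q(3)] by auto
      define c where "c = cj G x y \<otimes> inv y"
      have xy: "cj G x y \<in> ?Q"
        using Q(1) xG y unfolding normal_cj_iff by blast
      then have cQ: "c \<in> ?Q"
        unfolding c_def using Q(3) y by (simp add: subgroup.m_closed subgroup.m_inv_closed)
      then have cG: "c \<in> carrier G" using QG by blast
      \<comment> \<open>Since x fixes Y pointwise and y maps Y to itself, y and its conjugate by x
        act in the same way on Y. Their quotient c therefore acts trivially on Y.\<close>
      have c_fix: "cj G c u = u" if u: "u \<in> Y" for u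
      proof -
        have uG: "u \<in> carrier G" using u YQ QG by blast
        have "cj G (cj G x y) (cj G x u) = cj G x (cj G y u)"
          using xG yG uG by (simp add: m_assoc inv_mult_group)
        then have "cj G (cj G x y) u = cj G y u"
          using yY[OF u] u Y_iff by simp
        then have "cj G (inv y) (cj G (cj G x y) u) = u"
          using cj_cancel(2)[OF yG uG] by (simp only:)
        then show ?thesis
          using cj_cj[of "cj G x y" "inv y" u] xG yG uG by (simp only: c_def inv_closed m_closed)
      qed
      \<comment> \<open>Here P being inside Y, hence inside Q, is decisive: c fixes P pointwise, so
        it lies in N_Q(P) and thus in Y. It follows that x and c commute.\<close>
      then have "cj G c ` P = P"
        using PY by (force simp: image_iff subset_eq)
      then have "c \<in> Y"
        using cQ cG QNY unfolding N_def by blast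
      then have xc: "cj G x c = c"
        using Y_iff by blast
      have xy': "cj G x y = c \<otimes> y"
        using xG yG by (simp add: c_def m_assoc)
      \<comment> \<open>Because x fixes c, iterating the relation y^x = c y multiplies by one more
        factor c each time. At the exponent q the left side is y again, which gives c^q = 1.\<close>
      have pow: "cj G (x [^] n) y = c [^] n \<otimes> y" for n :: nat
      proof (induction n)
        case (Suc n)
        have xcn: "cj G x (c [^] k) = c [^] k" for k :: nat
        proof (induction k)
          case (Suc k)
          then show ?case
            using xG cG xc cj_mult[of x "c [^] k" c] by simp
        qed (use xG in simp)
        have "cj G (x [^] Suc n) y = cj G x (c [^] n \<otimes> y)"
          using xG yG Suc cj_cj[of "x [^] n" x y] by simp
        also have "\<dots> = c [^] n \<otimes> (c \<otimes> y)"
          using cj_mult[of x "c [^] n" y] xG yG cG xcn xy' by simp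
        finally show ?case
          using cG yG by (simp add: m_assoc)
      qed (use yG in simp)
      have "c [^] q \<otimes> y = y"
        using pow[of q] xq yG by simp
      then have "c [^] q = \<one>"
        using cG yG by (metis l_cancel_one' nat_pow_closed r_cancel_one)
      then have "c = \<one>"
        using pow_coprime_one[of c q "card ?Q"] pow_subgroup_card[OF fin Q(3) cQ] cG cop by blast
      then show False
        using xy' yG y Y_iff by simp
    qed
    then have "x \<in> centralizer G ?Q"
      using Y_iff xG by (auto simp: centralizer_def)
    then have "x \<in> ?Q"
      using ch by (auto simp: characteristic_p_def)
    then have "x = \<one>"
      using pow_coprime_one[of x q "card ?Q"] pow_subgroup_card[OF fin Q(3)] xG xq cop by blast
    then show "x = \<one>\<^bsub>G\<lparr>carrier := N\<rparr>\<^esub>"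
      by simp
  qed
qed

end

section \<open>Characteristic p under central extensions\<close>

context group_hom
begin

text \<open>The preimage of O_p(H) is an extension of the p-group kernel by a p-group, hence a
  normal p-subgroup of G. The opposite inclusion holds because a surjection sends normal p-subgroups
  to normal p-subgroups.\<close>

lemma O_p_image:
  assumes "finite (carrier G)" "prime p" "h ` carrier G = carrier H" "p_power p (kernel G H h)"
  shows "O_p p H = h ` O_p p G" "kernel G H h \<subseteq> O_p p G"
proof -
  have finH: "finite (carrier H)"
    using assms by (metis finite_imageI)
  let ?X = "{x \<in> carrier G. h x \<in> O_p p H}"
  have X: "?X \<lhd> G"
    using H.O_p_normal[OF finH assms(2)] by (rule normal_preimage)
  have hX: "h ` ?X = O_p p H"
    using assms(3) H.O_p_subgroup[OF finH assms(2)] subgroup.subset by fastforce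
  have "kernel G H h \<inter> ?X = kernel G H h"
    using subgroup.one_closed[OF H.O_p_subgroup[OF finH assms(2)]] by (auto simp: kernel_def)
  then have "p_power p ?X"
    using p_power_extension[OF assms(1) normal_imp_subgroup[OF X]] assms(4) hX
      H.O_p_p_power[OF finH assms(2)] by simp
  then have "?X \<subseteq> O_p p G"
    using X G.O_p_max by blast
  moreover have "h ` O_p p G \<subseteq> O_p p H"
    using H.O_p_max normal_image p_power_image G.O_p_facts G.O_p_subgroup assms by metis
  ultimately show "O_p p H = h ` O_p p G"
    using hX by blast
  show "kernel G H h \<subseteq> O_p p G"
    using G.O_p_max normal_kernel assms by blast
qed

text \<open>Upwards, an element centralizing O_p(G) maps into O_p(H), the image of O_p(G), and the
  kernel already lies in O_p(G). Downwards, an element of H centralizing O_p(H) lifts to one that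
  centralizes O_p(G) only modulo the kernel; a suitable p-power of the lift centralizes it exactly
  and so lies in O_p(G).\<close>

lemma characteristic_p_central_extension:
  assumes fin: "finite (carrier G)" and p: "prime p" and onto: "h ` carrier G = carrier H"
    and pker: "p_power p (kernel G H h)"
    and central: "\<And>g z. g \<in> carrier G \<Longrightarrow> z \<in> kernel G H h \<Longrightarrow> cj G g z = z"
  shows "characteristic_p p G \<longleftrightarrow> characteristic_p p H"
proof
  let ?Q = "O_p p G"
  have finH: "finite (carrier H)"
    using fin onto by (metis finite_imageI)
  have QG: "subgroup ?Q G" "?Q \<subseteq> carrier G"
    using G.O_p_subgroup[OF fin p] subgroup.subset by blast+
  have QH: "subgroup (O_p p H) H" "p_power p (O_p p H)"
    using H.O_p_subgroup[OF finH p] H.O_p_p_power[OF finH p] by blast+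
  have img: "O_p p H = h ` ?Q" "kernel G H h \<subseteq> ?Q"
    using O_p_image[OF fin p onto pker] .
  {
    assume ch: "characteristic_p p H"
    have "centralizer G ?Q \<subseteq> ?Q"
    proof
      fix g assume g: "g \<in> centralizer G ?Q"
      then have gG: "g \<in> carrier G" by (simp add: centralizer_def)
      have "cj H (h g) (h u) = h u" if "u \<in> ?Q" for u
        using g that QG hom_cj[of g u] by (auto simp: centralizer_def simp del: hom_mult)
      then have "h g \<in> centralizer H (O_p p H)"
        using gG by (simp add: centralizer_def img)
      then have "h g \<in> h ` ?Q"
        using ch img by (auto simp: characteristic_p_def)
      then obtain u where u: "u \<in> ?Q" "h g = h u"
        by blast
      then have "g \<otimes>\<^bsub>G\<^esub> inv\<^bsub>G\<^esub> u \<in> kernel G H h"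
        using gG QG by (auto simp: kernel_def)
      then have "g \<otimes>\<^bsub>G\<^esub> inv\<^bsub>G\<^esub> u \<otimes>\<^bsub>G\<^esub> u \<in> ?Q"
        using img u QG by (meson subgroup.m_closed subsetD)
      then show "g \<in> ?Q"
        using gG u QG by (auto simp: G.m_assoc)
    qed
    then show "characteristic_p p G"
      by (simp add: characteristic_p_def fin)
  next
    assume ch: "characteristic_p p G"
    show "characteristic_p p H"
    proof (rule H.characteristic_pI[OF finH p])
      fix y q assume y: "y \<in> centralizer H (O_p p H)" and q: "prime q" "q \<noteq> p" "y [^]\<^bsub>H\<^esub> q = \<one>\<^bsub>H\<^esub>"
      obtain g where g: "g \<in> carrier G" "y = h g"
        using y onto by (auto simp: centralizer_def)
      \<comment> \<open>The lift g shifts each u in O_p(G) by some z of the kernel. As z is central,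
        g^n shifts u by z^n, and the order of the kernel is an exponent that kills every z at
        once.\<close>
      let ?m = "card (kernel G H h)"
      have "cj G (g [^]\<^bsub>G\<^esub> ?m) u = u" if u: "u \<in> ?Q" for u
      proof -
        have uG: "u \<in> carrier G" using u QG by blast
        define z where "z = inv\<^bsub>G\<^esub> u \<otimes>\<^bsub>G\<^esub> cj G g u"
        have "cj H y (h u) = h u"
          using y u img by (auto simp: centralizer_def)
        then have "z \<in> kernel G H h"
          using g uG by (simp add: kernel_def z_def)
        then have z: "z \<in> carrier G" "z [^]\<^bsub>G\<^esub> ?m = \<one>\<^bsub>G\<^esub>"
          and zc: "\<And>k. k \<in> carrier G \<Longrightarrow> cj G k z = z"
          using G.pow_subgroup_card[OF fin subgroup_kernel] central by (auto simp: kernel_def)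
        have gu: "cj G g u = u \<otimes>\<^bsub>G\<^esub> z"
          using g uG by (simp add: z_def G.m_assoc)
        have "cj G (g [^]\<^bsub>G\<^esub> n) u = u \<otimes>\<^bsub>G\<^esub> z [^]\<^bsub>G\<^esub> n" for n :: nat
        proof (induction n)
          case (Suc n)
          have zn: "cj G g (z [^]\<^bsub>G\<^esub> k) = z [^]\<^bsub>G\<^esub> k" for k :: nat
          proof (induction k)
            case (Suc k)
            then show ?case
              using g z zc[of g] G.cj_mult[of g "z [^]\<^bsub>G\<^esub> k" z] by simp
          qed (use g in simp)
          have "cj G (g [^]\<^bsub>G\<^esub> Suc n) u = cj G g (u \<otimes>\<^bsub>G\<^esub> z [^]\<^bsub>G\<^esub> n)"
            using g uG Suc G.cj_cj[of "g [^]\<^bsub>G\<^esub> n" g u] by simp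
          also have "\<dots> = u \<otimes>\<^bsub>G\<^esub> z \<otimes>\<^bsub>G\<^esub> z [^]\<^bsub>G\<^esub> n"
            using G.cj_mult[of g u "z [^]\<^bsub>G\<^esub> n"] g uG z zn gu by simp
          finally show ?case
            using z uG by (simp add: G.m_assoc G.nat_pow_comm flip: G.nat_pow_Suc2)
        qed (use uG in simp)
        then show ?thesis
          using z uG by simp
      qed
      then have "g [^]\<^bsub>G\<^esub> ?m \<in> ?Q"
        using ch g by (auto simp: characteristic_p_def centralizer_def)
      then have "y [^]\<^bsub>H\<^esub> ?m \<in> O_p p H"
        using g img by (metis hom_nat_pow image_eqI)
      then have "(y [^]\<^bsub>H\<^esub> ?m) [^]\<^bsub>H\<^esub> card (O_p p H) = \<one>\<^bsub>H\<^esub>"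
        using H.pow_subgroup_card[OF finH QH(1)] by blast
      then have "y [^]\<^bsub>H\<^esub> (?m * card (O_p p H)) = \<one>\<^bsub>H\<^esub>"
        using g by (simp add: H.nat_pow_pow)
      moreover have "coprime (?m * card (O_p p H)) q"
        using pker QH(2) p q by (auto simp: p_power_def primes_coprime simp flip: power_add)
      ultimately show "y = \<one>\<^bsub>H\<^esub>"
        using H.pow_coprime_one[of y] q g by simp
    qed
  }
qed

end

section \<open>Characteristic p of direct products\<close>

lemma group_hom_fst: "group G \<Longrightarrow> group H \<Longrightarrow> group_hom (G \<times>\<times> H) G fst"
  and group_hom_snd: "group G \<Longrightarrow> group H \<Longrightarrow> group_hom (G \<times>\<times> H) H snd"
  by (auto simp: group_hom_def group_hom_axioms_def DirProd_group hom_def mult_DirProd')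

text \<open>Both projections are surjective, so they send the O_p of the product into the O_p of the
  factors; conversely the product of the two is a normal p-subgroup.\<close>

lemma O_p_DirProd:
  assumes "group G" "group H" "finite (carrier G)" "finite (carrier H)" "prime p"
  shows "O_p p (G \<times>\<times> H) = O_p p G \<times> O_p p H"
proof
  interpret G: group G by fact
  interpret H: group H by fact
  interpret D: group "G \<times>\<times> H" by (rule DirProd_group) fact+
  interpret f: group_hom "G \<times>\<times> H" G fst by (rule group_hom_fst) fact+
  interpret s: group_hom "G \<times>\<times> H" H snd by (rule group_hom_snd) fact+
  have fin: "finite (carrier (G \<times>\<times> H))"
    using assms by simp
  have onto: "fst ` carrier (G \<times>\<times> H) = carrier G" "snd ` carrier (G \<times>\<times> H) = carrier H"
    using G.one_closed H.one_closed by force+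
  note O = D.O_p_facts[OF fin assms(5)] D.O_p_subgroup[OF fin assms(5)]
  have "fst ` O_p p (G \<times>\<times> H) \<subseteq> O_p p G"
    by (intro G.O_p_max f.normal_image f.p_power_image O fin onto assms(5))
  moreover have "snd ` O_p p (G \<times>\<times> H) \<subseteq> O_p p H"
    by (intro H.O_p_max s.normal_image s.p_power_image O fin onto assms(5))
  ultimately show "O_p p (G \<times>\<times> H) \<subseteq> O_p p G \<times> O_p p H"
    by force
  note O1 = G.O_p_facts[OF assms(3,5)] G.O_p_subgroup[OF assms(3,5)]
  note O2 = H.O_p_facts[OF assms(4,5)] H.O_p_subgroup[OF assms(4,5)]
  show "O_p p G \<times> O_p p H \<subseteq> O_p p (G \<times>\<times> H)"
  proof (rule D.O_p_max)
    show "p_power p (O_p p G \<times> O_p p H)"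
      using O1(2) O2(2) unfolding p_power_def card_cartesian_product by (metis power_add)
    show "O_p p G \<times> O_p p H \<lhd> G \<times>\<times> H"
      using O1 O2 DirProd_subgroups[OF assms(1) O1(3) assms(2) O2(3)]
      by (auto simp: D.normal_cj_iff G.normal_cj_iff H.normal_cj_iff assms(1,2))
  qed
qed

lemma centralizer_DirProd:
  assumes "group G" "group H" "X \<subseteq> carrier G" "Y \<subseteq> carrier H" "X \<noteq> {}" "Y \<noteq> {}"
  shows "centralizer (G \<times>\<times> H) (X \<times> Y) = centralizer G X \<times> centralizer H Y"
  using assms by (auto simp: centralizer_def)

lemma characteristic_p_DirProd:
  assumes "group G" "group H" "finite (carrier G)" "finite (carrier H)" "prime p"
  shows "characteristic_p p (G \<times>\<times> H) \<longleftrightarrow> characteristic_p p G \<and> characteristic_p p H"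
proof -
  interpret G: group G by fact
  interpret H: group H by fact
  note OG = G.O_p_subgroup[OF assms(3,5)] and OH = H.O_p_subgroup[OF assms(4,5)]
  have G1: "O_p p G \<subseteq> carrier G" "\<one>\<^bsub>G\<^esub> \<in> O_p p G" "\<one>\<^bsub>G\<^esub> \<in> centralizer G (O_p p G)"
    using subgroup.subset[OF OG] subgroup.one_closed[OF OG] G.subgroup_centralizer subgroup.one_closed
    by blast+
  have H1: "O_p p H \<subseteq> carrier H" "\<one>\<^bsub>H\<^esub> \<in> O_p p H" "\<one>\<^bsub>H\<^esub> \<in> centralizer H (O_p p H)"
    using subgroup.subset[OF OH] subgroup.one_closed[OF OH] H.subgroup_centralizer subgroup.one_closed
    by blast+
  have "centralizer (G \<times>\<times> H) (O_p p G \<times> O_p p H) = centralizer G (O_p p G) \<times> centralizer H (O_p p H)"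
    using centralizer_DirProd G1 H1 assms by blast
  \<comment> \<open>An inclusion between rectangles splits into two inclusions because the rectangle
    of centralizers contains the identity and is not empty.\<close>
  then have "centralizer (G \<times>\<times> H) (O_p p (G \<times>\<times> H)) \<subseteq> O_p p (G \<times>\<times> H) \<longleftrightarrow>
      centralizer G (O_p p G) \<subseteq> O_p p G \<and> centralizer H (O_p p H) \<subseteq> O_p p H"
    using G1(3) H1(3) unfolding O_p_DirProd[OF assms] by (auto simp: times_subset_iff)
  then show ?thesis
    using assms by (simp add: characteristic_p_def DirProd_group)
qed

section \<open>Fusion systems\<close>

context fusion_system
begin

lemma mor_facts:
  assumes "\<phi> \<in> F P Q"
  shows mor_dom: "subgroup P G" and mor_cod: "subgroup Q G"
    and mor_ext: "\<phi> \<in> extensional P" and mor_inj: "inj_on \<phi> P"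
    and mor_group_hom: "group_hom (G\<lparr>carrier := P\<rparr>) G \<phi>"
    and mor_into: "\<phi> ` P \<subseteq> Q" and mor_image: "subgroup (\<phi> ` P) G"
proof -
  show P: "subgroup P G" and Q: "subgroup Q G"
    using mor_subgroups assms by blast+
  have h: "\<phi> \<in> hom (G\<lparr>carrier := P\<rparr>) (G\<lparr>carrier := Q\<rparr>)"
    using mor_inj_hom assms by blast
  show "\<phi> \<in> extensional P" "inj_on \<phi> P"
    using mor_inj_hom assms by blast+
  show "\<phi> ` P \<subseteq> Q"
    using h by (auto simp: hom_def)
  then show "group_hom (G\<lparr>carrier := P\<rparr>) G \<phi>"
    using h subgroup.subset[OF Q] subgroup_imp_group[OF P]
    by (auto simp: group_hom_def group_hom_axioms_def hom_def)
  show "subgroup (\<phi> ` P) G"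
    using mor_iso assms mor_subgroups by blast
qed

lemma mor_closed: "\<phi> \<in> F P Q \<Longrightarrow> x \<in> P \<Longrightarrow> \<phi> x \<in> Q"
  using mor_into by blast

lemma mor_mult:
  assumes "\<phi> \<in> F P Q" "x \<in> P" "y \<in> P"
  shows "\<phi> (x \<otimes> y) = \<phi> x \<otimes> \<phi> y"
  using group_hom.hom_mult[OF mor_group_hom[OF assms(1)], of x y] assms by simp

lemma mor_inv:
  assumes "\<phi> \<in> F P Q" "x \<in> P"
  shows "\<phi> (inv x) = inv (\<phi> x)"
  using group_hom.hom_inv[OF mor_group_hom[OF assms(1)], of x] assms m_inv_consistent[OF mor_dom[OF assms(1)]]
  by simp

lemma mor_one: "\<phi> \<in> F P Q \<Longrightarrow> \<phi> \<one> = \<one>"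
  using group_hom.hom_one[OF mor_group_hom] by fastforce

lemma mor_cj:
  assumes "\<phi> \<in> F P Q" "x \<in> P" "y \<in> P"
  shows "\<phi> (cj G x y) = cj G (\<phi> x) (\<phi> y)"
proof -
  note P = mor_dom[OF assms(1)]
  have "inv x \<in> P" "inv x \<otimes> y \<in> P"
    using P assms by (simp_all add: subgroup.m_closed subgroup.m_inv_closed)
  then show ?thesis
    using assms mor_mult[OF assms(1)] mor_inv[OF assms(1,2)] by simp
qed

lemma finite_subgroup: "subgroup P G \<Longrightarrow> finite P"
  using finite_G finite_subset subgroup.subset by blast

lemma mor_incl:
  assumes "subgroup P G" "subgroup Q G" "P \<subseteq> Q"
  shows "(\<lambda>x\<in>P. x) \<in> F P Q"
proof -
  have "cj G \<one> x = x" if "x \<in> P" for x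
    using that subgroup.mem_carrier[OF assms(1)] by simp
  then have "(\<lambda>x\<in>P. cj G \<one> x) = (\<lambda>x\<in>P. x)" "(\<lambda>x. cj G \<one> x) ` P = P"
    by (auto cong: image_cong intro!: restrict_ext)
  then show ?thesis
    using mor_conj[of P Q \<one>] assms by simp
qed

text \<open>The axioms let a codomain be changed only by corestricting to the image with
  \<open>mor_iso\<close> and then composing with an inclusion.\<close>

lemma mor_codomain:
  assumes "\<phi> \<in> F P Q" "subgroup R G" "\<phi> ` P \<subseteq> R"
  shows "\<phi> \<in> F P R"
proof -
  have "compose P (\<lambda>x\<in>\<phi> ` P. x) \<phi> \<in> F P R"
    using mor_compose mor_iso mor_incl mor_image assms by blast
  moreover have "compose P (\<lambda>x\<in>\<phi> ` P. x) \<phi> = \<phi>"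
    using mor_ext[OF assms(1)] by (intro extensionalityI[of _ P]) (auto simp: compose_def)
  ultimately show ?thesis by simp
qed

lemma mor_restrict:
  assumes "\<phi> \<in> F P Q" "subgroup P' G" "P' \<subseteq> P" "subgroup Q' G" "\<phi> ` P' \<subseteq> Q'"
  shows "restrict \<phi> P' \<in> F P' Q'"
proof -
  have "compose P' \<phi> (\<lambda>x\<in>P'. x) \<in> F P' Q"
    using mor_compose mor_incl mor_dom assms by blast
  moreover have "compose P' \<phi> (\<lambda>x\<in>P'. x) = restrict \<phi> P'"
    by (auto simp: compose_def fun_eq_iff)
  ultimately have "restrict \<phi> P' \<in> F P' Q" by simp
  then show ?thesis
    using mor_codomain assms by simp
qed

lemma aut_onto:
  assumes "\<phi> \<in> F P P"
  shows "\<phi> ` P = P"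
  using assms mor_into mor_inj mor_dom finite_subgroup endo_inj_surj by metis

lemma aut_Bij: "F P P \<subseteq> Bij P"
  using aut_onto mor_inj mor_ext by (auto simp: Bij_def bij_betw_def)

lemma carrier_fus_Aut [simp]: "carrier (fus_Aut F P) = F P P"
  by (simp add: fus_Aut_def)

lemma mult_fus_Aut: "\<phi> \<in> F P P \<Longrightarrow> \<psi> \<in> F P P \<Longrightarrow> \<phi> \<otimes>\<^bsub>fus_Aut F P\<^esub> \<psi> = compose P \<phi> \<psi>"
  using aut_Bij by (auto simp: fus_Aut_def BijGroup_def)

lemma group_fus_Aut:
  assumes "subgroup P G"
  shows "group (fus_Aut F P)"
proof -
  interpret B: group "BijGroup P"
    by (rule group_BijGroup)
  have "subgroup (F P P) (BijGroup P)"
  proof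
    show "F P P \<subseteq> carrier (BijGroup P)"
      using aut_Bij by (simp add: BijGroup_def)
    show "\<one>\<^bsub>BijGroup P\<^esub> \<in> F P P"
      using mor_incl[OF assms assms] by (simp add: BijGroup_def)
    show "\<phi> \<otimes>\<^bsub>BijGroup P\<^esub> \<psi> \<in> F P P" if "\<phi> \<in> F P P" "\<psi> \<in> F P P" for \<phi> \<psi>
      using mult_fus_Aut[OF that] mor_compose[OF that(2,1)] by (simp add: fus_Aut_def)
    show "inv\<^bsub>BijGroup P\<^esub> \<phi> \<in> F P P" if \<phi>: "\<phi> \<in> F P P" for \<phi>
    proof -
      have "\<phi> \<in> Bij P" using aut_Bij \<phi> by blast
      then show ?thesis
        using mor_iso[OF \<phi>] by (simp add: inv_BijGroup aut_onto[OF \<phi>])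
    qed
  qed
  then show ?thesis
    unfolding fus_Aut_def by (rule B.subgroup_imp_group)
qed

lemma finite_fus_Aut:
  assumes "subgroup P G"
  shows "finite (carrier (fus_Aut F P))"
proof (rule finite_subset)
  show "carrier (fus_Aut F P) \<subseteq> P \<rightarrow>\<^sub>E P"
    using mor_ext mor_closed by (auto simp: PiE_def)
  show "finite (P \<rightarrow>\<^sub>E P)"
    using assms finite_subgroup by (simp add: finite_PiE)
qed

lemma conj_aut:
  assumes "subgroup P G" "t \<in> carrier G" "cj G t ` P = P"
  shows "(\<lambda>x\<in>P. cj G t x) \<in> F P P"
  using mor_conj[OF assms(1,1,2)] assms(3) by simp

text \<open>The automorphisms of P induced by T form a homomorphic image of the p-group T, and
  \<open>inv\<close> says that conjugating by an automorphism in F permutes them. They are thus a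
  normal p-subgroup. The uses are T = P for inner automorphisms, and the image of a normalizer for
  the proof that centric radical subgroups are rectangles.\<close>

lemma conj_auts_subset_O_p:
  assumes p: "prime p" and P: "subgroup P G" and T: "subgroup T G" "\<And>t. t \<in> T \<Longrightarrow> cj G t ` P = P"
    and inv: "\<And>\<phi> t. \<phi> \<in> F P P \<Longrightarrow> t \<in> T \<Longrightarrow> \<exists>t'\<in>T. \<forall>x\<in>P. \<phi> (cj G t x) = cj G t' (\<phi> x)"
  shows "{(\<lambda>x\<in>P. cj G t x) | t. t \<in> T} \<subseteq> O_p p (fus_Aut F P)"
proof -
  interpret A: group "fus_Aut F P"
    by (rule group_fus_Aut[OF P])
  interpret T: group "G\<lparr>carrier := T\<rparr>"
    by (rule subgroup_imp_group[OF T(1)])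
  have TG: "t \<in> carrier G" if "t \<in> T" for t
    using that subgroup.mem_carrier[OF T(1)] by blast
  have PG: "x \<in> carrier G" if "x \<in> P" for x
    using that subgroup.mem_carrier[OF P] by blast
  define c where "c = (\<lambda>t. \<lambda>x\<in>P. cj G t x)"
  have c_mem: "c t \<in> F P P" if "t \<in> T" for t
    unfolding c_def using conj_aut P T TG that by blast
  have c_P: "cj G t x \<in> P" if "t \<in> T" "x \<in> P" for t x
    using T(2) that by blast
  \<comment> \<open>Conjugation \<open>cj\<close> acts from the right while automorphisms compose
    from the left, so inverses turn the antihomomorphism into a homomorphism. The image is the same
    since T is closed under inverses.\<close>
  define c' where "c' = (\<lambda>t. c (inv t))"
  have inv_T: "inv t \<in> T" if "t \<in> T" for t
    using that T(1) by (simp add: subgroup.m_inv_closed)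
  have "group_hom (G\<lparr>carrier := T\<rparr>) (fus_Aut F P) c'"
  proof (intro group_hom.intro T.is_group A.is_group group_hom_axioms.intro homI)
    fix s t assume s: "s \<in> carrier (G\<lparr>carrier := T\<rparr>)" and t: "t \<in> carrier (G\<lparr>carrier := T\<rparr>)"
    then have st: "s \<in> T" "t \<in> T" "s \<in> carrier G" "t \<in> carrier G" "inv s \<in> T" "inv t \<in> T"
      using TG inv_T by auto
    then show "c' s \<in> carrier (fus_Aut F P)"
      using c_mem by (simp add: c'_def)
    have "cj G (inv (s \<otimes> t)) x = cj G (inv s) (cj G (inv t) x)" if "x \<in> P" for x
      using st PG[OF that] cj_cj[of "inv t" "inv s" x] by (simp only: inv_mult_group inv_closed)
    moreover have "c' s \<otimes>\<^bsub>fus_Aut F P\<^esub> c' t = compose P (c (inv s)) (c (inv t))"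
      unfolding c'_def by (rule mult_fus_Aut) (use c_mem st in blast)+
    ultimately show "c' (s \<otimes>\<^bsub>G\<lparr>carrier := T\<rparr>\<^esub> t) = c' s \<otimes>\<^bsub>fus_Aut F P\<^esub> c' t"
      using c_P[OF st(6)] by (auto simp: c_def c'_def compose_def simp del: inv_inv intro!: restrict_ext)
  qed
  then interpret h: group_hom "G\<lparr>carrier := T\<rparr>" "fus_Aut F P" c' .
  have img: "c' ` T = c ` T"
    unfolding c'_def using inv_T TG by (force simp: image_iff)
  have s: "subgroup (c ` T) (fus_Aut F P)"
    using h.img_is_subgroup img by simp
  have T_fin: "finite T" "p_power p T"
    using finite_subgroup[OF T(1)] p_power_subgroup[OF p p_power_G T(1) subgroup_self] subgroup.subset[OF T(1)]
    by blast+
  have "c ` T \<lhd> fus_Aut F P"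
    unfolding A.normal_inv_iff
  proof (intro conjI ballI s)
    fix \<phi> \<tau> assume \<phi>: "\<phi> \<in> carrier (fus_Aut F P)" and "\<tau> \<in> c ` T"
    then obtain t where t: "t \<in> T" "\<tau> = c t" by blast
    have \<phi>F: "\<phi> \<in> F P P" using \<phi> by simp
    obtain t' where t': "t' \<in> T" "\<And>x. x \<in> P \<Longrightarrow> \<phi> (cj G t x) = cj G t' (\<phi> x)"
      using inv[OF \<phi>F t(1)] by blast
    have "compose P \<phi> (c t) = compose P (c t') \<phi>"
      using t' mor_closed[OF \<phi>F] by (auto simp: compose_def c_def intro!: restrict_ext)
    then have "\<phi> \<otimes>\<^bsub>fus_Aut F P\<^esub> c t = c t' \<otimes>\<^bsub>fus_Aut F P\<^esub> \<phi>"
      using mult_fus_Aut \<phi>F c_mem t t' by metis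
    moreover have "c t' \<in> carrier (fus_Aut F P)"
      using c_mem[OF t'(1)] by simp
    ultimately have "\<phi> \<otimes>\<^bsub>fus_Aut F P\<^esub> \<tau> \<otimes>\<^bsub>fus_Aut F P\<^esub> inv\<^bsub>fus_Aut F P\<^esub> \<phi> = c t'"
      using \<phi> t by (simp add: A.m_assoc del: carrier_fus_Aut)
    then show "\<phi> \<otimes>\<^bsub>fus_Aut F P\<^esub> \<tau> \<otimes>\<^bsub>fus_Aut F P\<^esub> inv\<^bsub>fus_Aut F P\<^esub> \<phi> \<in> c ` T"
      using t' by blast
  qed
  moreover have "p_power p (c ` T)"
    using h.p_power_image[OF _ T.subgroup_self p] T_fin img by simp
  ultimately have "c ` T \<subseteq> O_p p (fus_Aut F P)"
    using A.O_p_max by blast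
  then show ?thesis
    by (auto simp: c_def)
qed

lemma Inn_subset_O_p:
  assumes "prime p" "subgroup P G"
  shows "Inn G P \<subseteq> O_p p (fus_Aut F P)"
proof -
  have "cj G t ` P = P" if "t \<in> P" for t
  proof (rule cj_image_eq)
    show "cj G t ` P \<subseteq> P"
      using that assms by (auto intro!: subgroup.m_closed subgroup.m_inv_closed)
  qed (use assms that finite_subgroup subgroup.subset in blast)+
  moreover have "\<exists>t'\<in>P. \<forall>x\<in>P. \<phi> (cj G t x) = cj G t' (\<phi> x)" if "\<phi> \<in> F P P" "t \<in> P" for \<phi> t
    using that mor_cj mor_closed by blast
  ultimately show ?thesis
    unfolding Inn_def using conj_auts_subset_O_p[OF assms assms(2)] by blast
qed

end

subsection \<open>Products\<close>

lemma cj_DirProd: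
  assumes "group G" "group H" "g \<in> carrier (G \<times>\<times> H)"
  shows "cj (G \<times>\<times> H) g x = (cj G (fst g) (fst x), cj H (snd g) (snd x))"
  using assms by (cases g) (simp add: mult_DirProd')

lemma subgroup_fst:
  assumes "group G" "group H" "subgroup P (G \<times>\<times> H)"
  shows "subgroup (fst ` P) G" and "subgroup (snd ` P) H"
  using group_hom.subgroup_img_is_subgroup[OF group_hom_fst[OF assms(1,2)] assms(3)]
    group_hom.subgroup_img_is_subgroup[OF group_hom_snd[OF assms(1,2)] assms(3)] by auto

locale fusion_product = F1: fusion_system p G1 F1 + F2: fusion_system p G2 F2
  for p :: nat and G1 :: "('a, 'm) monoid_scheme" and F1 and G2 :: "('b, 'n) monoid_scheme" and F2
begin

abbreviation "GG \<equiv> G1 \<times>\<times> G2"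
abbreviation "FF \<equiv> fus_prod G1 F1 G2 F2"

lemma group_GG: "group GG"
  by (rule DirProd_group) (rule F1.is_group F2.is_group)+

text \<open>The witnesses in the definition of \<open>fus_prod\<close> may live on subgroups larger
  than the projections of P. Restricting them gives a normal form in which the domains match under
  composition and inversion.\<close>

lemma prod_mor:
  assumes "\<phi> \<in> FF P Q"
  obtains \<phi>1 \<phi>2 where "\<phi>1 \<in> F1 (fst ` P) (fst ` Q)" "\<phi>2 \<in> F2 (snd ` P) (snd ` Q)"
    "\<phi> = restrict (map_prod \<phi>1 \<phi>2) P" "subgroup P GG" "subgroup Q GG" "\<phi> ` P \<subseteq> Q"
proof -
  obtain \<phi>1 \<phi>2 P1 Q1 P2 Q2 where *: "\<phi> = restrict (map_prod \<phi>1 \<phi>2) P" "subgroup P GG" "subgroup Q GG"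
    "\<phi>1 \<in> F1 P1 Q1" "\<phi>2 \<in> F2 P2 Q2" "P \<subseteq> P1 \<times> P2" "map_prod \<phi>1 \<phi>2 ` P \<subseteq> Q"
    using assms unfolding fus_prod_def by blast
  note s = subgroup_fst[OF F1.is_group F2.is_group]
  have a: "restrict \<phi>1 (fst ` P) \<in> F1 (fst ` P) (fst ` Q)"
    by (rule F1.mor_restrict[OF *(4) s(1)[OF *(2)] _ s(1)[OF *(3)]]) (use *(6,7) in force)+
  have b: "restrict \<phi>2 (snd ` P) \<in> F2 (snd ` P) (snd ` Q)"
    by (rule F2.mor_restrict[OF *(5) s(2)[OF *(2)] _ s(2)[OF *(3)]]) (use *(6,7) in force)+
  have c: "\<phi> = restrict (map_prod (restrict \<phi>1 (fst ` P)) (restrict \<phi>2 (snd ` P))) P"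
    unfolding *(1) by (auto simp: fun_eq_iff restrict_def image_iff split: prod.splits)
  have d: "\<phi> ` P \<subseteq> Q"
    using *(7) by (simp add: *(1))
  show ?thesis
    by (rule that[OF a b c *(2,3) d])
qed

lemma prod_morI:
  assumes "\<phi>1 \<in> F1 P1 Q1" "\<phi>2 \<in> F2 P2 Q2" "subgroup P GG" "subgroup Q GG" "P \<subseteq> P1 \<times> P2"
    "map_prod \<phi>1 \<phi>2 ` P \<subseteq> Q"
  shows "restrict (map_prod \<phi>1 \<phi>2) P \<in> FF P Q"
  using assms unfolding fus_prod_def by blast

lemma prod_mor_times:
  assumes "\<phi>1 \<in> F1 P1 Q1" "\<phi>2 \<in> F2 P2 Q2"
  shows "restrict (map_prod \<phi>1 \<phi>2) (P1 \<times> P2) \<in> FF (P1 \<times> P2) (Q1 \<times> Q2)"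
  using assms F1.mor_facts[OF assms(1)] F2.mor_facts[OF assms(2)]
  by (intro prod_morI[OF assms] DirProd_subgroups F1.is_group F2.is_group) auto

lemma subset_times: "P \<subseteq> fst ` P \<times> snd ` P"
  by force

lemma fusion_system_prod: "fusion_system p GG FF"
proof (intro fusion_system.intro fusion_system_axioms.intro group_GG)
  show "finite (carrier GG)"
    using F1.finite_G F2.finite_G by simp
  show "p_power p (carrier GG)"
    using F1.p_power_G F2.p_power_G unfolding p_power_def carrier_DirProd card_cartesian_product
    by (metis power_add)
next
  fix \<phi> P Q assume \<phi>: "\<phi> \<in> FF P Q"
  obtain \<phi>1 \<phi>2 where *: "\<phi>1 \<in> F1 (fst ` P) (fst ` Q)" "\<phi>2 \<in> F2 (snd ` P) (snd ` Q)"
    "\<phi> = restrict (map_prod \<phi>1 \<phi>2) P" "subgroup P GG" "subgroup Q GG" "\<phi> ` P \<subseteq> Q"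
    using prod_mor[OF \<phi>] .
  show "subgroup P GG \<and> subgroup Q GG"
    using * by blast
  have val: "\<phi> x = (\<phi>1 (fst x), \<phi>2 (snd x))" if "x \<in> P" for x
    using that *(3) by (cases x) simp
  have inj: "inj_on \<phi> P"
  proof (rule inj_onI)
    fix x y assume xy: "x \<in> P" "y \<in> P" "\<phi> x = \<phi> y"
    then have eq: "\<phi>1 (fst x) = \<phi>1 (fst y)" "\<phi>2 (snd x) = \<phi>2 (snd y)"
      using val[OF xy(1)] val[OF xy(2)] by simp_all
    have "fst x = fst y" "snd x = snd y"
      using inj_onD[OF F1.mor_inj[OF *(1)] eq(1)] inj_onD[OF F2.mor_inj[OF *(2)] eq(2)] xy(1,2)
      by simp_all
    then show "x = y"
      by (simp add: prod_eq_iff)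
  qed
  have mult: "\<phi> (x \<otimes>\<^bsub>GG\<^esub> y) = \<phi> x \<otimes>\<^bsub>GG\<^esub> \<phi> y" if "x \<in> P" "y \<in> P" for x y
  proof -
    have "x \<otimes>\<^bsub>GG\<^esub> y \<in> P"
      using that *(4) by (simp add: subgroup.m_closed)
    then show ?thesis
      using that F1.mor_mult[OF *(1)] F2.mor_mult[OF *(2)] by (simp add: val mult_DirProd')
  qed
  show "\<phi> \<in> extensional P \<and> inj_on \<phi> P \<and> \<phi> \<in> hom (GG\<lparr>carrier := P\<rparr>) (GG\<lparr>carrier := Q\<rparr>)"
    using inj mult *(3,6) by (auto simp: hom_def)
  show "\<phi> \<in> FF P (\<phi> ` P) \<and> restrict (inv_into P \<phi>) (\<phi> ` P) \<in> FF (\<phi> ` P) P"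
  proof
    interpret h: group_hom "GG\<lparr>carrier := P\<rparr>" GG \<phi>
      using mult *(6) subgroup.subset[OF *(5)] group.subgroup_imp_group[OF group_GG *(4)] group_GG
      by (auto simp: group_hom_def group_hom_axioms_def hom_def)
    have s: "subgroup (\<phi> ` P) GG"
      using h.img_is_subgroup by simp
    show "\<phi> \<in> FF P (\<phi> ` P)"
      by (subst *(3), rule prod_morI[OF *(1,2,4) s subset_times]) (auto simp: *(3))
    \<comment> \<open>The inverse cannot be read off from the image of P, which need not be a
      rectangle. It is assembled from the coordinate inverses on the surrounding rectangle and then
      restricted.\<close>
    define \<psi>1 where "\<psi>1 = restrict (inv_into (fst ` P) \<phi>1) (\<phi>1 ` fst ` P)"
    define \<psi>2 where "\<psi>2 = restrict (inv_into (snd ` P) \<phi>2) (\<phi>2 ` snd ` P)"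
    have \<psi>: "\<psi>1 \<in> F1 (\<phi>1 ` fst ` P) (fst ` P)" "\<psi>2 \<in> F2 (\<phi>2 ` snd ` P) (snd ` P)"
      unfolding \<psi>1_def \<psi>2_def using F1.mor_iso[OF *(1)] F2.mor_iso[OF *(2)] by blast+
    have inv: "map_prod \<psi>1 \<psi>2 (\<phi> x) = x" if "x \<in> P" for x
      using that F1.mor_inj[OF *(1)] F2.mor_inj[OF *(2)]
      by (simp add: val \<psi>1_def \<psi>2_def)
    have "restrict (map_prod \<psi>1 \<psi>2) (\<phi> ` P) \<in> FF (\<phi> ` P) P"
    proof (rule prod_morI[OF \<psi> s *(4)])
      show "\<phi> ` P \<subseteq> \<phi>1 ` fst ` P \<times> \<phi>2 ` snd ` P"
      proof (rule image_subsetI)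
        fix x assume x: "x \<in> P"
        show "\<phi> x \<in> \<phi>1 ` fst ` P \<times> \<phi>2 ` snd ` P"
          unfolding val[OF x] by (intro SigmaI imageI x)
      qed
      show "map_prod \<psi>1 \<psi>2 ` \<phi> ` P \<subseteq> P"
        unfolding image_image using inv by (intro image_subsetI) (simp only:)
    qed
    moreover have "restrict (map_prod \<psi>1 \<psi>2) (\<phi> ` P) = restrict (inv_into P \<phi>) (\<phi> ` P)"
    proof (rule restrict_ext)
      fix y assume "y \<in> \<phi> ` P"
      then obtain x where x: "x \<in> P" "y = \<phi> x" by (rule imageE) simp
      then show "map_prod \<psi>1 \<psi>2 y = inv_into P \<phi> y"
        by (simp only: inv[OF x(1)] inv_into_f_f[OF inj x(1)])
    qed
    ultimately show "restrict (inv_into P \<phi>) (\<phi> ` P) \<in> FF (\<phi> ` P) P"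
      by simp
  qed
  fix \<psi> R assume \<psi>: "\<psi> \<in> FF Q R"
  obtain \<psi>1 \<psi>2 where \<psi>': "\<psi>1 \<in> F1 (fst ` Q) (fst ` R)" "\<psi>2 \<in> F2 (snd ` Q) (snd ` R)"
    "\<psi> = restrict (map_prod \<psi>1 \<psi>2) Q" "subgroup Q GG" "subgroup R GG" "\<psi> ` Q \<subseteq> R"
    using prod_mor[OF \<psi>] .
  let ?c1 = "compose (fst ` P) \<psi>1 \<phi>1" and ?c2 = "compose (snd ` P) \<psi>2 \<phi>2"
  have cval: "map_prod ?c1 ?c2 x = \<psi> (\<phi> x)" if x: "x \<in> P" for x
  proof -
    have "\<phi> x \<in> Q" "fst x \<in> fst ` P" "snd x \<in> snd ` P"
      using x *(6) by (simp_all add: image_subset_iff)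
    then show ?thesis
      using val[OF x] by (simp add: \<psi>'(3) compose_eq map_prod_def case_prod_beta)
  qed
  have eq: "compose P \<psi> \<phi> = restrict (map_prod ?c1 ?c2) P"
    unfolding compose_def[of P] by (rule restrict_ext) (simp only: cval)
  show "compose P \<psi> \<phi> \<in> FF P R"
    unfolding eq
  proof (rule prod_morI[OF F1.mor_compose[OF *(1) \<psi>'(1)] F2.mor_compose[OF *(2) \<psi>'(2)] *(4) \<psi>'(5)
          subset_times])
    have "\<psi> (\<phi> x) \<in> R" if "x \<in> P" for x
      using that *(6) \<psi>'(6) by blast
    then show "map_prod ?c1 ?c2 ` P \<subseteq> R"
      by (intro image_subsetI) (simp only: cval)
  qed
next
  fix P Q g assume P: "subgroup P GG" and Q: "subgroup Q GG" and g: "g \<in> carrier GG"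
    and PQ: "cj GG g ` P \<subseteq> Q"
  have g12: "fst g \<in> carrier G1" "snd g \<in> carrier G2"
    using g by auto
  \<comment> \<open>Conjugation by g is a restriction of the product of two conjugations defined on
    all of \<open>G1\<close> and \<open>G2\<close>, so no rectangle adapted to P has to be
    found.\<close>
  let ?c1 = "\<lambda>x\<in>carrier G1. cj G1 (fst g) x" and ?c2 = "\<lambda>x\<in>carrier G2. cj G2 (snd g) x"
  have c: "?c1 \<in> F1 (carrier G1) (carrier G1)" "?c2 \<in> F2 (carrier G2) (carrier G2)"
    using g12 by (auto intro!: F1.mor_conj F2.mor_conj F1.subgroup_self F2.subgroup_self)
  have PG: "P \<subseteq> carrier G1 \<times> carrier G2"
    using subgroup.subset[OF P] by simp
  have val: "cj GG g x = map_prod ?c1 ?c2 x" if "x \<in> P" for x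
  proof -
    have "fst x \<in> carrier G1" "snd x \<in> carrier G2"
      using subsetD[OF PG that] by (simp_all add: mem_Times_iff)
    then show ?thesis
      unfolding cj_DirProd[OF F1.is_group F2.is_group g] by (simp add: map_prod_def case_prod_beta)
  qed
  then have "(\<lambda>x\<in>P. cj GG g x) = restrict (map_prod ?c1 ?c2) P"
    by (rule restrict_ext)
  moreover have "map_prod ?c1 ?c2 ` P \<subseteq> Q"
  proof (rule image_subsetI)
    fix x assume x: "x \<in> P"
    then have "cj GG g x \<in> Q"
      using PQ by blast
    then show "map_prod ?c1 ?c2 x \<in> Q"
      by (simp only: val[OF x])
  qed
  ultimately show "(\<lambda>x\<in>P. cj GG g x) \<in> FF P Q"
    using prod_morI[OF c P Q PG] by (simp only:)
qed

end


subsection \<open>Quotients\<close>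

text \<open>
  The quotient group is allowed to be any group \<open>H\<close> whose elements are the cosets of \<open>Z\<close>, as its
  multiplication may differ from that of \<open>G Mod Z\<close> outside the carrier.
\<close>

locale fusion_quotient = G: fusion_system p G F + h: group_hom G H \<pi>
  for p :: nat and G :: "('a, 'm) monoid_scheme" and F
    and H :: "('a set, 'n) monoid_scheme" and \<pi> and Z +
  assumes prime_p: "prime p"
    and onto: "\<pi> ` carrier G = carrier H"
    and coset: "x \<in> carrier G \<Longrightarrow> \<pi> x = Z #>\<^bsub>G\<^esub> x"
    and ker: "kernel G H \<pi> = Z"
begin

abbreviation "E \<equiv> fus_quot G F Z"

definition "pre A = {x \<in> carrier G. \<pi> x \<in> A}"

lemma Z_subgroup: "subgroup Z G"
  using h.subgroup_kernel ker by simp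

lemma Z_carrier: "z \<in> Z \<Longrightarrow> z \<in> carrier G"
  by (rule subgroup.mem_carrier[OF Z_subgroup])
lemma pi_Z: "z \<in> Z \<Longrightarrow> \<pi> z = \<one>\<^bsub>H\<^esub>"
  using ker by (auto simp: kernel_def)

lemma pi_eq_iff:
  assumes "x \<in> carrier G" "y \<in> carrier G"
  shows "\<pi> x = \<pi> y \<longleftrightarrow> x \<otimes>\<^bsub>G\<^esub> inv\<^bsub>G\<^esub> y \<in> Z"
proof -
  have "\<pi> x = \<pi> y \<longleftrightarrow> \<pi> x \<otimes>\<^bsub>H\<^esub> inv\<^bsub>H\<^esub> (\<pi> y) = \<one>\<^bsub>H\<^esub>"
    using assms by (metis h.H.inv_equality h.H.inv_closed h.H.inv_inv h.H.r_inv h.hom_closed)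
  then show ?thesis
    using assms by (simp add: ker[symmetric] kernel_def)
qed

lemma pi_mem_image:
  assumes "subgroup P G" "Z \<subseteq> P" "x \<in> carrier G" "\<pi> x \<in> \<pi> ` P"
  shows "x \<in> P"
proof -
  obtain y where y: "y \<in> P" "\<pi> x = \<pi> y"
    using assms by blast
  then have yG: "y \<in> carrier G"
    using assms(1) subgroup.mem_carrier by metis
  have "x \<otimes>\<^bsub>G\<^esub> inv\<^bsub>G\<^esub> y \<in> P"
    using pi_eq_iff[OF assms(3) yG] y assms by blast
  then have "x \<otimes>\<^bsub>G\<^esub> inv\<^bsub>G\<^esub> y \<otimes>\<^bsub>G\<^esub> y \<in> P"
    using assms(1) y by (simp add: subgroup.m_closed)
  then show ?thesis
    using assms yG by (simp add: G.m_assoc)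
qed

lemma pre_facts:
  assumes "subgroup A H"
  shows pre_subgroup: "subgroup (pre A) G" and Z_pre: "Z \<subseteq> pre A" and pi_pre: "\<pi> ` pre A = A"
proof -
  show "subgroup (pre A) G"
    unfolding pre_def by (rule h.subgroup_preimage[OF assms])
  show "Z \<subseteq> pre A"
    using Z_carrier pi_Z subgroup.one_closed[OF assms] by (auto simp: pre_def)
  show "\<pi> ` pre A = A"
  proof (intro equalityI subsetI)
    fix a assume a: "a \<in> A"
    then have "a \<in> \<pi> ` carrier G"
      using onto subgroup.subset[OF assms] by blast
    then obtain x where "x \<in> carrier G" "a = \<pi> x" by blast
    then show "a \<in> \<pi> ` pre A"
      using a by (simp add: pre_def)
  qed (auto simp: pre_def)
qed

lemma pre_pi:
  assumes "subgroup P G" "Z \<subseteq> P"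
  shows "pre (\<pi> ` P) = P"
proof (intro equalityI subsetI)
  show "x \<in> P" if "x \<in> pre (\<pi> ` P)" for x
    using that pi_mem_image[OF assms] by (simp add: pre_def)
  show "x \<in> pre (\<pi> ` P)" if "x \<in> P" for x
    using that subgroup.mem_carrier[OF assms(1)] by (simp add: pre_def)
qed

lemma pi_image_eq:
  assumes "subgroup P G" "Z \<subseteq> P" "subgroup Q G" "Z \<subseteq> Q" "\<pi> ` P = \<pi> ` Q"
  shows "P = Q"
  using pre_pi assms by metis

lemma subgroup_pi: "subgroup P G \<Longrightarrow> subgroup (\<pi> ` P) H"
  by (rule h.subgroup_img_is_subgroup)

lemma coset_image:
  assumes "subgroup P G"
  shows "(\<lambda>x. Z #>\<^bsub>G\<^esub> x) ` P = \<pi> ` P"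
  by (intro image_cong refl) (simp add: coset subgroup.mem_carrier[OF assms])

lemma pi_cj:
  assumes "g \<in> carrier G" "x \<in> carrier G"
  shows "\<pi> (cj G g x) = cj H (\<pi> g) (\<pi> x)"
  by (rule h.hom_cj[OF assms])

text \<open>Invariance of Z is extracted from well-definedness: z and the identity have the same
  image in the quotient, so their images under \<phi> agree modulo Z. Thus \<phi> maps Z into Z, and
  onto it by finiteness.\<close>

lemma quot_mor:
  assumes "\<psi> \<in> E A B"
  obtains \<phi> P Q where "\<phi> \<in> F P Q" "Z \<subseteq> P" "Z \<subseteq> Q" "\<phi> ` Z = Z" "A = \<pi> ` P" "B = \<pi> ` Q"
    "\<psi> \<in> extensional A" "\<And>x. x \<in> P \<Longrightarrow> \<psi> (\<pi> x) = \<pi> (\<phi> x)"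
proof -
  obtain \<phi> P Q where *: "\<phi> \<in> F P Q" "Z \<subseteq> P" "Z \<subseteq> Q" "A = (\<lambda>x. Z #>\<^bsub>G\<^esub> x) ` P" "B = (\<lambda>x. Z #>\<^bsub>G\<^esub> x) ` Q"
    "\<psi> \<in> extensional A" "\<And>x. x \<in> P \<Longrightarrow> \<psi> (Z #>\<^bsub>G\<^esub> x) = Z #>\<^bsub>G\<^esub> \<phi> x"
    using assms unfolding fus_quot_def by blast
  note P = G.mor_dom[OF *(1)] and Q = G.mor_cod[OF *(1)]
  have val: "\<psi> (\<pi> x) = \<pi> (\<phi> x)" if "x \<in> P" for x
    using *(7)[OF that] coset subgroup.mem_carrier[OF P that]
      subgroup.mem_carrier[OF Q G.mor_closed[OF *(1) that]] by simp
  have "\<phi> z \<in> Z" if "z \<in> Z" for z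
  proof -
    have "\<pi> (\<phi> z) = \<pi> (\<phi> \<one>\<^bsub>G\<^esub>)"
      using val[of z] val[of "\<one>\<^bsub>G\<^esub>"] that *(2) pi_Z subgroup.one_closed[OF P] by auto
    also have "\<dots> = \<one>\<^bsub>H\<^esub>"
      using G.mor_one[OF *(1)] by simp
    finally show ?thesis
      using subgroup.mem_carrier[OF Q G.mor_closed[OF *(1)]] that *(2) by (auto simp: ker[symmetric] kernel_def)
  qed
  then have "\<phi> ` Z = Z"
    using G.finite_subgroup[OF Z_subgroup] G.mor_inj[OF *(1)] *(2)
    by (intro endo_inj_surj) (auto intro: inj_on_subset)
  then show ?thesis
    using that[of \<phi> P Q] * val coset_image[OF P] coset_image[OF Q] by simp
qed

lemma quot_morI:
  assumes "\<phi> \<in> F P Q" "Z \<subseteq> P" "Z \<subseteq> Q" "\<psi> \<in> extensional (\<pi> ` P)" "\<And>x. x \<in> P \<Longrightarrow> \<psi> (\<pi> x) = \<pi> (\<phi> x)"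
  shows "\<psi> \<in> E (\<pi> ` P) (\<pi> ` Q)"
proof -
  note P = G.mor_dom[OF assms(1)] and Q = G.mor_cod[OF assms(1)]
  have "\<psi> (Z #>\<^bsub>G\<^esub> x) = Z #>\<^bsub>G\<^esub> \<phi> x" if "x \<in> P" for x
    using assms(5)[OF that] coset subgroup.mem_carrier[OF P that]
      subgroup.mem_carrier[OF Q G.mor_closed[OF assms(1) that]] by simp
  then show ?thesis
    unfolding fus_quot_def mem_Collect_eq
    by (intro exI[of _ P] exI[of _ Q] bexI[of _ \<phi>] conjI ballI assms(1-4)
        coset_image[OF P, symmetric] coset_image[OF Q, symmetric])
qed

text \<open>Since the elements of \<open>H\<close> are cosets, the induced map can be the image map
  on sets, and no representatives are chosen. It sends Zx to Z\<phi>(x) whenever \<phi> maps Z onto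
  Z.\<close>

definition "induced P \<phi> = (\<lambda>C\<in>\<pi> ` P. \<phi> ` C)"

lemma induced_ext [simp]: "induced P \<phi> \<in> extensional (\<pi> ` P)"
  by (simp add: induced_def)

lemma induced_pi:
  assumes "\<phi> \<in> F P Q" "Z \<subseteq> P" "\<phi> ` Z = Z" "x \<in> P"
  shows "induced P \<phi> (\<pi> x) = \<pi> (\<phi> x)"
proof -
  note P = G.mor_dom[OF assms(1)] and Q = G.mor_cod[OF assms(1)]
  have "\<phi> ` (Z #>\<^bsub>G\<^esub> x) = (\<lambda>z. \<phi> z \<otimes>\<^bsub>G\<^esub> \<phi> x) ` Z"
  proof -
    have "\<phi> (z \<otimes>\<^bsub>G\<^esub> x) = \<phi> z \<otimes>\<^bsub>G\<^esub> \<phi> x" if "z \<in> Z" for z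
      using G.mor_mult[OF assms(1)] that assms(2,4) by blast
    then show ?thesis
      unfolding r_coset_def by force
  qed
  also have "\<dots> = Z #>\<^bsub>G\<^esub> \<phi> x"
    unfolding r_coset_def by (subst (2) assms(3)[symmetric]) auto
  finally have "\<phi> ` \<pi> x = \<pi> (\<phi> x)"
    using coset subgroup.mem_carrier[OF P assms(4)]
      subgroup.mem_carrier[OF Q G.mor_closed[OF assms(1,4)]] by (simp only:)
  then show ?thesis
    using assms(4) by (simp add: induced_def)
qed

lemma induced_mor:
  assumes "\<phi> \<in> F P Q" "Z \<subseteq> P" "Z \<subseteq> Q" "\<phi> ` Z = Z"
  shows "induced P \<phi> \<in> E (\<pi> ` P) (\<pi> ` Q)"
  using quot_morI[OF assms(1-3)] induced_pi[OF assms(1,2,4)] by simp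

lemma group_hom_on_image:
  assumes "subgroup P G" "subgroup Q G" "\<psi> ` \<pi> ` P \<subseteq> \<pi> ` Q"
    and "\<And>x y. x \<in> P \<Longrightarrow> y \<in> P \<Longrightarrow> \<psi> (\<pi> x \<otimes>\<^bsub>H\<^esub> \<pi> y) = \<psi> (\<pi> x) \<otimes>\<^bsub>H\<^esub> \<psi> (\<pi> y)"
  shows "\<psi> \<in> hom (H\<lparr>carrier := \<pi> ` P\<rparr>) (H\<lparr>carrier := \<pi> ` Q\<rparr>)"
  using assms by (auto simp: hom_def)

lemma fusion_system_quot: "fusion_system p H E"
proof (intro fusion_system.intro fusion_system_axioms.intro h.H.is_group)
  show "finite (carrier H)"
    using finite_imageI[OF G.finite_G, of \<pi>] onto by simp
  show "p_power p (carrier H)"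
    using h.p_power_image[OF G.finite_G G.subgroup_self prime_p G.p_power_G] onto by simp
next
  fix \<psi> A B assume \<psi>: "\<psi> \<in> E A B"
  obtain \<phi> P Q where *: "\<phi> \<in> F P Q" "Z \<subseteq> P" "Z \<subseteq> Q" "\<phi> ` Z = Z" "A = \<pi> ` P" "B = \<pi> ` Q"
    "\<psi> \<in> extensional A" "\<And>x. x \<in> P \<Longrightarrow> \<psi> (\<pi> x) = \<pi> (\<phi> x)"
    by (rule quot_mor[OF \<psi>]; rule that; assumption)
  note P = G.mor_dom[OF *(1)] and Q = G.mor_cod[OF *(1)]
  have PG: "x \<in> carrier G" if "x \<in> P" for x
    using subgroup.mem_carrier[OF P that] .
  have \<phi>G: "\<phi> x \<in> carrier G" if "x \<in> P" for x
    using subgroup.mem_carrier[OF Q G.mor_closed[OF *(1) that]] .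
  show "subgroup A H \<and> subgroup B H"
    using subgroup_pi P Q * by blast
  have into: "\<psi> ` A \<subseteq> B"
    using G.mor_closed[OF *(1)] *(8) by (auto simp: *(5,6))
  \<comment> \<open>Equal values put \<phi>(x y^-1) into Z, which is the image of Z under \<phi>.
    Injectivity of \<phi> brings x y^-1 itself back into Z.\<close>
  have inj: "inj_on \<psi> A"
  proof (rule inj_onI)
    fix a b assume "a \<in> A" "b \<in> A" and eq: "\<psi> a = \<psi> b"
    then obtain x y where xy: "a = \<pi> x" "b = \<pi> y" "x \<in> P" "y \<in> P"
      using * by blast
    have xyP: "x \<otimes>\<^bsub>G\<^esub> inv\<^bsub>G\<^esub> y \<in> P" "inv\<^bsub>G\<^esub> y \<in> P"
      using xy P by (simp_all add: subgroup.m_closed subgroup.m_inv_closed)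
    have "\<phi> (x \<otimes>\<^bsub>G\<^esub> inv\<^bsub>G\<^esub> y) \<in> Z"
      using eq *(8) xy xyP pi_eq_iff \<phi>G G.mor_mult[OF *(1)] G.mor_inv[OF *(1)] by simp
    then obtain z where "z \<in> Z" "\<phi> (x \<otimes>\<^bsub>G\<^esub> inv\<^bsub>G\<^esub> y) = \<phi> z"
      using *(4) by (metis image_iff)
    then have "x \<otimes>\<^bsub>G\<^esub> inv\<^bsub>G\<^esub> y \<in> Z"
      using inj_onD[OF G.mor_inj[OF *(1)]] xyP *(2) by blast
    then show "a = b"
      using pi_eq_iff xy PG by simp
  qed
  have mult: "\<psi> (\<pi> x \<otimes>\<^bsub>H\<^esub> \<pi> y) = \<psi> (\<pi> x) \<otimes>\<^bsub>H\<^esub> \<psi> (\<pi> y)" if "x \<in> P" "y \<in> P" for x y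
  proof -
    have "\<psi> (\<pi> (x \<otimes>\<^bsub>G\<^esub> y)) = \<pi> (\<phi> (x \<otimes>\<^bsub>G\<^esub> y))"
      using *(8) that P by (simp add: subgroup.m_closed)
    then show ?thesis
      using that PG \<phi>G G.mor_mult[OF *(1)] *(8) by simp
  qed
  show "\<psi> \<in> extensional A \<and> inj_on \<psi> A \<and> \<psi> \<in> hom (H\<lparr>carrier := A\<rparr>) (H\<lparr>carrier := B\<rparr>)"
    using inj *(7) group_hom_on_image[OF P Q _ mult] into unfolding *(5,6) by simp
  have \<psi>A: "\<psi> ` A = \<pi> ` \<phi> ` P"
    using *(8) by (auto simp: *(5) image_iff)
  have iso: "\<phi> \<in> F P (\<phi> ` P)" "restrict (inv_into P \<phi>) (\<phi> ` P) \<in> F (\<phi> ` P) P"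
    using G.mor_iso[OF *(1)] by simp_all
  have Z\<phi>: "Z \<subseteq> \<phi> ` P"
    using *(2,4) by blast
  show "\<psi> \<in> E A (\<psi> ` A) \<and> restrict (inv_into A \<psi>) (\<psi> ` A) \<in> E (\<psi> ` A) A"
  proof
    show "\<psi> \<in> E A (\<psi> ` A)"
      using quot_morI[OF iso(1) *(2) Z\<phi>] *(7,8) unfolding \<psi>A unfolding *(5) .
    show "restrict (inv_into A \<psi>) (\<psi> ` A) \<in> E (\<psi> ` A) A"
      unfolding \<psi>A unfolding *(5)
    proof (rule quot_morI[OF iso(2) Z\<phi> *(2)])
      fix y assume "y \<in> \<phi> ` P"
      then obtain x where x: "x \<in> P" "y = \<phi> x" by blast
      then have "inv_into (\<pi> ` P) \<psi> (\<pi> y) = \<pi> x"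
        using inj *(8) unfolding *(5) by (metis imageI inv_into_f_f)
      then show "restrict (inv_into (\<pi> ` P) \<psi>) (\<pi> ` \<phi> ` P) (\<pi> y) =
          \<pi> (restrict (inv_into P \<phi>) (\<phi> ` P) y)"
        using x G.mor_inj[OF *(1)] by simp
    qed simp
  qed
  fix \<chi> C assume \<chi>: "\<chi> \<in> E B C"
  obtain \<rho> Q' R where c: "\<rho> \<in> F Q' R" "Z \<subseteq> Q'" "Z \<subseteq> R" "\<rho> ` Z = Z" "B = \<pi> ` Q'" "C = \<pi> ` R"
    "\<chi> \<in> extensional B" "\<And>x. x \<in> Q' \<Longrightarrow> \<chi> (\<pi> x) = \<pi> (\<rho> x)"
    by (rule quot_mor[OF \<chi>]; rule that; assumption)
  \<comment> \<open>Two morphisms of the quotient are lifted independently. Their lifts can be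
    composed because the middle subgroups both contain Z and have the same image, hence
    coincide.\<close>
  have QQ: "Q' = Q"
    using pi_image_eq[OF G.mor_dom[OF c(1)] c(2) Q *(3)] *(6) c(5) by simp
  show "compose A \<chi> \<psi> \<in> E A C"
    unfolding *(5) c(6)
    by (rule quot_morI[OF G.mor_compose[OF *(1) c(1)[unfolded QQ]] *(2) c(3)])
      (use c(8) *(8) QQ G.mor_closed[OF *(1)] in \<open>auto simp: compose_def\<close>)
next
  fix A B g assume A: "subgroup A H" and B: "subgroup B H" and g: "g \<in> carrier H"
    and AB: "cj H g ` A \<subseteq> B"
  obtain g0 where g0: "g0 \<in> carrier G" "g = \<pi> g0"
    using g onto by blast
  have preG: "x \<in> carrier G" if "x \<in> pre A" for x
    using that by (simp add: pre_def)
  have "cj G g0 ` pre A \<subseteq> pre B"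
    using AB g0 pi_cj by (auto simp: pre_def image_subset_iff simp del: h.hom_mult)
  then have "(\<lambda>x\<in>pre A. cj G g0 x) \<in> F (pre A) (pre B)"
    by (rule G.mor_conj[OF pre_subgroup[OF A] pre_subgroup[OF B] g0(1)])
  then have "(\<lambda>a\<in>A. cj H g a) \<in> E (\<pi> ` pre A) (\<pi> ` pre B)"
  proof (rule quot_morI[OF _ Z_pre[OF A] Z_pre[OF B]])
    show "(\<lambda>a\<in>A. cj H g a) \<in> extensional (\<pi> ` pre A)"
      by (simp add: pi_pre[OF A])
    fix x assume x: "x \<in> pre A"
    then have "\<pi> x \<in> A"
      by (simp add: pre_def)
    then show "(\<lambda>a\<in>A. cj H g a) (\<pi> x) = \<pi> ((\<lambda>x\<in>pre A. cj G g0 x) x)"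
      by (simp only: restrict_apply' x pi_cj[OF g0(1) preG[OF x]] g0(2))
  qed
  then show "(\<lambda>x\<in>A. cj H g x) \<in> E A B"
    using pi_pre A B by simp
qed

end

subsection \<open>Centric radical subgroups of central products\<close>

lemma (in fusion_system) self_conjugate:
  assumes "subgroup P G"
  shows "P \<in> fus_conjugates F P"
  unfolding fus_conjugates_def mem_Collect_eq
  by (rule bexI[OF _ mor_incl[OF assms assms order_refl]]) simp

text \<open>Centrality of Z is recorded pointwise, as the fact that a morphism fixes the elements of
  Z in its domain. For localities this is verified along chains of conjugations.\<close>

locale central_fusion_product =
  fusion_product p G1 F1 G2 F2 + fusion_quotient p "G1 \<times>\<times> G2" "fus_prod G1 F1 G2 F2" H \<pi> Z
  for p :: nat and G1 :: "('a, 'm) monoid_scheme" and F1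
    and G2 :: "('b, 'n) monoid_scheme" and F2
    and H :: "(('a \<times> 'b) set, 'o) monoid_scheme" and \<pi> and Z +
  assumes Z_left: "(x, \<one>\<^bsub>G2\<^esub>) \<in> Z \<Longrightarrow> x = \<one>\<^bsub>G1\<^esub>"
    and Z_right: "(\<one>\<^bsub>G1\<^esub>, y) \<in> Z \<Longrightarrow> y = \<one>\<^bsub>G2\<^esub>"
    and Z_fixed: "\<phi> \<in> fus_prod G1 F1 G2 F2 P Q \<Longrightarrow> z \<in> P \<Longrightarrow> z \<in> Z \<Longrightarrow> \<phi> z = z"
begin

interpretation EE: fusion_system p H E
  by (rule fusion_system_quot)

definition times_mor ::
    "'a set \<Rightarrow> 'b set \<Rightarrow> ('a \<Rightarrow> 'a) \<Rightarrow> ('b \<Rightarrow> 'b) \<Rightarrow> ('a \<times> 'b) set \<Rightarrow> ('a \<times> 'b) set" where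
  "times_mor P1 P2 \<alpha> \<gamma> = induced (P1 \<times> P2) (restrict (map_prod \<alpha> \<gamma>) (P1 \<times> P2))"

lemma fixed_image:
  assumes "\<phi> \<in> FF P Q" "Z \<subseteq> P"
  shows "\<phi> ` Z = Z" and "Z \<subseteq> Q"
proof -
  have "\<phi> z = z" if "z \<in> Z" for z
    using Z_fixed[OF assms(1)] assms(2) that by blast
  then show "\<phi> ` Z = Z"
    by simp
  then show "Z \<subseteq> Q"
    using G.mor_into[OF assms(1)] assms(2) by blast
qed

lemma times_mor_facts:
  assumes "\<alpha> \<in> F1 P1 Q1" "\<gamma> \<in> F2 P2 Q2" "Z \<subseteq> P1 \<times> P2"
  shows Z_times_mor: "Z \<subseteq> Q1 \<times> Q2"
    and times_mor_in: "times_mor P1 P2 \<alpha> \<gamma> \<in> E (\<pi> ` (P1 \<times> P2)) (\<pi> ` (Q1 \<times> Q2))"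
    and times_mor_pi: "\<And>x1 x2. x1 \<in> P1 \<Longrightarrow> x2 \<in> P2 \<Longrightarrow>
      times_mor P1 P2 \<alpha> \<gamma> (\<pi> (x1, x2)) = \<pi> (\<alpha> x1, \<gamma> x2)"
proof -
  note m = prod_mor_times[OF assms(1,2)]
  show Q: "Z \<subseteq> Q1 \<times> Q2"
    by (rule fixed_image(2)[OF m assms(3)])
  show "times_mor P1 P2 \<alpha> \<gamma> \<in> E (\<pi> ` (P1 \<times> P2)) (\<pi> ` (Q1 \<times> Q2))"
    unfolding times_mor_def by (rule induced_mor[OF m assms(3) Q fixed_image(1)[OF m assms(3)]])
  show "times_mor P1 P2 \<alpha> \<gamma> (\<pi> (x1, x2)) = \<pi> (\<alpha> x1, \<gamma> x2)" if "x1 \<in> P1" "x2 \<in> P2" for x1 x2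
    using induced_pi[OF m assms(3) fixed_image(1)[OF m assms(3)], of "(x1, x2)"] that
    by (simp add: times_mor_def)
qed

lemma times_mor_ext [simp]: "times_mor P1 P2 \<alpha> \<gamma> \<in> extensional (\<pi> ` (P1 \<times> P2))"
  by (simp add: times_mor_def)

lemma ext_eqI:
  assumes "\<psi> \<in> extensional (\<pi> ` P)" "\<chi> \<in> extensional (\<pi> ` P)" "\<And>x. x \<in> P \<Longrightarrow> \<psi> (\<pi> x) = \<chi> (\<pi> x)"
  shows "\<psi> = \<chi>"
  using assms by (intro extensionalityI[of \<psi> "\<pi> ` P"]) auto

text \<open>Conjugation by g on the whole group is a morphism of the product system, so it fixes Z
  like every other morphism.\<close>

lemma Z_central:
  assumes "z \<in> Z" "g \<in> carrier GG"
  shows "cj GG g z = z"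
proof -
  have "(\<lambda>x\<in>carrier GG. cj GG g x) \<in> FF (carrier GG) (carrier GG)"
    using assms(2) G.m_closed G.inv_closed
    by (intro G.mor_conj G.subgroup_self image_subsetI) (simp_all del: carrier_DirProd)
  from Z_fixed[OF this Z_carrier[OF assms(1)] assms(1)] show ?thesis
    using Z_carrier[OF assms(1)] by simp
qed

text \<open>The trivial intersections of Z with the factors are exploited here: if x and y agree
  modulo Z and also in one coordinate, then x y^-1 is an element of Z inside one factor, so it is
  trivial.\<close>

lemma pi_eqD:
  assumes "x \<in> carrier GG" "y \<in> carrier GG" "\<pi> x = \<pi> y"
  shows "snd x = snd y \<Longrightarrow> fst x = fst y" and "fst x = fst y \<Longrightarrow> snd x = snd y"
proof -
  have xy: "fst x \<in> carrier G1" "snd x \<in> carrier G2" "fst y \<in> carrier G1" "snd y \<in> carrier G2"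
    using assms by (auto simp: mem_Times_iff)
  have "x \<otimes>\<^bsub>GG\<^esub> inv\<^bsub>GG\<^esub> y \<in> Z"
    using pi_eq_iff assms by blast
  then have z: "(fst x \<otimes>\<^bsub>G1\<^esub> inv\<^bsub>G1\<^esub> fst y, snd x \<otimes>\<^bsub>G2\<^esub> inv\<^bsub>G2\<^esub> snd y) \<in> Z"
    using inv_DirProd[OF F1.is_group F2.is_group xy(3,4)] by (simp add: mult_DirProd')
  show "fst x = fst y" if "snd x = snd y"
  proof -
    have "fst x \<otimes>\<^bsub>G1\<^esub> inv\<^bsub>G1\<^esub> fst y = \<one>\<^bsub>G1\<^esub>"
      by (rule Z_left) (use z that xy in simp)
    then have "fst x \<otimes>\<^bsub>G1\<^esub> inv\<^bsub>G1\<^esub> fst y \<otimes>\<^bsub>G1\<^esub> fst y = fst y"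
      using xy by simp
    then show ?thesis
      using xy by (simp add: F1.m_assoc)
  qed
  show "snd x = snd y" if "fst x = fst y"
  proof -
    have "snd x \<otimes>\<^bsub>G2\<^esub> inv\<^bsub>G2\<^esub> snd y = \<one>\<^bsub>G2\<^esub>"
      by (rule Z_right) (use z that xy in simp)
    then have "snd x \<otimes>\<^bsub>G2\<^esub> inv\<^bsub>G2\<^esub> snd y \<otimes>\<^bsub>G2\<^esub> snd y = snd y"
      using xy by simp
    then show ?thesis
      using xy by (simp add: F2.m_assoc)
  qed
qed

text \<open>A centralizer in a quotient may exceed the image of the centralizer, since commuting
  holds only modulo Z. Testing against pairs with one coordinate trivial removes this slack:
  conjugation keeps that coordinate trivial, and \<open>pi_eqD\<close> turns agreement modulo Z into
  equality.\<close>

lemma centralizer_times: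
  assumes "subgroup Q1 G1" "subgroup Q2 G2"
  shows "centralizer H (\<pi> ` (Q1 \<times> Q2)) = \<pi> ` (centralizer G1 Q1 \<times> centralizer G2 Q2)"
proof (intro equalityI subsetI)
  note one = subgroup.one_closed[OF assms(1)] subgroup.one_closed[OF assms(2)]
  fix c' assume c': "c' \<in> centralizer H (\<pi> ` (Q1 \<times> Q2))"
  then have "c' \<in> \<pi> ` carrier GG"
    using onto by (simp add: centralizer_def)
  then obtain c where "c \<in> carrier GG" "c' = \<pi> c"
    by blast
  then obtain c1 c2 where c: "c1 \<in> carrier G1" "c2 \<in> carrier G2" "c' = \<pi> (c1, c2)"
    by auto
  have cG: "(c1, c2) \<in> carrier GG"
    using c by simp
  have eq: "\<pi> (cj G1 c1 q1, cj G2 c2 q2) = \<pi> (q1, q2)" if q: "q1 \<in> Q1" "q2 \<in> Q2" for q1 q2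
  proof -
    have qG: "(q1, q2) \<in> carrier GG"
      using q assms by (simp add: subgroup.mem_carrier)
    have "cj H c' (\<pi> (q1, q2)) = \<pi> (q1, q2)"
      using c' q by (simp add: centralizer_def)
    then have "\<pi> (cj GG (c1, c2) (q1, q2)) = \<pi> (q1, q2)"
      unfolding c(3) pi_cj[OF cG qG] .
    then show ?thesis
      unfolding cj_DirProd[OF F1.is_group F2.is_group cG] by simp
  qed
  have "cj G1 c1 q1 = q1" if "q1 \<in> Q1" for q1
    using pi_eqD(1)[OF _ _ eq[OF that one(2)]] c subgroup.mem_carrier[OF assms(1) that] by simp
  moreover have "cj G2 c2 q2 = q2" if "q2 \<in> Q2" for q2
    using pi_eqD(2)[OF _ _ eq[OF one(1) that]] c subgroup.mem_carrier[OF assms(2) that] by simp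
  ultimately have "(c1, c2) \<in> centralizer G1 Q1 \<times> centralizer G2 Q2"
    using c by (simp add: centralizer_def)
  then show "c' \<in> \<pi> ` (centralizer G1 Q1 \<times> centralizer G2 Q2)"
    unfolding c(3) by (rule imageI)
next
  fix c' assume "c' \<in> \<pi> ` (centralizer G1 Q1 \<times> centralizer G2 Q2)"
  then obtain c1 c2 where c: "c1 \<in> centralizer G1 Q1" "c2 \<in> centralizer G2 Q2" "c' = \<pi> (c1, c2)"
    by blast
  then have cG: "(c1, c2) \<in> carrier GG"
    by (simp add: centralizer_def)
  have "cj H c' (\<pi> q) = \<pi> q" if q: "q \<in> Q1 \<times> Q2" for q
  proof -
    have qG: "q \<in> carrier GG"
      using q assms by (auto simp: subgroup.mem_carrier)
    have "cj GG (c1, c2) q = q"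
      unfolding cj_DirProd[OF F1.is_group F2.is_group cG] using q c by (auto simp: centralizer_def)
    then show ?thesis
      unfolding c(3) pi_cj[OF cG qG, symmetric] by simp
  qed
  then show "c' \<in> centralizer H (\<pi> ` (Q1 \<times> Q2))"
    unfolding c(3) using h.hom_closed[OF cG] by (auto simp: centralizer_def simp del: carrier_DirProd)
qed

text \<open>A lift of \<psi> has some domain containing Z whose image is that of the rectangle. Such
  a subgroup is determined by its image, so the lift is defined on the rectangle itself and splits
  into coordinates.\<close>

lemma aut_times:
  assumes "\<psi> \<in> E (\<pi> ` (P1 \<times> P2)) B" "subgroup P1 G1" "subgroup P2 G2" "Z \<subseteq> P1 \<times> P2"
  obtains \<alpha> \<gamma> Q where "\<alpha> \<in> F1 P1 (fst ` Q)" "\<gamma> \<in> F2 P2 (snd ` Q)" "\<psi> = times_mor P1 P2 \<alpha> \<gamma>"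
    "subgroup Q GG" "Z \<subseteq> Q" "B = \<pi> ` Q" "restrict (map_prod \<alpha> \<gamma>) (P1 \<times> P2) \<in> FF (P1 \<times> P2) Q"
proof -
  have ne: "P1 \<noteq> {}" "P2 \<noteq> {}"
    using assms subgroup.one_closed by blast+
  have P: "subgroup (P1 \<times> P2) GG"
    using DirProd_subgroups F1.is_group F2.is_group assms by blast
  obtain \<phi> P Q where q: "\<phi> \<in> FF P Q" "Z \<subseteq> P" "Z \<subseteq> Q" "\<phi> ` Z = Z" "\<pi> ` (P1 \<times> P2) = \<pi> ` P" "B = \<pi> ` Q"
    "\<psi> \<in> extensional (\<pi> ` (P1 \<times> P2))" "\<And>x. x \<in> P \<Longrightarrow> \<psi> (\<pi> x) = \<pi> (\<phi> x)"
    by (rule quot_mor[OF assms(1)]; rule that; assumption)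
  have eq: "P = P1 \<times> P2"
    by (rule pi_image_eq[OF G.mor_dom[OF q(1)] q(2) P assms(4) q(5)[symmetric]])
  obtain \<alpha> \<gamma> where m: "\<alpha> \<in> F1 (fst ` P) (fst ` Q)" "\<gamma> \<in> F2 (snd ` P) (snd ` Q)"
    "\<phi> = restrict (map_prod \<alpha> \<gamma>) P" "subgroup P GG" "subgroup Q GG" "\<phi> ` P \<subseteq> Q"
    using prod_mor[OF q(1)] .
  have m': "\<alpha> \<in> F1 P1 (fst ` Q)" "\<gamma> \<in> F2 P2 (snd ` Q)"
    using m(1,2) ne by (simp_all add: eq fst_image_times snd_image_times)
  have "\<psi> = times_mor P1 P2 \<alpha> \<gamma>"
  proof (rule ext_eqI[OF q(7) times_mor_ext])
    fix x assume "x \<in> P1 \<times> P2"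
    then obtain x1 x2 where x: "x = (x1, x2)" "x1 \<in> P1" "x2 \<in> P2"
      by (rule SigmaE)
    then have "\<phi> x = (\<alpha> x1, \<gamma> x2)"
      by (simp add: m(3) eq)
    moreover have "\<psi> (\<pi> x) = \<pi> (\<phi> x)"
      by (rule q(8)) (simp add: eq x)
    ultimately show "\<psi> (\<pi> x) = times_mor P1 P2 \<alpha> \<gamma> (\<pi> x)"
      using times_mor_pi[OF m' assms(4) x(2,3)] by (simp add: x(1))
  qed
  then show ?thesis
    using that m' m(5) q(1,3,6) unfolding m(3) eq by blast
qed

text \<open>Inducing maps on the quotient is an isomorphism from Aut(P1) x Aut(P2) onto the
  automizer of the image: it is onto by lifting and injective since Z meets both factors trivially.
  It carries both O_p and the inner automorphisms over, leaving an equality of two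
  rectangles.\<close>

lemma radical_times_iff:
  assumes P1: "subgroup P1 G1" and P2: "subgroup P2 G2" and ZP: "Z \<subseteq> P1 \<times> P2"
  shows "fus_radical p H E (\<pi> ` (P1 \<times> P2)) \<longleftrightarrow> fus_radical p G1 F1 P1 \<and> fus_radical p G2 F2 P2"
proof -
  have ne: "P1 \<noteq> {}" "P2 \<noteq> {}"
    using assms subgroup.one_closed by blast+
  have P: "subgroup (P1 \<times> P2) GG"
    using DirProd_subgroups F1.is_group F2.is_group P1 P2 by blast
  have A: "subgroup (\<pi> ` (P1 \<times> P2)) H"
    by (rule subgroup_pi[OF P])
  let ?A = "\<pi> ` (P1 \<times> P2)"
  let ?A1 = "fus_Aut F1 P1" and ?A2 = "fus_Aut F2 P2" and ?AE = "fus_Aut E ?A"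
  define h :: "('a \<Rightarrow> 'a) \<times> ('b \<Rightarrow> 'b) \<Rightarrow> ('a \<times> 'b) set \<Rightarrow> ('a \<times> 'b) set"
    where "h = (\<lambda>(\<alpha>, \<gamma>). times_mor P1 P2 \<alpha> \<gamma>)"
  interpret A1: group ?A1 by (rule F1.group_fus_Aut[OF P1])
  interpret A2: group ?A2 by (rule F2.group_fus_Aut[OF P2])
  interpret AE: group ?AE by (rule EE.group_fus_Aut[OF A])
  have h_in: "h (\<alpha>, \<gamma>) \<in> E ?A ?A" if "\<alpha> \<in> F1 P1 P1" "\<gamma> \<in> F2 P2 P2" for \<alpha> \<gamma>
    using times_mor_in[OF that ZP] by (simp add: h_def)
  have h_pi: "h (\<alpha>, \<gamma>) (\<pi> x) = \<pi> (\<alpha> (fst x), \<gamma> (snd x))"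
    if "\<alpha> \<in> F1 P1 P1" "\<gamma> \<in> F2 P2 P2" "x \<in> P1 \<times> P2" for \<alpha> \<gamma> x
    using times_mor_pi[OF that(1,2) ZP, of "fst x" "snd x"] that(3)
    by (simp add: h_def mem_Times_iff)
  have h_ext: "h \<xi> \<in> extensional ?A" for \<xi>
    by (cases \<xi>) (simp add: h_def)
  have "group_hom (?A1 \<times>\<times> ?A2) ?AE h"
  proof (intro group_hom.intro DirProd_group A1.is_group A2.is_group AE.is_group
      group_hom_axioms.intro homI)
    fix x assume x: "x \<in> carrier (?A1 \<times>\<times> ?A2)"
    obtain \<alpha> \<gamma> where x': "x = (\<alpha>, \<gamma>)" "\<alpha> \<in> F1 P1 P1" "\<gamma> \<in> F2 P2 P2"
      using x by (cases x) simp
    show "h x \<in> carrier ?AE"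
      using h_in x' by simp
    fix y assume y: "y \<in> carrier (?A1 \<times>\<times> ?A2)"
    obtain \<alpha>' \<gamma>' where y': "y = (\<alpha>', \<gamma>')" "\<alpha>' \<in> F1 P1 P1" "\<gamma>' \<in> F2 P2 P2"
      using y by (cases y) simp
    note c = F1.mor_compose[OF y'(2) x'(2)] F2.mor_compose[OF y'(3) x'(3)]
    have "h (compose P1 \<alpha> \<alpha>', compose P2 \<gamma> \<gamma>') = compose ?A (h x) (h y)"
    proof (rule ext_eqI[OF h_ext compose_extensional])
      fix u assume u: "u \<in> P1 \<times> P2"
      then have u': "fst u \<in> P1" "snd u \<in> P2" "(\<alpha>' (fst u), \<gamma>' (snd u)) \<in> P1 \<times> P2"
        using F1.mor_closed[OF y'(2)] F2.mor_closed[OF y'(3)] by auto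
      have "compose ?A (h x) (h y) (\<pi> u) = h x (h y (\<pi> u))"
        using u by (simp add: compose_eq)
      also have "\<dots> = \<pi> (\<alpha> (\<alpha>' (fst u)), \<gamma> (\<gamma>' (snd u)))"
        unfolding x'(1) y'(1) h_pi[OF y'(2,3) u] h_pi[OF x'(2,3) u'(3)] by simp
      finally show "h (compose P1 \<alpha> \<alpha>', compose P2 \<gamma> \<gamma>') (\<pi> u) = compose ?A (h x) (h y) (\<pi> u)"
        unfolding h_pi[OF c u] compose_eq[OF u'(1)] compose_eq[OF u'(2)] by simp
    qed
    then show "h (x \<otimes>\<^bsub>?A1 \<times>\<times> ?A2\<^esub> y) = h x \<otimes>\<^bsub>?AE\<^esub> h y"
      using F1.mult_fus_Aut[OF x'(2) y'(2)] F2.mult_fus_Aut[OF x'(3) y'(3)]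
        EE.mult_fus_Aut[OF h_in[OF x'(2,3)] h_in[OF y'(2,3)]]
      by (simp add: x'(1) y'(1))
  qed
  then interpret h: group_hom "?A1 \<times>\<times> ?A2" ?AE h .
  have inj: "inj_on h (carrier (?A1 \<times>\<times> ?A2))"
  proof (rule inj_onI)
    fix x y assume x: "x \<in> carrier (?A1 \<times>\<times> ?A2)" and y: "y \<in> carrier (?A1 \<times>\<times> ?A2)" and eq: "h x = h y"
    obtain \<alpha> \<gamma> where x': "x = (\<alpha>, \<gamma>)" "\<alpha> \<in> F1 P1 P1" "\<gamma> \<in> F2 P2 P2"
      using x by (cases x) simp
    obtain \<alpha>' \<gamma>' where y': "y = (\<alpha>', \<gamma>')" "\<alpha>' \<in> F1 P1 P1" "\<gamma>' \<in> F2 P2 P2"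
      using y by (cases y) simp
    note one = subgroup.one_closed[OF P1] subgroup.one_closed[OF P2]
    have eq': "\<pi> (\<alpha> u, \<gamma> v) = \<pi> (\<alpha>' u, \<gamma>' v)" if "u \<in> P1" "v \<in> P2" for u v
      using h_pi[OF x'(2,3), of "(u, v)"] h_pi[OF y'(2,3), of "(u, v)"] eq that x' y' by simp
    have G: "(\<alpha> u, \<gamma> v) \<in> carrier GG" "(\<alpha>' u, \<gamma>' v) \<in> carrier GG" if "u \<in> P1" "v \<in> P2" for u v
      using that F1.mor_closed[OF x'(2)] F1.mor_closed[OF y'(2)] F2.mor_closed[OF x'(3)]
        F2.mor_closed[OF y'(3)] subgroup.mem_carrier[OF P1] subgroup.mem_carrier[OF P2] by auto
    \<comment> \<open>With the second argument equal to the identity, the second coordinates of both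
      values are trivial, so agreement modulo Z forces the first coordinates to be equal.\<close>
    have "\<alpha> u = \<alpha>' u" if "u \<in> P1" for u
      using pi_eqD(1)[OF G[OF that one(2)] eq'[OF that one(2)]] F2.mor_one[OF x'(3)] F2.mor_one[OF y'(3)]
      by simp
    then have "\<alpha> = \<alpha>'"
      by (rule extensionalityI[OF F1.mor_ext[OF x'(2)] F1.mor_ext[OF y'(2)]])
    moreover have "\<gamma> v = \<gamma>' v" if "v \<in> P2" for v
      using pi_eqD(2)[OF G[OF one(1) that] eq'[OF one(1) that]] F1.mor_one[OF x'(2)] F1.mor_one[OF y'(2)]
      by simp
    then have "\<gamma> = \<gamma>'"
      by (rule extensionalityI[OF F2.mor_ext[OF x'(3)] F2.mor_ext[OF y'(3)]])
    ultimately show "x = y"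
      by (simp add: x' y')
  qed
  have onto_h: "h ` carrier (?A1 \<times>\<times> ?A2) = carrier ?AE"
  proof (intro equalityI subsetI)
    fix \<psi> assume "\<psi> \<in> carrier ?AE"
    then have \<psi>: "\<psi> \<in> E ?A ?A" by simp
    obtain \<alpha> \<gamma> Q where *: "\<alpha> \<in> F1 P1 (fst ` Q)" "\<gamma> \<in> F2 P2 (snd ` Q)" "\<psi> = times_mor P1 P2 \<alpha> \<gamma>"
      "subgroup Q GG" "Z \<subseteq> Q" "?A = \<pi> ` Q" "restrict (map_prod \<alpha> \<gamma>) (P1 \<times> P2) \<in> FF (P1 \<times> P2) Q"
      using aut_times[OF \<psi> P1 P2 ZP] .
    have "Q = P1 \<times> P2"
      by (rule pi_image_eq[OF *(4,5) P ZP *(6)[symmetric]])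
    then have "(\<alpha>, \<gamma>) \<in> carrier (?A1 \<times>\<times> ?A2)"
      using *(1,2) ne by (simp add: fst_image_times snd_image_times)
    moreover have "\<psi> = h (\<alpha>, \<gamma>)"
      by (simp add: h_def *(3))
    ultimately show "\<psi> \<in> h ` carrier (?A1 \<times>\<times> ?A2)"
      by (rule rev_image_eqI)
  qed (use h.hom_closed in blast)
  have "kernel (?A1 \<times>\<times> ?A2) ?AE h = {\<one>\<^bsub>?A1 \<times>\<times> ?A2\<^esub>}"
    using inj h.inj_iff_trivial_ker by blast
  \<comment> \<open>The trivial kernel counts as a p-group of order p^0, so the result on O_p of
    images applies to this isomorphism.\<close>
  then have pk: "p_power p (kernel (?A1 \<times>\<times> ?A2) ?AE h)"
    unfolding p_power_def by (metis card_1_singleton_iff power_0 One_nat_def)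
  note fin1 = F1.finite_fus_Aut[OF P1] and fin2 = F2.finite_fus_Aut[OF P2]
  have "finite (carrier (?A1 \<times>\<times> ?A2))"
    unfolding carrier_DirProd using fin1 fin2 by (rule finite_cartesian_product)
  from h.O_p_image(1)[OF this prime_p onto_h pk]
  have O: "O_p p ?AE = h ` (O_p p ?A1 \<times> O_p p ?A2)"
    unfolding O_p_DirProd[OF A1.is_group A2.is_group fin1 fin2 prime_p] .
  note O1 = A1.O_p_subgroup[OF fin1 prime_p] and O2 = A2.O_p_subgroup[OF fin2 prime_p]
  have I1: "Inn G1 P1 \<subseteq> O_p p ?A1" and I2: "Inn G2 P2 \<subseteq> O_p p ?A2"
    using F1.Inn_subset_O_p[OF prime_p P1] F2.Inn_subset_O_p[OF prime_p P2] .
  have O1': "O_p p ?A1 \<subseteq> carrier ?A1" and O2': "O_p p ?A2 \<subseteq> carrier ?A2"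
    using subgroup.subset[OF O1] subgroup.subset[OF O2] .
  have Inn_h: "h (\<lambda>x\<in>P1. cj G1 g1 x, \<lambda>x\<in>P2. cj G2 g2 x) = (\<lambda>a\<in>?A. cj H (\<pi> (g1, g2)) a)"
    if g: "g1 \<in> P1" "g2 \<in> P2" for g1 g2
  proof (rule ext_eqI[OF h_ext])
    have gG: "(g1, g2) \<in> carrier GG"
      using g subgroup.mem_carrier[OF P] by blast
    have c: "(\<lambda>x\<in>P1. cj G1 g1 x) \<in> F1 P1 P1" "(\<lambda>x\<in>P2. cj G2 g2 x) \<in> F2 P2 P2"
      using I1 I2 O1' O2' g unfolding Inn_def by auto
    fix x assume x: "x \<in> P1 \<times> P2"
    have xG: "x \<in> carrier GG"
      by (rule subgroup.mem_carrier[OF P x])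
    have "\<pi> (cj G1 g1 (fst x), cj G2 g2 (snd x)) = cj H (\<pi> (g1, g2)) (\<pi> x)"
      using pi_cj[OF gG xG] unfolding cj_DirProd[OF F1.is_group F2.is_group gG] by simp
    then show "h (\<lambda>x\<in>P1. cj G1 g1 x, \<lambda>x\<in>P2. cj G2 g2 x) (\<pi> x) = (\<lambda>a\<in>?A. cj H (\<pi> (g1, g2)) a) (\<pi> x)"
      unfolding h_pi[OF c x] using x by (simp only: restrict_apply' imageI mem_Times_iff)
  qed simp
  have I: "Inn H ?A = h ` (Inn G1 P1 \<times> Inn G2 P2)"
  proof (intro equalityI subsetI)
    fix \<tau> assume "\<tau> \<in> Inn H ?A"
    then obtain g1 g2 where g: "g1 \<in> P1" "g2 \<in> P2" "\<tau> = (\<lambda>a\<in>?A. cj H (\<pi> (g1, g2)) a)"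
      unfolding Inn_def by blast
    have "(\<lambda>x\<in>P1. cj G1 g1 x, \<lambda>x\<in>P2. cj G2 g2 x) \<in> Inn G1 P1 \<times> Inn G2 P2"
      using g unfolding Inn_def by blast
    then show "\<tau> \<in> h ` (Inn G1 P1 \<times> Inn G2 P2)"
      unfolding g(3) Inn_h[OF g(1,2), symmetric] by (rule imageI)
  next
    fix \<tau> assume "\<tau> \<in> h ` (Inn G1 P1 \<times> Inn G2 P2)"
    then obtain g1 g2 where g: "g1 \<in> P1" "g2 \<in> P2" "\<tau> = h (\<lambda>x\<in>P1. cj G1 g1 x, \<lambda>x\<in>P2. cj G2 g2 x)"
      unfolding Inn_def by blast
    show "\<tau> \<in> Inn H ?A"
      unfolding g(3) Inn_h[OF g(1,2)] Inn_def using g(1,2) by blast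
  qed
  \<comment> \<open>Both sets lie in the domain on which \<open>h\<close> is injective, so equality
    can be tested before applying it. The rectangles then split because the O_p of each factor
    contains the identity.\<close>
  have "O_p p ?AE = Inn H ?A \<longleftrightarrow> O_p p ?A1 \<times> O_p p ?A2 = Inn G1 P1 \<times> Inn G2 P2"
    unfolding O I
    by (rule inj_on_image_eq_iff[OF inj]) (use O1' O2' I1 I2 in \<open>auto simp del: EE.carrier_fus_Aut F1.carrier_fus_Aut F2.carrier_fus_Aut\<close>)
  also have "\<dots> \<longleftrightarrow> O_p p ?A1 = Inn G1 P1 \<and> O_p p ?A2 = Inn G2 P2"
    using subgroup.one_closed[OF O1] subgroup.one_closed[OF O2] by (auto simp: times_eq_iff)
  finally show ?thesis
    using P1 P2 A by (simp add: fus_radical_def)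
qed


text \<open>
  If \<open>P/Z\<close> is centric and radical and \<open>P\<close> has projections \<open>P\<^sub>1\<close> and \<open>P\<^sub>2\<close>, then \<open>N(P) \<inter> (P\<^sub>1 \<times> P\<^sub>2)\<close>
  induces a normal \<open>p\<close>-subgroup of the automizer of \<open>P/Z\<close>, since each morphism of \<open>P\<close> extends to
  \<open>P\<^sub>1 \<times> P\<^sub>2\<close>. As normalizers grow in \<open>p\<close>-groups, this forces \<open>P = P\<^sub>1 \<times> P\<^sub>2\<close>.
\<close>

lemma centric_radical_is_times:
  assumes "A \<in> fus_cr p H E"
  shows "pre A = fst ` pre A \<times> snd ` pre A"
proof (rule ccontr)
  let ?P = "pre A" and ?P1 = "fst ` pre A" and ?P2 = "snd ` pre A"
  let ?R = "?P1 \<times> ?P2"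
  assume neq: "?P \<noteq> ?R"
  have A: "subgroup A H" and cen: "\<And>B. B \<in> fus_conjugates E A \<Longrightarrow> centralizer H B \<subseteq> B"
    and rad: "O_p p (fus_Aut E A) = Inn H A"
    using assms by (auto simp: fus_cr_def fus_centric_def fus_radical_def)
  note P = pre_subgroup[OF A] and ZP = Z_pre[OF A] and piP = pi_pre[OF A]
  note PGG = subgroup.mem_carrier[OF P]
  note P12 = subgroup_fst[OF F1.is_group F2.is_group P]
  have R: "subgroup ?R GG"
    by (rule DirProd_subgroups[OF F1.is_group P12(1) F2.is_group P12(2)])
  note RGG = subgroup.mem_carrier[OF R]
  have PR: "?P \<subseteq> ?R"
    by (rule subset_times)
  have finP: "finite ?P"
    by (rule G.finite_subgroup[OF P])
  interpret R: group "GG\<lparr>carrier := ?R\<rparr>"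
    by (rule G.subgroup_imp_group[OF R])
  have pR: "p_power p ?R"
    by (rule G.p_power_subgroup[OF prime_p G.p_power_G R G.subgroup_self subgroup.subset[OF R]])
  have sP: "subgroup ?P (GG\<lparr>carrier := ?R\<rparr>)"
    using G.subgroup_restrict_iff[OF R PR] P by blast
  have R': "finite (carrier (GG\<lparr>carrier := ?R\<rparr>))" "p_power p (carrier (GG\<lparr>carrier := ?R\<rparr>))"
    "?P \<noteq> carrier (GG\<lparr>carrier := ?R\<rparr>)"
    using G.finite_subgroup[OF R] pR neq by simp_all
  obtain n where n: "n \<in> carrier (GG\<lparr>carrier := ?R\<rparr>)" "n \<notin> ?P" "cj (GG\<lparr>carrier := ?R\<rparr>) n ` ?P = ?P"
    using R.p_group_normalizer_grows[OF R'(1) prime_p R'(2) sP R'(3)] .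
  have nR: "n \<in> ?R"
    using n(1) by simp
  have nP: "cj GG n ` ?P = ?P"
    using n(3) G.m_inv_consistent[OF R nR] by simp
  define N where "N = ?R \<inter> {g \<in> carrier GG. cj GG g ` ?P = ?P}"
  have N: "subgroup N GG"
    unfolding N_def
    by (rule G.subgroups_Inter_pair[OF R G.subgroup_normalizer[OF finP subgroup.subset[OF P]]])
  note NGG = subgroup.mem_carrier[OF N]
  have NP: "cj GG t ` ?P = ?P" if "t \<in> N" for t
    using that by (simp add: N_def)
  have "{(\<lambda>x\<in>A. cj H t x) | t. t \<in> \<pi> ` N} \<subseteq> O_p p (fus_Aut E A)"
  proof (rule EE.conj_auts_subset_O_p[OF prime_p A subgroup_pi[OF N]])
    have pi_cj': "\<pi> (cj GG t x) = cj H (\<pi> t) (\<pi> x)" if "t \<in> N" "x \<in> ?P" for t x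
      by (rule pi_cj[OF NGG[OF that(1)] PGG[OF that(2)]])
    fix t' assume "t' \<in> \<pi> ` N"
    then obtain t where t: "t \<in> N" "t' = \<pi> t" by blast
    have "cj H t' ` \<pi> ` ?P = \<pi> ` cj GG t ` ?P"
      unfolding image_image t(2)
      by (rule image_cong[OF refl]) (rule pi_cj'[OF t(1), symmetric], assumption)
    then show "cj H t' ` A = A"
      unfolding NP[OF t(1)] piP .
    fix \<psi> assume \<psi>: "\<psi> \<in> E A A"
    obtain \<phi> P' Q where q: "\<phi> \<in> FF P' Q" "Z \<subseteq> P'" "Z \<subseteq> Q" "\<phi> ` Z = Z" "A = \<pi> ` P'" "A = \<pi> ` Q"
      "\<psi> \<in> extensional A" "\<And>x. x \<in> P' \<Longrightarrow> \<psi> (\<pi> x) = \<pi> (\<phi> x)"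
      by (rule quot_mor[OF \<psi>]; rule that; assumption)
    have eq: "P' = ?P" "Q = ?P"
      using pi_image_eq[OF G.mor_dom[OF q(1)] q(2) P ZP] pi_image_eq[OF G.mor_cod[OF q(1)] q(3) P ZP]
        q(5,6) piP by simp_all
    have \<phi>: "\<phi> \<in> FF ?P ?P"
      using q(1) unfolding eq .
    obtain \<alpha> \<gamma> where m: "\<alpha> \<in> F1 ?P1 ?P1" "\<gamma> \<in> F2 ?P2 ?P2" "\<phi> = restrict (map_prod \<alpha> \<gamma>) ?P"
      "subgroup ?P GG" "subgroup ?P GG" "\<phi> ` ?P \<subseteq> ?P"
      using prod_mor[OF \<phi>] .
    have tR: "fst t \<in> ?P1" "snd t \<in> ?P2"
      using t(1) by (auto simp: N_def mem_Times_iff)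
    \<comment> \<open>The element t may lie outside the domain of \<phi>. The coordinate maps extend
      \<phi> to the whole rectangle, and s is the value of this extension at t; it shows that \<phi>
      transports conjugation by t to conjugation by s.\<close>
    define s where "s = (\<alpha> (fst t), \<gamma> (snd t))"
    have sR: "s \<in> ?R"
      using F1.mor_closed[OF m(1) tR(1)] F2.mor_closed[OF m(2) tR(2)] by (simp add: s_def)
    have s_cj: "\<phi> (cj GG t x) = cj GG s (\<phi> x)" if x: "x \<in> ?P" for x
    proof -
      have tx: "cj GG t x \<in> ?P"
        using NP[OF t(1)] x by blast
      have x12: "fst x \<in> ?P1" "snd x \<in> ?P2"
        using x by (rule imageI)+
      have "\<phi> (cj GG t x) = (\<alpha> (cj G1 (fst t) (fst x)), \<gamma> (cj G2 (snd t) (snd x)))"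
        unfolding m(3) restrict_apply'[OF tx]
        unfolding cj_DirProd[OF F1.is_group F2.is_group NGG[OF t(1)]] by simp
      also have "\<dots> = (cj G1 (\<alpha> (fst t)) (\<alpha> (fst x)), cj G2 (\<gamma> (snd t)) (\<gamma> (snd x)))"
        by (simp only: F1.mor_cj[OF m(1) tR(1) x12(1)] F2.mor_cj[OF m(2) tR(2) x12(2)])
      also have "\<dots> = cj GG s (\<phi> x)"
        unfolding cj_DirProd[OF F1.is_group F2.is_group RGG[OF sR]] m(3) restrict_apply'[OF x]
        by (cases x) (simp add: s_def)
      finally show ?thesis .
    qed
    have \<phi>P: "\<phi> ` ?P = ?P"
      by (rule G.aut_onto[OF \<phi>])
    have "cj GG s ` \<phi> ` ?P = \<phi> ` cj GG t ` ?P"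
      unfolding image_image by (rule image_cong[OF refl]) (simp only: s_cj)
    then have "cj GG s ` ?P = ?P"
      unfolding NP[OF t(1)] \<phi>P .
    then have sN: "s \<in> N"
      using sR RGG[OF sR] by (simp add: N_def)
    have "\<psi> (cj H t' a) = cj H (\<pi> s) (\<psi> a)" if "a \<in> A" for a
    proof -
      obtain x where x: "x \<in> ?P" "a = \<pi> x"
        using \<open>a \<in> A\<close> piP by blast
      have tx: "cj GG t x \<in> ?P"
        using NP[OF t(1)] x by blast
      have "\<psi> (cj H t' a) = \<pi> (\<phi> (cj GG t x))"
        unfolding t(2) x(2) pi_cj'[OF t(1) x(1), symmetric] by (rule q(8)) (simp only: eq tx)
      also have "\<dots> = cj H (\<pi> s) (\<pi> (\<phi> x))"
        unfolding s_cj[OF x(1)] by (rule pi_cj'[OF sN G.mor_closed[OF \<phi> x(1)]])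
      also have "\<pi> (\<phi> x) = \<psi> a"
        unfolding x(2) by (rule q(8)[symmetric]) (simp only: eq x)
      finally show ?thesis .
    qed
    then show "\<exists>s'\<in>\<pi> ` N. \<forall>a\<in>A. \<psi> (cj H t' a) = cj H s' (\<psi> a)"
      using sN by blast
  qed
  moreover have nN: "n \<in> N"
    using nR nP RGG[OF nR] by (simp add: N_def)
  ultimately have "(\<lambda>x\<in>A. cj H (\<pi> n) x) \<in> Inn H A"
    unfolding rad by blast
  then obtain b where b: "b \<in> A" "(\<lambda>x\<in>A. cj H (\<pi> n) x) = (\<lambda>x\<in>A. cj H b x)"
    unfolding Inn_def by blast
  have nH: "\<pi> n \<in> carrier H"
    by (rule h.hom_closed[OF NGG[OF nN]])
  have bH: "b \<in> carrier H" and AH: "\<And>a. a \<in> A \<Longrightarrow> a \<in> carrier H"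
    using subgroup.mem_carrier[OF A] b(1) by blast+
  \<comment> \<open>Radicality makes n act on A as some b in A. Then \<pi>(n) b^-1 centralizes A and
    lies in A by centricity, which puts n into P against its choice.\<close>
  have "cj H (\<pi> n \<otimes>\<^bsub>H\<^esub> inv\<^bsub>H\<^esub> b) a = a" if a: "a \<in> A" for a
  proof -
    have "cj H (\<pi> n) a = cj H b a"
      using fun_cong[OF b(2), of a] a by simp
    then have "cj H (inv\<^bsub>H\<^esub> b) (cj H (\<pi> n) a) = a"
      using h.H.cj_cancel(2)[OF bH AH[OF a]] by (simp only:)
    then show ?thesis
      using h.H.cj_cj[OF nH _ AH[OF a], of "inv\<^bsub>H\<^esub> b"] bH by (simp only: h.H.inv_closed)
  qed
  then have "\<pi> n \<otimes>\<^bsub>H\<^esub> inv\<^bsub>H\<^esub> b \<in> centralizer H A"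
    using nH bH by (simp add: centralizer_def)
  then have "\<pi> n \<otimes>\<^bsub>H\<^esub> inv\<^bsub>H\<^esub> b \<in> A"
    using cen[OF EE.self_conjugate[OF A]] by blast
  then have "\<pi> n \<otimes>\<^bsub>H\<^esub> inv\<^bsub>H\<^esub> b \<otimes>\<^bsub>H\<^esub> b \<in> A"
    by (rule subgroup.m_closed[OF A _ b(1)])
  then have "\<pi> n \<in> A"
    using nH bH by (simp add: h.H.m_assoc)
  then show False
    using n(2) NGG[OF nN] by (simp add: pre_def)
qed

text \<open>Conjugates of the image of a rectangle are images of rectangles of conjugates, and by
  \<open>centralizer_times\<close> their centralizers are rectangular as well. As everything in
  sight contains Z, inclusions can be compared before passing to the quotient.\<close>

lemma centric_times_iff:
  assumes P1: "subgroup P1 G1" and P2: "subgroup P2 G2" and ZP: "Z \<subseteq> P1 \<times> P2"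
  shows "fus_centric H E (\<pi> ` (P1 \<times> P2)) \<longleftrightarrow> fus_centric G1 F1 P1 \<and> fus_centric G2 F2 P2"
proof
  let ?A = "\<pi> ` (P1 \<times> P2)"
  have ne: "P1 \<noteq> {}" "P2 \<noteq> {}"
    using assms subgroup.one_closed by blast+
  have cen_ne: "\<one>\<^bsub>G1\<^esub> \<in> centralizer G1 Q1" "\<one>\<^bsub>G2\<^esub> \<in> centralizer G2 Q2"
    if "subgroup Q1 G1" "subgroup Q2 G2" for Q1 Q2
    using F1.subgroup_centralizer[OF subgroup.subset[OF that(1)]]
      F2.subgroup_centralizer[OF subgroup.subset[OF that(2)]] subgroup.one_closed by blast+
  {
    assume cen: "fus_centric H E ?A"
    have key: "centralizer G1 Q1 \<subseteq> Q1 \<and> centralizer G2 Q2 \<subseteq> Q2"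
      if a: "\<alpha> \<in> F1 P1 Q1" "\<gamma> \<in> F2 P2 Q2" "\<alpha> ` P1 = Q1" "\<gamma> ` P2 = Q2" for \<alpha> \<gamma> Q1 Q2
    proof -
      note Q1 = F1.mor_cod[OF a(1)] and Q2 = F2.mor_cod[OF a(2)]
      have Q: "subgroup (Q1 \<times> Q2) GG"
        by (rule DirProd_subgroups[OF F1.is_group Q1 F2.is_group Q2])
      have "times_mor P1 P2 \<alpha> \<gamma> ` ?A = \<pi> ` (Q1 \<times> Q2)"
      proof -
        have "times_mor P1 P2 \<alpha> \<gamma> (\<pi> x) = \<pi> (map_prod \<alpha> \<gamma> x)" if "x \<in> P1 \<times> P2" for x
          using times_mor_pi[OF a(1,2) ZP, of "fst x" "snd x"] that by (cases x) simp
        then have "times_mor P1 P2 \<alpha> \<gamma> ` ?A = \<pi> ` map_prod \<alpha> \<gamma> ` (P1 \<times> P2)"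
          unfolding image_image by (rule image_cong[OF refl])
        then show ?thesis
          unfolding map_prod_surj_on[OF a(3,4)] .
      qed
      then have "\<pi> ` (Q1 \<times> Q2) \<in> fus_conjugates E ?A"
        unfolding fus_conjugates_def using times_mor_in[OF a(1,2) ZP] by blast
      then have "\<pi> ` (centralizer G1 Q1 \<times> centralizer G2 Q2) \<subseteq> \<pi> ` (Q1 \<times> Q2)"
        using cen unfolding fus_centric_def centralizer_times[OF Q1 Q2, symmetric] by blast
      then have "c \<in> Q1 \<times> Q2" if "c \<in> centralizer G1 Q1 \<times> centralizer G2 Q2" for c
        using pi_mem_image[OF Q Z_times_mor[OF a(1,2) ZP], of c] that
        by (auto simp: centralizer_def)
      then show ?thesis
        using cen_ne[OF Q1 Q2] by blast
    qed
    \<comment> \<open>Pairing a morphism on one factor with the identity on the other makes it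
      possible to vary one conjugate at a time.\<close>
    have id1: "(\<lambda>x\<in>P1. x) \<in> F1 P1 P1" "(\<lambda>x\<in>P1. x) ` P1 = P1"
      using F1.mor_incl[OF P1 P1] by simp_all
    have id2: "(\<lambda>x\<in>P2. x) \<in> F2 P2 P2" "(\<lambda>x\<in>P2. x) ` P2 = P2"
      using F2.mor_incl[OF P2 P2] by simp_all
    show "fus_centric G1 F1 P1 \<and> fus_centric G2 F2 P2"
      unfolding fus_centric_def fus_conjugates_def
      using key[OF _ id2(1) _ id2(2)] key[OF id1(1) _ id1(2)] P1 P2 by blast
  next
    assume cen: "fus_centric G1 F1 P1 \<and> fus_centric G2 F2 P2"
    have "centralizer H B \<subseteq> B" if B: "B \<in> fus_conjugates E ?A" for B
    proof -
      obtain \<psi> where \<psi>: "\<psi> \<in> E ?A B" "\<psi> ` ?A = B"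
        using B unfolding fus_conjugates_def by blast
      obtain \<alpha> \<gamma> Q where *: "\<alpha> \<in> F1 P1 (fst ` Q)" "\<gamma> \<in> F2 P2 (snd ` Q)" "\<psi> = times_mor P1 P2 \<alpha> \<gamma>"
        "subgroup Q GG" "Z \<subseteq> Q" "B = \<pi> ` Q" "restrict (map_prod \<alpha> \<gamma>) (P1 \<times> P2) \<in> FF (P1 \<times> P2) Q"
        using aut_times[OF \<psi>(1) P1 P2 ZP] .
      have a: "\<alpha> \<in> F1 P1 (\<alpha> ` P1)" "\<gamma> \<in> F2 P2 (\<gamma> ` P2)"
        using F1.mor_iso[OF *(1)] F2.mor_iso[OF *(2)] by simp_all
      note Q1 = F1.mor_image[OF *(1)] and Q2 = F2.mor_image[OF *(2)]
      have "\<psi> (\<pi> x) = \<pi> (map_prod \<alpha> \<gamma> x)" if "x \<in> P1 \<times> P2" for x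
        using times_mor_pi[OF a ZP, of "fst x" "snd x"] that by (cases x) (simp add: *(3))
      then have "\<psi> ` ?A = \<pi> ` map_prod \<alpha> \<gamma> ` (P1 \<times> P2)"
        unfolding image_image by (rule image_cong[OF refl])
      then have B: "B = \<pi> ` (\<alpha> ` P1 \<times> \<gamma> ` P2)"
        unfolding map_prod_surj_on[OF refl refl] \<psi>(2) .
      have "\<alpha> ` P1 \<in> fus_conjugates F1 P1" "\<gamma> ` P2 \<in> fus_conjugates F2 P2"
        unfolding fus_conjugates_def using a by blast+
      then have "centralizer G1 (\<alpha> ` P1) \<subseteq> \<alpha> ` P1" "centralizer G2 (\<gamma> ` P2) \<subseteq> \<gamma> ` P2"
        using cen unfolding fus_centric_def by blast+
      then show ?thesis
        unfolding B centralizer_times[OF Q1 Q2] by (intro image_mono Sigma_mono)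
    qed
    then show "fus_centric H E ?A"
      unfolding fus_centric_def
      using subgroup_pi[OF DirProd_subgroups[OF F1.is_group P1 F2.is_group P2]] by blast
  }
qed

text \<open>Each coordinate of a central element centralizes the corresponding factor, and a centric
  subgroup contains its own centralizer. This supplies the containment of Z on which the results
  about rectangles depend.\<close>

lemma Z_subset_centric:
  assumes "P1 \<in> fus_cr p G1 F1" "P2 \<in> fus_cr p G2 F2"
  shows "Z \<subseteq> P1 \<times> P2"
proof
  fix z assume z: "z \<in> Z"
  have P12: "subgroup P1 G1" "subgroup P2 G2"
    and cen: "\<And>Q. Q \<in> fus_conjugates F1 P1 \<Longrightarrow> centralizer G1 Q \<subseteq> Q"
      "\<And>Q. Q \<in> fus_conjugates F2 P2 \<Longrightarrow> centralizer G2 Q \<subseteq> Q"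
    using assms by (simp_all add: fus_cr_def fus_centric_def)
  have zG: "fst z \<in> carrier G1" "snd z \<in> carrier G2"
    using Z_carrier[OF z] by (auto simp: mem_Times_iff)
  have fixed: "cj G1 x (fst z) = fst z \<and> cj G2 y (snd z) = snd z"
    if "x \<in> carrier G1" "y \<in> carrier G2" for x y
  proof -
    have xy: "(x, y) \<in> carrier GG"
      using that by simp
    show ?thesis
      using Z_central[OF z xy] unfolding cj_DirProd[OF F1.is_group F2.is_group xy]
      by (simp add: prod_eq_iff)
  qed
  have "fst z \<in> centralizer G1 P1"
    using zG(1) fixed[OF _ F2.one_closed] F1.cj_fixed_swap[OF _ zG(1)] subgroup.mem_carrier[OF P12(1)]
    by (simp add: centralizer_def)
  moreover have "snd z \<in> centralizer G2 P2"
    using zG(2) fixed[OF F1.one_closed] F2.cj_fixed_swap[OF _ zG(2)] subgroup.mem_carrier[OF P12(2)]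
    by (simp add: centralizer_def)
  ultimately show "z \<in> P1 \<times> P2"
    using cen F1.self_conjugate[OF P12(1)] F2.self_conjugate[OF P12(2)]
    by (auto simp: mem_Times_iff subset_iff)
qed

theorem centric_radical_quot:
  "fus_cr p H E = (\<lambda>(P1, P2). \<pi> ` (P1 \<times> P2)) ` (fus_cr p G1 F1 \<times> fus_cr p G2 F2)"
proof (intro equalityI subsetI)
  fix A assume cr: "A \<in> fus_cr p H E"
  then have A: "subgroup A H"
    by (simp add: fus_cr_def fus_centric_def)
  define P1 P2 where "P1 = fst ` pre A" and "P2 = snd ` pre A"
  have P: "pre A = P1 \<times> P2"
    unfolding P1_def P2_def by (rule centric_radical_is_times[OF cr])
  note P12 = subgroup_fst[OF F1.is_group F2.is_group pre_subgroup[OF A], folded P1_def P2_def]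
  have ZP: "Z \<subseteq> P1 \<times> P2"
    using Z_pre[OF A] unfolding P .
  have A_eq: "A = \<pi> ` (P1 \<times> P2)"
    using pi_pre[OF A] unfolding P by simp
  have "P1 \<in> fus_cr p G1 F1" "P2 \<in> fus_cr p G2 F2"
    using cr radical_times_iff[OF P12 ZP] centric_times_iff[OF P12 ZP] unfolding A_eq fus_cr_def
    by simp_all
  then show "A \<in> (\<lambda>(P1, P2). \<pi> ` (P1 \<times> P2)) ` (fus_cr p G1 F1 \<times> fus_cr p G2 F2)"
    unfolding A_eq by (intro image_eqI[of _ _ "(P1, P2)"]) simp_all
next
  fix A assume "A \<in> (\<lambda>(P1, P2). \<pi> ` (P1 \<times> P2)) ` (fus_cr p G1 F1 \<times> fus_cr p G2 F2)"
  then obtain P1 P2 where A: "A = \<pi> ` (P1 \<times> P2)" and cr: "P1 \<in> fus_cr p G1 F1" "P2 \<in> fus_cr p G2 F2"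
    by auto
  then have P12: "subgroup P1 G1" "subgroup P2 G2"
    by (simp_all add: fus_cr_def fus_centric_def)
  have ZP: "Z \<subseteq> P1 \<times> P2"
    by (rule Z_subset_centric[OF cr])
  show "A \<in> fus_cr p H E"
    using cr radical_times_iff[OF P12 ZP] centric_times_iff[OF P12 ZP] unfolding A fus_cr_def
    by simp
qed

end

section \<open>Partial groups\<close>

lemma carrier_group_on [simp]: "carrier (group_on L H) = H"
  and mult_group_on [simp]: "x \<otimes>\<^bsub>group_on L H\<^esub> y = pprod L [x, y]"
  and one_group_on [simp]: "\<one>\<^bsub>group_on L H\<^esub> = pone L"
  and restrict_group_on: "(group_on L K)\<lparr>carrier := H\<rparr> = group_on L H"
  by (simp_all add: group_on_def)

lemma word_inv_simps [simp]:
  "word_inv L [] = []" "word_inv L (g # w) = word_inv L w @ [pinv L g]"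
  "word_inv L (u @ v) = word_inv L v @ word_inv L u"
  by (simp_all add: word_inv_def)

section \<open>Words, cancellation and inverses\<close>

context partial_group
begin

lemma dom_carrier: "w \<in> pdom L \<Longrightarrow> set w \<subseteq> carrier L"
  using pdom_words by auto

lemma dom_infix: "u @ v @ w \<in> pdom L \<Longrightarrow> v \<in> pdom L"
  using pdom_append by blast

lemma nil_dom: "[] \<in> pdom L"
proof -
  obtain f where "f \<in> carrier L"
    using carrier_nonempty by blast
  then have "[] @ [f] \<in> pdom L"
    using pdom_singleton by simp
  then show ?thesis
    using pdom_append by blast
qed

lemma one_closed: "pone L \<in> carrier L"
  unfolding pone_def by (rule pprod_closed[OF nil_dom])

lemma prod_append:
  assumes "u @ v \<in> pdom L"
  shows "[pprod L u, pprod L v] \<in> pdom L" "pprod L (u @ v) = pprod L [pprod L u, pprod L v]"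
  using pprod_assoc[of u v "[]"] pprod_assoc[of "[]" u "[pprod L v]"] assms by simp_all

lemma one_insert:
  assumes "u @ w \<in> pdom L"
  shows "u @ [pone L] @ w \<in> pdom L" "pprod L (u @ [pone L] @ w) = pprod L (u @ w)"
  using pprod_assoc[of u "[]" w] assms by (simp_all add: pone_def)

lemma one_words:
  assumes "f \<in> carrier L"
  shows "[pone L, f] \<in> pdom L" "pprod L [pone L, f] = f" "[f, pone L] \<in> pdom L" "pprod L [f, pone L] = f"
  using one_insert[of "[]" "[f]"] one_insert[of "[f]" "[]"] pdom_singleton[OF assms] pprod_singleton[OF assms]
  by simp_all

lemma word_inv_inv:
  assumes "set w \<subseteq> carrier L"
  shows "word_inv L (word_inv L w) = w"
  using assms by (induction w) (simp_all add: pinv_pinv)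

lemma word_inv_dom:
  assumes "w \<in> pdom L"
  shows "word_inv L w \<in> pdom L"
  using pprod_inv[OF assms] pdom_append by blast

lemma inv_word_cancel:
  assumes "w \<in> pdom L"
  shows "word_inv L w @ w \<in> pdom L" "pprod L (word_inv L w @ w) = pone L"
    "w @ word_inv L w \<in> pdom L" "pprod L (w @ word_inv L w) = pone L"
  using pprod_inv[OF assms] pprod_inv[OF word_inv_dom[OF assms]] word_inv_inv[OF dom_carrier[OF assms]]
  by simp_all

lemma inv_cancel:
  assumes "f \<in> carrier L"
  shows "[pinv L f, f] \<in> pdom L" "pprod L [pinv L f, f] = pone L"
    "[f, pinv L f] \<in> pdom L" "pprod L [f, pinv L f] = pone L"
  using inv_word_cancel[OF pdom_singleton[OF assms]] by simp_all

text \<open>In a partial group a word must be known to be in the domain before its product can be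
  rewritten. Here the inverse axiom for the whole word f # w does it: its inverse followed by the
  word itself ends in f^-1 f w.\<close>

lemma cancel_prefix:
  assumes "f # w \<in> pdom L"
  shows "pinv L f # f # w \<in> pdom L" "pprod L (pinv L f # f # w) = pprod L w"
proof -
  have f: "f \<in> carrier L"
    using dom_carrier[OF assms] by simp
  have w: "w \<in> pdom L"
    using pdom_append[of "[f]" w] assms by simp
  have "word_inv L w @ (pinv L f # f # w) \<in> pdom L"
    using inv_word_cancel(1)[OF assms] by simp
  then show d: "pinv L f # f # w \<in> pdom L"
    using pdom_append by blast
  have "pprod L ([] @ [pinv L f, f] @ w) = pprod L ([] @ [pone L] @ w)"
    using pprod_assoc[of "[]" "[pinv L f, f]" w] d inv_cancel(2)[OF f] by simp
  also have "\<dots> = pprod L w"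
    using one_insert(2)[of "[]" w] w by simp
  finally show "pprod L (pinv L f # f # w) = pprod L w"
    by simp
qed

lemma prod_Cons:
  assumes "f # w \<in> pdom L"
  shows "[f, pprod L w] \<in> pdom L" "pprod L (f # w) = pprod L [f, pprod L w]"
  using pprod_assoc[of "[f]" w "[]"] assms by simp_all

lemma cancel_left_pair:
  assumes "[f, g] \<in> pdom L"
  shows "pprod L [pinv L f, pprod L [f, g]] = g"
proof -
  have g: "g \<in> carrier L"
    using dom_carrier[OF assms] by simp
  show ?thesis
    using prod_Cons(2)[OF cancel_prefix(1)[OF assms]] cancel_prefix(2)[OF assms] pprod_singleton[OF g]
    by simp
qed

lemma inv_unique:
  assumes "[a, b] \<in> pdom L" "pprod L [a, b] = pone L"
  shows "b = pinv L a"
proof -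
  have "a \<in> carrier L"
    using dom_carrier[OF assms(1)] by simp
  then show ?thesis
    using cancel_left_pair[OF assms(1)] one_words(4)[of "pinv L a"] pinv_closed by (simp add: assms(2))
qed

lemma pinv_prod:
  assumes "w \<in> pdom L"
  shows "pinv L (pprod L w) = pprod L (word_inv L w)"
  by (rule inv_unique[symmetric])
    (use prod_append[OF inv_word_cancel(3)[OF assms]] inv_word_cancel(4)[OF assms] in simp_all)

lemma pinv_one [simp]: "pinv L (pone L) = pone L"
  using pinv_prod[OF nil_dom] by (simp add: pone_def)

subsection \<open>Subgroups\<close>

lemma subgroup_facts:
  assumes "pg_subgroup L H"
  shows subgroup_carrier: "H \<subseteq> carrier L" and subgroup_dom: "\<And>w. set w \<subseteq> H \<Longrightarrow> w \<in> pdom L"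
    and subgroup_prod: "\<And>w. set w \<subseteq> H \<Longrightarrow> pprod L w \<in> H"
    and subgroup_pinv: "\<And>x. x \<in> H \<Longrightarrow> pinv L x \<in> H" and subgroup_one: "pone L \<in> H"
proof -
  show "H \<subseteq> carrier L" "\<And>x. x \<in> H \<Longrightarrow> pinv L x \<in> H"
    using assms by (auto simp: pg_subgroup_def partial_subgroup_def)
  show dom: "w \<in> pdom L" if "set w \<subseteq> H" for w
    using assms that by (auto simp: pg_subgroup_def)
  show prod: "pprod L w \<in> H" if "set w \<subseteq> H" for w
    using assms that dom[OF that] by (auto simp: pg_subgroup_def partial_subgroup_def)
  show "pone L \<in> H"
    unfolding pone_def by (rule prod) simp
qed

lemma pg_subgroupI:
  assumes "H \<subseteq> carrier L" "\<And>h. h \<in> H \<Longrightarrow> pinv L h \<in> H"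
    and "\<And>w. set w \<subseteq> H \<Longrightarrow> w \<in> pdom L" "\<And>w. set w \<subseteq> H \<Longrightarrow> pprod L w \<in> H"
  shows "pg_subgroup L H"
  unfolding pg_subgroup_def partial_subgroup_def lists_eq_set using assms by blast

lemma group_group_on:
  assumes "pg_subgroup L H"
  shows "group (group_on L H)"
proof (rule groupI)
  note H = subgroup_facts[OF assms]
  have HL: "x \<in> carrier L" if "x \<in> H" for x
    using that H(1) by blast
  fix x assume x: "x \<in> carrier (group_on L H)"
  show "\<one>\<^bsub>group_on L H\<^esub> \<otimes>\<^bsub>group_on L H\<^esub> x = x"
    using x one_words(2)[OF HL] by simp
  show "\<exists>y\<in>carrier (group_on L H). y \<otimes>\<^bsub>group_on L H\<^esub> x = \<one>\<^bsub>group_on L H\<^esub>"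
    using x H(4) inv_cancel(2)[OF HL] by auto
  fix y assume y: "y \<in> carrier (group_on L H)"
  show "x \<otimes>\<^bsub>group_on L H\<^esub> y \<in> carrier (group_on L H)"
    using x y H(3)[of "[x, y]"] by simp
  fix z assume z: "z \<in> carrier (group_on L H)"
  have "[x, y, z] \<in> pdom L"
    using x y z H(2) by simp
  then show "x \<otimes>\<^bsub>group_on L H\<^esub> y \<otimes>\<^bsub>group_on L H\<^esub> z = x \<otimes>\<^bsub>group_on L H\<^esub> (y \<otimes>\<^bsub>group_on L H\<^esub> z)"
    using pprod_assoc[of "[]" "[x, y]" "[z]"] pprod_assoc[of "[x]" "[y, z]" "[]"] by simp
qed (use subgroup_one[OF assms] in simp)

lemma inv_group_on:
  assumes "pg_subgroup L H" "x \<in> H"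
  shows "inv\<^bsub>group_on L H\<^esub> x = pinv L x"
  by (rule group.inv_equality[OF group_group_on[OF assms(1)]])
    (use assms subgroup_facts[OF assms(1)] inv_cancel(2) in auto)

lemma subgroup_group_on_iff:
  assumes "pg_subgroup L K"
  shows "subgroup H (group_on L K) \<longleftrightarrow> pg_subgroup L H \<and> H \<subseteq> K"
proof
  assume H: "subgroup H (group_on L K)"
  have HK: "H \<subseteq> K"
    using subgroup.subset[OF H] by simp
  have dom: "w \<in> pdom L" if "set w \<subseteq> H" for w
    using that HK subgroup_dom[OF assms] by blast
  have "pprod L w \<in> H" if "set w \<subseteq> H" for w
    using that
  proof (induction w)
    case Nil
    then show ?case
      using subgroup.one_closed[OF H] by (simp add: pone_def)
  next
    case (Cons f w)
    then have "pprod L [f, pprod L w] \<in> H"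
      using subgroup.m_closed[OF H, of f "pprod L w"] by simp
    then show ?case
      using prod_Cons(2)[OF dom[OF Cons.prems]] by simp
  qed
  moreover have "pinv L h \<in> H" if "h \<in> H" for h
    using subgroup.m_inv_closed[OF H that] inv_group_on[OF assms] that HK by auto
  moreover have "H \<subseteq> carrier L"
    using HK subgroup_carrier[OF assms] by blast
  ultimately show "pg_subgroup L H \<and> H \<subseteq> K"
    using dom HK pg_subgroupI by blast
next
  assume H: "pg_subgroup L H \<and> H \<subseteq> K"
  interpret K: group "group_on L K"
    by (rule group_group_on[OF assms])
  have H': "pg_subgroup L H" using H by blast
  show "subgroup H (group_on L K)"
    using H subgroup_prod[OF H', of "[_, _]"] subgroup_pinv[OF H'] subgroup_one[OF H'] inv_group_on[OF assms]
    by (intro K.subgroupI) auto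
qed

lemma cj_group_on:
  assumes "pg_subgroup L H" "g \<in> H" "x \<in> H"
  shows "cj (group_on L H) g x = pconj L g x"
proof -
  have "[pinv L g, x, g] \<in> pdom L"
    using assms by (intro subgroup_dom[OF assms(1)]) (simp add: subgroup_pinv)
  then show ?thesis
    using pprod_assoc[of "[]" "[pinv L g, x]" "[g]"] assms by (simp add: inv_group_on pconj_def)
qed

subsection \<open>Conjugation\<close>

lemma conj_dom_iff: "x \<in> conj_dom L g \<longleftrightarrow> [pinv L g, x, g] \<in> pdom L"
  using dom_carrier by (fastforce simp: conj_dom_def)

lemma conj_closed: "x \<in> conj_dom L g \<Longrightarrow> pconj L g x \<in> carrier L"
  by (simp add: conj_dom_iff pconj_def pprod_closed)

lemma subgroup_conj_dom:
  assumes "pg_subgroup L H" "h \<in> H"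
  shows "H \<subseteq> conj_dom L h" "pconj L h ` H = H"
proof -
  interpret H: group "group_on L H"
    by (rule group_group_on[OF assms(1)])
  show "H \<subseteq> conj_dom L h"
  proof
    fix x assume "x \<in> H"
    then show "x \<in> conj_dom L h"
      unfolding conj_dom_iff using assms subgroup_pinv[OF assms(1)]
      by (intro subgroup_dom[OF assms(1)]) simp
  qed
  have eq: "pconj L h ` H = cj (group_on L H) h ` H"
    by (intro image_cong refl cj_group_on[OF assms, symmetric])
  have "cj (group_on L H) h ` H = H"
  proof (intro equalityI subsetI)
    fix x assume x: "x \<in> H"
    have "x = cj (group_on L H) h (cj (group_on L H) (inv\<^bsub>group_on L H\<^esub> h) x)"
      by (rule H.cj_cancel(1)[symmetric]) (use x assms in simp_all)
    moreover have "cj (group_on L H) (inv\<^bsub>group_on L H\<^esub> h) x \<in> H"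
      using H.m_closed[OF H.m_closed[OF H.inv_closed[OF H.inv_closed]] H.inv_closed, of h x h] x assms
      by (simp only: carrier_group_on)
    ultimately show "x \<in> cj (group_on L H) h ` H"
      by (rule image_eqI)
  next
    fix y assume "y \<in> cj (group_on L H) h ` H"
    then obtain x where "x \<in> H" "y = cj (group_on L H) h x" by (rule imageE)
    then show "y \<in> H"
      using H.m_closed[OF H.m_closed[OF H.inv_closed], of h x h] assms by (simp only: carrier_group_on)
  qed
  then show "pconj L h ` H = H"
    by (simp add: eq)
qed

lemma conj_comm:
  assumes "g \<in> carrier L" "x \<in> conj_dom L g"
  shows "[g, pinv L g, x, g] \<in> pdom L" "[x, g] \<in> pdom L" "[g, pconj L g x] \<in> pdom L"
    "pprod L [x, g] = pprod L [g, pconj L g x]"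
proof -
  let ?w = "[pinv L g, x, g]"
  have w: "?w \<in> pdom L"
    using assms by (simp add: conj_dom_iff)
  \<comment> \<open>This is the inverse of (g^-1, x, g) followed by the word itself; its last four
    letters form the word that allows g to be cancelled.\<close>
  have "[pinv L g, pinv L x] @ [g, pinv L g, x, g] \<in> pdom L"
    using inv_word_cancel(1)[OF w] assms(1) by (simp add: pinv_pinv)
  then show u: "[g, pinv L g, x, g] \<in> pdom L"
    using pdom_append by blast
  show xg: "[x, g] \<in> pdom L"
    using pdom_append[of "[pinv L g]" "[x, g]"] w by simp
  show "[g, pconj L g x] \<in> pdom L"
    using pprod_assoc[of "[g]" ?w "[]"] u by (simp add: pconj_def)
  have "pprod L [g, pconj L g x] = pprod L [g, pinv L g, x, g]"
    using pprod_assoc[of "[g]" ?w "[]"] u by (simp add: pconj_def)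
  also have "\<dots> = pprod L [pone L, x, g]"
    using pprod_assoc[of "[]" "[g, pinv L g]" "[x, g]"] u inv_cancel(4)[OF assms(1)] by simp
  also have "\<dots> = pprod L [x, g]"
    using one_insert(2)[of "[]" "[x, g]"] xg by simp
  finally show "pprod L [x, g] = pprod L [g, pconj L g x]"
    by simp
qed

text \<open>Membership in the domain of the inverse conjugation is again read off from a cancelling
  word: (g, g^-1, x, g) followed by its inverse begins with g, g^-1, x, g, g^-1. Bracketing these
  five letters in two ways gives both claims.\<close>

lemma conj_back:
  assumes "g \<in> carrier L" "x \<in> conj_dom L g"
  shows "pconj L g x \<in> conj_dom L (pinv L g)" "pconj L (pinv L g) (pconj L g x) = x"
proof -
  have x: "x \<in> carrier L"
    using assms by (simp add: conj_dom_def)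
  let ?u = "[g, pinv L g, x, g]"
  have u: "?u \<in> pdom L"
    by (rule conj_comm(1)[OF assms])
  have "[g, pinv L g, x, g, pinv L g] @ [pinv L x, g, pinv L g] \<in> pdom L"
    using inv_word_cancel(3)[OF u] assms(1) by (simp add: pinv_pinv)
  then have v: "[g, pinv L g, x, g, pinv L g] \<in> pdom L"
    using pdom_append by blast
  have vv: "[g, pconj L g x, pinv L g] \<in> pdom L"
    "pprod L [g, pinv L g, x, g, pinv L g] = pprod L [g, pconj L g x, pinv L g]"
    using pprod_assoc[of "[g]" "[pinv L g, x, g]" "[pinv L g]"] v by (simp_all add: pconj_def)
  show "pconj L g x \<in> conj_dom L (pinv L g)"
    using vv(1) assms(1) by (simp add: conj_dom_iff pinv_pinv)
  have 1: "[pone L, x, g, pinv L g] \<in> pdom L"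
    "pprod L [g, pinv L g, x, g, pinv L g] = pprod L [pone L, x, g, pinv L g]"
    using pprod_assoc[of "[]" "[g, pinv L g]" "[x, g, pinv L g]"] v inv_cancel(4)[OF assms(1)] by simp_all
  then have 2: "pprod L [pone L, x, g, pinv L g] = pprod L [pone L, x, pone L]" "[pone L, x, pone L] \<in> pdom L"
    using pprod_assoc[of "[pone L, x]" "[g, pinv L g]" "[]"] inv_cancel(4)[OF assms(1)] by simp_all
  have "pprod L [pone L, x, pone L] = x"
    using one_insert(2)[of "[pone L, x]" "[]"] one_words[OF x] by simp
  then show "pconj L (pinv L g) (pconj L g x) = x"
    using vv(2) 1 2 assms(1) by (simp add: pconj_def pinv_pinv)
qed

lemma conj_inj: "g \<in> carrier L \<Longrightarrow> inj_on (pconj L g) (conj_dom L g)"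
  by (rule inj_on_inverseI[of _ "pconj L (pinv L g)"]) (rule conj_back(2))

lemma conj_pinv:
  assumes "g \<in> carrier L" "x \<in> conj_dom L g"
  shows "pinv L x \<in> conj_dom L g" "pconj L g (pinv L x) = pinv L (pconj L g x)"
proof -
  have w: "[pinv L g, x, g] \<in> pdom L"
    using assms by (simp add: conj_dom_iff)
  have "word_inv L [pinv L g, x, g] = [pinv L g, pinv L x, g]"
    using assms by (simp add: pinv_pinv)
  then show "pinv L x \<in> conj_dom L g" "pconj L g (pinv L x) = pinv L (pconj L g x)"
    using word_inv_dom[OF w] pinv_prod[OF w] by (simp_all add: conj_dom_iff pconj_def)
qed

lemma conj_one:
  assumes "x \<in> carrier L"
  shows "x \<in> conj_dom L (pone L)" "pconj L (pone L) x = x"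
  using one_insert[of "[pone L, x]" "[]"] one_words[OF assms] by (simp_all add: conj_dom_iff pconj_def)

lemma center_comm:
  assumes "z \<in> pg_center L" "f \<in> carrier L"
  shows "f \<in> conj_dom L z" "pconj L z f = f" "[z, f] \<in> pdom L" "[f, z] \<in> pdom L"
    "pprod L [z, f] = pprod L [f, z]" "z \<in> carrier L"
proof -
  show z: "z \<in> carrier L" and f: "f \<in> conj_dom L z" "pconj L z f = f"
    using assms by (auto simp: pg_center_def pg_centralizer_def)
  show "[z, f] \<in> pdom L" "[f, z] \<in> pdom L" "pprod L [z, f] = pprod L [f, z]"
    using conj_comm[OF z f(1)] by (simp_all add: f(2))
qed

lemma center_conj:
  assumes "z \<in> pg_center L" "g \<in> carrier L"
  shows "pprod L [pinv L g, pprod L [z, g]] = z"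
  using cancel_left_pair[OF center_comm(4)[OF assms]] center_comm(5)[OF assms] by simp

text \<open>The centre consists of elements under which every f is fixed. This is the opposite
  reading, in which g acts and the central element is fixed.\<close>

lemma center_conj_dom:
  assumes "z \<in> pg_center L" "g \<in> carrier L" "z \<in> conj_dom L g"
  shows "pconj L g z = z"
  using assms(3) prod_Cons(2)[of "pinv L g" "[z, g]"] center_conj[OF assms(1,2)]
  by (simp add: conj_dom_iff pconj_def)

end

section \<open>Localities\<close>

text \<open>A word lies in the domain of a locality by means of a chain of objects, and the chain is
  determined by its first member. Recursion on the word with that member as a parameter replaces the
  indexed list of \<open>dom_of\<close> and suits inductions.\<close>

primrec via :: "('a, 'm) partial_group_scheme \<Rightarrow> 'a set set \<Rightarrow> 'a set \<Rightarrow> 'a list \<Rightarrow> bool" where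
  "via L \<Delta> P [] \<longleftrightarrow> P \<in> \<Delta>"
| "via L \<Delta> P (g # w) \<longleftrightarrow>
     P \<in> \<Delta> \<and> g \<in> carrier L \<and> P \<subseteq> conj_dom L g \<and> via L \<Delta> (pconj L g ` P) w"

primrec conj_word :: "('a, 'm) partial_group_scheme \<Rightarrow> 'a list \<Rightarrow> 'a \<Rightarrow> 'a" where
  "conj_word L [] x = x"
| "conj_word L (g # w) x = conj_word L w (pconj L g x)"

lemma via_obj: "via L \<Delta> P w \<Longrightarrow> P \<in> \<Delta>"
  by (cases w) simp_all

lemma via_append: "via L \<Delta> P (u @ v) \<longleftrightarrow> via L \<Delta> P u \<and> via L \<Delta> (conj_word L u ` P) v"
  by (induction u arbitrary: P) (auto simp: image_image dest: via_obj)

lemma via_carrier: "via L \<Delta> P w \<Longrightarrow> w \<in> lists (carrier L)"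
  by (induction w arbitrary: P) auto

lemma via_iff_chain:
  "via L \<Delta> P w \<longleftrightarrow> w \<in> lists (carrier L) \<and>
    (\<exists>Ps. length Ps = length w \<and> P \<in> \<Delta> \<and> set Ps \<subseteq> \<Delta> \<and>
      (\<forall>i<length w. (P # Ps) ! i \<subseteq> conj_dom L (w ! i) \<and> pconj L (w ! i) ` ((P # Ps) ! i) = Ps ! i))"
proof (induction w arbitrary: P)
  case (Cons g w)
  show ?case
  proof
    assume v: "via L \<Delta> P (g # w)"
    then obtain Ps where "length Ps = length w" "pconj L g ` P \<in> \<Delta>" "set Ps \<subseteq> \<Delta>"
      "\<forall>i<length w. (pconj L g ` P # Ps) ! i \<subseteq> conj_dom L (w ! i) \<and>
        pconj L (w ! i) ` ((pconj L g ` P # Ps) ! i) = Ps ! i"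
      using Cons.IH[of "pconj L g ` P"] by auto
    with v show "g # w \<in> lists (carrier L) \<and>
      (\<exists>Ps. length Ps = length (g # w) \<and> P \<in> \<Delta> \<and> set Ps \<subseteq> \<Delta> \<and>
      (\<forall>i<length (g # w). (P # Ps) ! i \<subseteq> conj_dom L ((g # w) ! i) \<and>
        pconj L ((g # w) ! i) ` ((P # Ps) ! i) = Ps ! i))"
      by (intro conjI via_carrier[OF v] exI[of _ "pconj L g ` P # Ps"])
        (auto simp: nth_Cons split: nat.splits)
  next
    assume "g # w \<in> lists (carrier L) \<and>
      (\<exists>Ps. length Ps = length (g # w) \<and> P \<in> \<Delta> \<and> set Ps \<subseteq> \<Delta> \<and>
      (\<forall>i<length (g # w). (P # Ps) ! i \<subseteq> conj_dom L ((g # w) ! i) \<and>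
        pconj L ((g # w) ! i) ` ((P # Ps) ! i) = Ps ! i))"
    then obtain Qs where Qs: "length Qs = Suc (length w)" "P \<in> \<Delta>" "set Qs \<subseteq> \<Delta>" "g # w \<in> lists (carrier L)"
      "\<And>i. i < Suc (length w) \<Longrightarrow> (P # Qs) ! i \<subseteq> conj_dom L ((g # w) ! i) \<and>
        pconj L ((g # w) ! i) ` ((P # Qs) ! i) = Qs ! i"
      by auto
    obtain Q Ps where Ps: "Qs = Q # Ps"
      using Qs(1) by (cases Qs) auto
    have 0: "P \<subseteq> conj_dom L g" "pconj L g ` P = Q"
      using Qs(5)[of 0] Ps by auto
    have "(Q # Ps) ! i \<subseteq> conj_dom L (w ! i) \<and> pconj L (w ! i) ` ((Q # Ps) ! i) = Ps ! i"
      if "i < length w" for i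
      using Qs(5)[of "Suc i"] that Ps by simp
    then have "via L \<Delta> Q w"
      using Cons.IH[of Q] Qs Ps by auto
    then show "via L \<Delta> P (g # w)"
      using 0 Qs by auto
  qed
qed auto

lemma dom_of_iff: "w \<in> dom_of L \<Delta> \<longleftrightarrow> (\<exists>P. via L \<Delta> P w)"
proof
  assume "w \<in> dom_of L \<Delta>"
  then obtain Qs where Qs: "w \<in> lists (carrier L)" "length Qs = Suc (length w)" "set Qs \<subseteq> \<Delta>"
    "\<forall>i<length w. Qs ! i \<subseteq> conj_dom L (w ! i) \<and> pconj L (w ! i) ` (Qs ! i) = Qs ! Suc i"
    unfolding dom_of_def by blast
  obtain P Ps where P: "Qs = P # Ps"
    using Qs(2) by (cases Qs) auto
  have "via L \<Delta> P w"
    unfolding via_iff_chain using Qs unfolding P by (intro conjI exI[of _ Ps]) auto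
  then show "\<exists>P. via L \<Delta> P w" ..
next
  assume "\<exists>P. via L \<Delta> P w"
  then obtain P Ps where "w \<in> lists (carrier L)" "length Ps = length w" "P \<in> \<Delta>" "set Ps \<subseteq> \<Delta>"
    "\<forall>i<length w. (P # Ps) ! i \<subseteq> conj_dom L (w ! i) \<and> pconj L (w ! i) ` ((P # Ps) ! i) = Ps ! i"
    unfolding via_iff_chain by blast
  then show "w \<in> dom_of L \<Delta>"
    unfolding dom_of_def by (intro CollectI conjI exI[of _ "P # Ps"]) auto
qed

section \<open>Chains of objects and multiplicativity of conjugation\<close>

context locality
begin

lemma dom_iff: "w \<in> pdom L \<longleftrightarrow> (\<exists>P. via L \<Delta> P w)"
  unfolding dom_eq by (rule dom_of_iff)

lemma via_dom: "via L \<Delta> P w \<Longrightarrow> w \<in> pdom L"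
  using dom_iff by blast

lemma S_subgroup: "pg_subgroup L S" and S_p_power: "p_power p S"
  using p_subgroup_S by (auto simp: pg_p_subgroup_def)

lemma S_carrier: "s \<in> S \<Longrightarrow> s \<in> carrier L"
  using subgroup_carrier[OF S_subgroup] by blast

lemma obj_subgroup: "P \<in> \<Delta> \<Longrightarrow> pg_subgroup L P" and obj_S: "P \<in> \<Delta> \<Longrightarrow> P \<subseteq> S"
  using objects_subgroups by blast+

lemma finite_sub: "X \<subseteq> carrier L \<Longrightarrow> finite X"
  using finite_carrier finite_subset by blast

lemma obj_overgroup:
  assumes "P \<in> \<Delta>" "pg_subgroup L Q" "P \<subseteq> Q" "Q \<subseteq> S"
  shows "Q \<in> \<Delta>"
proof (rule objects_closed[OF assms(1) one_closed _ assms(2,4)])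
  have P: "P \<subseteq> carrier L"
    using subgroup_carrier obj_subgroup assms(1) by blast
  then show "P \<subseteq> conj_dom L (pone L)"
    using conj_one by blast
  show "pconj L (pone L) ` P \<subseteq> Q"
    using P conj_one assms(3) by (auto simp: subset_iff)
qed

lemma S_obj: "S \<in> \<Delta>"
proof -
  obtain P where "P \<in> \<Delta>"
    using objects_nonempty by blast
  then show ?thesis
    using obj_overgroup S_subgroup obj_S by blast
qed

lemma subgroup_conj_S:
  assumes "pg_subgroup L P" "P \<subseteq> S" "s \<in> S"
  shows "P \<subseteq> conj_dom L s" "pconj L s ` P \<subseteq> S" "pg_subgroup L (pconj L s ` P)"
proof -
  note S = subgroup_conj_dom[OF S_subgroup assms(3)]
  show "P \<subseteq> conj_dom L s" "pconj L s ` P \<subseteq> S"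
    using S assms(2) by blast+
  interpret S: group "group_on L S"
    by (rule group_group_on[OF S_subgroup])
  have "pconj L s ` P = cj (group_on L S) s ` P"
    by (intro image_cong refl cj_group_on[OF S_subgroup, symmetric]) (use assms in blast)+
  moreover have "subgroup (cj (group_on L S) s ` P) (group_on L S)"
    by (rule S.subgroup_cj_image) (use assms subgroup_group_on_iff[OF S_subgroup] in simp_all)
  ultimately show "pg_subgroup L (pconj L s ` P)"
    using subgroup_group_on_iff[OF S_subgroup] by simp
qed

lemma obj_conj_S:
  assumes "P \<in> \<Delta>" "s \<in> S"
  shows "pconj L s ` P \<in> \<Delta>" "via L \<Delta> P [s]"
proof -
  note P = obj_subgroup[OF assms(1)] obj_S[OF assms(1)]
  note c = subgroup_conj_S[OF P assms(2)]
  show o: "pconj L s ` P \<in> \<Delta>"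
    by (rule objects_closed[OF assms(1) S_carrier[OF assms(2)] c(1,3,2) order_refl])
  show "via L \<Delta> P [s]"
    using o assms c S_carrier by simp
qed

lemma via_back:
  assumes "via L \<Delta> P [g]"
  shows "via L \<Delta> (pconj L g ` P) [pinv L g]" "pconj L (pinv L g) ` pconj L g ` P = P"
proof -
  have a: "P \<in> \<Delta>" "g \<in> carrier L" "P \<subseteq> conj_dom L g" "pconj L g ` P \<in> \<Delta>"
    using assms by auto
  show eq: "pconj L (pinv L g) ` pconj L g ` P = P"
    unfolding image_image using conj_back(2)[OF a(2)] a(3) by force
  show "via L \<Delta> (pconj L g ` P) [pinv L g]"
    using a conj_back(1)[OF a(2)] pinv_closed eq by (auto simp: subset_iff)
qed

lemma via_word_inv:
  assumes "via L \<Delta> P w"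
  shows "via L \<Delta> (conj_word L w ` P) (word_inv L w) \<and>
    conj_word L (word_inv L w) ` conj_word L w ` P = P"
  using assms
proof (induction w arbitrary: P)
  case (Cons g w)
  let ?Q = "pconj L g ` P"
  have Q: "via L \<Delta> ?Q w"
    using Cons.prems by simp
  note IH = Cons.IH[OF Q, THEN conjunct1] Cons.IH[OF Q, THEN conjunct2]
  have g: "via L \<Delta> P [g]"
    using Cons.prems via_obj[OF Q] by simp
  have eq: "conj_word L (g # w) ` P = conj_word L w ` ?Q"
    by (simp add: image_image)
  have app: "conj_word L (u @ v) = (\<lambda>x. conj_word L v (conj_word L u x))" for u v
    by (rule ext, induction u) simp_all
  have "via L \<Delta> (conj_word L w ` ?Q) (word_inv L (g # w))"
    unfolding word_inv_simps via_append IH(2) using IH(1) via_back(1)[OF g] by blast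
  moreover have "conj_word L (word_inv L (g # w)) ` conj_word L w ` ?Q =
      pconj L (pinv L g) ` conj_word L (word_inv L w) ` conj_word L w ` ?Q"
    by (simp add: app image_image)
  ultimately show ?case
    unfolding eq IH(2) via_back(2)[OF g] by blast
qed simp_all

text \<open>Run the chain of w backwards, apply x, which normalizes the object P it belongs to, and
  run forwards again. So the word w^-1, x, w is in the domain, and its product can be bracketed from
  the middle or from both ends.\<close>

lemma via_conj_word:
  assumes "via L \<Delta> P w" "x \<in> P"
  shows "word_inv L w @ [x] @ w \<in> pdom L" "x \<in> conj_dom L (pprod L w)"
    "pconj L (pprod L w) x = conj_word L w x"
proof -
  have P: "pg_subgroup L P"
    using via_obj[OF assms(1)] obj_subgroup by blast
  have x: "via L \<Delta> P [x]" "pconj L x ` P = P"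
    using via_obj[OF assms(1)] subgroup_conj_dom[OF P assms(2)] subgroup_carrier[OF P] assms(2) by auto
  note i = via_word_inv[OF assms(1), THEN conjunct1] via_word_inv[OF assms(1), THEN conjunct2]
  have "via L \<Delta> (conj_word L w ` P) (word_inv L w @ [x] @ w)"
    unfolding via_append i(2) using i(1) x assms(1) by simp
  then show d: "word_inv L w @ [x] @ w \<in> pdom L"
    by (rule via_dom)
  have w: "w \<in> pdom L"
    by (rule via_dom[OF assms(1)])
  have 1: "[pinv L (pprod L w)] @ [x] @ w \<in> pdom L"
    "pprod L (word_inv L w @ [x] @ w) = pprod L ([pinv L (pprod L w)] @ [x] @ w)"
    using pprod_assoc[of "[]" "word_inv L w" "[x] @ w"] d by (simp_all add: pinv_prod[OF w])
  then have 2: "[pinv L (pprod L w), x, pprod L w] \<in> pdom L"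
    "pprod L (word_inv L w @ [x] @ w) = pconj L (pprod L w) x"
    using pprod_assoc[of "[pinv L (pprod L w), x]" w "[]"] by (simp_all add: pconj_def)
  show "x \<in> conj_dom L (pprod L w)"
    using 2 by (simp add: conj_dom_iff)
  have "pprod L (word_inv L w @ [x] @ w) = conj_word L w x"
    using assms d
  proof (induction w arbitrary: P x)
    case Nil
    then have "x \<in> carrier L"
      using subgroup_carrier obj_subgroup by auto
    then show ?case
      by (simp add: pprod_singleton)
  next
    case (Cons g w)
    have "pprod L (word_inv L w @ [pinv L g, x, g] @ w) = pprod L (word_inv L w @ [pconj L g x] @ w)"
      "word_inv L w @ [pconj L g x] @ w \<in> pdom L"
      using pprod_assoc[of "word_inv L w" "[pinv L g, x, g]" w] Cons.prems(3) by (simp_all add: pconj_def)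
    then show ?case
      using Cons.IH[of "pconj L g ` P" "pconj L g x"] Cons.prems by simp
  qed
  then show "pconj L (pprod L w) x = conj_word L w x"
    using 2(2) by simp
qed

lemma via_prod:
  assumes "via L \<Delta> P w"
  shows "P \<subseteq> conj_dom L (pprod L w)" "pconj L (pprod L w) ` P = conj_word L w ` P"
  using via_conj_word[OF assms] by (auto intro!: image_cong)

text \<open>
  \<open>S\<^sub>g = {x \<in> S. x\<^sup>g \<in> S}\<close> permutes the objects that can start the word \<open>(g)\<close>, because
  \<open>g = x\<^sup>-\<^sup>1 g x\<^sup>g\<close>. This makes \<open>c\<^sub>g\<close> multiplicative on \<open>S\<^sub>g\<close>.
\<close>

lemma via_shift:
  assumes P: "via L \<Delta> P [g]" and x: "x \<in> S" "x \<in> conj_dom L g" "pconj L g x \<in> S"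
  shows "via L \<Delta> (pconj L x ` P) [g]"
proof -
  have PD: "P \<in> \<Delta>" and g: "g \<in> carrier L" and Pg: "pconj L g ` P \<in> \<Delta>"
    using P by auto
  let ?w = "[pinv L x, g, pconj L g x]"
  note vx = obj_conj_S[OF PD x(1)]
  have "via L \<Delta> (pconj L x ` P) [pinv L x]" "pconj L (pinv L x) ` pconj L x ` P = P"
    by (rule via_back[OF vx(2)])+
  moreover have "via L \<Delta> (pconj L g ` P) [pconj L g x]"
    by (rule obj_conj_S[OF Pg x(3)])
  ultimately have v: "via L \<Delta> (pconj L x ` P) ?w"
    using P by simp
  have d: "?w \<in> pdom L"
    by (rule via_dom[OF v])
  have "pprod L ?w = pprod L [pinv L x, pprod L [g, pconj L g x]]"
    by (rule prod_Cons(2)[OF d])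
  also have "\<dots> = pprod L [pinv L x, pprod L [x, g]]"
    by (simp only: conj_comm(4)[OF g x(2)])
  also have "\<dots> = g"
    by (rule cancel_left_pair[OF conj_comm(2)[OF g x(2)]])
  finally have w: "pprod L ?w = g" .
  have "pconj L g ` pconj L x ` P = conj_word L ?w ` pconj L x ` P"
    using via_prod(2)[OF v] unfolding w .
  also have "\<dots> = pconj L (pconj L g x) ` pconj L g ` pconj L (pinv L x) ` pconj L x ` P"
    by (simp add: image_image)
  also have "\<dots> \<in> \<Delta>"
    unfolding via_back(2)[OF vx(2)] by (rule obj_conj_S[OF Pg x(3)])
  finally show ?thesis
    using via_prod(1)[OF v] vx(1) g unfolding w by simp
qed

text \<open>The point is the domain of (g^-1, x, g, g^-1, y, g). Starting from P^g the chain passes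
  through P, P^x and P^(xy); each of these can start the word (g) by \<open>via_shift\<close>.
  Cancelling the middle pair then compares the two sides.\<close>

lemma conj_mult:
  assumes g: "g \<in> carrier L" and x: "x \<in> S" "x \<in> conj_dom L g" "pconj L g x \<in> S"
    and y: "y \<in> S" "y \<in> conj_dom L g" "pconj L g y \<in> S"
  shows "pprod L [x, y] \<in> conj_dom L g" "pconj L g (pprod L [x, y]) = pprod L [pconj L g x, pconj L g y]"
proof -
  obtain P where P: "via L \<Delta> P [g]"
    using dom_iff pdom_singleton[OF g] by blast
  let ?W = "[pinv L g, x, g, pinv L g, y, g]" and ?V = "[pinv L g, x, y, g]"
  let ?Px = "pconj L x ` P"
  have PD: "P \<in> \<Delta>" using P by simp
  have Px: "via L \<Delta> ?Px [g]" "via L \<Delta> P [x]"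
    using via_shift[OF P x] obj_conj_S[OF PD x(1)] by blast+
  then have PxD: "?Px \<in> \<Delta>" by simp
  have Pxy: "via L \<Delta> (pconj L y ` ?Px) [g]" "via L \<Delta> ?Px [y]"
    using via_shift[OF Px(1) y] obj_conj_S[OF PxD y(1)] by blast+
  note b = via_back[OF P] and bx = via_back[OF Px(1)]
  have "via L \<Delta> (pconj L g ` P) ?W"
    using b bx P Px Pxy by simp
  then have W: "?W \<in> pdom L"
    by (rule via_dom)
  have "via L \<Delta> (pconj L g ` P) ?V"
    using b P Px Pxy by simp
  then have V: "?V \<in> pdom L"
    by (rule via_dom)
  show "pprod L [x, y] \<in> conj_dom L g"
    using pprod_assoc[of "[pinv L g]" "[x, y]" "[g]"] V by (simp add: conj_dom_iff)
  have "pconj L g (pprod L [x, y]) = pprod L ?V"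
    using pprod_assoc[of "[pinv L g]" "[x, y]" "[g]"] V by (simp add: pconj_def)
  also have "\<dots> = pprod L ([pinv L g, x] @ [pone L] @ [y, g])"
    using one_insert(2)[of "[pinv L g, x]" "[y, g]"] V by simp
  also have "\<dots> = pprod L ?W"
    using pprod_assoc[of "[pinv L g, x]" "[g, pinv L g]" "[y, g]"] W inv_cancel(4)[OF g] by simp
  also have "\<dots> = pprod L [pconj L g x, pconj L g y]"
    using prod_append(2)[of "[pinv L g, x, g]" "[pinv L g, y, g]"] W by (simp add: pconj_def)
  finally show "pconj L g (pprod L [x, y]) = pprod L [pconj L g x, pconj L g y]" .
qed

lemma conj_subgroup:
  assumes P: "pg_subgroup L P" "P \<subseteq> S" and g: "g \<in> carrier L" and c: "P \<subseteq> conj_dom L g" "pconj L g ` P \<subseteq> S"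
  shows "pg_subgroup L (pconj L g ` P)"
proof -
  interpret S: group "group_on L S"
    by (rule group_group_on[OF S_subgroup])
  have "subgroup (pconj L g ` P) (group_on L S)"
  proof (rule S.subgroupI)
    show "pconj L g ` P \<subseteq> carrier (group_on L S)"
      using c by simp
    show "pconj L g ` P \<noteq> {}"
      using subgroup_one[OF P(1)] by blast
    fix a assume "a \<in> pconj L g ` P"
    then obtain x where x: "x \<in> P" "a = pconj L g x" by blast
    have aS: "a \<in> S"
      using x c by blast
    have xc: "x \<in> conj_dom L g"
      using x c by blast
    show "inv\<^bsub>group_on L S\<^esub> a \<in> pconj L g ` P"
      unfolding inv_group_on[OF S_subgroup aS] unfolding x(2) conj_pinv(2)[OF g xc, symmetric]
      by (rule imageI[OF subgroup_pinv[OF P(1) x(1)]])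
    fix b assume "b \<in> pconj L g ` P"
    then obtain y where y: "y \<in> P" "b = pconj L g y" by blast
    have "pprod L [a, b] = pconj L g (pprod L [x, y])"
      unfolding x(2) y(2) by (rule conj_mult(2)[OF g, symmetric]) (use x(1) y(1) P c in blast)+
    moreover have "pprod L [x, y] \<in> P"
      using x y by (intro subgroup_prod[OF P(1)]) simp
    ultimately show "a \<otimes>\<^bsub>group_on L S\<^esub> b \<in> pconj L g ` P"
      by simp
  qed
  then show ?thesis
    using subgroup_group_on_iff[OF S_subgroup] by blast
qed

lemma obj_conj:
  assumes "P \<in> \<Delta>" "g \<in> carrier L" "P \<subseteq> conj_dom L g" "pconj L g ` P \<subseteq> S"
  shows "pconj L g ` P \<in> \<Delta>"
  using objects_closed[OF assms(1-3) conj_subgroup[OF obj_subgroup[OF assms(1)] obj_S[OF assms(1)] assms(2-4)]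
      assms(4) order_refl] .

subsection \<open>Normalizers of objects\<close>

lemma normalizer_word:
  assumes "P \<in> \<Delta>" "set w \<subseteq> pg_normalizer L P"
  shows "via L \<Delta> P w \<and> conj_word L w ` P = P"
  using assms(2)
proof (induction w)
  case (Cons g w)
  have g: "g \<in> carrier L" "P \<subseteq> conj_dom L g" "pconj L g ` P = P"
    using Cons.prems by (auto simp: pg_normalizer_def)
  have "conj_word L (g # w) ` P = conj_word L w ` pconj L g ` P"
    by (simp add: image_image)
  then show ?case
    using Cons g assms(1) by simp
qed (use assms(1) in simp_all)

lemma normalizer_subgroup:
  assumes "P \<in> \<Delta>"
  shows "pg_subgroup L (pg_normalizer L P)"
proof -
  have w: "via L \<Delta> P w" "conj_word L w ` P = P" if "set w \<subseteq> pg_normalizer L P" for w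
    using normalizer_word[OF assms that] by blast+
  have "pprod L w \<in> pg_normalizer L P" if "set w \<subseteq> pg_normalizer L P" for w
    using via_prod[OF w(1)[OF that]] w(2)[OF that] pprod_closed[OF via_dom[OF w(1)[OF that]]]
    by (simp add: pg_normalizer_def)
  moreover have "w \<in> pdom L" if "set w \<subseteq> pg_normalizer L P" for w
    using via_dom[OF w(1)[OF that]] .
  moreover have "pinv L g \<in> pg_normalizer L P" if "g \<in> pg_normalizer L P" for g
  proof -
    have "via L \<Delta> P [g]" "pconj L g ` P = P"
      using w[of "[g]"] that by simp_all
    then show ?thesis
      using via_back[of P g] by (simp add: pg_normalizer_def)
  qed
  moreover have "pg_normalizer L P \<subseteq> carrier L"
    by (auto simp: pg_normalizer_def)
  ultimately show ?thesis
    using pg_subgroupI by blast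
qed

lemma obj_normalizer:
  assumes "P \<in> \<Delta>"
  shows "P \<subseteq> pg_normalizer L P"
proof
  fix x assume x: "x \<in> P"
  show "x \<in> pg_normalizer L P"
    using subgroup_conj_dom[OF obj_subgroup[OF assms] x] subsetD[OF subgroup_carrier[OF obj_subgroup[OF assms]] x]
    unfolding pg_normalizer_def by blast
qed

lemma obj_p_power:
  assumes "prime p" "P \<in> \<Delta>"
  shows "p_power p P"
proof -
  interpret S: group "group_on L S"
    by (rule group_group_on[OF S_subgroup])
  have "subgroup P (group_on L S)"
    using subgroup_group_on_iff[OF S_subgroup] obj_subgroup obj_S assms by blast
  from S.card_subgroup_dvd[OF this] show ?thesis
    using p_power_dvd[OF assms(1) S_p_power] by simp
qed

lemma obj_subset_O_p:
  assumes "prime p" "R \<in> \<Delta>"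
  shows "R \<subseteq> O_p p (group_on L (pg_normalizer L R))"
proof -
  note N = normalizer_subgroup[OF assms(2)] and RN = obj_normalizer[OF assms(2)]
  interpret N: group "group_on L (pg_normalizer L R)"
    by (rule group_group_on[OF N])
  have "R \<lhd> group_on L (pg_normalizer L R)"
    unfolding N.normal_cj_iff
  proof (intro conjI ballI)
    show "subgroup R (group_on L (pg_normalizer L R))"
      using subgroup_group_on_iff[OF N] obj_subgroup[OF assms(2)] RN by blast
    fix g x assume g: "g \<in> carrier (group_on L (pg_normalizer L R))" and x: "x \<in> R"
    have "pconj L g x \<in> R"
      using g x by (auto simp: pg_normalizer_def)
    then show "cj (group_on L (pg_normalizer L R)) g x \<in> R"
      using cj_group_on[OF N] g x RN by (simp add: subset_iff)
  qed
  then show ?thesis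
    using N.O_p_max obj_p_power[OF assms] by blast
qed

text \<open>Under these inclusions the normalizer of P in the locality is its normalizer inside the
  finite group N(R). Since P lies in R, and R in O_p(N(R)), the finite group result applies.\<close>

lemma characteristic_p_smaller_object:
  assumes "prime p" "P \<in> \<Delta>" "R \<in> \<Delta>" "P \<subseteq> R" "pg_normalizer L P \<subseteq> pg_normalizer L R"
    and ch: "characteristic_p p (group_on L (pg_normalizer L R))"
  shows "characteristic_p p (group_on L (pg_normalizer L P))"
proof -
  let ?N = "pg_normalizer L R"
  note N = normalizer_subgroup[OF assms(3)] and RN = obj_normalizer[OF assms(3)]
  interpret N: group "group_on L ?N"
    by (rule group_group_on[OF N])
  have NL: "?N \<subseteq> carrier L"
    by (rule subgroup_carrier[OF N])
  have P: "subgroup P (group_on L ?N)"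
    using subgroup_group_on_iff[OF N] obj_subgroup[OF assms(2)] assms(4) RN by blast
  have eq: "cj (group_on L ?N) g ` P = pconj L g ` P" if "g \<in> ?N" for g
    using that assms(4) RN by (intro image_cong refl cj_group_on[OF N]) auto
  have sub: "P \<subseteq> conj_dom L g" if "g \<in> ?N" for g
    using that assms(4) by (auto simp: pg_normalizer_def)
  have "{g \<in> ?N. cj (group_on L ?N) g ` P = P} = {g \<in> ?N. pconj L g ` P = P}"
    by (rule Collect_cong) (simp only: eq cong: conj_cong)
  also have "\<dots> = pg_normalizer L P"
    using sub assms(5) NL by (auto simp: pg_normalizer_def[of L P])
  finally have "{g \<in> carrier (group_on L ?N). cj (group_on L ?N) g ` P = P} = pg_normalizer L P"
    by (simp only: carrier_group_on)
  then show ?thesis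
    using N.characteristic_p_normalizer[OF assms(1) ch P] obj_subset_O_p[OF assms(1,3)] assms(4)
    by (simp add: restrict_group_on)
qed

end

section \<open>The fusion system of a locality\<close>

text \<open>Each step conjugates on an object R that contains the image reached so far. The domain P
  is any subgroup of S, so restriction is built into the chains; the codomain is left open until
  \<open>loc_fus\<close>.\<close>

inductive loc_mor ::
    "('a, 'm) partial_group_scheme \<Rightarrow> 'a set set \<Rightarrow> 'a set \<Rightarrow> 'a set \<Rightarrow> ('a \<Rightarrow> 'a) \<Rightarrow> bool"
  for L \<Delta> S where
  loc_id: "pg_subgroup L P \<Longrightarrow> P \<subseteq> S \<Longrightarrow> loc_mor L \<Delta> S P (\<lambda>x\<in>P. x)"
| loc_step: "loc_mor L \<Delta> S P \<phi> \<Longrightarrow> \<phi> ` P \<subseteq> R \<Longrightarrow> R \<in> \<Delta> \<Longrightarrow> g \<in> carrier L \<Longrightarrow>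
    R \<subseteq> conj_dom L g \<Longrightarrow> pconj L g ` R \<subseteq> S \<Longrightarrow> loc_mor L \<Delta> S P (\<lambda>x\<in>P. pconj L g (\<phi> x))"

definition loc_fus ::
    "('a, 'm) partial_group_scheme \<Rightarrow> 'a set set \<Rightarrow> 'a set \<Rightarrow> 'a fusion" where
  "loc_fus L \<Delta> S P Q = {\<phi>. loc_mor L \<Delta> S P \<phi> \<and> pg_subgroup L Q \<and> Q \<subseteq> S \<and> \<phi> ` P \<subseteq> Q}"

lemma fusion_of_least:
  assumes "fusion_system p (group_on L S) F"
    and "\<And>R g. R \<in> \<Delta> \<Longrightarrow> g \<in> carrier L \<Longrightarrow> R \<subseteq> conj_dom L g \<Longrightarrow> pconj L g ` R \<subseteq> S \<Longrightarrow>
      restrict (pconj L g) R \<in> F R (pconj L g ` R)"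
  shows "fusion_of p L \<Delta> S P Q \<subseteq> F P Q"
  unfolding fusion_of_def by (rule Inter_lower) (use assms in blast)

context locality
begin

lemma loc_mor_facts:
  assumes "loc_mor L \<Delta> S P \<phi>"
  shows "pg_subgroup L P \<and> P \<subseteq> S \<and> \<phi> \<in> extensional P \<and> inj_on \<phi> P \<and> \<phi> ` P \<subseteq> S \<and> pg_subgroup L (\<phi> ` P) \<and>
    (\<forall>x\<in>P. \<forall>y\<in>P. \<phi> (pprod L [x, y]) = pprod L [\<phi> x, \<phi> y])"
  using assms
proof induction
  case (loc_id P)
  have "pprod L [x, y] \<in> P" if "x \<in> P" "y \<in> P" for x y
    using subgroup_prod[OF loc_id(1), of "[x, y]"] that by simp
  then have "\<forall>x\<in>P. \<forall>y\<in>P. (\<lambda>x\<in>P. x) (pprod L [x, y]) = pprod L [(\<lambda>x\<in>P. x) x, (\<lambda>x\<in>P. x) y]"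
    by simp
  moreover have "(\<lambda>x\<in>P. x) ` P = P" "inj_on (\<lambda>x\<in>P. x) P" "(\<lambda>x\<in>P. x) \<in> extensional P"
    by (simp, simp add: inj_on_def, rule restrict_extensional)
  ultimately show ?case
    using loc_id by (simp only: simp_thms)
next
  case (loc_step P \<phi> R g)
  then have P: "pg_subgroup L P" "P \<subseteq> S" and \<phi>: "inj_on \<phi> P" "\<phi> ` P \<subseteq> S" "pg_subgroup L (\<phi> ` P)"
    "\<And>x y. x \<in> P \<Longrightarrow> y \<in> P \<Longrightarrow> \<phi> (pprod L [x, y]) = pprod L [\<phi> x, \<phi> y]"
    by blast+
  have c: "\<phi> ` P \<subseteq> conj_dom L g" "pconj L g ` \<phi> ` P \<subseteq> S"
    using loc_step by blast+
  have img: "(\<lambda>x\<in>P. pconj L g (\<phi> x)) ` P = pconj L g ` \<phi> ` P"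
    by (simp add: image_image)
  have "inj_on (pconj L g) (\<phi> ` P)"
    by (rule inj_on_subset[OF conj_inj[OF loc_step(4)] c(1)])
  then have "inj_on (\<lambda>x\<in>P. pconj L g (\<phi> x)) P"
    using \<phi>(1) by (auto simp: inj_on_def)
  moreover have "pg_subgroup L (pconj L g ` \<phi> ` P)"
    by (rule conj_subgroup[OF \<phi>(3,2) loc_step(4) c])
  moreover have "(\<lambda>x\<in>P. pconj L g (\<phi> x)) (pprod L [x, y]) =
      pprod L [(\<lambda>x\<in>P. pconj L g (\<phi> x)) x, (\<lambda>x\<in>P. pconj L g (\<phi> x)) y]"
    if xy: "x \<in> P" "y \<in> P" for x y
  proof -
    have "pprod L [x, y] \<in> P"
      using subgroup_prod[OF P(1), of "[x, y]"] xy by simp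
    moreover have "pconj L g (pprod L [\<phi> x, \<phi> y]) = pprod L [pconj L g (\<phi> x), pconj L g (\<phi> y)]"
      by (rule conj_mult(2)[OF loc_step(4)]) (use xy \<phi>(2) c in blast)+
    ultimately show ?thesis
      using \<phi>(4)[OF xy] xy by simp
  qed
  then have "\<forall>x\<in>P. \<forall>y\<in>P. (\<lambda>x\<in>P. pconj L g (\<phi> x)) (pprod L [x, y]) =
      pprod L [(\<lambda>x\<in>P. pconj L g (\<phi> x)) x, (\<lambda>x\<in>P. pconj L g (\<phi> x)) y]"
    by (intro ballI)
  moreover have "(\<lambda>x\<in>P. pconj L g (\<phi> x)) \<in> extensional P"
    by (rule restrict_extensional)
  ultimately show ?case
    using P c(2) by (simp only: img simp_thms)
qed

lemma loc_mor_conj: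
  assumes "pg_subgroup L P" "P \<subseteq> R" "R \<in> \<Delta>" "g \<in> carrier L" "R \<subseteq> conj_dom L g" "pconj L g ` R \<subseteq> S"
  shows "loc_mor L \<Delta> S P (\<lambda>x\<in>P. pconj L g x)"
proof -
  have P: "loc_mor L \<Delta> S P (\<lambda>x\<in>P. x)"
    using assms obj_S[OF assms(3)] by (intro loc_id) auto
  have "loc_mor L \<Delta> S P (\<lambda>x\<in>P. pconj L g ((\<lambda>x\<in>P. x) x))"
    by (rule loc_step[OF P _ assms(3-6)]) (use assms(2) in simp)
  moreover have "(\<lambda>x\<in>P. pconj L g ((\<lambda>x\<in>P. x) x)) = (\<lambda>x\<in>P. pconj L g x)"
    by (rule restrict_ext) simp
  ultimately show ?thesis by simp
qed

lemma loc_mor_restrict: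
  assumes "loc_mor L \<Delta> S P \<phi>" "pg_subgroup L P'" "P' \<subseteq> P"
  shows "loc_mor L \<Delta> S P' (restrict \<phi> P')"
  using assms
proof induction
  case (loc_id P)
  have eq: "restrict (\<lambda>x\<in>P. x) P' = (\<lambda>x\<in>P'. x)"
    using loc_id by (intro restrict_ext) auto
  show ?case
    unfolding eq by (rule loc_mor.loc_id) (use loc_id in blast)+
next
  case (loc_step P \<phi> R g)
  have "loc_mor L \<Delta> S P' (restrict \<phi> P')"
    using loc_step by blast
  then have "loc_mor L \<Delta> S P' (\<lambda>x\<in>P'. pconj L g (restrict \<phi> P' x))"
  proof (rule loc_mor.loc_step[OF _ _ loc_step(3-6)])
    have "restrict \<phi> P' ` P' = \<phi> ` P'"
      by simp
    then show "restrict \<phi> P' ` P' \<subseteq> R"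
      using loc_step(2,9) by blast
  qed
  moreover have "(\<lambda>x\<in>P'. pconj L g (restrict \<phi> P' x)) = restrict (\<lambda>x\<in>P. pconj L g (\<phi> x)) P'"
    using loc_step(9) by (intro restrict_ext) auto
  ultimately show ?case by (simp only:)
qed

lemma loc_mor_compose:
  assumes "loc_mor L \<Delta> S P' \<psi>" "loc_mor L \<Delta> S P \<phi>" "\<phi> ` P \<subseteq> P'"
  shows "loc_mor L \<Delta> S P (\<lambda>x\<in>P. \<psi> (\<phi> x))"
  using assms
proof induction
  case (loc_id P')
  have "(\<lambda>x\<in>P. (\<lambda>x\<in>P'. x) (\<phi> x)) = restrict \<phi> P"
    using loc_id(4) by (intro restrict_ext) auto
  also have "\<dots> = \<phi>"
    using loc_mor_facts[OF loc_id(3)] by (simp add: extensional_restrict)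
  finally show ?case
    using loc_id by simp
next
  case (loc_step P' \<psi> R g)
  have "loc_mor L \<Delta> S P (\<lambda>x\<in>P. \<psi> (\<phi> x))"
    using loc_step by blast
  then have "loc_mor L \<Delta> S P (\<lambda>x\<in>P. pconj L g ((\<lambda>x\<in>P. \<psi> (\<phi> x)) x))"
    by (rule loc_mor.loc_step[OF _ _ loc_step(3-6)]) (use loc_step(2,9) in auto)
  moreover have "(\<lambda>x\<in>P. pconj L g ((\<lambda>x\<in>P. \<psi> (\<phi> x)) x)) = (\<lambda>x\<in>P. (\<lambda>x\<in>P'. pconj L g (\<psi> x)) (\<phi> x))"
    using loc_step(9) by (intro restrict_ext) auto
  ultimately show ?case by (simp only:)
qed

text \<open>The image of R under g is again an object, and g^-1 conjugates it back to R. Reversing a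
  chain step by step therefore stays within the chains.\<close>

lemma loc_mor_inverse:
  assumes "loc_mor L \<Delta> S P \<phi>"
  shows "\<exists>\<psi>. loc_mor L \<Delta> S (\<phi> ` P) \<psi> \<and> (\<forall>x\<in>P. \<psi> (\<phi> x) = x)"
  using assms
proof induction
  case (loc_id P)
  have "(\<lambda>x\<in>P. x) ` P = P"
    by simp
  then show ?case
    by (simp only:) (intro exI[of _ "\<lambda>x\<in>P. x"] conjI ballI loc_mor.loc_id[OF loc_id], simp)
next
  case (loc_step P \<phi> R g)
  then obtain \<psi> where \<psi>: "loc_mor L \<Delta> S (\<phi> ` P) \<psi>" "\<And>x. x \<in> P \<Longrightarrow> \<psi> (\<phi> x) = x"
    by blast
  let ?\<phi> = "\<lambda>x\<in>P. pconj L g (\<phi> x)"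
  have "loc_mor L \<Delta> S P ?\<phi>"
    by (rule loc_mor.loc_step) (use loc_step in blast)+
  then have s: "pg_subgroup L (?\<phi> ` P)"
    using loc_mor_facts by blast
  have img: "?\<phi> ` P = pconj L g ` \<phi> ` P"
    by (simp add: image_image)
  have R: "pconj L g ` R \<in> \<Delta>"
    by (rule obj_conj[OF loc_step(3-6)])
  have rev: "pconj L (pinv L g) ` pconj L g ` R = R" "pconj L g ` R \<subseteq> conj_dom L (pinv L g)"
    using via_back[of R g] loc_step R by simp_all
  have m: "loc_mor L \<Delta> S (?\<phi> ` P) (\<lambda>y\<in>?\<phi> ` P. pconj L (pinv L g) y)"
  proof (rule loc_mor_conj[OF s _ R pinv_closed[OF loc_step(4)] rev(2)])
    show "?\<phi> ` P \<subseteq> pconj L g ` R"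
      unfolding img by (rule image_mono[OF loc_step(2)])
    show "pconj L (pinv L g) ` pconj L g ` R \<subseteq> S"
      unfolding rev by (rule obj_S[OF loc_step(3)])
  qed
  have bk: "pconj L (pinv L g) (pconj L g (\<phi> x)) = \<phi> x" if "x \<in> P" for x
    by (rule conj_back(2)[OF loc_step(4)]) (use loc_step that in blast)
  have "loc_mor L \<Delta> S (?\<phi> ` P) (\<lambda>y\<in>?\<phi> ` P. \<psi> ((\<lambda>y\<in>?\<phi> ` P. pconj L (pinv L g) y) y))"
    by (rule loc_mor_compose[OF \<psi>(1) m]) (use bk in auto)
  moreover have "(\<lambda>y\<in>?\<phi> ` P. \<psi> ((\<lambda>y\<in>?\<phi> ` P. pconj L (pinv L g) y) y)) (?\<phi> x) = x" if "x \<in> P" for x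
  proof -
    have "?\<phi> x \<in> ?\<phi> ` P"
      using that by (rule imageI)
    then have "(\<lambda>y\<in>?\<phi> ` P. \<psi> ((\<lambda>y\<in>?\<phi> ` P. pconj L (pinv L g) y) y)) (?\<phi> x) = \<psi> (pconj L (pinv L g) (?\<phi> x))"
      by (simp only: restrict_apply')
    then show ?thesis
      using bk[OF that] \<psi>(2)[OF that] that by simp
  qed
  ultimately show ?case by blast
qed

lemma subgroup_S_iff: "subgroup P (group_on L S) \<longleftrightarrow> pg_subgroup L P \<and> P \<subseteq> S"
  by (rule subgroup_group_on_iff[OF S_subgroup])

lemma fusion_system_loc_fus: "fusion_system p (group_on L S) (loc_fus L \<Delta> S)"
proof (intro fusion_system.intro fusion_system_axioms.intro group_group_on[OF S_subgroup])
  show "finite (carrier (group_on L S))"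
    using finite_sub[OF subgroup_carrier[OF S_subgroup]] by simp
  show "p_power p (carrier (group_on L S))"
    using S_p_power by simp
next
  fix \<phi> P Q assume \<phi>: "\<phi> \<in> loc_fus L \<Delta> S P Q"
  then have m: "loc_mor L \<Delta> S P \<phi>" and Q: "pg_subgroup L Q" "Q \<subseteq> S" "\<phi> ` P \<subseteq> Q"
    by (simp_all add: loc_fus_def)
  note f = loc_mor_facts[OF m]
  show "subgroup P (group_on L S) \<and> subgroup Q (group_on L S)"
    using f Q subgroup_S_iff by blast
  show "\<phi> \<in> extensional P \<and> inj_on \<phi> P \<and>
      \<phi> \<in> hom ((group_on L S)\<lparr>carrier := P\<rparr>) ((group_on L S)\<lparr>carrier := Q\<rparr>)"
    unfolding restrict_group_on using f Q(3) by (auto simp: hom_def)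
  obtain \<psi> where \<psi>: "loc_mor L \<Delta> S (\<phi> ` P) \<psi>" "\<And>x. x \<in> P \<Longrightarrow> \<psi> (\<phi> x) = x"
    using loc_mor_inverse[OF m] by blast
  have "\<psi> = restrict (inv_into P \<phi>) (\<phi> ` P)"
  proof (rule extensionalityI[of _ "\<phi> ` P"])
    show "\<psi> \<in> extensional (\<phi> ` P)"
      using loc_mor_facts[OF \<psi>(1)] by blast
    fix y assume "y \<in> \<phi> ` P"
    then obtain x where "x \<in> P" "y = \<phi> x" by blast
    then show "\<psi> y = restrict (inv_into P \<phi>) (\<phi> ` P) y"
      using \<psi>(2) f by simp
  qed simp
  moreover have "\<psi> ` \<phi> ` P = P"
    using \<psi>(2) by force
  ultimately show "\<phi> \<in> loc_fus L \<Delta> S P (\<phi> ` P) \<and> restrict (inv_into P \<phi>) (\<phi> ` P) \<in> loc_fus L \<Delta> S (\<phi> ` P) P"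
    using m \<psi>(1) f by (simp add: loc_fus_def)
  fix \<psi> R assume "\<psi> \<in> loc_fus L \<Delta> S Q R"
  then have n: "loc_mor L \<Delta> S Q \<psi>" and R: "pg_subgroup L R" "R \<subseteq> S" "\<psi> ` Q \<subseteq> R"
    by (simp_all add: loc_fus_def)
  have "loc_mor L \<Delta> S P (\<lambda>x\<in>P. \<psi> (\<phi> x))"
    by (rule loc_mor_compose[OF n m Q(3)])
  moreover have "\<psi> (\<phi> x) \<in> R" if "x \<in> P" for x
    using that R(3) Q(3) by blast
  ultimately show "compose P \<psi> \<phi> \<in> loc_fus L \<Delta> S P R"
    using R(1,2) by (simp add: loc_fus_def compose_def image_subset_iff)
next
  fix P Q g
  assume P: "subgroup P (group_on L S)" and Q: "subgroup Q (group_on L S)" and g: "g \<in> carrier (group_on L S)"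
    and PQ: "cj (group_on L S) g ` P \<subseteq> Q"
  have gS: "g \<in> S" using g by simp
  have P': "pg_subgroup L P" "P \<subseteq> S" and Q': "pg_subgroup L Q" "Q \<subseteq> S"
    using P Q subgroup_S_iff by blast+
  have eq: "cj (group_on L S) g x = pconj L g x" if "x \<in> P" for x
    by (rule cj_group_on[OF S_subgroup gS]) (use that P' in blast)
  have img: "cj (group_on L S) g ` P = pconj L g ` P"
    by (rule image_cong[OF refl eq])
  \<comment> \<open>Conjugation by an element of S is a chain with one step, through the object S
    itself.\<close>
  have "loc_mor L \<Delta> S P (\<lambda>x\<in>P. pconj L g x)"
    by (rule loc_mor_conj[OF P' S_obj S_carrier[OF gS] subgroup_conj_dom(1)[OF S_subgroup gS]])
      (use subgroup_conj_dom(2)[OF S_subgroup gS] in blast)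
  moreover have "(\<lambda>x\<in>P. cj (group_on L S) g x) = (\<lambda>x\<in>P. pconj L g x)"
    by (rule restrict_ext[OF eq])
  ultimately show "(\<lambda>x\<in>P. cj (group_on L S) g x) \<in> loc_fus L \<Delta> S P Q"
    using PQ Q' unfolding img loc_fus_def by (simp add: image_subset_iff)
qed

text \<open>One inclusion is minimality, as the chains form a fusion system containing the
  generators. For the other, every competing system contains each chain, by corestricting the image
  to R and composing with the generator on R.\<close>

lemma fusion_of_eq: "fusion_of p L \<Delta> S = loc_fus L \<Delta> S"
proof (intro ext equalityI)
  fix P Q
  show "fusion_of p L \<Delta> S P Q \<subseteq> loc_fus L \<Delta> S P Q"
  proof (rule fusion_of_least[OF fusion_system_loc_fus])
    fix R g assume R: "R \<in> \<Delta>" "g \<in> carrier L" "R \<subseteq> conj_dom L g" "pconj L g ` R \<subseteq> S"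
    have "loc_mor L \<Delta> S R (\<lambda>x\<in>R. pconj L g x)"
      by (rule loc_mor_conj[OF obj_subgroup[OF R(1)] order_refl R])
    then show "restrict (pconj L g) R \<in> loc_fus L \<Delta> S R (pconj L g ` R)"
      using obj_conj[OF R] obj_subgroup R(4) by (simp add: loc_fus_def)
  qed
  show "loc_fus L \<Delta> S P Q \<subseteq> fusion_of p L \<Delta> S P Q"
    unfolding fusion_of_def
  proof (intro subsetI InterI)
    fix \<phi> X assume \<phi>: "\<phi> \<in> loc_fus L \<Delta> S P Q"
      and "X \<in> {F P Q |F. fusion_system p (group_on L S) F \<and>
        (\<forall>R\<in>\<Delta>. \<forall>g\<in>carrier L. R \<subseteq> conj_dom L g \<and> pconj L g ` R \<subseteq> S \<longrightarrow>
          restrict (pconj L g) R \<in> F R (pconj L g ` R))}"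
    then obtain F where F: "X = F P Q" "fusion_system p (group_on L S) F"
      and F': "\<forall>R\<in>\<Delta>. \<forall>g\<in>carrier L. R \<subseteq> conj_dom L g \<and> pconj L g ` R \<subseteq> S \<longrightarrow>
        restrict (pconj L g) R \<in> F R (pconj L g ` R)"
      unfolding mem_Collect_eq by (elim exE conjE) (rule that)
    interpret F: fusion_system p "group_on L S" F
      by (rule F(2))
    have "\<phi> \<in> F P (\<phi> ` P)" if "loc_mor L \<Delta> S P \<phi>" for P \<phi>
      using that
    proof induction
      case (loc_id P)
      then have "subgroup P (group_on L S)"
        using subgroup_S_iff by blast
      moreover have "(\<lambda>x\<in>P. x) ` P = P"
        by simp
      ultimately show ?case
        using F.mor_incl[of P P] by (simp only: order_refl)
    next
      case (loc_step P \<phi> R g)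
      let ?\<phi> = "\<lambda>x\<in>P. pconj L g (\<phi> x)"
      have c: "restrict (pconj L g) R \<in> F R (pconj L g ` R)"
        using F' loc_step(3-6) by simp
      have "compose P (restrict (pconj L g) R) \<phi> \<in> F P (pconj L g ` R)"
        by (rule F.mor_compose[OF F.mor_codomain[OF loc_step(7) F.mor_dom[OF c] loc_step(2)] c])
      moreover have "compose P (restrict (pconj L g) R) \<phi> = ?\<phi>"
        unfolding compose_def using loc_step(2) by (intro restrict_ext) auto
      ultimately have "?\<phi> \<in> F P (pconj L g ` R)"
        by simp
      then show ?case
        by (rule F.mor_iso[THEN conjunct1])
    qed
    from this[of P \<phi>] show "\<phi> \<in> X"
      unfolding F(1) using \<phi> F.mor_codomain[of \<phi> P "\<phi> ` P" Q] subgroup_S_iff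
      by (simp add: loc_fus_def)
  qed
qed

lemma fusion_system_fusion_of: "fusion_system p (group_on L S) (fusion_of p L \<Delta> S)"
  unfolding fusion_of_eq by (rule fusion_system_loc_fus)

text \<open>With domain S every image along the chain is S, so every object used is S and every g
  normalizes S. The chain can then be multiplied out in the group N(S). The equation
  \<open>P = S\<close> stands apart so that the induction may treat the domain as a
  variable.\<close>

lemma loc_mor_S:
  assumes "loc_mor L \<Delta> S P \<phi>" "P = S"
  shows "\<exists>g\<in>pg_normalizer L S. \<phi> = (\<lambda>x\<in>S. pconj L g x)"
  using assms
proof induction
  case (loc_id P)
  have "pconj L (pone L) x = x" if "x \<in> S" for x
    using conj_one S_carrier[OF that] by blast
  then have "(\<lambda>x\<in>P. x) = (\<lambda>x\<in>S. pconj L (pone L) x)"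
    unfolding loc_id(3) by (intro restrict_ext) simp
  then show ?case
    using subgroup_one[OF normalizer_subgroup[OF S_obj]] by blast
next
  case (loc_step P \<phi> R g)
  then obtain h where h: "h \<in> pg_normalizer L S" "\<phi> = (\<lambda>x\<in>S. pconj L h x)"
    by blast
  have hS: "pconj L h ` S = S"
    using h(1) by (simp add: pg_normalizer_def)
  then have "\<phi> ` P = S"
    using h(2) loc_step(8) by simp
  then have R: "R = S"
    using loc_step(2) obj_S[OF loc_step(3)] by blast
  have "pconj L g ` S = S"
  proof (rule endo_inj_surj)
    show "finite S"
      by (rule finite_sub[OF subgroup_carrier[OF S_subgroup]])
    show "pconj L g ` S \<subseteq> S" "inj_on (pconj L g) S"
      using loc_step R inj_on_subset[OF conj_inj[OF loc_step(4)]] by blast+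
  qed
  then have g: "g \<in> pg_normalizer L S"
    using loc_step R by (simp add: pg_normalizer_def)
  have v: "via L \<Delta> S [h, g]"
    using normalizer_word[OF S_obj, of "[h, g]"] h g by simp
  have "pprod L [h, g] \<in> pg_normalizer L S"
    using subgroup_prod[OF normalizer_subgroup[OF S_obj], of "[h, g]"] h g by simp
  moreover have "(\<lambda>x\<in>P. pconj L g (\<phi> x)) = (\<lambda>x\<in>S. pconj L (pprod L [h, g]) x)"
    unfolding loc_step(8) h(2) using via_conj_word(3)[OF v] by (intro restrict_ext) simp
  ultimately show ?case by blast
qed

text \<open>S is a normal p-subgroup of its normalizer, so it lies in O_p. Conversely O_p is a
  p-subgroup of the locality, and S is maximal among those.\<close>

lemma O_p_normalizer_S:
  assumes p: "prime p"
  shows "O_p p (group_on L (pg_normalizer L S)) = S"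
proof (rule S_maximal[OF _ obj_subset_O_p[OF p S_obj]])
  note N = normalizer_subgroup[OF S_obj]
  interpret N: group "group_on L (pg_normalizer L S)"
    by (rule group_group_on[OF N])
  have finN: "finite (carrier (group_on L (pg_normalizer L S)))"
    using finite_sub[OF subgroup_carrier[OF N]] by simp
  show "pg_p_subgroup p L (O_p p (group_on L (pg_normalizer L S)))"
    using N.O_p_subgroup[OF finN p] N.O_p_p_power[OF finN p] subgroup_group_on_iff[OF N]
    by (simp add: pg_p_subgroup_def)
qed

text \<open>Every automorphism of S in the fusion system is conjugation by an element of N(S), so
  its automizer is a quotient of N(S). The kernel centralizes S = O_p(N(S)) and hence lies in S.
  Therefore O_p of the automizer is the image of S, which consists of the inner
  automorphisms.\<close>

lemma S_centric_radical:
  assumes p: "prime p" and ch: "characteristic_p p (group_on L (pg_normalizer L S))"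
  shows "S \<in> fus_cr p (group_on L S) (fusion_of p L \<Delta> S)"
proof -
  let ?F = "fusion_of p L \<Delta> S" and ?N = "pg_normalizer L S" and ?G = "group_on L S"
  interpret F: fusion_system p ?G ?F
    by (rule fusion_system_fusion_of)
  note N = normalizer_subgroup[OF S_obj] and SN = obj_normalizer[OF S_obj]
  interpret N: group "group_on L ?N"
    by (rule group_group_on[OF N])
  have S: "subgroup S ?G"
    using F.subgroup_self by simp
  interpret A: group "fus_Aut ?F S"
    by (rule F.group_fus_Aut[OF S])
  have finN: "finite (carrier (group_on L ?N))"
    using finite_sub[OF subgroup_carrier[OF N]] by simp
  note O_N = O_p_normalizer_S[OF p]
  have "centralizer ?G Q \<subseteq> Q" if "Q \<in> fus_conjugates ?F S" for Q
  proof -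
    obtain \<phi> where "\<phi> \<in> ?F S Q" "\<phi> ` S = Q"
      using \<open>Q \<in> _\<close> unfolding fus_conjugates_def by blast
    then have "\<phi> ` S \<subseteq> S" "inj_on \<phi> S" "\<phi> ` S = Q"
      using F.mor_inj subgroup.subset[OF F.mor_cod] by auto
    then have "Q = S"
      using endo_inj_surj[of S \<phi>] F.finite_subgroup[OF S] by blast
    then show ?thesis
      by (auto simp: centralizer_def)
  qed
  then have centric: "fus_centric ?G ?F S"
    using S by (simp add: fus_centric_def)
  \<comment> \<open>The inverse again turns the right action into a homomorphism for composition
    from the left.\<close>
  define c where "c = (\<lambda>g. \<lambda>x\<in>S. pconj L (pinv L g) x)"
  have c_mem: "c g \<in> ?F S S" if "g \<in> ?N" for g
  proof -
    have "pinv L g \<in> ?N"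
      by (rule subgroup_pinv[OF N that])
    then have g: "pinv L g \<in> carrier L" "S \<subseteq> conj_dom L (pinv L g)" "pconj L (pinv L g) ` S = S"
      by (simp_all add: pg_normalizer_def)
    have "loc_mor L \<Delta> S S (\<lambda>x\<in>S. pconj L (pinv L g) x)"
      by (rule loc_mor_conj[OF S_subgroup order_refl S_obj g(1,2)]) (simp add: g(3))
    then show ?thesis
      unfolding fusion_of_eq loc_fus_def c_def using S_subgroup g(3) by simp
  qed
  have "group_hom (group_on L ?N) (fus_Aut ?F S) c"
  proof (intro group_hom.intro N.is_group A.is_group group_hom_axioms.intro homI)
    fix g h assume "g \<in> carrier (group_on L ?N)" "h \<in> carrier (group_on L ?N)"
    then have gh: "g \<in> ?N" "h \<in> ?N" "pinv L g \<in> ?N" "pinv L h \<in> ?N"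
      using subgroup_pinv[OF N] by simp_all
    show "c g \<in> carrier (fus_Aut ?F S)"
      using c_mem gh by simp
    have d: "[g, h] \<in> pdom L"
      using gh by (intro subgroup_dom[OF N]) simp
    have v: "via L \<Delta> S [pinv L h, pinv L g]"
      using normalizer_word[OF S_obj, of "[pinv L h, pinv L g]"] gh by simp
    have "c (pprod L [g, h]) = compose S (c g) (c h)"
    proof (rule extensionalityI[of _ S])
      fix x assume x: "x \<in> S"
      have hx: "pconj L (pinv L h) x \<in> S"
        using gh(4) x by (auto simp: pg_normalizer_def)
      have "pconj L (pinv L (pprod L [g, h])) x = pconj L (pinv L g) (pconj L (pinv L h) x)"
        using via_conj_word(3)[OF v x] by (simp add: pinv_prod[OF d])
      then show "c (pprod L [g, h]) x = compose S (c g) (c h) x"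
        using x hx by (simp add: c_def compose_def)
    qed (simp_all add: c_def)
    then show "c (g \<otimes>\<^bsub>group_on L ?N\<^esub> h) = c g \<otimes>\<^bsub>fus_Aut ?F S\<^esub> c h"
      using F.mult_fus_Aut c_mem gh by simp
  qed
  then interpret c: group_hom "group_on L ?N" "fus_Aut ?F S" c .
  have onto: "c ` carrier (group_on L ?N) = carrier (fus_Aut ?F S)"
  proof (intro equalityI subsetI)
    fix \<phi> assume "\<phi> \<in> carrier (fus_Aut ?F S)"
    then have "\<phi> \<in> ?F S S"
      by simp
    then have "loc_mor L \<Delta> S S \<phi>"
      by (simp add: fusion_of_eq loc_fus_def)
    then obtain g where g: "g \<in> ?N" "\<phi> = (\<lambda>x\<in>S. pconj L g x)"
      using loc_mor_S by blast
    then have "\<phi> = c (pinv L g)"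
      using subgroup_carrier[OF N] by (auto simp: c_def pinv_pinv)
    then show "\<phi> \<in> c ` carrier (group_on L ?N)"
      using subgroup_pinv[OF N g(1)] by simp
  qed (use c.hom_closed in blast)
  have ker: "kernel (group_on L ?N) (fus_Aut ?F S) c \<subseteq> S"
  proof
    fix g assume "g \<in> kernel (group_on L ?N) (fus_Aut ?F S) c"
    then have g: "g \<in> ?N" "c g = \<one>\<^bsub>fus_Aut ?F S\<^esub>"
      by (simp_all add: kernel_def)
    then have "c g = (\<lambda>x\<in>S. x)"
      by (simp add: fus_Aut_def BijGroup_def)
    then have "pconj L (pinv L g) x = x" if "x \<in> S" for x
      using that unfolding c_def by (metis restrict_apply')
    moreover have "cj (group_on L ?N) (pinv L g) x = pconj L (pinv L g) x" if "x \<in> S" for x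
      by (rule cj_group_on[OF N subgroup_pinv[OF N g(1)]]) (use that SN in blast)
    ultimately have "pinv L g \<in> centralizer (group_on L ?N) (O_p p (group_on L ?N))"
      unfolding O_N centralizer_def carrier_group_on using subgroup_pinv[OF N g(1)] by simp
    then have "pinv L g \<in> S"
      using ch O_N by (auto simp: characteristic_p_def)
    then have "pinv L (pinv L g) \<in> S"
      by (rule subgroup_pinv[OF S_subgroup])
    then show "g \<in> S"
      using g(1) subgroup_carrier[OF N] by (auto simp: pinv_pinv)
  qed
  have "subgroup S (group_on L ?N)"
    using subgroup_group_on_iff[OF N] S_subgroup SN by blast
  then have "p_power p (kernel (group_on L ?N) (fus_Aut ?F S) c)"
    by (rule N.p_power_subgroup[OF p S_p_power c.subgroup_kernel _ ker])
  from c.O_p_image(1)[OF finN p onto this]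
  have O: "O_p p (fus_Aut ?F S) = c ` S"
    unfolding O_N .
  have "c g \<in> Inn ?G S" if "g \<in> S" for g
  proof -
    have g': "pinv L g \<in> S"
      by (rule subgroup_pinv[OF S_subgroup that])
    have "c g = (\<lambda>x\<in>S. cj ?G (pinv L g) x)"
      unfolding c_def by (rule restrict_ext, rule cj_group_on[OF S_subgroup g', symmetric])
    then show ?thesis
      unfolding Inn_def using g' by blast
  qed
  then have "O_p p (fus_Aut ?F S) \<subseteq> Inn ?G S"
    unfolding O by blast
  moreover have "Inn ?G S \<subseteq> O_p p (fus_Aut ?F S)"
    by (rule F.Inn_subset_O_p[OF p S])
  ultimately have "O_p p (fus_Aut ?F S) = Inn ?G S"
    by blast
  then show ?thesis
    using centric S by (simp add: fus_cr_def fus_radical_def)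
qed

subsection \<open>Central subgroups\<close>

text \<open>A central element fixes every object pointwise, so a chain of objects passes through it
  without change.\<close>

lemma center_via:
  assumes "z \<in> pg_center L"
  shows "via L \<Delta> P (u @ [z] @ v) \<longleftrightarrow> via L \<Delta> P (u @ v)"
proof -
  have "via L \<Delta> Q ([z] @ v) \<longleftrightarrow> via L \<Delta> Q v" for Q
  proof (cases "Q \<in> \<Delta>")
    case True
    then have Q: "Q \<subseteq> carrier L"
      using subgroup_carrier obj_subgroup by blast
    then have "pconj L z ` Q = Q"
      using center_comm(2)[OF assms] by force
    then show ?thesis
      using True Q center_comm(1,6)[OF assms] one_closed by auto
  qed (auto dest: via_obj)
  then show ?thesis
    by (simp only: via_append)
qed

text \<open>Once the letter is known to fit anywhere, it is moved to the front by exchanging it with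
  its left neighbour. This makes it possible to calculate with central letters as in a
  group.\<close>

lemma center_insert:
  assumes "z \<in> pg_center L" "u @ v \<in> pdom L"
  shows "u @ [z] @ v \<in> pdom L" "pprod L (u @ [z] @ v) = pprod L [z, pprod L (u @ v)]"
proof -
  have d: "u @ [z] @ v \<in> pdom L" if "u @ v \<in> pdom L" for u v
    using that dom_iff center_via[OF assms(1)] by blast
  show "u @ [z] @ v \<in> pdom L"
    by (rule d[OF assms(2)])
  show "pprod L (u @ [z] @ v) = pprod L [z, pprod L (u @ v)]"
    using assms(2)
  proof (induction u arbitrary: v rule: rev_induct)
    case Nil
    then show ?case
      using prod_Cons(2)[of z v] d[of "[]" v] by simp
  next
    case (snoc f u)
    have f: "f \<in> carrier L"
      using dom_carrier[OF snoc.prems] by simp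
    have d1: "u @ [f, z] @ v \<in> pdom L"
      using d[of "u @ [f]" v] snoc.prems by simp
    have d2: "u @ [z, f] @ v \<in> pdom L"
      using d[of u "f # v"] snoc.prems by simp
    have "pprod L (u @ [f, z] @ v) = pprod L (u @ [z, f] @ v)"
      using pprod_assoc[OF d1] pprod_assoc[OF d2] center_comm(5)[OF assms(1) f] by simp
    then show ?case
      using snoc.IH[of "f # v"] snoc.prems by simp
  qed
qed

lemma center_conj_mult:
  assumes "z \<in> pg_center L" "x \<in> conj_dom L g"
  shows "pprod L [x, z] \<in> conj_dom L g" "pconj L g (pprod L [x, z]) = pprod L [pconj L g x, z]"
proof -
  have w: "[pinv L g, x] @ [g] \<in> pdom L"
    using assms(2) by (simp add: conj_dom_iff)
  note i = center_insert[OF assms(1) w]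
  have *: "[pinv L g, pprod L [x, z], g] \<in> pdom L"
    "pprod L [pinv L g, x, z, g] = pprod L [pinv L g, pprod L [x, z], g]"
    using pprod_assoc[of "[pinv L g]" "[x, z]" "[g]"] i(1) by simp_all
  show "pprod L [x, z] \<in> conj_dom L g"
    using *(1) by (simp add: conj_dom_iff)
  show "pconj L g (pprod L [x, z]) = pprod L [pconj L g x, z]"
    using i(2) *(2) center_comm(5)[OF assms(1) conj_closed[OF assms(2)]] by (simp add: pconj_def)
qed

lemma center_subset_S:
  assumes p: "prime p" and ch: "characteristic_p p (group_on L (pg_normalizer L S))"
  shows "pg_center L \<subseteq> S"
proof
  note N = normalizer_subgroup[OF S_obj] and SN = obj_normalizer[OF S_obj]
  fix z assume z: "z \<in> pg_center L"
  have c: "x \<in> conj_dom L z" "pconj L z x = x" if "x \<in> S" for x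
    using center_comm(1,2)[OF z S_carrier[OF that]] .
  then have "pconj L z ` S = S"
    by force
  then have zN: "z \<in> pg_normalizer L S"
    using c(1) center_comm(6)[OF z one_closed] unfolding pg_normalizer_def by blast
  have "cj (group_on L (pg_normalizer L S)) z x = x" if "x \<in> S" for x
    using cj_group_on[OF N zN, of x] c(2)[OF that] that SN by (metis subsetD)
  then have "z \<in> centralizer (group_on L (pg_normalizer L S)) (O_p p (group_on L (pg_normalizer L S)))"
    unfolding O_p_normalizer_S[OF p] centralizer_def carrier_group_on using zN by blast
  then show "z \<in> S"
    using ch O_p_normalizer_S[OF p] by (auto simp: characteristic_p_def)
qed

lemma center_fixed:
  assumes "loc_mor L \<Delta> S P \<phi>" "z \<in> pg_center L" "z \<in> P"
  shows "\<phi> z = z"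
  using assms
proof induction
  case (loc_step P \<phi> R g)
  then have "z \<in> conj_dom L g" "\<phi> z = z"
    by (metis image_eqI subsetD)+
  then show ?case
    using loc_step center_conj_dom[of z g] by simp
qed simp

lemma subgroup_central_mult:
  assumes P: "pg_subgroup L P" "P \<subseteq> S" and X: "pg_subgroup L X" "X \<subseteq> S" "X \<subseteq> pg_center L"
  shows "pg_subgroup L (P <#>\<^bsub>group_on L S\<^esub> X)" "P <#>\<^bsub>group_on L S\<^esub> X \<subseteq> S" "P \<subseteq> P <#>\<^bsub>group_on L S\<^esub> X"
proof -
  interpret S: group "group_on L S"
    by (rule group_group_on[OF S_subgroup])
  have s: "subgroup P (group_on L S)" "subgroup X (group_on L S)"
    using P X subgroup_S_iff by blast+
  have "X \<lhd> group_on L S"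
    unfolding S.normal_cj_iff
  proof (intro conjI ballI s(2))
    fix g x assume g: "g \<in> carrier (group_on L S)" and x: "x \<in> X"
    have gS: "g \<in> S" "g \<in> carrier L" "x \<in> S"
      using g x X S_carrier by auto
    have "x \<in> conj_dom L g"
      using subgroup_conj_dom(1)[OF S_subgroup gS(1)] gS(3) by blast
    then have "pconj L g x = x"
      using center_conj_dom[OF _ gS(2)] x X by blast
    then show "cj (group_on L S) g x \<in> X"
      unfolding cj_group_on[OF S_subgroup gS(1,3)] using x by simp
  qed
  then have "subgroup (X <#>\<^bsub>group_on L S\<^esub> P) (group_on L S)"
    "P <#>\<^bsub>group_on L S\<^esub> X = X <#>\<^bsub>group_on L S\<^esub> P"
    using S.mult_norm_subgroup[OF _ s(1)] S.commut_normal[OF s(1)] by blast+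
  then show "pg_subgroup L (P <#>\<^bsub>group_on L S\<^esub> X)" "P <#>\<^bsub>group_on L S\<^esub> X \<subseteq> S"
    using subgroup_S_iff by simp_all
  have "x \<in> P <#>\<^bsub>group_on L S\<^esub> X" if "x \<in> P" for x
  proof -
    have "x = pprod L [x, pone L]"
      using one_words(4) S_carrier P that by (metis subsetD)
    then show ?thesis
      unfolding set_mult_def mult_group_on using that subgroup_one[OF X(1)] by blast
  qed
  then show "P \<subseteq> P <#>\<^bsub>group_on L S\<^esub> X"
    by blast
qed

lemma central_mult_mem:
  "y \<in> P <#>\<^bsub>group_on L S\<^esub> X \<longleftrightarrow> (\<exists>x\<in>P. \<exists>z\<in>X. y = pprod L [x, z])"
  by (auto simp: set_mult_def)

lemma obj_central_mult:
  assumes "P \<in> \<Delta>" and X: "pg_subgroup L X" "X \<subseteq> S" "X \<subseteq> pg_center L"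
  shows "P <#>\<^bsub>group_on L S\<^esub> X \<in> \<Delta>"
  using subgroup_central_mult[OF obj_subgroup[OF assms(1)] obj_S[OF assms(1)] X] obj_overgroup[OF assms(1)]
  by blast

text \<open>The step on R extends to RX, which is again an object, since conjugation by g fixes X
  pointwise. Prescribing the value on every product x z determines the extension on P by z = 1 and
  on X by x = 1.\<close>

lemma central_extension:
  assumes "loc_mor L \<Delta> S P \<phi>" and X: "pg_subgroup L X" "X \<subseteq> S" "X \<subseteq> pg_center L"
  shows "\<exists>\<psi>. loc_mor L \<Delta> S (P <#>\<^bsub>group_on L S\<^esub> X) \<psi> \<and>
    (\<forall>x\<in>P. \<forall>z\<in>X. \<psi> (pprod L [x, z]) = pprod L [\<phi> x, z])"
  using assms(1)
proof induction
  case (loc_id P)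
  note PX = subgroup_central_mult[OF loc_id X]
  have "loc_mor L \<Delta> S (P <#>\<^bsub>group_on L S\<^esub> X) (\<lambda>y\<in>P <#>\<^bsub>group_on L S\<^esub> X. y)"
    by (rule loc_mor.loc_id[OF PX(1,2)])
  moreover have "(\<lambda>y\<in>P <#>\<^bsub>group_on L S\<^esub> X. y) (pprod L [x, z]) = pprod L [(\<lambda>x\<in>P. x) x, z]"
    if "x \<in> P" "z \<in> X" for x z
  proof -
    have "pprod L [x, z] \<in> P <#>\<^bsub>group_on L S\<^esub> X"
      using that central_mult_mem by blast
    then show ?thesis
      using that by simp
  qed
  ultimately show ?case
    by blast
next
  case (loc_step P \<phi> R g)
  then obtain \<psi> where \<psi>: "loc_mor L \<Delta> S (P <#>\<^bsub>group_on L S\<^esub> X) \<psi>"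
    "\<And>x z. x \<in> P \<Longrightarrow> z \<in> X \<Longrightarrow> \<psi> (pprod L [x, z]) = pprod L [\<phi> x, z]"
    by blast
  let ?PX = "P <#>\<^bsub>group_on L S\<^esub> X" and ?RX = "R <#>\<^bsub>group_on L S\<^esub> X"
  have c: "pprod L [r, z] \<in> conj_dom L g" "pconj L g (pprod L [r, z]) = pprod L [pconj L g r, z]"
    if "r \<in> R" "z \<in> X" for r z
    using center_conj_mult[of z r g] that X loc_step(5) by blast+
  have "pprod L [pconj L g r, z] \<in> S" if "r \<in> R" "z \<in> X" for r z
    using subgroup_prod[OF S_subgroup, of "[pconj L g r, z]"] that X loc_step(6) by auto
  then have cS: "pconj L g ` ?RX \<subseteq> S" "?RX \<subseteq> conj_dom L g"
    using c by (auto simp: central_mult_mem)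
  have "pprod L [\<phi> x, z] \<in> ?RX" if "x \<in> P" "z \<in> X" for x z
    using that loc_step(2) central_mult_mem by blast
  then have img: "\<psi> ` ?PX \<subseteq> ?RX"
    using \<psi>(2) by (auto simp: central_mult_mem[of _ P])
  have "loc_mor L \<Delta> S ?PX (\<lambda>y\<in>?PX. pconj L g (\<psi> y))"
    by (rule loc_mor.loc_step[OF \<psi>(1) img obj_central_mult[OF loc_step(3) X] loc_step(4) cS(2,1)])
  moreover have "(\<lambda>y\<in>?PX. pconj L g (\<psi> y)) (pprod L [x, z]) = pprod L [(\<lambda>x\<in>P. pconj L g (\<phi> x)) x, z]"
    if xz: "x \<in> P" "z \<in> X" for x z
  proof -
    have "pprod L [x, z] \<in> ?PX"
      using xz central_mult_mem by blast
    moreover have "\<phi> x \<in> R"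
      using xz loc_step(2) by blast
    ultimately show ?thesis
      using xz \<psi>(2)[OF xz] c(2)[of "\<phi> x" z] by simp
  qed
  ultimately show ?case
    by blast
qed

lemma center_fus_central:
  assumes X: "pg_subgroup L X" "X \<subseteq> S" "X \<subseteq> pg_center L"
  shows "fus_central (group_on L S) (fusion_of p L \<Delta> S) X"
  unfolding fus_central_def
proof (intro conjI allI ballI)
  show "subgroup X (group_on L S)"
    using X subgroup_S_iff by blast
  fix P Q \<phi> assume \<phi>: "\<phi> \<in> fusion_of p L \<Delta> S P Q"
  interpret F: fusion_system p "group_on L S" "fusion_of p L \<Delta> S"
    by (rule fusion_system_fusion_of)
  have m: "loc_mor L \<Delta> S P \<phi>" and Q: "pg_subgroup L Q" "Q \<subseteq> S" "\<phi> ` P \<subseteq> Q"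
    using \<phi> by (simp_all add: fusion_of_eq loc_fus_def)
  obtain \<psi> where \<psi>: "loc_mor L \<Delta> S (P <#>\<^bsub>group_on L S\<^esub> X) \<psi>"
    "\<And>x z. x \<in> P \<Longrightarrow> z \<in> X \<Longrightarrow> \<psi> (pprod L [x, z]) = pprod L [\<phi> x, z]"
    using central_extension[OF m X] by blast
  have P: "pg_subgroup L P" "P \<subseteq> S"
    using loc_mor_facts[OF m] by blast+
  have "pprod L [\<phi> x, z] \<in> Q <#>\<^bsub>group_on L S\<^esub> X" if "x \<in> P" "z \<in> X" for x z
    using that Q(3) central_mult_mem by blast
  then have "\<psi> ` (P <#>\<^bsub>group_on L S\<^esub> X) \<subseteq> Q <#>\<^bsub>group_on L S\<^esub> X"
    using \<psi>(2) by (auto simp: central_mult_mem[of _ P])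
  then have "\<psi> \<in> fusion_of p L \<Delta> S (P <#>\<^bsub>group_on L S\<^esub> X) (Q <#>\<^bsub>group_on L S\<^esub> X)"
    using \<psi>(1) subgroup_central_mult[OF Q(1,2) X] by (simp add: fusion_of_eq loc_fus_def)
  moreover have "\<psi> x = \<phi> x" if x: "x \<in> P" for x
  proof -
    have "x \<in> carrier L" "\<phi> x \<in> carrier L"
      using x P Q S_carrier by blast+
    then show ?thesis
      using \<psi>(2)[OF x subgroup_one[OF X(1)]] one_words(4) by simp
  qed
  moreover have "\<psi> z = z" if z: "z \<in> X" for z
  proof -
    have "z \<in> carrier L"
      using z X S_carrier by blast
    then show ?thesis
      using \<psi>(2)[OF subgroup_one[OF P(1)] z] F.mor_one[OF \<phi>] one_words(2) by simp
  qed
  ultimately show "\<exists>\<psi>\<in>fusion_of p L \<Delta> S (P <#>\<^bsub>group_on L S\<^esub> X) (Q <#>\<^bsub>group_on L S\<^esub> X).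
      (\<forall>x\<in>P. \<psi> x = \<phi> x) \<and> (\<forall>x\<in>X. \<psi> x = x)"
    by blast
qed

end

section \<open>Direct products of localities\<close>

lemma pg_prod_simps [simp]:
  "carrier (pg_prod L1 L2) = carrier L1 \<times> carrier L2"
  "pinv (pg_prod L1 L2) x = (pinv L1 (fst x), pinv L2 (snd x))"
  "u \<in> pdom (pg_prod L1 L2) \<longleftrightarrow> map fst u \<in> pdom L1 \<and> map snd u \<in> pdom L2"
  "pprod (pg_prod L1 L2) u = (pprod L1 (map fst u), pprod L2 (map snd u))"
  "pone (pg_prod L1 L2) = (pone L1, pone L2)"
  by (simp_all add: pg_prod_def pone_def map_prod_def case_prod_beta)

lemma word_inv_prod:
  "map fst (word_inv (pg_prod L1 L2) w) = word_inv L1 (map fst w)"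
  "map snd (word_inv (pg_prod L1 L2) w) = word_inv L2 (map snd w)"
  by (induction w) simp_all

lemma group_on_prod: "group_on (pg_prod L1 L2) (H1 \<times> H2) = group_on L1 H1 \<times>\<times> group_on L2 H2"
  by (auto simp: group_on_def DirProd_def fun_eq_iff)

lemma conj_dom_prod:
  "x \<in> conj_dom (pg_prod L1 L2) g \<longleftrightarrow> fst x \<in> conj_dom L1 (fst g) \<and> snd x \<in> conj_dom L2 (snd g)"
  by (auto simp: conj_dom_def mem_Times_iff)

lemma pconj_prod: "pconj (pg_prod L1 L2) g x = (pconj L1 (fst g) (fst x), pconj L2 (snd g) (snd x))"
  by (simp add: pconj_def)

lemma pconj_prod_images:
  "fst ` pconj (pg_prod L1 L2) g ` P = pconj L1 (fst g) ` fst ` P"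
  "snd ` pconj (pg_prod L1 L2) g ` P = pconj L2 (snd g) ` snd ` P"
  "pconj (pg_prod L1 L2) g ` (P1 \<times> P2) = pconj L1 (fst g) ` P1 \<times> pconj L2 (snd g) ` P2"
proof -
  show "fst ` pconj (pg_prod L1 L2) g ` P = pconj L1 (fst g) ` fst ` P"
    "snd ` pconj (pg_prod L1 L2) g ` P = pconj L2 (snd g) ` snd ` P"
    by (simp_all add: image_image pconj_prod)
  have "pconj (pg_prod L1 L2) g = map_prod (pconj L1 (fst g)) (pconj L2 (snd g))"
    by (simp add: fun_eq_iff pconj_prod)
  then show "pconj (pg_prod L1 L2) g ` (P1 \<times> P2) = pconj L1 (fst g) ` P1 \<times> pconj L2 (snd g) ` P2"
    by (simp add: map_prod_surj_on)
qed

lemma partial_group_prod: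
  assumes "partial_group L1" "partial_group L2"
  shows "partial_group (pg_prod L1 L2)"
proof -
  interpret A: partial_group L1 by fact
  interpret B: partial_group L2 by fact
  show ?thesis
  proof
    show "carrier (pg_prod L1 L2) \<noteq> {}"
      using A.carrier_nonempty B.carrier_nonempty by simp
    show "pdom (pg_prod L1 L2) \<subseteq> lists (carrier (pg_prod L1 L2))"
    proof
      fix w assume "w \<in> pdom (pg_prod L1 L2)"
      then have "fst x \<in> carrier L1 \<and> snd x \<in> carrier L2" if "x \<in> set w" for x
        using A.dom_carrier[of "map fst w"] B.dom_carrier[of "map snd w"] that by auto
      then show "w \<in> lists (carrier (pg_prod L1 L2))"
        by (auto simp: mem_Times_iff)
    qed
  next
    fix u v w assume d: "u @ v @ w \<in> pdom (pg_prod L1 L2)"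
    then have "map fst u @ map fst v @ map fst w \<in> pdom L1" "map snd u @ map snd v @ map snd w \<in> pdom L2"
      by simp_all
    from A.pprod_assoc[OF this(1)] B.pprod_assoc[OF this(2)]
    show "u @ [pprod (pg_prod L1 L2) v] @ w \<in> pdom (pg_prod L1 L2) \<and>
        pprod (pg_prod L1 L2) (u @ v @ w) = pprod (pg_prod L1 L2) (u @ [pprod (pg_prod L1 L2) v] @ w)"
      by simp
  next
    fix w assume "w \<in> pdom (pg_prod L1 L2)"
    then have "map fst w \<in> pdom L1" "map snd w \<in> pdom L2"
      by simp_all
    from A.pprod_inv[OF this(1)] B.pprod_inv[OF this(2)]
    show "word_inv (pg_prod L1 L2) w @ w \<in> pdom (pg_prod L1 L2) \<and>
        pprod (pg_prod L1 L2) (word_inv (pg_prod L1 L2) w @ w) = pone (pg_prod L1 L2)"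
      by (simp add: word_inv_prod)
  next
    fix u v assume "u @ v \<in> pdom (pg_prod L1 L2)"
    then show "u \<in> pdom (pg_prod L1 L2) \<and> v \<in> pdom (pg_prod L1 L2)"
      using A.pdom_append[of "map fst u" "map fst v"] B.pdom_append[of "map snd u" "map snd v"] by simp
  qed (auto simp: A.pinv_closed B.pinv_closed A.pinv_pinv B.pinv_pinv A.pprod_closed B.pprod_closed
      A.pdom_singleton B.pdom_singleton A.pprod_singleton B.pprod_singleton)
qed

locale locality_pair = A: locality p L1 \<Delta>1 S1 + B: locality p L2 \<Delta>2 S2
  for p :: nat and L1 :: "('a, 'm) partial_group_scheme" and \<Delta>1 S1
    and L2 :: "('b, 'n) partial_group_scheme" and \<Delta>2 S2 +
  assumes p: "prime p"
begin

abbreviation "LL \<equiv> pg_prod L1 L2"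
abbreviation "DD \<equiv> objects_prod L1 \<Delta>1 S1 L2 \<Delta>2 S2"
abbreviation "SS \<equiv> S1 \<times> S2"

interpretation LL: partial_group LL
  by (rule partial_group_prod[OF A.partial_group_axioms B.partial_group_axioms])

lemma subgroup_times:
  assumes "pg_subgroup L1 P1" "pg_subgroup L2 P2"
  shows "pg_subgroup LL (P1 \<times> P2)"
proof (rule LL.pg_subgroupI)
  have sub: "set (map fst w) \<subseteq> P1" "set (map snd w) \<subseteq> P2" if "set w \<subseteq> P1 \<times> P2" for w
    using that by auto
  show "P1 \<times> P2 \<subseteq> carrier LL"
    using A.subgroup_carrier[OF assms(1)] B.subgroup_carrier[OF assms(2)] by auto
  show "pinv LL h \<in> P1 \<times> P2" if "h \<in> P1 \<times> P2" for h
    using that A.subgroup_pinv[OF assms(1)] B.subgroup_pinv[OF assms(2)] by (auto simp: mem_Times_iff)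
  show "w \<in> pdom LL" "pprod LL w \<in> P1 \<times> P2" if "set w \<subseteq> P1 \<times> P2" for w
    using A.subgroup_dom[OF assms(1) sub(1)[OF that]] B.subgroup_dom[OF assms(2) sub(2)[OF that]]
      A.subgroup_prod[OF assms(1) sub(1)[OF that]] B.subgroup_prod[OF assms(2) sub(2)[OF that]]
    by simp_all
qed

lemma subgroup_proj:
  assumes "pg_subgroup LL P"
  shows "pg_subgroup L1 (fst ` P)" "pg_subgroup L2 (snd ` P)"
proof -
  note P = LL.subgroup_facts[OF assms]
  \<comment> \<open>A word over a projection of P lifts letter by letter to a word over P, where the
    domain and the product are under control.\<close>
  have lift: "\<exists>u. set u \<subseteq> P \<and> w = map h u" if "set w \<subseteq> h ` P" for w and h :: "'a \<times> 'b \<Rightarrow> 'c"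
  proof -
    have "w \<in> lists (h ` P)"
      using that by auto
    then show ?thesis
      unfolding lists_image by auto
  qed
  show "pg_subgroup L1 (fst ` P)"
  proof (rule A.pg_subgroupI)
    show "fst ` P \<subseteq> carrier L1"
      using P(1) by auto
    show "pinv L1 h \<in> fst ` P" if h: "h \<in> fst ` P" for h
    proof -
      obtain x where x: "x \<in> P" "h = fst x"
        using h by blast
      have "fst (pinv LL x) \<in> fst ` P"
        by (rule imageI[OF P(4)[OF x(1)]])
      then show ?thesis
        by (simp add: x(2))
    qed
    fix w assume "set w \<subseteq> fst ` P"
    then obtain u where u: "set u \<subseteq> P" "w = map fst u"
      using lift by blast
    show "w \<in> pdom L1"
      using P(2)[OF u(1)] by (simp add: u(2))
    have "fst (pprod LL u) \<in> fst ` P"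
      by (rule imageI[OF P(3)[OF u(1)]])
    then show "pprod L1 w \<in> fst ` P"
      by (simp add: u(2))
  qed
  show "pg_subgroup L2 (snd ` P)"
  proof (rule B.pg_subgroupI)
    show "snd ` P \<subseteq> carrier L2"
      using P(1) by auto
    show "pinv L2 h \<in> snd ` P" if h: "h \<in> snd ` P" for h
    proof -
      obtain x where x: "x \<in> P" "h = snd x"
        using h by blast
      have "snd (pinv LL x) \<in> snd ` P"
        by (rule imageI[OF P(4)[OF x(1)]])
      then show ?thesis
        by (simp add: x(2))
    qed
    fix w assume "set w \<subseteq> snd ` P"
    then obtain u where u: "set u \<subseteq> P" "w = map snd u"
      using lift by blast
    show "w \<in> pdom L2"
      using P(2)[OF u(1)] by (simp add: u(2))
    have "snd (pprod LL u) \<in> snd ` P"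
      by (rule imageI[OF P(3)[OF u(1)]])
    then show "pprod L2 w \<in> snd ` P"
      by (simp add: u(2))
  qed
qed

lemma obj_times:
  assumes "P1 \<in> \<Delta>1" "P2 \<in> \<Delta>2"
  shows "P1 \<times> P2 \<in> DD"
  unfolding objects_prod_def
  using assms subgroup_times[OF A.obj_subgroup[OF assms(1)] B.obj_subgroup[OF assms(2)]]
    A.obj_S[OF assms(1)] B.obj_S[OF assms(2)] by blast

lemma obj_proj:
  assumes "P \<in> DD"
  shows "fst ` P \<in> \<Delta>1" "snd ` P \<in> \<Delta>2"
proof -
  obtain P1 P2 where P: "pg_subgroup LL P" "P \<subseteq> SS" "P1 \<in> \<Delta>1" "P2 \<in> \<Delta>2" "P1 \<times> P2 \<subseteq> P"
    using assms unfolding objects_prod_def by blast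
  have ne: "P1 \<noteq> {}" "P2 \<noteq> {}"
    using A.subgroup_one[OF A.obj_subgroup[OF P(3)]] B.subgroup_one[OF B.obj_subgroup[OF P(4)]] by blast+
  have "fst ` (P1 \<times> P2) \<subseteq> fst ` P" "snd ` (P1 \<times> P2) \<subseteq> snd ` P"
    by (rule image_mono[OF P(5)])+
  then have "P1 \<subseteq> fst ` P" "P2 \<subseteq> snd ` P"
    using ne by (simp_all only: fst_image_times snd_image_times if_False)
  moreover have S: "fst ` P \<subseteq> S1" "snd ` P \<subseteq> S2"
    using P(2) by auto
  ultimately show "fst ` P \<in> \<Delta>1"
    by (intro A.obj_overgroup[OF P(3) subgroup_proj(1)[OF P(1)]])
  show "snd ` P \<in> \<Delta>2"
    by (rule B.obj_overgroup[OF P(4) subgroup_proj(2)[OF P(1)] \<open>P2 \<subseteq> snd ` P\<close> S(2)])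
qed

lemma obj_proj_times: "P \<in> DD \<Longrightarrow> fst ` P \<times> snd ` P \<in> DD"
  by (intro obj_times obj_proj)

lemma subset_proj: "P \<subseteq> fst ` P \<times> snd ` P"
  by force

lemma conj_dom_subset:
  "P \<subseteq> conj_dom LL g \<longleftrightarrow> fst ` P \<subseteq> conj_dom L1 (fst g) \<and> snd ` P \<subseteq> conj_dom L2 (snd g)"
  by (auto simp: conj_dom_prod subset_iff)

lemma via_proj:
  assumes "via LL DD P w"
  shows "via L1 \<Delta>1 (fst ` P) (map fst w) \<and> via L2 \<Delta>2 (snd ` P) (map snd w)"
  using assms
proof (induction w arbitrary: P)
  case (Cons g w)
  then have "P \<in> DD" "g \<in> carrier LL" "P \<subseteq> conj_dom LL g"
    and IH: "via L1 \<Delta>1 (fst ` pconj LL g ` P) (map fst w)" "via L2 \<Delta>2 (snd ` pconj LL g ` P) (map snd w)"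
    by simp_all
  then show ?case
    using obj_proj IH unfolding conj_dom_subset pconj_prod_images by auto
qed (simp add: obj_proj)

lemma via_times:
  assumes "via L1 \<Delta>1 P1 (map fst w)" "via L2 \<Delta>2 P2 (map snd w)"
  shows "via LL DD (P1 \<times> P2) w"
  using assms
proof (induction w arbitrary: P1 P2)
  case (Cons g w)
  then have "via LL DD (pconj LL g ` (P1 \<times> P2)) w"
    unfolding pconj_prod_images by simp
  moreover have "P1 \<times> P2 \<subseteq> conj_dom LL g"
    using Cons.prems by (auto simp: conj_dom_prod)
  ultimately show ?case
    using Cons.prems obj_times[of P1 P2] by (simp add: mem_Times_iff)
qed (simp add: obj_times)

lemma S_times: "pg_p_subgroup p LL SS"
proof -
  have "p_power p SS"
    using A.S_p_power B.S_p_power unfolding p_power_def card_cartesian_product by (metis power_add)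
  then show ?thesis
    using subgroup_times[OF A.S_subgroup B.S_subgroup] by (simp add: pg_p_subgroup_def)
qed

lemma p_power_proj:
  assumes "pg_subgroup LL R" "p_power p R"
  shows "p_power p (fst ` R)" "p_power p (snd ` R)"
proof -
  note R = LL.group_group_on[OF assms(1)] and R1 = A.group_group_on[OF subgroup_proj(1)[OF assms(1)]]
    and R2 = B.group_group_on[OF subgroup_proj(2)[OF assms(1)]]
  have fin: "finite (carrier (group_on LL R))"
    using LL.subgroup_carrier[OF assms(1)] A.finite_carrier B.finite_carrier
    by (simp add: finite_subset[OF _ finite_cartesian_product])
  interpret f: group_hom "group_on LL R" "group_on L1 (fst ` R)" fst
    using R R1 by (auto simp: group_hom_def group_hom_axioms_def hom_def)
  interpret s: group_hom "group_on LL R" "group_on L2 (snd ` R)" snd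
    using R R2 by (auto simp: group_hom_def group_hom_axioms_def hom_def)
  have s: "subgroup R (group_on LL R)"
    using f.G.subgroup_self by simp
  show "p_power p (fst ` R)" "p_power p (snd ` R)"
    using f.p_power_image[OF fin s p assms(2)] s.p_power_image[OF fin s p assms(2)] .
qed

lemma locality_prod: "locality p LL DD SS"
proof (intro locality.intro LL.partial_group_axioms locality_axioms.intro S_times)
  show "finite (carrier LL)"
    using A.finite_carrier B.finite_carrier by simp
  show "DD \<noteq> {}"
    using obj_times[OF A.S_obj B.S_obj] by blast
  show "pg_subgroup LL P \<and> P \<subseteq> SS" if "P \<in> DD" for P
    using that by (simp add: objects_prod_def)
  show "pdom LL = dom_of LL DD"
  proof (intro equalityI subsetI)
    fix w assume "w \<in> pdom LL"
    then obtain P1 P2 where "via L1 \<Delta>1 P1 (map fst w)" "via L2 \<Delta>2 P2 (map snd w)"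
      using A.dom_iff B.dom_iff by auto
    then show "w \<in> dom_of LL DD"
      unfolding dom_of_iff using via_times by blast
  next
    fix w assume "w \<in> dom_of LL DD"
    then obtain P where "via LL DD P w"
      unfolding dom_of_iff by blast
    then show "w \<in> pdom LL"
      using via_proj[of P w] A.via_dom[of "fst ` P"] B.via_dom[of "snd ` P"] by simp
  qed
next
  \<comment> \<open>The projections of R are p-subgroups containing S1 and S2, so they equal them by
    maximality. Then R is squeezed between the rectangle and itself.\<close>
  fix R assume R: "pg_p_subgroup p LL R" "SS \<subseteq> R"
  have R': "pg_subgroup LL R" "p_power p R"
    using R by (simp_all add: pg_p_subgroup_def)
  have one: "pone L1 \<in> S1" "pone L2 \<in> S2"
    using A.subgroup_one[OF A.S_subgroup] B.subgroup_one[OF B.S_subgroup] .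
  have "S1 \<subseteq> fst ` R" "S2 \<subseteq> snd ` R"
    using R(2) one by force+
  then have "fst ` R = S1" "snd ` R = S2"
    using A.S_maximal B.S_maximal subgroup_proj[OF R'(1)] p_power_proj[OF R'] by (simp_all add: pg_p_subgroup_def)
  then show "R = SS"
    using R(2) subset_proj[of R] by blast
next
  fix P g Q
  assume P: "P \<in> DD" and g: "g \<in> carrier LL" and c: "P \<subseteq> conj_dom LL g" and Q: "pg_subgroup LL Q" "Q \<subseteq> SS"
    and PQ: "pconj LL g ` P \<subseteq> Q"
  obtain P1 P2 where P12: "P1 \<in> \<Delta>1" "P2 \<in> \<Delta>2" "P1 \<times> P2 \<subseteq> P"
    using P unfolding objects_prod_def by blast
  have ne: "P1 \<noteq> {}" "P2 \<noteq> {}"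
    using A.subgroup_one[OF A.obj_subgroup[OF P12(1)]] B.subgroup_one[OF B.obj_subgroup[OF P12(2)]] by blast+
  have g': "fst g \<in> carrier L1" "snd g \<in> carrier L2"
    using g by auto
  have c': "P1 \<subseteq> conj_dom L1 (fst g)" "P2 \<subseteq> conj_dom L2 (snd g)"
    using c P12(3) ne unfolding subset_iff conj_dom_prod by (auto simp: mem_Times_iff)
  \<comment> \<open>The conjugate of the rectangle inside P is a rectangle inside Q. Its sides lie
    in S1 and S2, so they are objects, and Q contains a product of objects.\<close>
  have PQ': "pconj L1 (fst g) ` P1 \<times> pconj L2 (snd g) ` P2 \<subseteq> Q"
    unfolding pconj_prod_images(3)[symmetric] using PQ P12(3) by blast
  then have "pconj L1 (fst g) ` P1 \<subseteq> S1" "pconj L2 (snd g) ` P2 \<subseteq> S2"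
    using Q(2) ne by blast+
  then have "pconj L1 (fst g) ` P1 \<in> \<Delta>1" "pconj L2 (snd g) ` P2 \<in> \<Delta>2"
    using A.obj_conj[OF P12(1) g'(1) c'(1)] B.obj_conj[OF P12(2) g'(2) c'(2)] by blast+
  then show "Q \<in> DD"
    unfolding objects_prod_def using Q PQ' by blast
qed

interpretation C: locality p LL DD SS
  by (rule locality_prod)

subsection \<open>Objective characteristic \<open>p\<close>\<close>

lemma normalizer_times:
  assumes "P1 \<in> \<Delta>1" "P2 \<in> \<Delta>2"
  shows "pg_normalizer LL (P1 \<times> P2) = pg_normalizer L1 P1 \<times> pg_normalizer L2 P2"
proof -
  have ne: "P1 \<noteq> {}" "P2 \<noteq> {}"
    using A.subgroup_one[OF A.obj_subgroup[OF assms(1)]] B.subgroup_one[OF B.obj_subgroup[OF assms(2)]] by blast+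
  show ?thesis
    unfolding pg_normalizer_def pconj_prod_images conj_dom_subset
    using ne by (auto simp: times_eq_iff fst_image_times snd_image_times)
qed

lemma normalizer_proj:
  assumes "P \<in> DD"
  shows "pg_normalizer LL P \<subseteq> pg_normalizer LL (fst ` P \<times> snd ` P)"
proof
  fix g assume "g \<in> pg_normalizer LL P"
  then have g: "g \<in> carrier LL" "P \<subseteq> conj_dom LL g" "pconj LL g ` P = P"
    by (simp_all add: pg_normalizer_def)
  have "fst ` P = pconj L1 (fst g) ` fst ` P" "snd ` P = pconj L2 (snd g) ` snd ` P"
    using pconj_prod_images(1,2)[of L1 L2 g P] unfolding g(3) .
  then show "g \<in> pg_normalizer LL (fst ` P \<times> snd ` P)"
    unfolding normalizer_times[OF obj_proj[OF assms]] using g conj_dom_subset[of P g]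
    by (simp add: pg_normalizer_def mem_Times_iff)
qed

lemma characteristic_p_normalizer_times:
  assumes "P1 \<in> \<Delta>1" "P2 \<in> \<Delta>2"
  shows "characteristic_p p (group_on LL (pg_normalizer LL (P1 \<times> P2))) \<longleftrightarrow>
    characteristic_p p (group_on L1 (pg_normalizer L1 P1)) \<and>
    characteristic_p p (group_on L2 (pg_normalizer L2 P2))"
  unfolding normalizer_times[OF assms] group_on_prod
  by (rule characteristic_p_DirProd[OF A.group_group_on[OF A.normalizer_subgroup[OF assms(1)]]
        B.group_group_on[OF B.normalizer_subgroup[OF assms(2)]] _ _ p])
    (simp_all add: A.finite_sub B.finite_sub A.subgroup_carrier[OF A.normalizer_subgroup[OF assms(1)]]
      B.subgroup_carrier[OF B.normalizer_subgroup[OF assms(2)]])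

lemma objective_characteristic_p_prod:
  "objective_characteristic_p p LL DD SS \<longleftrightarrow>
    objective_characteristic_p p L1 \<Delta>1 S1 \<and> objective_characteristic_p p L2 \<Delta>2 S2"
proof -
  have "(\<forall>P\<in>DD. characteristic_p p (group_on LL (pg_normalizer LL P))) \<longleftrightarrow>
    (\<forall>P\<in>\<Delta>1. characteristic_p p (group_on L1 (pg_normalizer L1 P))) \<and>
    (\<forall>P\<in>\<Delta>2. characteristic_p p (group_on L2 (pg_normalizer L2 P)))" (is "?l \<longleftrightarrow> ?r")
  proof
    assume ?l
    then show ?r
      using characteristic_p_normalizer_times obj_times A.S_obj B.S_obj by blast
  next
    assume r: ?r
    show ?l
    proof
      fix P assume P: "P \<in> DD"
      note P' = obj_proj[OF P]
      show "characteristic_p p (group_on LL (pg_normalizer LL P))"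
        by (rule C.characteristic_p_smaller_object[OF p P obj_proj_times[OF P] subset_proj normalizer_proj[OF P]])
          (use r P' characteristic_p_normalizer_times[OF P'] in blast)
    qed
  qed
  then show ?thesis
    using A.locality_axioms B.locality_axioms locality_prod by (simp add: objective_characteristic_p_def)
qed

subsection \<open>Fusion\<close>

abbreviation "G1 \<equiv> group_on L1 S1"
abbreviation "G2 \<equiv> group_on L2 S2"
abbreviation "F1 \<equiv> fusion_of p L1 \<Delta>1 S1"
abbreviation "F2 \<equiv> fusion_of p L2 \<Delta>2 S2"

interpretation FF: fusion_product p G1 F1 G2 F2
  by (intro fusion_product.intro A.fusion_system_fusion_of B.fusion_system_fusion_of)

lemma S_group_prod: "group_on LL SS = G1 \<times>\<times> G2"
  by (rule group_on_prod)

text \<open>A product of two chains is formed one factor at a time: first the chain in the first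
  factor runs through objects R x S2 with elements (g, 1), and \<open>loc_mor_prod\<close> then runs
  the second. The two chains may have different lengths.\<close>

lemma loc_mor_left:
  assumes "loc_mor L1 \<Delta>1 S1 P1 \<phi>1" "pg_subgroup L2 P2" "P2 \<subseteq> S2"
  shows "loc_mor LL DD SS (P1 \<times> P2) (\<lambda>x\<in>P1 \<times> P2. (\<phi>1 (fst x), snd x))"
  using assms
proof induction
  case (loc_id P1)
  have "(\<lambda>x\<in>P1 \<times> P2. ((\<lambda>x\<in>P1. x) (fst x), snd x)) = (\<lambda>x\<in>P1 \<times> P2. x)"
    by (rule restrict_ext) auto
  moreover have "loc_mor LL DD SS (P1 \<times> P2) (\<lambda>x\<in>P1 \<times> P2. x)"
    by (rule loc_mor.loc_id[OF subgroup_times[OF loc_id(1,3)]]) (use loc_id in blast)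
  ultimately show ?case
    by (simp only:)
next
  case (loc_step P1 \<phi>1 R g)
  let ?\<phi> = "\<lambda>x\<in>P1 \<times> P2. (\<phi>1 (fst x), snd x)" and ?g = "(g, pone L2)"
  have one: "x \<in> conj_dom L2 (pone L2)" "pconj L2 (pone L2) x = x" if "x \<in> S2" for x
    using B.conj_one B.S_carrier[OF that] by blast+
  have m: "loc_mor LL DD SS (P1 \<times> P2) ?\<phi>"
    using loc_step by blast
  have "loc_mor LL DD SS (P1 \<times> P2) (\<lambda>x\<in>P1 \<times> P2. pconj LL ?g (?\<phi> x))"
  proof (rule loc_mor.loc_step[OF m _ obj_times[OF loc_step(3) B.S_obj]])
    have "?\<phi> x \<in> R \<times> S2" if x: "x \<in> P1 \<times> P2" for x
      using x loc_step(2,9) by (auto simp: mem_Times_iff)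
    then show "?\<phi> ` (P1 \<times> P2) \<subseteq> R \<times> S2"
      by (rule image_subsetI)
    show "?g \<in> carrier LL"
      using loc_step(4) B.one_closed by simp
    show "R \<times> S2 \<subseteq> conj_dom LL ?g"
      using loc_step(5) one by (auto simp: conj_dom_prod)
    show "pconj LL ?g ` (R \<times> S2) \<subseteq> SS"
      unfolding pconj_prod_images using loc_step(6) one by (auto simp: image_subset_iff)
  qed
  moreover have "(\<lambda>x\<in>P1 \<times> P2. pconj LL ?g (?\<phi> x)) =
      (\<lambda>x\<in>P1 \<times> P2. ((\<lambda>x\<in>P1. pconj L1 g (\<phi>1 x)) (fst x), snd x))"
    using loc_step(9) one by (intro restrict_ext) (auto simp: pconj_prod)
  ultimately show ?case
    by (simp only:)
qed

lemma loc_mor_prod: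
  assumes "loc_mor L2 \<Delta>2 S2 P2 \<phi>2" "loc_mor L1 \<Delta>1 S1 P1 \<phi>1"
  shows "loc_mor LL DD SS (P1 \<times> P2) (\<lambda>x\<in>P1 \<times> P2. (\<phi>1 (fst x), \<phi>2 (snd x)))"
  using assms
proof induction
  case (loc_id P2)
  have "(\<lambda>x\<in>P1 \<times> P2. (\<phi>1 (fst x), (\<lambda>x\<in>P2. x) (snd x))) = (\<lambda>x\<in>P1 \<times> P2. (\<phi>1 (fst x), snd x))"
    by (rule restrict_ext) auto
  moreover note loc_mor_left[OF loc_id(3,1,2)]
  ultimately show ?case
    by (simp only:)
next
  case (loc_step P2 \<phi>2 R g)
  let ?\<phi> = "\<lambda>x\<in>P1 \<times> P2. (\<phi>1 (fst x), \<phi>2 (snd x))" and ?g = "(pone L1, g)"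
  have one: "x \<in> conj_dom L1 (pone L1)" "pconj L1 (pone L1) x = x" if "x \<in> S1" for x
    using A.conj_one A.S_carrier[OF that] by blast+
  have \<phi>1: "\<phi>1 x \<in> S1" if "x \<in> P1" for x
    using A.loc_mor_facts[OF loc_step(8)] that by blast
  have m: "loc_mor LL DD SS (P1 \<times> P2) ?\<phi>"
    using loc_step by blast
  have "loc_mor LL DD SS (P1 \<times> P2) (\<lambda>x\<in>P1 \<times> P2. pconj LL ?g (?\<phi> x))"
  proof (rule loc_mor.loc_step[OF m _ obj_times[OF A.S_obj loc_step(3)]])
    have "?\<phi> x \<in> S1 \<times> R" if x: "x \<in> P1 \<times> P2" for x
      using x loc_step(2) \<phi>1 by (auto simp: mem_Times_iff)
    then show "?\<phi> ` (P1 \<times> P2) \<subseteq> S1 \<times> R"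
      by (rule image_subsetI)
    show "?g \<in> carrier LL"
      using loc_step(4) A.one_closed by simp
    show "S1 \<times> R \<subseteq> conj_dom LL ?g"
      using loc_step(5) one by (auto simp: conj_dom_prod)
    show "pconj LL ?g ` (S1 \<times> R) \<subseteq> SS"
      unfolding pconj_prod_images using loc_step(6) one by (auto simp: image_subset_iff)
  qed
  moreover have "(\<lambda>x\<in>P1 \<times> P2. pconj LL ?g (?\<phi> x)) =
      (\<lambda>x\<in>P1 \<times> P2. (\<phi>1 (fst x), (\<lambda>x\<in>P2. pconj L2 g (\<phi>2 x)) (snd x)))"
    using \<phi>1 one by (intro restrict_ext) (auto simp: pconj_prod)
  ultimately show ?case
    by (simp only:)
qed

text \<open>A generator on an object R is the restriction of the product of two conjugations on the
  projections of R, which are objects of the factors. Conversely a product morphism is a product of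
  chains on a rectangle, restricted to P.\<close>

lemma fusion_of_prod: "fusion_of p LL DD SS = fus_prod G1 F1 G2 F2"
proof (intro ext equalityI)
  fix P Q
  show "fusion_of p LL DD SS P Q \<subseteq> fus_prod G1 F1 G2 F2 P Q"
  proof (rule fusion_of_least)
    show "fusion_system p (group_on LL SS) (fus_prod G1 F1 G2 F2)"
      unfolding S_group_prod by (rule FF.fusion_system_prod)
    fix R g assume R: "R \<in> DD" "g \<in> carrier LL" "R \<subseteq> conj_dom LL g" "pconj LL g ` R \<subseteq> SS"
    let ?R1 = "fst ` R" and ?R2 = "snd ` R"
    have g: "fst g \<in> carrier L1" "snd g \<in> carrier L2"
      using R(2) by auto
    have c: "?R1 \<subseteq> conj_dom L1 (fst g)" "?R2 \<subseteq> conj_dom L2 (snd g)"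
      using R(3) unfolding conj_dom_subset by blast+
    have "fst ` pconj LL g ` R \<subseteq> S1" "snd ` pconj LL g ` R \<subseteq> S2"
      using R(4) by auto
    then have i: "pconj L1 (fst g) ` ?R1 \<subseteq> S1" "pconj L2 (snd g) ` ?R2 \<subseteq> S2"
      unfolding pconj_prod_images .
    note R12 = obj_proj[OF R(1)]
    have "loc_mor L1 \<Delta>1 S1 ?R1 (\<lambda>x\<in>?R1. pconj L1 (fst g) x)"
      by (rule A.loc_mor_conj[OF A.obj_subgroup[OF R12(1)] order_refl R12(1) g(1) c(1) i(1)])
    then have m1: "restrict (pconj L1 (fst g)) ?R1 \<in> F1 ?R1 S1"
      unfolding A.fusion_of_eq loc_fus_def using A.S_subgroup i(1) by simp
    have "loc_mor L2 \<Delta>2 S2 ?R2 (\<lambda>x\<in>?R2. pconj L2 (snd g) x)"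
      by (rule B.loc_mor_conj[OF B.obj_subgroup[OF R12(2)] order_refl R12(2) g(2) c(2) i(2)])
    then have m2: "restrict (pconj L2 (snd g)) ?R2 \<in> F2 ?R2 S2"
      unfolding B.fusion_of_eq loc_fus_def using B.S_subgroup i(2) by simp
    have val: "map_prod (restrict (pconj L1 (fst g)) ?R1) (restrict (pconj L2 (snd g)) ?R2) x = pconj LL g x"
      if "x \<in> R" for x
      using that imageI[OF that, of fst] imageI[OF that, of snd]
      by (simp add: pconj_prod map_prod_def case_prod_beta)
    have "restrict (map_prod (restrict (pconj L1 (fst g)) ?R1) (restrict (pconj L2 (snd g)) ?R2)) R
        \<in> fus_prod G1 F1 G2 F2 R (pconj LL g ` R)"
    proof (rule FF.prod_morI[OF m1 m2 _ _ subset_proj])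
      show "subgroup R (G1 \<times>\<times> G2)"
        unfolding S_group_prod[symmetric] C.subgroup_S_iff using C.obj_subgroup[OF R(1)] C.obj_S[OF R(1)] by blast
      show "subgroup (pconj LL g ` R) (G1 \<times>\<times> G2)"
        unfolding S_group_prod[symmetric] C.subgroup_S_iff using C.obj_subgroup[OF C.obj_conj[OF R]] R(4) by blast
      show "map_prod (restrict (pconj L1 (fst g)) ?R1) (restrict (pconj L2 (snd g)) ?R2) ` R \<subseteq> pconj LL g ` R"
        using val by (intro image_subsetI) (simp only: imageI)
    qed
    moreover have "restrict (map_prod (restrict (pconj L1 (fst g)) ?R1) (restrict (pconj L2 (snd g)) ?R2)) R
        = restrict (pconj LL g) R"
      by (rule restrict_ext[OF val])
    ultimately show "restrict (pconj LL g) R \<in> fus_prod G1 F1 G2 F2 R (pconj LL g ` R)"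
      by (simp only:)
  qed
  show "fus_prod G1 F1 G2 F2 P Q \<subseteq> fusion_of p LL DD SS P Q"
  proof
    fix \<phi> assume \<phi>: "\<phi> \<in> fus_prod G1 F1 G2 F2 P Q"
    obtain \<phi>1 \<phi>2 where *: "\<phi>1 \<in> F1 (fst ` P) (fst ` Q)" "\<phi>2 \<in> F2 (snd ` P) (snd ` Q)"
      "\<phi> = restrict (map_prod \<phi>1 \<phi>2) P" "subgroup P (G1 \<times>\<times> G2)" "subgroup Q (G1 \<times>\<times> G2)" "\<phi> ` P \<subseteq> Q"
      using FF.prod_mor[OF \<phi>] .
    have m: "loc_mor L1 \<Delta>1 S1 (fst ` P) \<phi>1" "loc_mor L2 \<Delta>2 S2 (snd ` P) \<phi>2"
      using *(1,2) by (simp_all add: A.fusion_of_eq B.fusion_of_eq loc_fus_def)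
    have P: "pg_subgroup LL P" and Q: "pg_subgroup LL Q" "Q \<subseteq> SS"
      using *(4,5) unfolding S_group_prod[symmetric] C.subgroup_S_iff by blast+
    let ?\<psi> = "\<lambda>x\<in>fst ` P \<times> snd ` P. (\<phi>1 (fst x), \<phi>2 (snd x))"
    have "restrict ?\<psi> P = \<phi>"
      unfolding *(3)
    proof (rule restrict_ext)
      fix x assume x: "x \<in> P"
      show "?\<psi> x = map_prod \<phi>1 \<phi>2 x"
        using subsetD[OF subset_proj x] by (simp add: map_prod_def case_prod_beta)
    qed
    moreover have "loc_mor LL DD SS P (restrict ?\<psi> P)"
      by (rule C.loc_mor_restrict[OF loc_mor_prod[OF m(2,1)] P subset_proj])
    ultimately have "loc_mor LL DD SS P \<phi>"
      by (simp only:)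
    then show "\<phi> \<in> fusion_of p LL DD SS P Q"
      unfolding C.fusion_of_eq loc_fus_def using Q *(6) by simp
  qed
qed

end

section \<open>Quotients by central subgroups\<close>

locale central_quotient = locality p L \<Delta> S
  for p :: nat and L :: "('a, 'm) partial_group_scheme" and \<Delta> S +
  fixes Z :: "'a set"
  assumes p: "prime p" and Z_sub: "pg_subgroup L Z" and Z_center: "Z \<subseteq> pg_center L" and Z_S: "Z \<subseteq> S"
begin

abbreviation "\<beta> \<equiv> pg_proj L Z"
abbreviation "QQ \<equiv> pg_quot L Z"
abbreviation "\<Delta>Q \<equiv> (`) \<beta> ` \<Delta>"
abbreviation "SQ \<equiv> \<beta> ` S"

section \<open>The coset map of a central subgroup\<close>

lemma Z_cen: "z \<in> Z \<Longrightarrow> z \<in> pg_center L" and Z_carrier: "z \<in> Z \<Longrightarrow> z \<in> carrier L"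
  using Z_center Z_S S_carrier by blast+

lemma Z_comm:
  assumes "z \<in> Z" "x \<in> carrier L"
  shows "[z, x] \<in> pdom L" "pprod L [z, x] = pprod L [x, z]" "pprod L [z, x] \<in> carrier L"
  using center_comm(3,5)[OF Z_cen[OF assms(1)] assms(2)] pprod_closed by blast+

lemma Z_mult:
  assumes "z \<in> Z" "w \<in> Z" "x \<in> carrier L"
  shows "pprod L [w, pprod L [z, x]] = pprod L [pprod L [w, z], x]" "pprod L [w, z] \<in> Z"
proof -
  have "[w, z, x] \<in> pdom L"
    using center_insert(1)[OF Z_cen[OF assms(2)], of "[]" "[z, x]"] Z_comm(1)[OF assms(1,3)] by simp
  then show "pprod L [w, pprod L [z, x]] = pprod L [pprod L [w, z], x]"
    using pprod_assoc[of "[w]" "[z, x]" "[]"] pprod_assoc[of "[]" "[w, z]" "[x]"] by simp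
  show "pprod L [w, z] \<in> Z"
    using assms by (intro subgroup_prod[OF Z_sub]) simp
qed

lemma Z_inv:
  assumes "z \<in> Z" "x \<in> carrier L"
  shows "pprod L [pinv L z, pprod L [z, x]] = x" "pinv L z \<in> Z"
  using cancel_left_pair[OF Z_comm(1)[OF assms]] subgroup_pinv[OF Z_sub assms(1)] .

lemma rcoset_eq:
  assumes "x \<in> carrier L"
  shows "pg_rcoset L Z x = {pprod L [z, x] | z. z \<in> Z}"
  unfolding pg_rcoset_def using Z_comm(1)[OF _ assms] by blast

lemma rcoset_mult:
  assumes "z \<in> Z" "x \<in> carrier L"
  shows "pg_rcoset L Z (pprod L [z, x]) = pg_rcoset L Z x"
proof -
  have sub: "pg_rcoset L Z (pprod L [z, x]) \<subseteq> pg_rcoset L Z x" if "z \<in> Z" "x \<in> carrier L" for z x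
    unfolding rcoset_eq[OF that(2)] rcoset_eq[OF Z_comm(3)[OF that]]
    using Z_mult[OF that(1) _ that(2)] by blast
  show ?thesis
    using sub[OF assms] sub[OF Z_inv(2)[OF assms] Z_comm(3)[OF assms]] unfolding Z_inv(1)[OF assms] by blast
qed

lemma rcoset_self:
  assumes "x \<in> carrier L"
  shows "x \<in> pg_rcoset L Z x"
  unfolding rcoset_eq[OF assms] using one_words(2)[OF assms] subgroup_one[OF Z_sub] by force

lemma rcoset_mem_eq:
  assumes "x \<in> carrier L" "y \<in> pg_rcoset L Z x"
  shows "pg_rcoset L Z y = pg_rcoset L Z x"
  using assms(2) rcoset_mult[OF _ assms(1)] unfolding rcoset_eq[OF assms(1)] by blast

text \<open>Multiplication by an element of Z is defined everywhere and invertible, so cosets that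
  meet are equal and each coset is maximal. From here on \<open>pg_proj\<close> is the ordinary
  coset map.\<close>

lemma max_rcosets_eq: "max_rcosets L Z = pg_rcoset L Z ` carrier L"
proof -
  have "pg_rcoset L Z y = pg_rcoset L Z x"
    if "x \<in> carrier L" "y \<in> carrier L" "pg_rcoset L Z x \<subseteq> pg_rcoset L Z y" for x y
    using rcoset_mem_eq[OF that(2), of x] rcoset_self[OF that(1)] that(3) by blast
  then show ?thesis
    unfolding max_rcosets_def by blast
qed

lemma proj_eq:
  assumes "x \<in> carrier L"
  shows "\<beta> x = pg_rcoset L Z x"
  unfolding pg_proj_def
proof (rule the_equality)
  show "pg_rcoset L Z x \<in> max_rcosets L Z \<and> x \<in> pg_rcoset L Z x"
    unfolding max_rcosets_eq using assms rcoset_self by blast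
  fix C assume "C \<in> max_rcosets L Z \<and> x \<in> C"
  then obtain y where "y \<in> carrier L" "C = pg_rcoset L Z y" "x \<in> C"
    unfolding max_rcosets_eq by blast
  then show "C = pg_rcoset L Z x"
    using rcoset_mem_eq by blast
qed

lemma proj_mult:
  assumes "z \<in> Z" "x \<in> carrier L"
  shows "\<beta> (pprod L [z, x]) = \<beta> x" "\<beta> (pprod L [x, z]) = \<beta> x"
  using rcoset_mult[OF assms] proj_eq[OF assms(2)] proj_eq[OF Z_comm(3)[OF assms]]
  unfolding Z_comm(2)[OF assms] by simp_all

lemma proj_eqE:
  assumes "x \<in> carrier L" "y \<in> carrier L" "\<beta> x = \<beta> y"
  obtains z where "z \<in> Z" "y = pprod L [z, x]"
  using rcoset_self[OF assms(2)] assms(3) unfolding proj_eq[OF assms(1)] proj_eq[OF assms(2)]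
  unfolding rcoset_eq[OF assms(1)] rcoset_eq[OF assms(2)] by blast

text \<open>The letters z^-1 and z are inserted around x, where they cancel by centrality.
  Bracketing them with f^-1 and f instead gives conjugation by z f.\<close>

lemma proj_conj:
  assumes "f \<in> carrier L" "z \<in> Z" "x \<in> conj_dom L f"
  shows "x \<in> conj_dom L (pprod L [z, f])" "pconj L (pprod L [z, f]) x = pconj L f x"
proof -
  let ?w = "[pinv L f, pinv L z, x, z, f]"
  note zi = Z_inv(2)[OF assms(2,1)]
  have d0: "[pinv L f, x] @ [f] \<in> pdom L"
    using assms(3) by (simp add: conj_dom_iff)
  note i1 = center_insert[OF Z_cen[OF assms(2)] d0]
  have d1: "[pinv L f] @ [x, z, f] \<in> pdom L"
    using i1(1) by simp
  note i2 = center_insert[OF Z_cen[OF zi] d1]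
  have w: "?w \<in> pdom L"
    using i2(1) by simp
  have "pprod L ?w = pprod L [pinv L z, pprod L [z, pconj L f x]]"
    using i1(2) i2(2) by (simp add: pconj_def)
  then have val: "pprod L ?w = pconj L f x"
    unfolding Z_inv(1)[OF assms(2) conj_closed[OF assms(3)]] .
  have inv: "pinv L (pprod L [z, f]) = pprod L [pinv L f, pinv L z]"
    using pinv_prod[OF Z_comm(1)[OF assms(2,1)]] by simp
  have 1: "[pprod L [pinv L f, pinv L z], x, z, f] \<in> pdom L"
    "pprod L ?w = pprod L [pprod L [pinv L f, pinv L z], x, z, f]"
    using pprod_assoc[of "[]" "[pinv L f, pinv L z]" "[x, z, f]"] w by simp_all
  then have 2: "[pprod L [pinv L f, pinv L z], x, pprod L [z, f]] \<in> pdom L"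
    "pprod L ?w = pprod L [pprod L [pinv L f, pinv L z], x, pprod L [z, f]]"
    using pprod_assoc[of "[pprod L [pinv L f, pinv L z], x]" "[z, f]" "[]"] by simp_all
  show "x \<in> conj_dom L (pprod L [z, f])"
    using 2(1) by (simp add: conj_dom_iff inv)
  show "pconj L (pprod L [z, f]) x = pconj L f x"
    using 2(2) val by (simp add: pconj_def inv)
qed

lemma proj_conj_eq:
  assumes "f \<in> carrier L" "g \<in> carrier L" "\<beta> f = \<beta> g" "x \<in> conj_dom L f"
  shows "x \<in> conj_dom L g" "pconj L g x = pconj L f x"
proof -
  obtain z where z: "z \<in> Z" "g = pprod L [z, f]"
    using proj_eqE[OF assms(1-3)] .
  show "x \<in> conj_dom L g" "pconj L g x = pconj L f x"
    using proj_conj[OF assms(1) z(1) assms(4)] unfolding z(2) .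
qed

text \<open>Elements with the same image conjugate in the same way, so a chain of objects for one
  lift of a word serves for every lift.\<close>

lemma via_proj_eq:
  assumes "via L \<Delta> P v" "map \<beta> v = map \<beta> w" "set w \<subseteq> carrier L"
  shows "via L \<Delta> P w"
  using assms
proof (induction v arbitrary: P w)
  case (Cons f v)
  then obtain g w' where w: "w = g # w'" "\<beta> f = \<beta> g" "map \<beta> v = map \<beta> w'" "g \<in> carrier L" "set w' \<subseteq> carrier L"
    by (cases w) auto
  have P: "P \<in> \<Delta>" "f \<in> carrier L" "P \<subseteq> conj_dom L f" "via L \<Delta> (pconj L f ` P) v"
    using Cons.prems(1) by simp_all
  have c: "x \<in> conj_dom L g" "pconj L g x = pconj L f x" if "x \<in> P" for x
    using proj_conj_eq[OF P(2) w(4,2)] P(3) that by blast+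
  have "pconj L g ` P = pconj L f ` P"
    by (rule image_cong[OF refl c(2)])
  then show ?case
    using Cons.IH[OF P(4) w(3,5)] P c w by auto
qed simp

text \<open>Two lifts differ by central letters, which can be collected into a single element of Z
  in front of the product. This is what makes the definite description of the quotient product
  meaningful.\<close>

lemma word_proj_eq:
  assumes "v \<in> pdom L" "map \<beta> v = map \<beta> w" "set w \<subseteq> carrier L"
  shows "w \<in> pdom L" "\<beta> (pprod L w) = \<beta> (pprod L v)"
proof -
  show w: "w \<in> pdom L"
    using assms dom_iff via_proj_eq by blast
  have "\<exists>z\<in>Z. pprod L w = pprod L [z, pprod L v]"
    using assms w
  proof (induction v arbitrary: w)
    case Nil
    then show ?case
      using subgroup_one[OF Z_sub] one_words(2)[OF one_closed]
      by (auto simp flip: pone_def intro!: bexI[of _ "pone L"])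
  next
    case (Cons f v)
    then obtain g w' where w: "w = g # w'" "\<beta> f = \<beta> g" "map \<beta> v = map \<beta> w'" "g \<in> carrier L" "set w' \<subseteq> carrier L"
      by (cases w) auto
    have f: "f \<in> carrier L"
      using dom_carrier[OF Cons.prems(1)] by simp
    have d: "v \<in> pdom L" "w' \<in> pdom L"
      using pdom_append[of "[f]" v] pdom_append[of "[g]" w'] Cons.prems(1,4) w(1) by simp_all
    obtain z' where z': "z' \<in> Z" "pprod L w' = pprod L [z', pprod L v]"
      using Cons.IH[OF d(1) w(3,5) d(2)] by blast
    obtain z where z: "z \<in> Z" "g = pprod L [z, f]"
      using proj_eqE[OF f w(4,2)] .
    let ?a = "pprod L v"
    have fa: "[f, ?a] \<in> pdom L" "pprod L (f # v) = pprod L [f, ?a]"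
      using prod_Cons[OF Cons.prems(1)] .
    have i1: "[f, z', ?a] \<in> pdom L" "pprod L [f, z', ?a] = pprod L [z', pprod L [f, ?a]]"
      using center_insert[OF Z_cen[OF z'(1)], of "[f]" "[?a]"] fa(1) by simp_all
    have i2: "[z, f, z', ?a] \<in> pdom L" "pprod L [z, f, z', ?a] = pprod L [z, pprod L [f, z', ?a]]"
      using center_insert[OF Z_cen[OF z(1)], of "[]" "[f, z', ?a]"] i1(1) by simp_all
    have j1: "[g, z', ?a] \<in> pdom L" "pprod L [z, f, z', ?a] = pprod L [g, z', ?a]"
      using pprod_assoc[of "[]" "[z, f]" "[z', ?a]"] i2(1) z(2) by simp_all
    have j2: "pprod L [g, z', ?a] = pprod L [g, pprod L w']"
      using pprod_assoc[of "[g]" "[z', ?a]" "[]"] j1(1) z'(2) by simp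
    have "pprod L w = pprod L [g, pprod L w']"
      using prod_Cons(2)[of g w'] Cons.prems(4) w(1) by simp
    also have "\<dots> = pprod L [z, pprod L [z', pprod L [f, ?a]]]"
      using i1(2) i2(2) j1(2) j2 by simp
    also have "\<dots> = pprod L [pprod L [z, z'], pprod L (f # v)]"
      unfolding fa(2) by (rule Z_mult(1)[OF z'(1) z(1) pprod_closed[OF fa(1)]])
    finally show ?case
      using Z_mult(2)[OF z'(1) z(1) f] by blast
  qed
  then show "\<beta> (pprod L w) = \<beta> (pprod L v)"
    using proj_mult(1)[OF _ pprod_closed[OF assms(1)]] by auto
qed

section \<open>The quotient partial group and its subgroups\<close>

lemma quot_carrier: "carrier QQ = \<beta> ` carrier L"
  by (simp add: pg_quot_def max_rcosets_eq proj_eq)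

lemma quot_dom: "pdom QQ = map \<beta> ` pdom L"
  by (simp add: pg_quot_def)

lemma quot_dom_iff:
  assumes "set w \<subseteq> carrier L"
  shows "map \<beta> w \<in> pdom QQ \<longleftrightarrow> w \<in> pdom L"
  unfolding quot_dom using word_proj_eq(1)[OF _ _ assms] by auto

lemma quot_prod:
  assumes "w \<in> pdom L"
  shows "pprod QQ (map \<beta> w) = \<beta> (pprod L w)"
  unfolding pg_quot_def partial_group.simps
proof (rule the_equality)
  show "\<exists>v\<in>pdom L. map \<beta> v = map \<beta> w \<and> \<beta> (pprod L w) = \<beta> (pprod L v)"
    using assms by blast
  fix C assume "\<exists>v\<in>pdom L. map \<beta> v = map \<beta> w \<and> C = \<beta> (pprod L v)"
  then show "C = \<beta> (pprod L w)"
    using word_proj_eq(2)[OF _ _ dom_carrier[OF assms]] by auto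
qed

lemma quot_one: "pone QQ = \<beta> (pone L)"
  using quot_prod[OF nil_dom] by (simp add: pone_def)

lemma quot_pinv:
  assumes "f \<in> carrier L"
  shows "pinv QQ (\<beta> f) = \<beta> (pinv L f)"
  unfolding pg_quot_def partial_group.simps
proof (rule the_equality)
  show "\<exists>g\<in>carrier L. \<beta> g = \<beta> f \<and> \<beta> (pinv L f) = \<beta> (pinv L g)"
    using assms by blast
  fix C assume "\<exists>g\<in>carrier L. \<beta> g = \<beta> f \<and> C = \<beta> (pinv L g)"
  then obtain g where g: "g \<in> carrier L" "\<beta> g = \<beta> f" "C = \<beta> (pinv L g)"
    by blast
  obtain z where z: "z \<in> Z" "g = pprod L [z, f]"
    using proj_eqE[OF assms g(1) g(2)[symmetric]] .
  have "pinv L g = pprod L [pinv L f, pinv L z]"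
    using pinv_prod[OF Z_comm(1)[OF z(1) assms]] z(2) by simp
  then show "C = \<beta> (pinv L f)"
    using g(3) proj_mult(2)[OF Z_inv(2)[OF z(1) assms] pinv_closed[OF assms]] by simp
qed

lemma quot_word_inv:
  assumes "set w \<subseteq> carrier L"
  shows "word_inv QQ (map \<beta> w) = map \<beta> (word_inv L w)"
  using assms by (induction w) (simp_all add: quot_pinv)

lemma quot_lift:
  assumes "set W \<subseteq> carrier QQ"
  obtains w where "set w \<subseteq> carrier L" "W = map \<beta> w"
proof -
  have "W \<in> lists (\<beta> ` carrier L)"
    using assms by (auto simp: quot_carrier)
  then show ?thesis
    unfolding lists_image using that by auto
qed

lemma partial_group_quot: "partial_group QQ"
proof
  show "carrier QQ \<noteq> {}"
    using carrier_nonempty by (simp add: quot_carrier)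
  show "pdom QQ \<subseteq> lists (carrier QQ)"
    unfolding quot_dom quot_carrier using dom_carrier by fastforce
next
  fix C assume C: "C \<in> carrier QQ"
  then obtain f where f: "f \<in> carrier L" "C = \<beta> f"
    by (auto simp: quot_carrier)
  show "pinv QQ C \<in> carrier QQ" "pinv QQ (pinv QQ C) = C"
    using f pinv_closed pinv_pinv by (auto simp: quot_pinv quot_carrier)
  show "[C] \<in> pdom QQ"
    using quot_dom_iff[of "[f]"] f pdom_singleton by simp
  show "pprod QQ [C] = C"
    using quot_prod[OF pdom_singleton[OF f(1)]] f pprod_singleton by simp
next
  fix W assume "W \<in> pdom QQ"
  then obtain w where w: "w \<in> pdom L" "W = map \<beta> w"
    by (auto simp: quot_dom)
  show "pprod QQ W \<in> carrier QQ"
    using quot_prod[OF w(1)] pprod_closed[OF w(1)] by (simp add: w(2) quot_carrier)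
  have "word_inv QQ W @ W = map \<beta> (word_inv L w @ w)"
    by (simp add: w(2) quot_word_inv[OF dom_carrier[OF w(1)]])
  then show "word_inv QQ W @ W \<in> pdom QQ \<and> pprod QQ (word_inv QQ W @ W) = pone QQ"
    using inv_word_cancel(1,2)[OF w(1)] quot_prod[OF inv_word_cancel(1)[OF w(1)]]
    by (simp only: quot_one quot_dom imageI simp_thms)
next
  fix U V assume "U @ V \<in> pdom QQ"
  then obtain x where x: "x \<in> pdom L" "U @ V = map \<beta> x"
    by (auto simp: quot_dom)
  then obtain u v where uv: "x = u @ v" "U = map \<beta> u" "V = map \<beta> v"
    by (auto simp: append_eq_map_conv)
  then show "U \<in> pdom QQ \<and> V \<in> pdom QQ"
    using x(1) pdom_append[of u v] by (auto simp: quot_dom)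
next
  fix U V W assume "U @ V @ W \<in> pdom QQ"
  then obtain x where x: "x \<in> pdom L" "U @ V @ W = map \<beta> x"
    by (auto simp: quot_dom)
  then obtain u v w where uvw: "x = u @ v @ w" "U = map \<beta> u" "V = map \<beta> v" "W = map \<beta> w"
    by (auto simp: append_eq_map_conv)
  have d: "u @ v @ w \<in> pdom L" "v \<in> pdom L"
    using x(1) uvw(1) dom_infix by auto
  have eq: "U @ [pprod QQ V] @ W = map \<beta> (u @ [pprod L v] @ w)" "U @ V @ W = map \<beta> (u @ v @ w)"
    by (simp_all add: uvw quot_prod[OF d(2)])
  show "U @ [pprod QQ V] @ W \<in> pdom QQ \<and> pprod QQ (U @ V @ W) = pprod QQ (U @ [pprod QQ V] @ W)"
    unfolding eq using pprod_assoc[OF d(1)] d(1)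
    by (simp only: quot_prod quot_dom imageI simp_thms)
qed

interpretation QQ: partial_group QQ
  by (rule partial_group_quot)

lemma quot_conj:
  assumes "g \<in> carrier L" "x \<in> carrier L"
  shows "\<beta> x \<in> conj_dom QQ (\<beta> g) \<longleftrightarrow> x \<in> conj_dom L g"
    and "x \<in> conj_dom L g \<Longrightarrow> pconj QQ (\<beta> g) (\<beta> x) = \<beta> (pconj L g x)"
proof -
  have eq: "[pinv QQ (\<beta> g), \<beta> x, \<beta> g] = map \<beta> [pinv L g, x, g]"
    by (simp add: quot_pinv[OF assms(1)])
  have w: "set [pinv L g, x, g] \<subseteq> carrier L"
    using assms pinv_closed by simp
  show "\<beta> x \<in> conj_dom QQ (\<beta> g) \<longleftrightarrow> x \<in> conj_dom L g"
    unfolding QQ.conj_dom_iff conj_dom_iff eq by (rule quot_dom_iff[OF w])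
  show "pconj QQ (\<beta> g) (\<beta> x) = \<beta> (pconj L g x)" if "x \<in> conj_dom L g"
    using that quot_prod unfolding pconj_def eq conj_dom_iff by blast
qed

lemma quot_conj_subset:
  assumes "g \<in> carrier L" "P \<subseteq> carrier L"
  shows "\<beta> ` P \<subseteq> conj_dom QQ (\<beta> g) \<longleftrightarrow> P \<subseteq> conj_dom L g"
    and "P \<subseteq> conj_dom L g \<Longrightarrow> pconj QQ (\<beta> g) ` \<beta> ` P = \<beta> ` pconj L g ` P"
proof -
  show "\<beta> ` P \<subseteq> conj_dom QQ (\<beta> g) \<longleftrightarrow> P \<subseteq> conj_dom L g"
    using quot_conj(1)[OF assms(1)] assms(2) by blast
  show "pconj QQ (\<beta> g) ` \<beta> ` P = \<beta> ` pconj L g ` P" if "P \<subseteq> conj_dom L g"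
    unfolding image_image
    by (rule image_cong[OF refl], rule quot_conj(2)[OF assms(1)]) (use that assms(2) in blast)+
qed

lemma subgroup_quot:
  assumes "pg_subgroup L H"
  shows "pg_subgroup QQ (\<beta> ` H)"
proof (rule QQ.pg_subgroupI)
  note H = subgroup_facts[OF assms]
  show "\<beta> ` H \<subseteq> carrier QQ"
    using H(1) by (auto simp: quot_carrier)
  show "pinv QQ C \<in> \<beta> ` H" if "C \<in> \<beta> ` H" for C
    using that H(1,4) quot_pinv by auto
  fix W assume "set W \<subseteq> \<beta> ` H"
  then have "W \<in> lists (\<beta> ` H)"
    by auto
  then obtain w where w: "set w \<subseteq> H" "W = map \<beta> w"
    unfolding lists_image by auto
  show "W \<in> pdom QQ"
    unfolding w(2) quot_dom by (rule imageI[OF H(2)[OF w(1)]])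
  show "pprod QQ W \<in> \<beta> ` H"
    unfolding w(2) quot_prod[OF H(2)[OF w(1)]] by (rule imageI[OF H(3)[OF w(1)]])
qed

definition "lift K = {x \<in> carrier L. \<beta> x \<in> K}"

lemma lift_facts:
  assumes "pg_subgroup QQ K"
  shows subgroup_lift: "pg_subgroup L (lift K)" and proj_lift: "\<beta> ` lift K = K" and Z_lift: "Z \<subseteq> lift K"
proof -
  note K = QQ.subgroup_facts[OF assms]
  show "pg_subgroup L (lift K)"
  proof (rule pg_subgroupI)
    show "lift K \<subseteq> carrier L"
      by (auto simp: lift_def)
    show "pinv L h \<in> lift K" if "h \<in> lift K" for h
      using that K(4)[of "\<beta> h"] pinv_closed by (auto simp: lift_def quot_pinv)
    fix w assume w: "set w \<subseteq> lift K"
    then have w': "set w \<subseteq> carrier L" "set (map \<beta> w) \<subseteq> K"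
      by (auto simp: lift_def)
    show d: "w \<in> pdom L"
      using K(2)[OF w'(2)] quot_dom_iff[OF w'(1)] by blast
    show "pprod L w \<in> lift K"
      using K(3)[OF w'(2)] quot_prod[OF d] pprod_closed[OF d] by (simp add: lift_def)
  qed
  show "\<beta> ` lift K = K"
    using K(1) unfolding quot_carrier lift_def by blast
  show "Z \<subseteq> lift K"
  proof
    fix z assume z: "z \<in> Z"
    have "\<beta> z = pone QQ"
      using proj_mult(1)[OF z one_closed] one_words(4)[OF Z_carrier[OF z]] by (simp add: quot_one)
    then show "z \<in> lift K"
      using K(5) Z_carrier[OF z] by (simp add: lift_def)
  qed
qed

lemma proj_mem_image:
  assumes "pg_subgroup L P" "Z \<subseteq> P" "x \<in> carrier L" "\<beta> x \<in> \<beta> ` P"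
  shows "x \<in> P"
proof -
  obtain y where y: "y \<in> P" "\<beta> y = \<beta> x"
    using assms(4) by force
  then have "y \<in> carrier L"
    using subgroup_carrier[OF assms(1)] by blast
  then obtain z where z: "z \<in> Z" "x = pprod L [z, y]"
    using proj_eqE[OF _ assms(3) y(2)] by blast
  show ?thesis
    unfolding z(2) using z(1) y(1) assms(2) by (intro subgroup_prod[OF assms(1)]) auto
qed

lemma group_hom_proj:
  assumes "pg_subgroup L H"
  shows "group_hom (group_on L H) (group_on QQ (\<beta> ` H)) \<beta>"
    and "kernel (group_on L H) (group_on QQ (\<beta> ` H)) \<beta> = Z \<inter> H"
proof -
  have "\<beta> (pprod L [x, y]) = pprod QQ [\<beta> x, \<beta> y]" if "x \<in> H" "y \<in> H" for x y
    using quot_prod[OF subgroup_dom[OF assms, of "[x, y]"]] that by simp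
  then show "group_hom (group_on L H) (group_on QQ (\<beta> ` H)) \<beta>"
    by (intro group_hom.intro group_group_on[OF assms] QQ.group_group_on[OF subgroup_quot[OF assms]]
        group_hom_axioms.intro homI) simp_all
  have "\<beta> x = \<beta> (pone L) \<longleftrightarrow> x \<in> Z" if x: "x \<in> carrier L" for x
  proof
    assume "\<beta> x = \<beta> (pone L)"
    then obtain z where z: "z \<in> Z" "x = pprod L [z, pone L]"
      using proj_eqE[OF one_closed x] by metis
    then show "x \<in> Z"
      using one_words(4)[OF Z_carrier[OF z(1)]] by simp
  next
    assume "x \<in> Z"
    then show "\<beta> x = \<beta> (pone L)"
      using proj_mult(1)[OF _ one_closed] one_words(4)[OF x] by metis
  qed
  then show "kernel (group_on L H) (group_on QQ (\<beta> ` H)) \<beta> = Z \<inter> H"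
    using subgroup_carrier[OF assms] by (auto simp: kernel_def quot_one)
qed

lemma Z_p_power: "p_power p Z"
proof -
  interpret S: group "group_on L S"
    by (rule group_group_on[OF S_subgroup])
  have "subgroup Z (group_on L S)"
    using subgroup_S_iff Z_sub Z_S by blast
  from S.card_subgroup_dvd[OF this] show ?thesis
    using p_power_dvd[OF p S_p_power] by simp
qed

subsection \<open>The quotient is a locality\<close>

lemma obj_Z:
  assumes "P \<in> \<Delta>"
  shows "P <#>\<^bsub>group_on L S\<^esub> Z \<in> \<Delta>" "Z \<subseteq> P <#>\<^bsub>group_on L S\<^esub> Z" "P \<subseteq> P <#>\<^bsub>group_on L S\<^esub> Z"
    "\<beta> ` (P <#>\<^bsub>group_on L S\<^esub> Z) = \<beta> ` P"
proof -
  note P = obj_subgroup[OF assms]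
  show "P <#>\<^bsub>group_on L S\<^esub> Z \<in> \<Delta>"
    by (rule obj_central_mult[OF assms Z_sub Z_S Z_center])
  show PZ: "P \<subseteq> P <#>\<^bsub>group_on L S\<^esub> Z"
    by (rule subgroup_central_mult(3)[OF P obj_S[OF assms] Z_sub Z_S Z_center])
  show "Z \<subseteq> P <#>\<^bsub>group_on L S\<^esub> Z"
  proof
    fix z assume z: "z \<in> Z"
    have "z = pprod L [pone L, z]"
      using one_words(2)[OF Z_carrier[OF z]] by simp
    then show "z \<in> P <#>\<^bsub>group_on L S\<^esub> Z"
      unfolding central_mult_mem using z subgroup_one[OF P] by blast
  qed
  have "\<beta> y \<in> \<beta> ` P" if y: "y \<in> P <#>\<^bsub>group_on L S\<^esub> Z" for y
  proof -
    obtain x z where "x \<in> P" "z \<in> Z" "y = pprod L [x, z]"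
      using y unfolding central_mult_mem by blast
    then show ?thesis
      using proj_mult(2)[of z x] subgroup_carrier[OF P] by blast
  qed
  then show "\<beta> ` (P <#>\<^bsub>group_on L S\<^esub> Z) = \<beta> ` P"
    using PZ by blast
qed

text \<open>P and PZ have the same image. Every object of the quotient thus has a representative
  containing Z, which is the kind that can be recovered from its image.\<close>

lemma quot_objE:
  assumes "A \<in> \<Delta>Q"
  obtains P where "P \<in> \<Delta>" "Z \<subseteq> P" "A = \<beta> ` P"
proof -
  obtain P where P: "P \<in> \<Delta>" "A = \<beta> ` P"
    using assms by blast
  show ?thesis
    using that[OF obj_Z(1,2)[OF P(1)]] obj_Z(4)[OF P(1)] P(2) by simp
qed

lemma obj_carrier: "P \<in> \<Delta> \<Longrightarrow> P \<subseteq> carrier L"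
  by (rule subgroup_carrier[OF obj_subgroup])

lemma Z_conj_image:
  assumes "g \<in> carrier L" "P \<subseteq> conj_dom L g" "Z \<subseteq> P"
  shows "Z \<subseteq> pconj L g ` P"
proof
  fix z assume z: "z \<in> Z"
  then have "pconj L g z = z"
    using center_conj_dom[OF Z_cen[OF z] assms(1)] assms by blast
  then show "z \<in> pconj L g ` P"
    using z assms(3) by force
qed

text \<open>A chain in the quotient only provides objects up to Z. Choosing representatives that
  contain Z makes them unique: the conjugate of P contains Z too and has the same image as the
  chosen next object, so the two agree and the chain continues.\<close>

lemma via_lift:
  assumes "via QQ \<Delta>Q (\<beta> ` P) (map \<beta> w)" "set w \<subseteq> carrier L" "P \<in> \<Delta>" "Z \<subseteq> P"
  shows "via L \<Delta> P w"
  using assms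
proof (induction w arbitrary: P)
  case (Cons g w)
  have g: "g \<in> carrier L" and w: "set w \<subseteq> carrier L"
    using Cons.prems(2) by simp_all
  note PL = obj_carrier[OF Cons.prems(3)]
  have a: "\<beta> ` P \<subseteq> conj_dom QQ (\<beta> g)" "via QQ \<Delta>Q (pconj QQ (\<beta> g) ` \<beta> ` P) (map \<beta> w)"
    using Cons.prems(1) by simp_all
  have c: "P \<subseteq> conj_dom L g"
    using a(1) quot_conj_subset(1)[OF g PL] by blast
  have v: "via QQ \<Delta>Q (\<beta> ` pconj L g ` P) (map \<beta> w)"
    using a(2) unfolding quot_conj_subset(2)[OF g PL c] .
  obtain P' where P': "P' \<in> \<Delta>" "Z \<subseteq> P'" "\<beta> ` pconj L g ` P = \<beta> ` P'"
    using quot_objE[OF via_obj[OF v]] .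
  have "pconj L g ` P = P'"
  proof (intro equalityI subsetI)
    fix y assume y: "y \<in> pconj L g ` P"
    then have "y \<in> carrier L"
      using c conj_closed by blast
    moreover have "\<beta> y \<in> \<beta> ` P'"
      unfolding P'(3)[symmetric] by (rule imageI[OF y])
    ultimately show "y \<in> P'"
      by (rule proj_mem_image[OF obj_subgroup[OF P'(1)] P'(2)])
  next
    fix y assume y: "y \<in> P'"
    then have "\<beta> y \<in> \<beta> ` pconj L g ` P"
      unfolding P'(3) by (rule imageI)
    then obtain x where x: "x \<in> P" "\<beta> (pconj L g x) = \<beta> y"
      by force
    have xc: "x \<in> conj_dom L g"
      using x(1) c by blast
    obtain z where z: "z \<in> Z" "y = pprod L [z, pconj L g x]"
      using proj_eqE[OF conj_closed[OF xc] _ x(2)] y obj_carrier[OF P'(1)] by blast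
    \<comment> \<open>The discrepancy z is central, so it can be moved inside the conjugation and
      absorbed into P, which contains Z.\<close>
    have "y = pconj L g (pprod L [x, z])"
      unfolding z(2) center_conj_mult(2)[OF Z_cen[OF z(1)] xc] by (rule Z_comm(2)[OF z(1) conj_closed[OF xc]])
    moreover have "pprod L [x, z] \<in> P"
      using x(1) z(1) Cons.prems(4) by (intro subgroup_prod[OF obj_subgroup[OF Cons.prems(3)]]) auto
    ultimately show "y \<in> pconj L g ` P"
      by blast
  qed
  then have "via L \<Delta> (pconj L g ` P) w"
    using Cons.IH[of "pconj L g ` P"] v w P'(1,2) by simp
  then show ?case
    using Cons.prems(3) g c by simp
qed simp

lemma via_quot:
  assumes "via L \<Delta> P w"
  shows "via QQ \<Delta>Q (\<beta> ` P) (map \<beta> w)"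
  using assms
proof (induction w arbitrary: P)
  case (Cons g w)
  have a: "P \<in> \<Delta>" "g \<in> carrier L" "P \<subseteq> conj_dom L g" "via L \<Delta> (pconj L g ` P) w"
    using Cons.prems by simp_all
  note PL = obj_carrier[OF a(1)]
  have "via QQ \<Delta>Q (pconj QQ (\<beta> g) ` \<beta> ` P) (map \<beta> w)"
    unfolding quot_conj_subset(2)[OF a(2) PL a(3)] by (rule Cons.IH[OF a(4)])
  then show ?case
    using a quot_conj_subset(1)[OF a(2) PL] by (simp add: quot_carrier)
qed simp

lemma locality_quot: "locality p QQ \<Delta>Q SQ"
proof (intro locality.intro partial_group_quot locality_axioms.intro)
  interpret S: group_hom "group_on L S" "group_on QQ SQ" \<beta>
    by (rule group_hom_proj(1)[OF S_subgroup])
  show "finite (carrier QQ)"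
    using finite_carrier by (simp add: quot_carrier)
  have "p_power p SQ"
    using S.p_power_image[OF _ S.G.subgroup_self p] S_p_power finite_sub[OF subgroup_carrier[OF S_subgroup]]
    by simp
  then show "pg_p_subgroup p QQ SQ"
    using subgroup_quot[OF S_subgroup] by (simp add: pg_p_subgroup_def)
  show "\<Delta>Q \<noteq> {}"
    using objects_nonempty by blast
  show "pg_subgroup QQ A \<and> A \<subseteq> SQ" if "A \<in> \<Delta>Q" for A
    using that subgroup_quot[OF obj_subgroup] obj_S by blast
  show "pdom QQ = dom_of QQ \<Delta>Q"
  proof (intro equalityI subsetI)
    fix W assume "W \<in> pdom QQ"
    then obtain w P where "W = map \<beta> w" "via L \<Delta> P w"
      unfolding quot_dom using dom_iff by blast
    then show "W \<in> dom_of QQ \<Delta>Q"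
      unfolding dom_of_iff using via_quot by blast
  next
    fix W assume "W \<in> dom_of QQ \<Delta>Q"
    then obtain A where A: "via QQ \<Delta>Q A W"
      unfolding dom_of_iff by blast
    have "set W \<subseteq> carrier QQ"
      using via_carrier[OF A] by auto
    then obtain w where w: "set w \<subseteq> carrier L" "W = map \<beta> w"
      using quot_lift by blast
    obtain P where P: "P \<in> \<Delta>" "Z \<subseteq> P" "A = \<beta> ` P"
      using quot_objE[OF via_obj[OF A]] .
    have "via L \<Delta> P w"
      by (rule via_lift[OF _ w(1) P(1,2)]) (use A P(3) w(2) in simp)
    then show "W \<in> pdom QQ"
      unfolding quot_dom w(2) by (intro imageI via_dom)
  qed
next
  fix R assume R: "pg_p_subgroup p QQ R" "SQ \<subseteq> R"
  have R': "pg_subgroup QQ R" "p_power p R"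
    using R(1) by (simp_all add: pg_p_subgroup_def)
  note l = lift_facts[OF R'(1)]
  interpret l: group_hom "group_on L (lift R)" "group_on QQ (\<beta> ` lift R)" \<beta>
    by (rule group_hom_proj(1)[OF l(1)])
  \<comment> \<open>The preimage of R is an extension of the p-group Z by R. It is therefore a
    p-subgroup containing S, and maximality of S descends to the quotient.\<close>
  have "p_power p (lift R)"
  proof (rule l.p_power_extension)
    show "finite (carrier (group_on L (lift R)))"
      using finite_sub[OF subgroup_carrier[OF l(1)]] by simp
    show "subgroup (lift R) (group_on L (lift R))"
      using l.G.subgroup_self by simp
    have "Z \<inter> lift R \<inter> lift R = Z"
      using l(3) by blast
    then show "p_power p (kernel (group_on L (lift R)) (group_on QQ (\<beta> ` lift R)) \<beta> \<inter> lift R)"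
      unfolding group_hom_proj(2)[OF l(1)] using Z_p_power by simp
    show "p_power p (\<beta> ` lift R)"
      unfolding l(2) by (rule R'(2))
  qed
  moreover have "S \<subseteq> lift R"
    using R(2) S_carrier by (auto simp: lift_def)
  ultimately have "lift R = S"
    using S_maximal[of "lift R"] l(1) by (simp add: pg_p_subgroup_def)
  then show "R = SQ"
    using l(2) by simp
next
  fix A C T
  assume A: "A \<in> \<Delta>Q" and C: "C \<in> carrier QQ" and AC: "A \<subseteq> conj_dom QQ C" and T: "pg_subgroup QQ T" "T \<subseteq> SQ"
    and AT: "pconj QQ C ` A \<subseteq> T"
  obtain P where P: "P \<in> \<Delta>" "Z \<subseteq> P" "A = \<beta> ` P"
    using quot_objE[OF A] .
  obtain g where g: "g \<in> carrier L" "C = \<beta> g"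
    using C unfolding quot_carrier by blast
  note PL = obj_carrier[OF P(1)]
  have c: "P \<subseteq> conj_dom L g"
    using AC quot_conj_subset(1)[OF g(1) PL] unfolding P(3) g(2) by blast
  have PT: "\<beta> ` pconj L g ` P \<subseteq> T"
    using AT unfolding P(3) g(2) quot_conj_subset(2)[OF g(1) PL c] .
  note l = lift_facts[OF T(1)]
  have "lift T \<subseteq> S"
  proof
    fix x assume "x \<in> lift T"
    then have "x \<in> carrier L" "\<beta> x \<in> SQ"
      using T(2) by (auto simp: lift_def)
    then show "x \<in> S"
      by (rule proj_mem_image[OF S_subgroup Z_S])
  qed
  moreover have "pconj L g ` P \<subseteq> lift T"
    using PT c conj_closed unfolding lift_def by blast
  ultimately have "lift T \<in> \<Delta>"
    using objects_closed[OF P(1) g(1) c l(1)] by blast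
  then have "\<beta> ` lift T \<in> \<Delta>Q"
    by (rule imageI)
  then show "T \<in> \<Delta>Q"
    unfolding l(2) .
qed

interpretation Q: locality p QQ \<Delta>Q SQ
  by (rule locality_quot)

text \<open>As P contains Z, it is the full preimage of its image. An element normalizing the image
  thus conjugates P into P, and injectivity on a finite set makes this an equality.\<close>

lemma normalizer_quot:
  assumes "P \<in> \<Delta>" "Z \<subseteq> P"
  shows "pg_normalizer QQ (\<beta> ` P) = \<beta> ` pg_normalizer L P"
proof -
  note PL = obj_carrier[OF assms(1)]
  have key: "\<beta> g \<in> pg_normalizer QQ (\<beta> ` P) \<longleftrightarrow> g \<in> pg_normalizer L P" if g: "g \<in> carrier L" for g
  proof
    assume "\<beta> g \<in> pg_normalizer QQ (\<beta> ` P)"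
    then have a: "\<beta> ` P \<subseteq> conj_dom QQ (\<beta> g)" "pconj QQ (\<beta> g) ` \<beta> ` P = \<beta> ` P"
      by (simp_all add: pg_normalizer_def)
    have c: "P \<subseteq> conj_dom L g"
      using a(1) quot_conj_subset(1)[OF g PL] by blast
    have "\<beta> ` pconj L g ` P = \<beta> ` P"
      using a(2) unfolding quot_conj_subset(2)[OF g PL c] .
    then have im: "\<beta> (pconj L g x) \<in> \<beta> ` P" if "x \<in> P" for x
      using imageI[OF imageI[OF that]] by metis
    have "pconj L g x \<in> P" if x: "x \<in> P" for x
      by (rule proj_mem_image[OF obj_subgroup[OF assms(1)] assms(2) conj_closed[OF subsetD[OF c x]] im[OF x]])
    then have "pconj L g ` P = P"
      using endo_inj_surj[OF finite_sub[OF PL]] inj_on_subset[OF conj_inj[OF g] c] by blast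
    then show "g \<in> pg_normalizer L P"
      using g c by (simp add: pg_normalizer_def)
  next
    assume "g \<in> pg_normalizer L P"
    then have c: "P \<subseteq> conj_dom L g" "pconj L g ` P = P"
      by (simp_all add: pg_normalizer_def)
    then show "\<beta> g \<in> pg_normalizer QQ (\<beta> ` P)"
      using quot_conj_subset[OF g PL] g by (simp add: pg_normalizer_def quot_carrier)
  qed
  show ?thesis
  proof (intro equalityI subsetI)
    fix C assume C: "C \<in> pg_normalizer QQ (\<beta> ` P)"
    then have "C \<in> \<beta> ` carrier L"
      by (simp add: pg_normalizer_def quot_carrier)
    then obtain g where g: "g \<in> carrier L" "C = \<beta> g"
      by blast
    then have "g \<in> pg_normalizer L P"
      using key[OF g(1)] C by simp
    then show "C \<in> \<beta> ` pg_normalizer L P"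
      unfolding g(2) by (rule imageI)
  next
    fix C assume "C \<in> \<beta> ` pg_normalizer L P"
    then obtain g where "g \<in> pg_normalizer L P" "C = \<beta> g"
      by blast
    then show "C \<in> pg_normalizer QQ (\<beta> ` P)"
      using key by (simp add: pg_normalizer_def)
  qed
qed

lemma characteristic_p_normalizer_quot:
  assumes "P \<in> \<Delta>" "Z \<subseteq> P"
  shows "characteristic_p p (group_on L (pg_normalizer L P)) \<longleftrightarrow>
    characteristic_p p (group_on QQ (pg_normalizer QQ (\<beta> ` P)))"
proof -
  let ?N = "pg_normalizer L P"
  note N = normalizer_subgroup[OF assms(1)]
  have ZN: "Z \<subseteq> ?N"
    using assms(2) obj_normalizer[OF assms(1)] by blast
  interpret h: group_hom "group_on L ?N" "group_on QQ (\<beta> ` ?N)" \<beta>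
    by (rule group_hom_proj(1)[OF N])
  have ker: "kernel (group_on L ?N) (group_on QQ (\<beta> ` ?N)) \<beta> = Z"
    using group_hom_proj(2)[OF N] ZN by blast
  show ?thesis
    unfolding normalizer_quot[OF assms]
  proof (rule h.characteristic_p_central_extension[OF _ p])
    show "finite (carrier (group_on L ?N))"
      using finite_sub[OF subgroup_carrier[OF N]] by simp
    show "\<beta> ` carrier (group_on L ?N) = carrier (group_on QQ (\<beta> ` ?N))"
      by simp
    show "p_power p (kernel (group_on L ?N) (group_on QQ (\<beta> ` ?N)) \<beta>)"
      unfolding ker by (rule Z_p_power)
    fix g z assume g: "g \<in> carrier (group_on L ?N)"
      and z: "z \<in> kernel (group_on L ?N) (group_on QQ (\<beta> ` ?N)) \<beta>"
    have g': "g \<in> ?N" and z': "z \<in> Z" "z \<in> ?N"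
      using g z ZN unfolding ker by auto
    have "g \<in> carrier L" "z \<in> conj_dom L g"
      using g' z'(1) assms(2) by (auto simp: pg_normalizer_def)
    then show "cj (group_on L ?N) g z = z"
      unfolding cj_group_on[OF N g' z'(2)] by (rule center_conj_dom[OF Z_cen[OF z'(1)]])
  qed
qed

lemma normalizer_obj_Z:
  assumes "P \<in> \<Delta>"
  shows "pg_normalizer L P \<subseteq> pg_normalizer L (P <#>\<^bsub>group_on L S\<^esub> Z)"
proof
  fix g assume "g \<in> pg_normalizer L P"
  then have g: "g \<in> carrier L" "P \<subseteq> conj_dom L g" "pconj L g ` P = P"
    by (simp_all add: pg_normalizer_def)
  have c: "pprod L [x, z] \<in> conj_dom L g" "pconj L g (pprod L [x, z]) = pprod L [pconj L g x, z]"
    if "x \<in> P" "z \<in> Z" for x z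
    using center_conj_mult[OF Z_cen[OF that(2)]] g(2) that(1) by blast+
  have "pconj L g ` (P <#>\<^bsub>group_on L S\<^esub> Z) = P <#>\<^bsub>group_on L S\<^esub> Z"
  proof (intro equalityI subsetI)
    fix y assume "y \<in> pconj L g ` (P <#>\<^bsub>group_on L S\<^esub> Z)"
    then obtain x z where y: "x \<in> P" "z \<in> Z" "y = pconj L g (pprod L [x, z])"
      by (auto simp: central_mult_mem)
    have "pconj L g x \<in> P"
      using y(1) g(3) by blast
    then show "y \<in> P <#>\<^bsub>group_on L S\<^esub> Z"
      unfolding y(3) c(2)[OF y(1,2)] central_mult_mem using y(2) by blast
  next
    fix y assume "y \<in> P <#>\<^bsub>group_on L S\<^esub> Z"
    then obtain x z where y: "x \<in> P" "z \<in> Z" "y = pprod L [x, z]"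
      unfolding central_mult_mem by blast
    then obtain x' where x': "x' \<in> P" "x = pconj L g x'"
      using g(3) by blast
    have "y = pconj L g (pprod L [x', z])"
      using c(2)[OF x'(1) y(2)] y(3) x'(2) by simp
    moreover have "pprod L [x', z] \<in> P <#>\<^bsub>group_on L S\<^esub> Z"
      unfolding central_mult_mem using x'(1) y(2) by blast
    ultimately show "y \<in> pconj L g ` (P <#>\<^bsub>group_on L S\<^esub> Z)"
      by (rule image_eqI)
  qed
  moreover have "P <#>\<^bsub>group_on L S\<^esub> Z \<subseteq> conj_dom L g"
    using c(1) by (auto simp: central_mult_mem)
  ultimately show "g \<in> pg_normalizer L (P <#>\<^bsub>group_on L S\<^esub> Z)"
    using g(1) by (simp add: pg_normalizer_def)
qed

lemma objective_characteristic_p_quot: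
  "objective_characteristic_p p QQ \<Delta>Q SQ \<longleftrightarrow> objective_characteristic_p p L \<Delta> S"
proof -
  have "(\<forall>A\<in>\<Delta>Q. characteristic_p p (group_on QQ (pg_normalizer QQ A))) \<longleftrightarrow>
    (\<forall>P\<in>\<Delta>. characteristic_p p (group_on L (pg_normalizer L P)))" (is "?l \<longleftrightarrow> ?r")
  proof
    assume r: ?r
    show ?l
    proof
      fix A assume "A \<in> \<Delta>Q"
      then obtain P where P: "P \<in> \<Delta>" "Z \<subseteq> P" "A = \<beta> ` P"
        using quot_objE by blast
      show "characteristic_p p (group_on QQ (pg_normalizer QQ A))"
        unfolding P(3) using r P(1) characteristic_p_normalizer_quot[OF P(1,2)] by blast
    qed
  next
    assume l: ?l
    show ?r
    proof
      fix P assume P: "P \<in> \<Delta>"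
      note PZ = obj_Z[OF P]
      have "characteristic_p p (group_on L (pg_normalizer L (P <#>\<^bsub>group_on L S\<^esub> Z)))"
        using l PZ(1) characteristic_p_normalizer_quot[OF PZ(1,2)] by blast
      then show "characteristic_p p (group_on L (pg_normalizer L P))"
        by (rule characteristic_p_smaller_object[OF p P PZ(1,3) normalizer_obj_Z[OF P]])
    qed
  qed
  then show ?thesis
    using locality_axioms locality_quot by (simp add: objective_characteristic_p_def)
qed

subsection \<open>The fusion system of the quotient\<close>

lemma proj_rcoset:
  assumes "x \<in> S"
  shows "\<beta> x = Z #>\<^bsub>group_on L S\<^esub> x"
  unfolding proj_eq[OF S_carrier[OF assms]] rcoset_eq[OF S_carrier[OF assms]] r_coset_def by auto

lemma fusion_quotient_proj:
  "fusion_quotient p (group_on L S) (fusion_of p L \<Delta> S) (group_on QQ SQ) \<beta> Z"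
proof (intro fusion_quotient.intro fusion_quotient_axioms.intro fusion_system_fusion_of
    group_hom_proj(1)[OF S_subgroup] p)
  show "\<beta> ` carrier (group_on L S) = carrier (group_on QQ SQ)"
    by simp
  show "\<beta> x = Z #>\<^bsub>group_on L S\<^esub> x" if "x \<in> carrier (group_on L S)" for x
    using that proj_rcoset by simp
  show "kernel (group_on L S) (group_on QQ SQ) \<beta> = Z"
    using group_hom_proj(2)[OF S_subgroup] Z_S by blast
qed

interpretation FQ: fusion_quotient p "group_on L S" "fusion_of p L \<Delta> S" "group_on QQ SQ" \<beta> Z
  by (rule fusion_quotient_proj)

lemma loc_mor_quot:
  assumes "loc_mor L \<Delta> S P \<phi>" "Z \<subseteq> P"
  shows "\<exists>\<psi>. loc_mor QQ \<Delta>Q SQ (\<beta> ` P) \<psi> \<and> (\<forall>x\<in>P. \<psi> (\<beta> x) = \<beta> (\<phi> x))"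
  using assms
proof induction
  case (loc_id P)
  have "loc_mor QQ \<Delta>Q SQ (\<beta> ` P) (\<lambda>x\<in>\<beta> ` P. x)"
    by (rule loc_mor.loc_id[OF subgroup_quot[OF loc_id(1)] image_mono[OF loc_id(2)]])
  then show ?case
    by (intro exI conjI ballI) (assumption, simp)
next
  case (loc_step P \<phi> R g)
  then obtain \<psi> where \<psi>: "loc_mor QQ \<Delta>Q SQ (\<beta> ` P) \<psi>" "\<And>x. x \<in> P \<Longrightarrow> \<psi> (\<beta> x) = \<beta> (\<phi> x)"
    by blast
  note RL = obj_carrier[OF loc_step(3)]
  have "loc_mor QQ \<Delta>Q SQ (\<beta> ` P) (\<lambda>C\<in>\<beta> ` P. pconj QQ (\<beta> g) (\<psi> C))"
  proof (rule loc_mor.loc_step[OF \<psi>(1)])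
    show "\<psi> ` \<beta> ` P \<subseteq> \<beta> ` R"
      using \<psi>(2) loc_step(2) by auto
    show "\<beta> ` R \<in> \<Delta>Q"
      by (rule imageI[OF loc_step(3)])
    show "\<beta> g \<in> carrier QQ"
      unfolding quot_carrier by (rule imageI[OF loc_step(4)])
    show "\<beta> ` R \<subseteq> conj_dom QQ (\<beta> g)"
      using quot_conj_subset(1)[OF loc_step(4) RL] loc_step(5) by blast
    show "pconj QQ (\<beta> g) ` \<beta> ` R \<subseteq> SQ"
      unfolding quot_conj_subset(2)[OF loc_step(4) RL loc_step(5)] by (rule image_mono[OF loc_step(6)])
  qed
  moreover have "(\<lambda>C\<in>\<beta> ` P. pconj QQ (\<beta> g) (\<psi> C)) (\<beta> x) = \<beta> ((\<lambda>x\<in>P. pconj L g (\<phi> x)) x)" if x: "x \<in> P" for x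
  proof -
    have \<phi>x: "\<phi> x \<in> R"
      using x loc_step(2) by blast
    have "pconj QQ (\<beta> g) (\<beta> (\<phi> x)) = \<beta> (pconj L g (\<phi> x))"
      by (rule quot_conj(2)[OF loc_step(4)]) (use \<phi>x RL loc_step(5) in blast)+
    then show ?thesis
      using x \<psi>(2)[OF x] by simp
  qed
  ultimately show ?case
    by blast
qed

text \<open>A generator of the quotient system lives on the image of an object R containing Z, where
  it is induced by a generator of the original system. Conversely a chain is pushed to the quotient
  step by step, and a morphism there is determined by its values on cosets.\<close>

lemma fusion_of_quot: "fusion_of p QQ \<Delta>Q SQ = fus_quot (group_on L S) (fusion_of p L \<Delta> S) Z"
proof (intro ext equalityI)
  fix A B
  show "fusion_of p QQ \<Delta>Q SQ A B \<subseteq> fus_quot (group_on L S) (fusion_of p L \<Delta> S) Z A B"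
  proof (rule fusion_of_least[OF FQ.fusion_system_quot])
    fix T C assume T: "T \<in> \<Delta>Q" and C: "C \<in> carrier QQ" and TC: "T \<subseteq> conj_dom QQ C" "pconj QQ C ` T \<subseteq> SQ"
    obtain R where R: "R \<in> \<Delta>" "Z \<subseteq> R" "T = \<beta> ` R"
      using quot_objE[OF T] .
    obtain g where g: "g \<in> carrier L" "C = \<beta> g"
      using C unfolding quot_carrier by blast
    note RL = obj_carrier[OF R(1)]
    have c: "R \<subseteq> conj_dom L g"
      using TC(1) quot_conj_subset(1)[OF g(1) RL] unfolding R(3) g(2) by blast
    note img = quot_conj_subset(2)[OF g(1) RL c]
    have im: "\<beta> ` pconj L g ` R \<subseteq> SQ"
      using TC(2) unfolding R(3) g(2) img .
    have RS: "pconj L g ` R \<subseteq> S"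
    proof (rule image_subsetI)
      fix x assume x: "x \<in> R"
      have "\<beta> (pconj L g x) \<in> SQ"
        by (rule subsetD[OF im imageI[OF imageI[OF x]]])
      then show "pconj L g x \<in> S"
        by (rule proj_mem_image[OF S_subgroup Z_S conj_closed[OF subsetD[OF c x]]])
    qed
    have "loc_mor L \<Delta> S R (\<lambda>x\<in>R. pconj L g x)"
      by (rule loc_mor_conj[OF obj_subgroup[OF R(1)] order_refl R(1) g(1) c RS])
    then have m: "restrict (pconj L g) R \<in> fusion_of p L \<Delta> S R (pconj L g ` R)"
      unfolding fusion_of_eq loc_fus_def using obj_subgroup[OF obj_conj[OF R(1) g(1) c RS]] RS by simp
    have "restrict (pconj QQ C) T \<in> fus_quot (group_on L S) (fusion_of p L \<Delta> S) Z (\<beta> ` R) (\<beta> ` pconj L g ` R)"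
    proof (rule FQ.quot_morI[OF m R(2) Z_conj_image[OF g(1) c R(2)]])
      show "restrict (pconj QQ C) T \<in> extensional (\<beta> ` R)"
        unfolding R(3) by (rule restrict_extensional)
      fix x assume x: "x \<in> R"
      have "pconj QQ (\<beta> g) (\<beta> x) = \<beta> (pconj L g x)"
        by (rule quot_conj(2)[OF g(1)]) (use x RL c in blast)+
      then show "restrict (pconj QQ C) T (\<beta> x) = \<beta> (restrict (pconj L g) R x)"
        using x by (simp add: R(3) g(2))
    qed
    then show "restrict (pconj QQ C) T \<in> fus_quot (group_on L S) (fusion_of p L \<Delta> S) Z T (pconj QQ C ` T)"
      unfolding R(3) g(2) img .
  qed
  show "fus_quot (group_on L S) (fusion_of p L \<Delta> S) Z A B \<subseteq> fusion_of p QQ \<Delta>Q SQ A B"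
  proof
    fix \<psi> assume \<psi>: "\<psi> \<in> fus_quot (group_on L S) (fusion_of p L \<Delta> S) Z A B"
    obtain \<phi> P Q where q: "\<phi> \<in> fusion_of p L \<Delta> S P Q" "Z \<subseteq> P" "Z \<subseteq> Q" "\<phi> ` Z = Z" "A = \<beta> ` P" "B = \<beta> ` Q"
      "\<psi> \<in> extensional A" "\<And>x. x \<in> P \<Longrightarrow> \<psi> (\<beta> x) = \<beta> (\<phi> x)"
      by (rule FQ.quot_mor[OF \<psi>]; rule that; assumption)
    have m: "loc_mor L \<Delta> S P \<phi>" and Q: "pg_subgroup L Q" "Q \<subseteq> S" "\<phi> ` P \<subseteq> Q"
      using q(1) by (simp_all add: fusion_of_eq loc_fus_def)
    obtain \<chi> where \<chi>: "loc_mor QQ \<Delta>Q SQ (\<beta> ` P) \<chi>" "\<And>x. x \<in> P \<Longrightarrow> \<chi> (\<beta> x) = \<beta> (\<phi> x)"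
      using loc_mor_quot[OF m q(2)] by blast
    have "\<chi> \<in> extensional (\<beta> ` P)"
      using Q.loc_mor_facts[OF \<chi>(1)] by blast
    then have "\<psi> = \<chi>"
    proof (rule extensionalityI[OF q(7)[unfolded q(5)]])
      fix a assume "a \<in> \<beta> ` P"
      then obtain x where "x \<in> P" "a = \<beta> x" by blast
      then show "\<psi> a = \<chi> a"
        using \<chi>(2) q(8) by simp
    qed
    moreover have "\<chi> ` \<beta> ` P \<subseteq> \<beta> ` Q"
      using \<chi>(2) Q(3) by auto
    ultimately show "\<psi> \<in> fusion_of p QQ \<Delta>Q SQ A B"
      unfolding Q.fusion_of_eq loc_fus_def q(5,6)
      using \<chi>(1) subgroup_quot[OF Q(1)] image_mono[OF Q(2)] by simp
  qed
qed

lemma locality_over_quot: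
  "locality_over p QQ \<Delta>Q SQ (group_on L S Mod Z) (fus_quot (group_on L S) (fusion_of p L \<Delta> S) Z)"
  unfolding locality_over_def
proof (intro conjI ballI locality_quot fusion_of_quot[symmetric])
  interpret N: normal Z "group_on L S"
    using FQ.h.normal_kernel FQ.ker by simp
  show "carrier (group_on L S Mod Z) = SQ"
    unfolding carrier_FactGroup carrier_group_on by (rule image_cong[OF refl proj_rcoset[symmetric]])
  fix x y assume "x \<in> SQ" "y \<in> SQ"
  then obtain a b where ab: "a \<in> S" "b \<in> S" "x = \<beta> a" "y = \<beta> b"
    by blast
  have abS: "pprod L [a, b] \<in> S" "[a, b] \<in> pdom L"
    using ab(1,2) subgroup_prod[OF S_subgroup, of "[a, b]"] subgroup_dom[OF S_subgroup, of "[a, b]"] by simp_all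
  have "x \<otimes>\<^bsub>group_on L S Mod Z\<^esub> y = Z #>\<^bsub>group_on L S\<^esub> pprod L [a, b]"
    using N.rcos_sum[of a b] ab by (simp add: proj_rcoset)
  also have "\<dots> = pprod QQ [x, y]"
    using quot_prod[OF abS(2)] ab by (simp add: proj_rcoset[OF abS(1)])
  finally show "x \<otimes>\<^bsub>group_on L S Mod Z\<^esub> y = pprod QQ [x, y]" .
qed

end

section \<open>Central products of localities\<close>

locale central_product = locality_pair p L1 \<Delta>1 S1 L2 \<Delta>2 S2
  for p :: nat and L1 :: "('a, 'm) partial_group_scheme" and \<Delta>1 S1
    and L2 :: "('b, 'n) partial_group_scheme" and \<Delta>2 S2 +
  fixes Z :: "('a \<times> 'b) set"
  assumes Z_sub: "pg_subgroup (pg_prod L1 L2) Z" and Z_center: "Z \<subseteq> pg_center (pg_prod L1 L2)"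
    and Z_left: "(x, pone L2) \<in> Z \<Longrightarrow> x = pone L1"
    and Z_right: "(pone L1, y) \<in> Z \<Longrightarrow> y = pone L2"
    and Z_S: "Z \<subseteq> S1 \<times> S2"
begin

sublocale Q: central_quotient p LL DD SS Z
  by (intro central_quotient.intro locality_prod central_quotient_axioms.intro p Z_sub Z_center Z_S)

interpretation C: central_fusion_product p G1 F1 G2 F2 "group_on Q.QQ Q.SQ" Q.\<beta> Z
proof (intro central_fusion_product.intro central_fusion_product_axioms.intro fusion_product.intro
    A.fusion_system_fusion_of B.fusion_system_fusion_of)
  show "fusion_quotient p (G1 \<times>\<times> G2) (fus_prod G1 F1 G2 F2) (group_on Q.QQ Q.SQ) Q.\<beta> Z"
    using Q.fusion_quotient_proj unfolding fusion_of_prod S_group_prod .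
  show "x = \<one>\<^bsub>G1\<^esub>" if "(x, \<one>\<^bsub>G2\<^esub>) \<in> Z" for x
    using Z_left that by simp
  show "y = \<one>\<^bsub>G2\<^esub>" if "(\<one>\<^bsub>G1\<^esub>, y) \<in> Z" for y
    using Z_right that by simp
  show "\<phi> z = z" if "\<phi> \<in> fus_prod G1 F1 G2 F2 P Q" "z \<in> P" "z \<in> Z" for \<phi> P Q z
    using Q.center_fixed[OF _ Q.Z_cen[OF that(3)] that(2)] that(1)
    by (simp add: fusion_of_prod[symmetric] Q.fusion_of_eq loc_fus_def)
qed

lemma objective_characteristic_p_iff:
  "objective_characteristic_p p Q.QQ Q.\<Delta>Q Q.SQ \<longleftrightarrow>
    objective_characteristic_p p L1 \<Delta>1 S1 \<and> objective_characteristic_p p L2 \<Delta>2 S2"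
  unfolding Q.objective_characteristic_p_quot by (rule objective_characteristic_p_prod)

lemma centric_radical_quot_eq:
  "fus_cr p (group_on Q.QQ Q.SQ) (fusion_of p Q.QQ Q.\<Delta>Q Q.SQ) =
    (\<lambda>(P1, P2). Q.\<beta> ` (P1 \<times> P2)) ` (fus_cr p G1 F1 \<times> fus_cr p G2 F2)"
  unfolding Q.fusion_of_quot fusion_of_prod S_group_prod by (rule C.centric_radical_quot)

text \<open>The image of the rectangle is also the image of an object P containing Z. Both subgroups
  contain Z, so they are equal, and the projections of P are objects.\<close>

lemma obj_factors:
  assumes "P1 \<in> fus_cr p G1 F1" "P2 \<in> fus_cr p G2 F2" "Q.\<beta> ` (P1 \<times> P2) \<in> Q.\<Delta>Q"
  shows "P1 \<in> \<Delta>1" "P2 \<in> \<Delta>2"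
proof -
  have ZP: "Z \<subseteq> P1 \<times> P2"
    by (rule C.Z_subset_centric[OF assms(1,2)])
  have s: "subgroup P1 G1" "subgroup P2 G2"
    using assms(1,2) by (simp_all add: fus_cr_def fus_centric_def)
  obtain P where P: "P \<in> DD" "Z \<subseteq> P" "Q.\<beta> ` (P1 \<times> P2) = Q.\<beta> ` P"
    using Q.quot_objE[OF assms(3)] .
  have sP: "subgroup P (G1 \<times>\<times> G2)"
    using Q.subgroup_S_iff Q.obj_subgroup[OF P(1)] Q.obj_S[OF P(1)] unfolding S_group_prod by blast
  have "P1 \<times> P2 = P"
    by (rule C.pi_image_eq[OF DirProd_subgroups[OF C.F1.is_group s(1) C.F2.is_group s(2)] ZP sP P(2,3)])
  then have "fst ` (P1 \<times> P2) \<in> \<Delta>1" "snd ` (P1 \<times> P2) \<in> \<Delta>2"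
    using obj_proj[OF P(1)] by simp_all
  moreover have "P1 \<noteq> {}" "P2 \<noteq> {}"
    using subgroup.one_closed[OF s(1)] subgroup.one_closed[OF s(2)] by blast+
  ultimately show "P1 \<in> \<Delta>1" "P2 \<in> \<Delta>2"
    by (simp_all only: fst_image_times snd_image_times if_False)
qed

text \<open>If objective characteristic p fails, neither side holds. Otherwise S1 and S2 are centric
  radical, so each factor can be probed with the largest subgroup of the other one held
  fixed.\<close>

lemma linking_locality_iff:
  "linking_locality p Q.QQ Q.\<Delta>Q Q.SQ \<longleftrightarrow>
    linking_locality p L1 \<Delta>1 S1 \<and> linking_locality p L2 \<Delta>2 S2"
proof (cases "objective_characteristic_p p L1 \<Delta>1 S1 \<and> objective_characteristic_p p L2 \<Delta>2 S2")
  case False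
  then show ?thesis
    using objective_characteristic_p_iff by (auto simp: linking_locality_def)
next
  case True
  have ch: "characteristic_p p (group_on L1 (pg_normalizer L1 S1))"
    "characteristic_p p (group_on L2 (pg_normalizer L2 S2))"
    using True A.S_obj B.S_obj by (auto simp: objective_characteristic_p_def)
  note S1 = A.S_centric_radical[OF p ch(1)] and S2 = B.S_centric_radical[OF p ch(2)]
  have "fus_cr p (group_on Q.QQ Q.SQ) (fusion_of p Q.QQ Q.\<Delta>Q Q.SQ) \<subseteq> Q.\<Delta>Q \<longleftrightarrow>
    fus_cr p G1 F1 \<subseteq> \<Delta>1 \<and> fus_cr p G2 F2 \<subseteq> \<Delta>2"
  proof
    assume l: "fus_cr p (group_on Q.QQ Q.SQ) (fusion_of p Q.QQ Q.\<Delta>Q Q.SQ) \<subseteq> Q.\<Delta>Q"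
    have im: "Q.\<beta> ` (P1 \<times> P2) \<in> Q.\<Delta>Q" if "P1 \<in> fus_cr p G1 F1" "P2 \<in> fus_cr p G2 F2" for P1 P2
      using l that unfolding centric_radical_quot_eq by blast
    show "fus_cr p G1 F1 \<subseteq> \<Delta>1 \<and> fus_cr p G2 F2 \<subseteq> \<Delta>2"
      using obj_factors(1)[OF _ S2 im[OF _ S2]] obj_factors(2)[OF S1 _ im[OF S1]] by blast
  next
    assume r: "fus_cr p G1 F1 \<subseteq> \<Delta>1 \<and> fus_cr p G2 F2 \<subseteq> \<Delta>2"
    show "fus_cr p (group_on Q.QQ Q.SQ) (fusion_of p Q.QQ Q.\<Delta>Q Q.SQ) \<subseteq> Q.\<Delta>Q"
      unfolding centric_radical_quot_eq
    proof (rule image_subsetI)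
      fix X assume "X \<in> fus_cr p G1 F1 \<times> fus_cr p G2 F2"
      then obtain P1 P2 where X: "X = (P1, P2)" "P1 \<in> \<Delta>1" "P2 \<in> \<Delta>2"
        using r by blast
      have "P1 \<times> P2 \<in> DD"
        by (rule obj_times[OF X(2,3)])
      then show "(case X of (P1, P2) \<Rightarrow> Q.\<beta> ` (P1 \<times> P2)) \<in> Q.\<Delta>Q"
        by (simp add: X(1))
    qed
  qed
  then show ?thesis
    using True objective_characteristic_p_iff A.locality_axioms B.locality_axioms Q.locality_quot
    by (simp add: linking_locality_def)
qed

section \<open>Centrality of Z in the fusion systems\<close>

lemma Z_fus_center: "Z \<subseteq> fus_center (G1 \<times>\<times> G2) (fus_prod G1 F1 G2 F2)"
  using Q.center_fus_central[OF Z_sub Z_S Z_center] unfolding fusion_of_prod S_group_prod fus_center_def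
  by (auto intro: generate.incl)

text \<open>Although Z need not be a rectangle, each projection is central: testing an element of Z
  against pairs (f, 1) and (1, g) examines its coordinates separately.\<close>

lemma Z_proj_center: "fst ` Z \<subseteq> pg_center L1" "snd ` Z \<subseteq> pg_center L2"
proof -
  have c: "fst z \<in> carrier L1 \<and> snd z \<in> carrier L2 \<and>
      (f \<in> carrier L1 \<longrightarrow> f \<in> conj_dom L1 (fst z) \<and> pconj L1 (fst z) f = f) \<and>
      (g \<in> carrier L2 \<longrightarrow> g \<in> conj_dom L2 (snd z) \<and> pconj L2 (snd z) g = g)"
    if z: "z \<in> Z" for z f g
    using Q.center_comm(1,2,6)[OF Q.Z_cen[OF z], of "(f, pone L2)"]
      Q.center_comm(1,2,6)[OF Q.Z_cen[OF z], of "(pone L1, g)"] A.one_closed B.one_closed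
      Q.Z_carrier[OF z]
    by (auto simp: conj_dom_prod pconj_prod)
  show "fst ` Z \<subseteq> pg_center L1"
    unfolding pg_center_def pg_centralizer_def using c by blast
  show "snd ` Z \<subseteq> pg_center L2"
    unfolding pg_center_def pg_centralizer_def using c by blast
qed

lemma fus_central_product_Z:
  "fus_central_product p G1 F1 G2 F2 Z (fus_quot (G1 \<times>\<times> G2) (fus_prod G1 F1 G2 F2) Z)"
  unfolding fus_central_product_def
proof (intro conjI refl A.fusion_system_fusion_of B.fusion_system_fusion_of)
  show s: "subgroup Z (G1 \<times>\<times> G2)"
    using Q.subgroup_S_iff Z_sub Z_S unfolding S_group_prod by blast
  have "fst ` Z \<subseteq> S1" "snd ` Z \<subseteq> S2"
    using Z_S by auto
  then have "fus_central G1 F1 (fst ` Z)" "fus_central G2 F2 (snd ` Z)"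
    using A.center_fus_central[OF subgroup_proj(1)[OF Z_sub] _ Z_proj_center(1)]
      B.center_fus_central[OF subgroup_proj(2)[OF Z_sub] _ Z_proj_center(2)] by blast+
  then have "fst ` Z \<subseteq> fus_center G1 F1" "snd ` Z \<subseteq> fus_center G2 F2"
    unfolding fus_center_def by (auto intro: generate.incl)
  then show "Z \<subseteq> fus_center G1 F1 \<times> fus_center G2 F2"
    using subset_proj[of Z] by blast
  have "\<one>\<^bsub>G1 \<times>\<times> G2\<^esub> \<in> Z"
    by (rule subgroup.one_closed[OF s])
  then have one: "(pone L1, pone L2) \<in> Z \<inter> (S1 \<times> {pone L2})" "(pone L1, pone L2) \<in> Z \<inter> ({pone L1} \<times> S2)"
    using A.subgroup_one[OF A.S_subgroup] B.subgroup_one[OF B.S_subgroup] by simp_all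
  have "Z \<inter> (S1 \<times> {pone L2}) \<subseteq> {(pone L1, pone L2)}"
    using Z_left by blast
  then show "Z \<inter> (carrier G1 \<times> {\<one>\<^bsub>G2\<^esub>}) = {\<one>\<^bsub>G1 \<times>\<times> G2\<^esub>}"
    unfolding carrier_group_on one_group_on one_DirProd using one(1) by blast
  have "Z \<inter> ({pone L1} \<times> S2) \<subseteq> {(pone L1, pone L2)}"
    using Z_right by blast
  then show "Z \<inter> ({\<one>\<^bsub>G1\<^esub>} \<times> carrier G2) = {\<one>\<^bsub>G1 \<times>\<times> G2\<^esub>}"
    unfolding carrier_group_on one_group_on one_DirProd using one(2) by blast
qed

lemma locality_over_Z:
  "locality_over p Q.QQ Q.\<Delta>Q Q.SQ ((G1 \<times>\<times> G2) Mod Z) (fus_quot (G1 \<times>\<times> G2) (fus_prod G1 F1 G2 F2) Z)"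
  using Q.locality_over_quot unfolding fusion_of_prod S_group_prod .

end

lemma (in locality_pair) center_subset_S_prod:
  assumes "objective_characteristic_p p L1 \<Delta>1 S1" "objective_characteristic_p p L2 \<Delta>2 S2"
  shows "pg_center LL \<subseteq> SS"
proof -
  interpret C: locality p LL DD SS
    by (rule locality_prod)
  show ?thesis
    by (rule C.center_subset_S[OF p])
      (use assms objective_characteristic_p_prod C.S_obj in \<open>auto simp: objective_characteristic_p_def\<close>)
qed

theorem lemma5p9:
  fixes p :: nat
    and L\<^sub>1 :: "'a partial_group" and \<Delta>\<^sub>1 :: "'a set set" and S\<^sub>1 :: "'a set"
    and L\<^sub>2 :: "'b partial_group" and \<Delta>\<^sub>2 :: "'b set set" and S\<^sub>2 :: "'b set"
    and L :: "('a \<times> 'b) partial_group" and \<Delta> :: "('a \<times> 'b) set set"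
    and S Z :: "('a \<times> 'b) set"
    and \<iota>\<^sub>1 :: "'a \<Rightarrow> 'a \<times> 'b" and \<iota>\<^sub>2 :: "'b \<Rightarrow> 'a \<times> 'b"
    and \<beta> :: "'a \<times> 'b \<Rightarrow> ('a \<times> 'b) set"
    and G\<^sub>1 :: "'a monoid" and G\<^sub>2 :: "'b monoid"
    and F\<^sub>1 :: "'a fusion" and F\<^sub>2 :: "'b fusion"
  assumes "prime p"
    and "locality p L\<^sub>1 \<Delta>\<^sub>1 S\<^sub>1" and "locality p L\<^sub>2 \<Delta>\<^sub>2 S\<^sub>2"
    and "L = pg_prod L\<^sub>1 L\<^sub>2"
    and "\<Delta> = objects_prod L\<^sub>1 \<Delta>\<^sub>1 S\<^sub>1 L\<^sub>2 \<Delta>\<^sub>2 S\<^sub>2"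
    and "S = S\<^sub>1 \<times> S\<^sub>2"
    and "\<iota>\<^sub>1 = (\<lambda>f. (f, pone L\<^sub>2))" and "\<iota>\<^sub>2 = (\<lambda>f. (pone L\<^sub>1, f))"
    and "pg_subgroup L Z" and "Z \<subseteq> pg_center L"
    and "Z \<inter> \<iota>\<^sub>1 ` carrier L\<^sub>1 = {pone L}" and "Z \<inter> \<iota>\<^sub>2 ` carrier L\<^sub>2 = {pone L}"
    and "\<beta> = pg_proj L Z"
    and "G\<^sub>1 = group_on L\<^sub>1 S\<^sub>1" and "G\<^sub>2 = group_on L\<^sub>2 S\<^sub>2"
    and "F\<^sub>1 = fusion_of p L\<^sub>1 \<Delta>\<^sub>1 S\<^sub>1" and "F\<^sub>2 = fusion_of p L\<^sub>2 \<Delta>\<^sub>2 S\<^sub>2"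
  shows
    "(objective_characteristic_p p L\<^sub>1 \<Delta>\<^sub>1 S\<^sub>1 \<and> objective_characteristic_p p L\<^sub>2 \<Delta>\<^sub>2 S\<^sub>2 \<longleftrightarrow>
        Z \<subseteq> S \<and> objective_characteristic_p p (pg_quot L Z) ((`) \<beta> ` \<Delta>) (\<beta> ` S)) \<and>
     (linking_locality p L\<^sub>1 \<Delta>\<^sub>1 S\<^sub>1 \<and> linking_locality p L\<^sub>2 \<Delta>\<^sub>2 S\<^sub>2 \<longleftrightarrow>
        Z \<subseteq> S \<and> linking_locality p (pg_quot L Z) ((`) \<beta> ` \<Delta>) (\<beta> ` S)) \<and>
     (Z \<subseteq> S \<longrightarrow>
        Z \<subseteq> fus_center (G\<^sub>1 \<times>\<times> G\<^sub>2) (fus_prod G\<^sub>1 F\<^sub>1 G\<^sub>2 F\<^sub>2) \<and>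
        fus_central_product p G\<^sub>1 F\<^sub>1 G\<^sub>2 F\<^sub>2 Z
          (fus_quot (G\<^sub>1 \<times>\<times> G\<^sub>2) (fus_prod G\<^sub>1 F\<^sub>1 G\<^sub>2 F\<^sub>2) Z) \<and>
        locality_over p (pg_quot L Z) ((`) \<beta> ` \<Delta>) (\<beta> ` S)
          ((G\<^sub>1 \<times>\<times> G\<^sub>2) Mod Z) (fus_quot (G\<^sub>1 \<times>\<times> G\<^sub>2) (fus_prod G\<^sub>1 F\<^sub>1 G\<^sub>2 F\<^sub>2) Z))"
proof -
  interpret LP: locality_pair p L\<^sub>1 \<Delta>\<^sub>1 S\<^sub>1 L\<^sub>2 \<Delta>\<^sub>2 S\<^sub>2
    by (intro locality_pair.intro locality_pair_axioms.intro assms(1-3))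
  have one: "pone L = (pone L\<^sub>1, pone L\<^sub>2)"
    by (simp add: assms(4))
  have ZL: "fst z \<in> carrier L\<^sub>1" "snd z \<in> carrier L\<^sub>2" if "z \<in> Z" for z
    using assms(10) that by (auto simp: assms(4) pg_center_def pg_centralizer_def)
  have left: "x = pone L\<^sub>1" if "(x, pone L\<^sub>2) \<in> Z" for x
  proof -
    have "(x, pone L\<^sub>2) \<in> Z \<inter> \<iota>\<^sub>1 ` carrier L\<^sub>1"
      using that ZL(1)[OF that] by (simp add: assms(7))
    then show ?thesis
      unfolding assms(11) one by simp
  qed
  have right: "y = pone L\<^sub>2" if "(pone L\<^sub>1, y) \<in> Z" for y
  proof -
    have "(pone L\<^sub>1, y) \<in> Z \<inter> \<iota>\<^sub>2 ` carrier L\<^sub>2"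
      using that ZL(2)[OF that] by (simp add: assms(8))
    then show ?thesis
      unfolding assms(12) one by simp
  qed
  \<comment> \<open>This supplies the inclusion demanded on the right of (a) and (b). When Z is not
    contained in S, both sides of those equivalences fail and (c) is vacuous; otherwise the central
    product is available.\<close>
  have ZS: "Z \<subseteq> S"
    if "objective_characteristic_p p L\<^sub>1 \<Delta>\<^sub>1 S\<^sub>1" "objective_characteristic_p p L\<^sub>2 \<Delta>\<^sub>2 S\<^sub>2"
    using LP.center_subset_S_prod[OF that] assms(10) unfolding assms(4,6) by blast
  have cp: "central_product p L\<^sub>1 \<Delta>\<^sub>1 S\<^sub>1 L\<^sub>2 \<Delta>\<^sub>2 S\<^sub>2 Z" if "Z \<subseteq> S"
    using assms(9,10) left right that unfolding assms(4,6)
    by (intro central_product.intro central_product_axioms.intro LP.locality_pair_axioms)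
  note d = assms(4-6,13-17)
  show ?thesis
  proof (cases "Z \<subseteq> S")
    case True
    interpret CP: central_product p L\<^sub>1 \<Delta>\<^sub>1 S\<^sub>1 L\<^sub>2 \<Delta>\<^sub>2 S\<^sub>2 Z
      by (rule cp[OF True])
    show ?thesis
      using True CP.objective_characteristic_p_iff CP.linking_locality_iff CP.Z_fus_center
        CP.fus_central_product_Z CP.locality_over_Z
      unfolding d by blast
  next
    case False
    then show ?thesis
      using ZS by (auto simp: linking_locality_def)
  qed
qed

end
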